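(* Let $r\in\mathbb{N}$ with $r\geq 2$. Suppose that conditions (A1)–(A4) hold with $s=r+2$ and with $r_1>\frac{r-1}{2}$. Then $S_N$ admits the Edgeworth expansion of order $r$: there are polynomials $P_1,\dots,P_r$ such that $$\mathbb{P}\left(\frac{S_N-NA}{\sqrt{N}}\leq z\right)-\mathfrak{N}(z)=\sum_{p=1}^r \frac{P_p(z)}{N^{p/2}}\,\mathfrak{n}(z)+o\left(N^{-r/2}\right)$$ uniformly for $z\in\mathbb{R}$.
   Context: Let $X_1,X_2,\dots$ be real random variables and $S_N=\sum_{n=1}^N X_n$. Assume there are a complex Banach space $\mathcal{B}$ with dual $\mathcal{B}'$, a family of bounded linear operators $\mathcal{L}_t:\mathcal{B}\to\mathcal{B}$ ($t\in\mathbb{R}$), and vectors $v\in\mathcal{B}$, $\ell\in\mathcal{B}'$ such that $\mathbb{E}(e^{itS_N})=\ell(\mathcal{L}_t^N v)$ for all $t\in\mathbb{R}$ and $N\geq 1$. The conditions are: (A1) $t\mapsto\mathcal{L}_t$ is continuous (in operator norm) and there exist $s\in\mathbb{N}$ and $\delta>0$ such that $t\mapsto\mathcal{L}_t$ is $s$ times continuously differentiable for $|t|\leq\delta$. (A2) $1$ is an isolated and simple eigenvalue of $\mathcal{L}_0$, all other eigenvalues of $\mathcal{L}_0$ have absolute value less than $1$, and the essential spectrum of $\mathcal{L}_0$ is contained in a disk of radius strictly less than $1$. (A3) For all $t\neq 0$, the spectrum of $\mathcal{L}_t$ is contained in $\{|z|<1\}$. (A4) There are positive real numbers $K,r_1,r_2,N_0$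 such that $\|\mathcal{L}_t^N\|\leq N^{-r_2}$ for all $t$ with $K\leq|t|\leq N^{r_1}$ and all $N>N_0$. Under (A1)–(A3) with $s\geq 3$ there are $A\in\mathbb{R}$ and $\sigma^2\geq 0$ such that $(S_N-NA)/\sqrt{N}$ converges in distribution to $\mathcal{N}(0,\sigma^2)$; it is assumed that $\sigma^2>0$. Here $\mathfrak{n}(y)=\frac{1}{\sqrt{2\pi\sigma^2}}e^{-y^2/(2\sigma^2)}$ and $\mathfrak{N}(z)=\int_{-\infty}^z\mathfrak{n}(y)\,dy$. *)

theory Defs
  imports "HOL-Analysis.Analysis" "HOL-Probability.Probability"
begin

class complex_banach = banach +
  fixes cscale :: "complex \<Rightarrow> 'a \<Rightarrow> 'a"
  assumes cscale_add_right: "cscale c (x + y) = cscale c x + cscale c y"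
    and cscale_add_left: "cscale (c + d) x = cscale c x + cscale d x"
    and cscale_cscale: "cscale c (cscale d x) = cscale (c * d) x"
    and cscale_one: "cscale 1 x = x"
    and cscale_of_real: "cscale (complex_of_real a) x = scaleR a x"
    and norm_cscale: "norm (cscale c x) = cmod c * norm x"

definition clinear_op :: "('b::complex_banach \<Rightarrow>\<^sub>L 'b) \<Rightarrow> bool" where
  "clinear_op T \<longleftrightarrow> (\<forall>c x. blinfun_apply T (cscale c x) = cscale c (blinfun_apply T x))"

definition clinear_fun :: "('b::complex_banach \<Rightarrow>\<^sub>L complex) \<Rightarrow> bool" where
  "clinear_fun l \<longleftrightarrow> (\<forall>c x. blinfun_apply l (cscale c x) = c * blinfun_apply l x)"

definition opow :: "('b::real_normed_vector \<Rightarrow>\<^sub>L 'b) \<Rightarrow> nat \<Rightarrow> 'b \<Rightarrow> 'b" where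
  "opow T N = blinfun_apply T ^^ N"

definition cspan :: "'b::complex_banach set \<Rightarrow> 'b set" where
  "cspan F = {x. \<exists>c. x = (\<Sum>y\<in>F. cscale (c y) y)}"

definition cfinite_dim :: "'b::complex_banach set \<Rightarrow> bool" where
  "cfinite_dim S \<longleftrightarrow> (\<exists>F. finite F \<and> S \<subseteq> cspan F)"

text \<open>Spectrum: \<open>z\<close> such that \<open>z I - T\<close> is not bijective (by the open mapping
  theorem equivalent to not having a bounded inverse).\<close>

definition cspectrum :: "('b::complex_banach \<Rightarrow>\<^sub>L 'b) \<Rightarrow> complex set" where
  "cspectrum T = {z. \<not> bij (\<lambda>x. cscale z x - blinfun_apply T x)}"

definition is_eigenvalue :: "('b::complex_banach \<Rightarrow>\<^sub>L 'b) \<Rightarrow> complex \<Rightarrow> bool" where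
  "is_eigenvalue T z \<longleftrightarrow> (\<exists>x. x \<noteq> 0 \<and> blinfun_apply T x = cscale z x)"

definition gen_eigenspace :: "('b::complex_banach \<Rightarrow>\<^sub>L 'b) \<Rightarrow> complex \<Rightarrow> 'b set" where
  "gen_eigenspace T z =
     {x. \<exists>k. ((\<lambda>y. blinfun_apply T y - cscale z y) ^^ k) x = 0}"

definition simple_eigenvalue :: "('b::complex_banach \<Rightarrow>\<^sub>L 'b) \<Rightarrow> complex \<Rightarrow> bool" where
  "simple_eigenvalue T z \<longleftrightarrow> is_eigenvalue T z \<and>
     (\<exists>e. gen_eigenspace T z = {cscale c e | c. True})"

definition isolated_in_spectrum :: "('b::complex_banach \<Rightarrow>\<^sub>L 'b) \<Rightarrow> complex \<Rightarrow> bool" where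
  "isolated_in_spectrum T z \<longleftrightarrow> z \<in> cspectrum T \<and>
     (\<exists>\<epsilon>>0. \<forall>w\<in>cspectrum T. w \<noteq> z \<longrightarrow> \<epsilon> \<le> dist w z)"

definition fredholm :: "('b::complex_banach \<Rightarrow> 'b) \<Rightarrow> bool" where
  "fredholm S \<longleftrightarrow> cfinite_dim (S -` {0}) \<and> closed (range S) \<and>
     (\<exists>F. finite F \<and> (\<forall>x. \<exists>y f. f \<in> cspan F \<and> x = S y + f))"

definition ess_spectrum :: "('b::complex_banach \<Rightarrow>\<^sub>L 'b) \<Rightarrow> complex set" where
  "ess_spectrum T = {z. \<not> fredholm (\<lambda>x. cscale z x - blinfun_apply T x)}"

definition Ck_on :: "nat \<Rightarrow> real set \<Rightarrow> (real \<Rightarrow> 'a::real_normed_vector) \<Rightarrow> bool" where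
  "Ck_on s S f \<longleftrightarrow> (\<exists>D. D 0 = f \<and>
     (\<forall>k<s. \<forall>t\<in>S. (D k has_vector_derivative D (Suc k) t) (at t within S)) \<and>
     (\<forall>k\<le>s. continuous_on S (D k)))"

definition gauss_n :: "real \<Rightarrow> real \<Rightarrow> real" where
  "gauss_n \<sigma>2 y = 1 / sqrt (2 * pi * \<sigma>2) * exp (- (y^2) / (2 * \<sigma>2))"

definition gauss_N :: "real \<Rightarrow> real \<Rightarrow> real" where
  "gauss_N \<sigma>2 z = (LBINT y=-\<infinity>..ereal z. gauss_n \<sigma>2 y)"

end

theory Submission
  imports Defs "HOL-Real_Asymp.Real_Asymp"
begin

text \<open>Spectral perturbation theory splits off the leading eigenvalue: near \<open>0\<close> the characteristic
  function of \<open>S\<^sub>N\<close> is \<open>\<kappa>(t)\<^sup>N a(t)\<close> up to an error \<open>C N \<theta>\<^sup>N |t|\<close>, with \<open>\<kappa>\<close> and \<open>a\<close> of class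
  \<open>C\<^sup>r\<^sup>+\<^sup>2\<close>. The eigenvalue \<open>\<kappa>\<close> and its eigenvector solve a fixed point equation for
  the inverse of the bordered operator \<open>\<L>\<^sub>0 - 1 - e \<otimes> \<pi>\<close>, and their derivatives are again
  expressed through inverses of such operators; so no contour integrals are needed. The central
  limit theorem forces \<open>log \<kappa>(t) = i A t - \<sigma>\<^sup>2 t\<^sup>2 / 2 + O(t\<^sup>3)\<close>, and expanding
  \<open>\<kappa>(t / \<surd>N)\<^sup>N a(t / \<surd>N)\<close> in powers of \<open>1 / \<surd>N\<close> gives polynomial multiples of the Gaussian, the
  Fourier transforms of derivatives of the normal density. The difference of the distribution
  functions is then controlled by a smoothing inequality with a Gaussian kernel of width
  \<open>o(N powr (-r/2))\<close>: this requires decay of the characteristic function for \<open>|t| \<le> N powr \<rho>\<close> with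
  \<open>\<rho> > (r-1)/2\<close>, which follows for intermediate \<open>t\<close> from (A3) and compactness, and for large \<open>t\<close>
  from (A4), whose polynomial rate can be made arbitrarily fast by submultiplicativity.\<close>

text \<open>Two scales fix the exponents. The kernel must be narrower than N powr (-r/2), so after
  rescaling by sqrt N the frequencies slightly beyond N powr (r/2) still matter. For S_N itself
  these lie beyond N powr ((r-1)/2), whence the bound on \<open>r1\<close>. The Fourier transform of
  a Gaussian kernel has no bounded support, but past that cutoff it is smaller than every power of
  N.

  The smoothing inequality divides by |t|. Near 0 an error that is merely small in N would not be
  integrable after that division, so the spectral remainder is compared with its value at t = 0,
  which yields the factor |t| at the price of a factor N.

  Invertibility of z - L_0 for |z| \<ge> 1, z \<noteq> 1 has to be derived from (A2). Closed range
  and injectivity bound z - L_0 from below; this bound prevents the inverse from blowing up while z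
  moves in from infinity along a ray. Approaching z = 1 in the same way splits the space into the
  eigenline and the range of 1 - L_0, and removing the eigenline leaves an operator whose powers
  decay geometrically.\<close>

lemma bounded_bilinear_cscale [bounded_bilinear]:
  "bounded_bilinear (cscale :: complex \<Rightarrow> 'a::complex_banach \<Rightarrow> 'a)"
proof
  show "cscale (r *\<^sub>R c) x = r *\<^sub>R cscale c x" for r c and x :: 'a
    by (simp add: scaleR_conv_of_real cscale_cscale [symmetric] cscale_of_real)
  show "cscale c (r *\<^sub>R x) = r *\<^sub>R cscale c x" for r c and x :: 'a
    by (metis cscale_cscale cscale_of_real mult.commute)
  show "\<exists>K. \<forall>c (x::'a). norm (cscale c x) \<le> norm c * norm x * K"
    by (rule exI [of _ 1]) (simp add: norm_cscale)
qed (simp_all add: cscale_add_left cscale_add_right)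

interpretation cscale: bounded_bilinear "cscale :: complex \<Rightarrow> 'a::complex_banach \<Rightarrow> 'a"
  by (rule bounded_bilinear_cscale)

section \<open>The bounded inverse theorem\<close>

text \<open>Baire category inside the closed, hence complete, range: the closed image of some ball
  has interior relative to \<open>range f\<close>. The estimate stays approximate, with an error
  \<eta> as small as desired; iterating it gives exact preimages. Surjectivity is not assumed
  because the result is applied to \<open>1 - T\<close>, whose range is a proper subspace.\<close>

lemma closed_range_ball_dense:
  fixes f :: "'a::real_normed_vector \<Rightarrow> 'b::banach"
  assumes f: "bounded_linear f" and cl: "closed (range f)"
  obtains C where "C \<ge> 0"
    "\<And>y \<eta>. y \<in> range f \<Longrightarrow> \<eta> > 0 \<Longrightarrow> \<exists>x. norm x \<le> C * norm y \<and> norm (y - f x) < \<eta>"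
proof -
  interpret f: bounded_linear f by fact
  have range_closed: "y + z \<in> range f" "y - z \<in> range f" "c *\<^sub>R y \<in> range f"
    if "y \<in> range f" "z \<in> range f" for y z c
  proof -
    obtain a b where "y = f a" "z = f b" using \<open>y \<in> range f\<close> \<open>z \<in> range f\<close> by blast
    then have "y + z = f (a + b)" "y - z = f (a - b)" "c *\<^sub>R y = f (c *\<^sub>R a)"
      by (simp_all add: f.add f.diff f.scaleR)
    then show "y + z \<in> range f" "y - z \<in> range f" "c *\<^sub>R y \<in> range f" by (simp_all only: rangeI)
  qed
  define A where "A n = closure (f ` cball 0 (real n))" for n
  have A_sub: "A n \<subseteq> range f" for n
    unfolding A_def by (rule closure_minimal) (use cl in auto)
  have A_cov: "(\<Union>n. A n) = range f"
  proof (rule equalityI)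
    show "(\<Union>n. A n) \<subseteq> range f" using A_sub by (intro UN_least)
    show "range f \<subseteq> (\<Union>n. A n)"
    proof (rule image_subsetI)
      fix x :: 'a
      obtain n where "norm x \<le> real n" using real_arch_simple by blast
      then have "f x \<in> f ` cball 0 (real n)" by (intro imageI) simp
      then show "f x \<in> (\<Union>n. A n)" unfolding A_def
        using closure_subset [of "f ` cball 0 (real n)"] by auto
    qed
  qed
  have "\<exists>n. (top_of_set (range f)) interior_of (A n) \<noteq> {}"
  proof (rule ccontr)
    assume H: "\<nexists>n. (top_of_set (range f)) interior_of (A n) \<noteq> {}"
    have "(top_of_set (range f)) interior_of \<Union>(range A) = {}"
    proof (rule Baire_category_alt)
      show "completely_metrizable_space (top_of_set (range f)) \<or>
        locally_compact_space (top_of_set (range f)) \<and> regular_space (top_of_set (range f))"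
        by (intro disjI1 completely_metrizable_space_closedin completely_metrizable_space_euclidean)
          (simp add: cl)
      show "countable (range A)" by simp
      fix T assume "T \<in> range A"
      then obtain n where T: "T = A n" by auto
      have "closed (A n)" by (simp add: A_def)
      then show "closedin (top_of_set (range f)) T \<and> (top_of_set (range f)) interior_of T = {}"
        using H T A_sub [of n] closed_subset [of "A n" "range f"] by blast
    qed
    moreover have "(top_of_set (range f)) interior_of (range f) = range f"
      using interior_of_topspace [of "top_of_set (range f)"] by simp
    ultimately show False using A_cov by auto
  qed
  then obtain n y0 where "y0 \<in> (top_of_set (range f)) interior_of (A n)" by blast
  then obtain U where U: "openin (top_of_set (range f)) U" "y0 \<in> U" "U \<subseteq> A n"
    by (auto simp: interior_of_def)
  then obtain e where e: "e > 0" "ball y0 e \<inter> range f \<subseteq> U"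
    unfolding openin_contains_ball by blast
  have y0: "y0 \<in> range f" using U A_sub by blast
  \<comment> \<open>The interior point gives information near \<open>y0\<close> only. Subtracting
    approximate preimages of \<open>y0 + y\<close> and of \<open>y0\<close> recentres at the origin
    and doubles the radius.\<close>
  have *: "\<exists>x. norm x \<le> 2 * real n \<and> norm (y - f x) < \<eta>"
    if y: "y \<in> range f" "norm y < e" and \<eta>: "\<eta> > 0" for y \<eta>
  proof -
    have "y0 + y \<in> range f" using y0 y(1) by (rule range_closed)
    then have "y0 + y \<in> A n" proof -
      assume "y0 + y \<in> range f"
      moreover have "y0 + y \<in> ball y0 e" using y(2) by (simp add: dist_norm)
      ultimately show "y0 + y \<in> A n" using e(2) U(3) by blast
    qed
    then have "\<exists>z\<in>f ` cball 0 (real n). dist z (y0 + y) < \<eta> / 2"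
      unfolding A_def closure_approachable using \<eta> half_gt_zero by blast
    then obtain x1 where x1: "norm x1 \<le> real n" "dist (f x1) (y0 + y) < \<eta> / 2" by auto
    have "y0 \<in> A n" using U by blast
    then have "\<exists>z\<in>f ` cball 0 (real n). dist z y0 < \<eta> / 2"
      unfolding A_def closure_approachable using \<eta> half_gt_zero by blast
    then obtain x2 where x2: "norm x2 \<le> real n" "dist (f x2) y0 < \<eta> / 2" by auto
    have "norm (x1 - x2) \<le> 2 * real n" using norm_triangle_ineq4 [of x1 x2] x1 x2 by simp
    moreover have "y - f (x1 - x2) = (f x2 - y0) - (f x1 - (y0 + y))" by (simp add: f.diff)
    then have "norm (y - f (x1 - x2)) \<le> dist (f x2) y0 + dist (f x1) (y0 + y)"
      unfolding dist_norm by (simp only: norm_triangle_ineq4)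
    then have "norm (y - f (x1 - x2)) < \<eta>" using x1 x2 by linarith
    ultimately show ?thesis by blast
  qed
  show ?thesis
  proof (rule that [of "4 * real n / e"])
    show "0 \<le> 4 * real n / e" using e by simp
    fix y and \<eta> :: real assume y: "y \<in> range f" and \<eta>: "\<eta> > 0"
    show "\<exists>x. norm x \<le> 4 * real n / e * norm y \<and> norm (y - f x) < \<eta>"
    proof (cases "y = 0")
      case True then show ?thesis by (intro exI [of _ 0]) (simp add: f.zero \<eta>)
    next
      case False
      define c where "c = e / (2 * norm y)"
      have c: "c > 0" using e False by (simp add: c_def)
      have "c *\<^sub>R y \<in> range f" using y y by (rule range_closed)
      moreover have "norm (c *\<^sub>R y) < e" using e False by (simp add: c_def)
      ultimately obtain x where x: "norm x \<le> 2 * real n" "norm (c *\<^sub>R y - f x) < c * \<eta>"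
        using * [of "c *\<^sub>R y" "c * \<eta>"] c \<eta> by auto
      have "norm (x /\<^sub>R c) \<le> 4 * real n / e * norm y"
        using x(1) e False by (simp add: c_def divide_simps mult_ac)
      moreover have "y - f (x /\<^sub>R c) = (c *\<^sub>R y - f x) /\<^sub>R c"
        using c by (simp add: f.scaleR scaleR_diff_right)
      then have "norm (y - f (x /\<^sub>R c)) = norm (c *\<^sub>R y - f x) / c" using c by (simp add: divide_inverse)
      then have "norm (y - f (x /\<^sub>R c)) < \<eta>" using x(2) c by (simp add: pos_divide_less_eq mult.commute)
      ultimately show ?thesis by blast
    qed
  qed
qed

text \<open>Successive approximation: each correction halves the residual, so the corrections
  \<open>g (Y k)\<close> are dominated by a geometric series with sum \<open>2 * C * norm y\<close>.
  The constant \<open>2 * C + 1\<close> is positive even if \<open>C = 0\<close>.\<close>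

lemma closed_range_preimage_bound:
  fixes f :: "'a::banach \<Rightarrow> 'b::banach"
  assumes f: "bounded_linear f" and cl: "closed (range f)"
  obtains C where "C > 0" "\<And>y. y \<in> range f \<Longrightarrow> \<exists>x. f x = y \<and> norm x \<le> C * norm y"
proof -
  interpret f: bounded_linear f by fact
  obtain C where C: "C \<ge> 0"
    "\<And>y \<eta>. y \<in> range f \<Longrightarrow> \<eta> > 0 \<Longrightarrow> \<exists>x. norm x \<le> C * norm y \<and> norm (y - f x) < \<eta>"
    by (rule closed_range_ball_dense [OF f cl]) blast
  have "\<exists>x. norm x \<le> C * norm y \<and> norm (y - f x) \<le> norm y / 2" if y: "y \<in> range f" for y
  proof (cases "y = 0")
    case True then show ?thesis by (intro exI [of _ 0]) (simp add: f.zero)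
  next
    case False
    then show ?thesis using C(2) [OF y, of "norm y / 2"] less_imp_le by auto
  qed
  then obtain g where g: "\<And>y. y \<in> range f \<Longrightarrow> norm (g y) \<le> C * norm y"
    "\<And>y. y \<in> range f \<Longrightarrow> norm (y - f (g y)) \<le> norm y / 2"
    by (metis (no_types))
  show ?thesis
  proof (rule that [of "2 * C + 1"])
    show "2 * C + 1 > 0" using C by simp
    fix y assume y: "y \<in> range f"
    define Y where "Y = rec_nat y (\<lambda>_ z. z - f (g z))"
    have Y0: "Y 0 = y" and YS: "Y (Suc k) = Y k - f (g (Y k))" for k by (simp_all add: Y_def)
    have Yr: "Y k \<in> range f" for k
    proof (induction k)
      case (Suc k)
      then obtain a where "Y k = f a" by blast
      then have "Y (Suc k) = f (a - g (Y k))" by (simp add: YS f.diff)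
      then show ?case by (simp only: rangeI)
    qed (simp add: Y0 y)
    have Yn: "norm (Y k) \<le> norm y * (1/2) ^ k" for k
    proof (induction k)
      case (Suc k)
      have "norm (Y (Suc k)) \<le> norm (Y k) / 2" using g(2) [OF Yr] by (simp add: YS)
      then show ?case using Suc by simp
    qed (simp add: Y0)
    have gn: "norm (g (Y k)) \<le> C * norm y * (1/2) ^ k" for k
      using g(1) [OF Yr, of k] mult_left_mono [OF Yn [of k] C(1)] by (simp add: mult_ac)
    have sg: "summable (\<lambda>k::nat. C * norm y * (1/2) ^ k)" by (intro summable_mult) simp
    then have sn: "summable (\<lambda>k. norm (g (Y k)))"
      by (rule summable_comparison_test') (simp add: gn)
    then have s: "summable (\<lambda>k. g (Y k))" by (rule summable_norm_cancel)
    have "norm (\<Sum>k. g (Y k)) \<le> (\<Sum>k. C * norm y * (1/2) ^ k)"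
      using summable_norm [OF sn] suminf_le [OF gn sn sg] by linarith
    also have "\<dots> = 2 * C * norm y" by (subst suminf_mult) (simp_all add: suminf_geometric)
    also have "\<dots> \<le> (2 * C + 1) * norm y" by (simp add: algebra_simps)
    finally have n: "norm (\<Sum>k. g (Y k)) \<le> (2 * C + 1) * norm y" .
    have part: "(\<Sum>k<n. f (g (Y k))) = y - Y n" for n
      by (induction n) (simp_all add: Y0 YS)
    have "(\<lambda>n. norm y * (1/2) ^ n) \<longlonglongrightarrow> norm y * 0"
      by (intro tendsto_intros) simp
    then have "Y \<longlonglongrightarrow> 0" by (intro Lim_null_comparison [of Y]) (auto simp: Yn)
    then have "(\<lambda>n. \<Sum>k<n. f (g (Y k))) \<longlonglongrightarrow> y - 0" unfolding part by (intro tendsto_intros)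
    moreover have "(\<lambda>k. f (g (Y k))) sums f (\<Sum>k. g (Y k))" using f.sums [OF summable_sums [OF s]] .
    ultimately have "f (\<Sum>k. g (Y k)) = y" unfolding sums_def by (metis LIMSEQ_unique diff_zero)
    with n show "\<exists>x. f x = y \<and> norm x \<le> (2 * C + 1) * norm y" by blast
  qed
qed

lemma bij_bounded_linear_inv:
  fixes f :: "'a::banach \<Rightarrow> 'b::banach"
  assumes f: "bounded_linear f" and b: "bij f"
  shows "bounded_linear (inv f)"
proof -
  interpret f: bounded_linear f by fact
  have r: "range f = UNIV" using b by (simp add: bij_def)
  have inj: "inj f" using b by (simp add: bij_def)
  obtain C where C: "C > 0" "\<And>y. y \<in> range f \<Longrightarrow> \<exists>x. f x = y \<and> norm x \<le> C * norm y"
    by (rule closed_range_preimage_bound [OF f]) (simp_all add: r)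
  have [simp]: "f (inv f y) = y" for y using b by (simp add: bij_is_surj surj_f_inv_f)
  show ?thesis
  proof (rule bounded_linear_intro [where K = C])
    show "inv f (x + y) = inv f x + inv f y" for x y by (rule injD [OF inj]) (simp add: f.add)
    show "inv f (r *\<^sub>R x) = r *\<^sub>R inv f x" for r x by (rule injD [OF inj]) (simp add: f.scaleR)
    show "norm (inv f x) \<le> norm x * C" for x
    proof -
      obtain z where "f z = x" "norm z \<le> C * norm x" using C(2) [of x] r by auto
      then show ?thesis using inv_f_f [OF inj, of z] by (simp add: mult.commute)
    qed
  qed
qed

section \<open>The algebra of bounded operators\<close>

text \<open>A copy of the type of bounded operators on which \<open>*\<close> can mean composition,
  so that powers, Neumann series and inverses become Banach algebra computations.\<close>

typedef (overloaded) 'b endo = "UNIV :: ('b::real_normed_vector \<Rightarrow>\<^sub>L 'b) set"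
  morphisms op_of Endo ..

setup_lifting type_definition_endo

instantiation endo :: (real_normed_vector) real_normed_vector
begin
lift_definition zero_endo :: "'a endo" is 0 .
lift_definition plus_endo :: "'a endo \<Rightarrow> 'a endo \<Rightarrow> 'a endo" is "(+)" .
lift_definition minus_endo :: "'a endo \<Rightarrow> 'a endo \<Rightarrow> 'a endo" is "(-)" .
lift_definition uminus_endo :: "'a endo \<Rightarrow> 'a endo" is uminus .
lift_definition scaleR_endo :: "real \<Rightarrow> 'a endo \<Rightarrow> 'a endo" is scaleR .
lift_definition norm_endo :: "'a endo \<Rightarrow> real" is norm .
definition dist_endo :: "'a endo \<Rightarrow> 'a endo \<Rightarrow> real" where "dist_endo x y = norm (x - y)"
definition sgn_endo :: "'a endo \<Rightarrow> 'a endo" where "sgn_endo x = scaleR (inverse (norm x)) x"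
definition uniformity_endo :: "('a endo \<times> 'a endo) filter" where
  "uniformity_endo = (INF e\<in>{0<..}. principal {(x, y). dist x y < e})"
definition open_endo :: "'a endo set \<Rightarrow> bool" where
  "open_endo U = (\<forall>x\<in>U. \<forall>\<^sub>F (x', y) in uniformity. x' = x \<longrightarrow> y \<in> U)"
instance
proof
  fix x y z :: "'a endo" and a b :: real and U :: "'a endo set"
  show "x + y + z = x + (y + z)" by transfer (rule add.assoc)
  show "x + y = y + x" by transfer (rule add.commute)
  show "0 + x = x" by transfer simp
  show "- x + x = 0" by transfer simp
  show "x - y = x + - y" by transfer simp
  show "a *\<^sub>R (x + y) = a *\<^sub>R x + a *\<^sub>R y" by transfer (rule scaleR_add_right)
  show "(a + b) *\<^sub>R x = a *\<^sub>R x + b *\<^sub>R x" by transfer (rule scaleR_add_left)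
  show "a *\<^sub>R b *\<^sub>R x = (a * b) *\<^sub>R x" by transfer simp
  show "1 *\<^sub>R x = x" by transfer simp
  show "dist x y = norm (x - y)" by (rule dist_endo_def)
  show "sgn x = inverse (norm x) *\<^sub>R x" by (rule sgn_endo_def)
  show "uniformity = (INF e\<in>{0<..}. principal {(x, y). dist x (y :: 'a endo) < e})"
    by (rule uniformity_endo_def)
  show "open U = (\<forall>x\<in>U. \<forall>\<^sub>F (x', y) in uniformity. x' = x \<longrightarrow> y \<in> U)"
    by (rule open_endo_def)
  show "(norm x = 0) = (x = 0)" by transfer simp
  show "norm (x + y) \<le> norm x + norm y" by transfer (rule norm_triangle_ineq)
  show "norm (a *\<^sub>R x) = \<bar>a\<bar> * norm x" by transfer simp
qed
end

instantiation endo :: (real_normed_vector) "{real_normed_algebra, monoid_mult}"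
begin
lift_definition times_endo :: "'a endo \<Rightarrow> 'a endo \<Rightarrow> 'a endo" is "(o\<^sub>L)" .
lift_definition one_endo :: "'a endo" is id_blinfun .
instance
proof
  fix a b c :: "'a endo" and r :: real
  show "a * b * c = a * (b * c)" by transfer (rule blinfun_eqI, simp)
  show "(a + b) * c = a * c + b * c"
    by transfer (rule bounded_bilinear.add_left [OF bounded_bilinear_blinfun_compose])
  show "a * (b + c) = a * b + a * c"
    by transfer (rule bounded_bilinear.add_right [OF bounded_bilinear_blinfun_compose])
  show "r *\<^sub>R a * b = r *\<^sub>R (a * b)"
    by transfer (rule bounded_bilinear.scaleR_left [OF bounded_bilinear_blinfun_compose])
  show "a * r *\<^sub>R b = r *\<^sub>R (a * b)"
    by transfer (rule bounded_bilinear.scaleR_right [OF bounded_bilinear_blinfun_compose])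
  show "norm (a * b) \<le> norm a * norm b" by transfer (rule norm_blinfun_compose)
  show "1 * a = a" "a * 1 = a" by (transfer; rule blinfun_eqI; simp)+
qed
end

lift_definition app :: "'b::real_normed_vector endo \<Rightarrow> 'b \<Rightarrow> 'b" is blinfun_apply .

lemma endo_eqI: "(\<And>x. app S x = app T x) \<Longrightarrow> S = T"
  by transfer (rule blinfun_eqI)

lemma app_simps [simp]:
  "app 0 x = 0" "app 1 x = x" "app (S * T) x = app S (app T x)"
  by (transfer; simp)+

lemma bounded_bilinear_app [bounded_bilinear]: "bounded_bilinear app"
proof
  show "\<exists>K. \<forall>(a::'a endo) b. norm (app a b) \<le> norm a * norm b * K"
    by (intro exI [of _ 1] allI) (transfer, simp add: norm_blinfun)
qed (transfer, simp only: blinfun.add_left blinfun.add_right blinfun.scaleR_left blinfun.scaleR_right)+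

interpretation app: bounded_bilinear app by (rule bounded_bilinear_app)

lemma norm_app: "norm (app S x) \<le> norm S * norm x"
  by transfer (rule norm_blinfun)

lemma bounded_linear_op_of: "bounded_linear op_of"
  by (rule bounded_linear_intro [of _ 1])
    (simp_all add: plus_endo.rep_eq scaleR_endo.rep_eq norm_endo.rep_eq)

lemma bounded_linear_Endo: "bounded_linear Endo"
  by (rule bounded_linear_intro [of _ 1])
    (simp_all add: plus_endo.abs_eq scaleR_endo.abs_eq norm_endo.abs_eq)

lemma app_Endo [simp]: "app (Endo T) x = blinfun_apply T x"
  by (simp add: app.abs_eq)

instance endo :: (banach) banach
proof
  fix X :: "nat \<Rightarrow> 'a endo" assume "Cauchy X"
  then have "Cauchy (\<lambda>n. op_of (X n))" by (rule bounded_linear.Cauchy [OF bounded_linear_op_of])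
  then obtain T where "(\<lambda>n. op_of (X n)) \<longlonglongrightarrow> T" using Cauchy_convergent convergent_def by blast
  then have "(\<lambda>n. Endo (op_of (X n))) \<longlonglongrightarrow> Endo T"
    by (rule bounded_linear.tendsto [OF bounded_linear_Endo])
  then show "convergent X" by (auto simp: op_of_inverse convergent_def)
qed

lemma app_power: "app (T ^ n) = app T ^^ n"
  by (induction n) (auto simp: fun_eq_iff)

lemma norm_endo_bound: "0 \<le> b \<Longrightarrow> (\<And>x. norm (app T x) \<le> b * norm x) \<Longrightarrow> norm T \<le> b"
  by transfer (rule norm_blinfun_bound)

lemma endo_of_bounded_linear:
  assumes "bounded_linear f" obtains T where "\<And>x. app T x = f x"
  by (rule that [of "Endo (Blinfun f)"]) (simp add: assms bounded_linear_Blinfun_apply)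

section \<open>Inverses in a Banach algebra\<close>

definition is_inverse :: "'a::monoid_mult \<Rightarrow> 'a \<Rightarrow> bool" where
  "is_inverse a b \<longleftrightarrow> a * b = 1 \<and> b * a = 1"

lemma is_inverse_unique: "is_inverse a b \<Longrightarrow> is_inverse a c \<Longrightarrow> b = c"
  unfolding is_inverse_def by (metis mult.assoc mult_1_left mult_1_right)

lemma norm_power_le:
  fixes x :: "'a::{real_normed_algebra,monoid_mult}"
  shows "norm (x ^ n) \<le> norm (1 :: 'a) * norm x ^ n"
proof (induction n)
  case (Suc n)
  have "norm (x ^ Suc n) \<le> norm x * norm (x ^ n)" by (simp add: norm_mult_ineq)
  also have "\<dots> \<le> norm x * (norm (1 :: 'a) * norm x ^ n)" by (intro mult_left_mono Suc) simp
  finally show ?case by (simp add: mult_ac)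
qed simp

lemma neumann_series:
  fixes x :: "'a::{real_normed_algebra,monoid_mult,banach}"
  assumes x: "norm x < 1"
  obtains y where "is_inverse (1 - x) y" "norm (y - 1) \<le> norm x / (1 - norm x)"
proof -
  define y where "y = (\<Sum>n. x ^ n)"
  have s: "summable (\<lambda>n. x ^ n)"
    by (rule summable_comparison_test' [where g = "\<lambda>n. norm (1 :: 'a) * norm x ^ n" and N = 0])
      (use x in \<open>simp_all add: norm_power_le summable_mult\<close>)
  have h: "(\<Sum>n. x ^ Suc n) = y - 1" unfolding y_def using suminf_split_head [OF s] by simp
  have 1: "x * y = y - 1" using suminf_mult [OF s, of x] h by (simp add: y_def)
  have 2: "y * x = y - 1" using suminf_mult2 [OF s, of x] h by (simp add: y_def power_commutes)
  \<comment> \<open>The relation \<open>y - 1 = x + x * (y - 1)\<close> bounds \<open>y - 1\<close>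
    without reference to \<open>norm 1\<close>.\<close>
  have "norm (y - 1) = norm (x + x * (y - 1))" using 1 by (simp add: right_diff_distrib)
  also have "\<dots> \<le> norm x + norm x * norm (y - 1)"
    using norm_triangle_ineq [of x "x * (y - 1)"] norm_mult_ineq [of x "y - 1"] by linarith
  finally have "norm (y - 1) * (1 - norm x) \<le> norm x" by (simp add: algebra_simps)
  then have "norm (y - 1) \<le> norm x / (1 - norm x)" using x by (simp add: pos_le_divide_eq)
  moreover have "is_inverse (1 - x) y"
    by (simp add: is_inverse_def left_diff_distrib right_diff_distrib 1 2)
  ultimately show ?thesis using that by blast
qed

text \<open>Factor \<open>a' = a * (1 - b * (a - a'))\<close> and invert the second factor by its
  Neumann series. The bound \<open>q\<close> is a parameter, so that a numerical value such as 1/2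
  can be inserted where the product of norms is only estimated.\<close>

lemma is_inverse_perturb:
  fixes a :: "'a::{real_normed_algebra,monoid_mult,banach}"
  assumes ab: "is_inverse a b" and q: "norm b * norm (a' - a) \<le> q" "q < 1"
  obtains b' where "is_inverse a' b'" "norm (b' - b) \<le> norm b * (q / (1 - q))"
proof -
  define x where "x = b * (a - a')"
  have nx: "norm x \<le> q"
    using norm_mult_ineq [of b "a - a'"] q by (simp add: x_def norm_minus_commute)
  then obtain y where y: "is_inverse (1 - x) y" "norm (y - 1) \<le> norm x / (1 - norm x)"
    using neumann_series [of x] q by auto
  have ba: "b * a = 1" "a * b = 1" using ab by (auto simp: is_inverse_def)
  have bx: "b * a' = 1 - x" by (simp add: x_def right_diff_distrib ba)
  have ax: "a' = a * (1 - x)" unfolding bx [symmetric] by (simp add: mult.assoc [symmetric] ba)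
  have y': "(1 - x) * y = 1" "y * (1 - x) = 1" using y(1) by (auto simp: is_inverse_def)
  have "a' * (y * b) = a * ((1 - x) * y) * b" unfolding ax by (simp only: mult.assoc)
  then have "a' * (y * b) = 1" by (simp add: y' ba)
  moreover have "y * b * a' = 1" by (simp add: mult.assoc bx y')
  ultimately have "is_inverse a' (y * b)" by (simp add: is_inverse_def)
  moreover have "norm (y * b - b) \<le> norm b * (q / (1 - q))"
  proof -
    have "norm (y * b - b) = norm ((y - 1) * b)" by (simp add: left_diff_distrib)
    also have "\<dots> \<le> norm (y - 1) * norm b" by (rule norm_mult_ineq)
    also have "\<dots> \<le> (norm x / (1 - norm x)) * norm b" by (intro mult_right_mono y) simp
    also have "0 \<le> q" using nx norm_ge_zero order_trans by blast
    then have "norm x / (1 - norm x) \<le> q / (1 - q)" using nx q by (intro frac_le) auto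
    finally show ?thesis by (simp add: mult_right_mono mult.commute)
  qed
  ultimately show ?thesis using that by blast
qed

lemma continuous_on_is_inverse:
  fixes f g :: "'c::topological_space \<Rightarrow> 'a::{real_normed_algebra,monoid_mult,banach}"
  assumes f: "continuous_on S f" and fg: "\<And>x. x \<in> S \<Longrightarrow> is_inverse (f x) (g x)"
  shows "continuous_on S g"
  unfolding continuous_on_def
proof
  fix x assume x: "x \<in> S"
  define q where "q y = norm (g x) * norm (f y - f x)" for y
  have "(f \<longlongrightarrow> f x) (at x within S)" using f x by (auto simp: continuous_on_def)
  then have "((\<lambda>y. norm (f y - f x)) \<longlongrightarrow> norm (f x - f x)) (at x within S)"
    by (intro tendsto_intros)
  then have q0: "(q \<longlongrightarrow> norm (g x) * 0) (at x within S)"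
    unfolding q_def by (intro tendsto_intros) simp
  then have ev: "\<forall>\<^sub>F y in at x within S. q y < 1" by (intro order_tendstoD(2)) auto
  have "((\<lambda>y. norm (g x) * (q y / (1 - q y))) \<longlongrightarrow> norm (g x) * (0 / (1 - 0))) (at x within S)"
    using q0 by (intro tendsto_intros) auto
  moreover have "\<forall>\<^sub>F y in at x within S. norm (g y - g x) \<le> norm (g x) * (q y / (1 - q y))"
    using ev unfolding eventually_at_filter
  proof eventually_elim
    case (elim y)
    show ?case
    proof (intro impI)
      assume "y \<noteq> x" and y: "y \<in> S"
      then have "q y < 1" using elim by simp
      then obtain b where "is_inverse (f y) b" "norm (b - g x) \<le> norm (g x) * (q y / (1 - q y))"
        using is_inverse_perturb [OF fg [OF x], of "f y" "q y"] by (auto simp: q_def)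
      then show "norm (g y - g x) \<le> norm (g x) * (q y / (1 - q y))"
        using is_inverse_unique fg [OF y] by blast
    qed
  qed
  ultimately have "((\<lambda>y. g y - g x) \<longlongrightarrow> 0) (at x within S)"
    by (intro Lim_null_comparison [where f = "\<lambda>y. g y - g x"]) auto
  then show "(g \<longlongrightarrow> g x) (at x within S)" by (simp add: LIM_zero_iff)
qed

lemma mult_one_minus_power:
  fixes x :: "'a::{ring,monoid_mult}"
  shows "(1 - x ^ n) = (\<Sum>j<n. x ^ j) * (1 - x)"
proof (induction n)
  case (Suc n)
  have "(\<Sum>j<Suc n. x ^ j) * (1 - x) = (1 - x ^ n) + x ^ n * (1 - x)"
    by (simp add: distrib_right Suc [symmetric])
  then show ?case by (simp add: right_diff_distrib power_commutes)
qed simp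

section \<open>Complex scalars and the spectral radius\<close>

text \<open>The types know real linearity only. Complex scalars are embedded as operators
  \<open>cs c\<close>, and the complex linear operators are those commuting with all of them, which
  makes resolvents \<open>cs z - T\<close> elements of the algebra.\<close>

definition cs :: "complex \<Rightarrow> 'b::complex_banach endo" where
  "cs c = Endo (Blinfun (cscale c))"

definition clin :: "'b::complex_banach endo \<Rightarrow> bool" where
  "clin T \<longleftrightarrow> (\<forall>c x. app T (cscale c x) = cscale c (app T x))"

lemma app_cs [simp]: "app (cs c) x = cscale c x"
  by (simp add: cs_def bounded_linear_Blinfun_apply cscale.bounded_linear_right)

lemma cs_add: "cs (a + b) = cs a + cs b"
  by (rule endo_eqI) (simp add: app.add_left cscale_add_left)

lemma cs_mult: "cs (a * b) = cs a * cs b"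
  by (rule endo_eqI) (simp add: cscale_cscale)

lemma cs_1 [simp]: "cs 1 = 1" by (rule endo_eqI) (simp add: cscale_one)

lemma cs_0 [simp]: "cs 0 = 0" by (rule endo_eqI) (simp add: cscale.zero_left)

lemma cs_of_real_mult: "cs (of_real r) * T = r *\<^sub>R T"
  by (rule endo_eqI) (simp add: cscale_of_real app.scaleR_left)

lemma cs_sum: "cs (sum f A) = (\<Sum>i\<in>A. cs (f i))"
  by (induction A rule: infinite_finite_induct) (simp_all add: cs_add)

lemma norm_cs: "norm (cs c) \<le> cmod c"
  by (rule norm_endo_bound) (simp_all add: norm_cscale)

lemma bounded_linear_cs: "bounded_linear cs"
proof (rule bounded_linear_intro [of _ 1])
  show "cs (r *\<^sub>R x) = r *\<^sub>R cs x" for r x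
    by (rule endo_eqI) (simp add: app.scaleR_left cscale.scaleR_left)
qed (simp_all add: cs_add norm_cs)

lemma clin_commute: "clin T \<longleftrightarrow> (\<forall>c. T * cs c = cs c * T)"
proof
  assume "clin T" then show "\<forall>c. T * cs c = cs c * T" by (auto simp: clin_def intro!: endo_eqI)
next
  assume "\<forall>c. T * cs c = cs c * T"
  then have "app (T * cs c) x = app (cs c * T) x" for c x by simp
  then show "clin T" by (simp add: clin_def)
qed

lemma clinD: "clin T \<Longrightarrow> T * cs c = cs c * T"
  by (simp add: clin_commute)

lemma clin_inverse: assumes "clin T" "is_inverse T J" shows "clin J"
  unfolding clin_commute
proof
  fix c
  have "J * cs c = J * cs c * (T * J)" using assms by (simp add: is_inverse_def)
  also have "\<dots> = J * (T * cs c) * J" using assms by (simp add: clinD mult.assoc)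
  also have "\<dots> = cs c * J" using assms by (simp add: is_inverse_def mult.assoc [symmetric])
  finally show "J * cs c = cs c * J" .
qed

lemma power_cs_mult: assumes "clin T" shows "(cs c * T) ^ n = cs (c ^ n) * T ^ n"
proof (induction n)
  case (Suc n)
  have "(cs c * T) ^ Suc n = cs c * (T * cs (c ^ n)) * T ^ n" using Suc by (simp add: mult.assoc)
  also have "\<dots> = cs c * cs (c ^ n) * T * T ^ n" using assms by (simp add: clinD mult.assoc)
  finally show ?case by (simp add: cs_mult mult.assoc)
qed simp

lemma sum_powers_root_of_unity:
  assumes "0 < n" "j < n"
  shows "(\<Sum>k<n. cis (2 * pi * real k / real n) ^ j) = (if j = 0 then of_nat n else 0)"
proof (cases "j = 0")
  case False
  define w where "w = cis (2 * pi * real j / real n)"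
  have pow: "cis (2 * pi * real k / real n) ^ j = w ^ k" for k
    by (simp add: w_def Complex.DeMoivre mult_ac)
  have "w \<noteq> 1"
  proof
    assume "w = 1"
    then have "cos (2 * pi * real j / real n) = 1" by (simp add: w_def complex_eq_iff)
    then obtain x :: int where x: "2 * pi * real j / real n = x * (2 * pi)"
      unfolding cos_one_2pi_int by auto
    then have "real j = real_of_int x * real n" using assms by (simp add: field_simps)
    then have "int j = x * int n" by (metis of_int_eq_iff of_int_mult of_int_of_nat_eq)
    then have "int n dvd int j" by simp
    then show False using assms False by (simp add: nat_dvd_not_less)
  qed
  moreover have "w ^ n = 1" using assms by (simp add: w_def Complex.DeMoivre)
  ultimately show ?thesis using False by (simp add: pow geometric_sum)
qed simp

text \<open>Averaging the resolvent over the $n$-th roots of unity yields the inverse of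
  $1 - s^n T^n$. Equicontinuity in $n$ of these averages lets one push $s$ from $0$ to $1$.\<close>

lemma spectral_radius_less_one:
  fixes T :: "'b::complex_banach endo"
  assumes T: "clin T" and inv: "\<And>w. cmod w \<le> 1 \<Longrightarrow> \<exists>b. is_inverse (1 - cs w * T) b"
  obtains n where "n > 0" "norm (T ^ n) < 1"
proof -
  define J where "J w = (SOME b. is_inverse (1 - cs w * T) b)" for w
  have J: "is_inverse (1 - cs w * T) (J w)" if "cmod w \<le> 1" for w
    unfolding J_def using inv [OF that] by (rule someI_ex)
  have csc: "continuous_on (cball 0 1) cs"
    by (rule linear_continuous_on [OF bounded_linear_cs])
  have "continuous_on (cball 0 1) J"
    by (rule continuous_on_is_inverse [where f = "\<lambda>w. 1 - cs w * T"])
      (auto intro!: continuous_on_diff continuous_on_mult continuous_on_const J csc)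
  then have uJ: "uniformly_continuous_on (cball 0 1) J"
    by (simp add: compact_uniformly_continuous)
  define om where "om n k = cis (2 * pi * real k / real n)" for n k :: nat
  define F where "F n s = (\<Sum>k<n. J (of_real s * om n k)) /\<^sub>R real n" for n and s :: real
  have le1: "cmod (of_real s * om n k) \<le> 1" if "0 \<le> s" "s \<le> 1" for s n k
    using that by (simp add: norm_mult om_def)
  have F: "(1 - s ^ n *\<^sub>R T ^ n) * F n s = 1" if s: "0 \<le> s" "s \<le> 1" and n: "n > 0" for s n
  proof -
    have k: "(1 - s ^ n *\<^sub>R T ^ n) * J (of_real s * om n k) = (\<Sum>j<n. cs ((of_real s * om n k) ^ j) * T ^ j)"
      for k
    proof -
      define w where "w = of_real s * om n k"
      have "w ^ n = of_real (s ^ n)" using n by (simp add: w_def om_def Complex.DeMoivre power_mult_distrib)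
      then have "(1 - s ^ n *\<^sub>R T ^ n) = 1 - (cs w * T) ^ n"
        by (simp only: power_cs_mult [OF T] cs_of_real_mult)
      also have "\<dots> = (\<Sum>j<n. (cs w * T) ^ j) * (1 - cs w * T)" by (rule mult_one_minus_power)
      finally have "(1 - s ^ n *\<^sub>R T ^ n) * J w = (\<Sum>j<n. (cs w * T) ^ j) * ((1 - cs w * T) * J w)"
        by (simp only: mult.assoc)
      also have "(1 - cs w * T) * J w = 1" using J [OF le1 [OF s]] by (simp add: is_inverse_def w_def)
      finally show ?thesis by (simp add: power_cs_mult [OF T] w_def)
    qed
    have "(1 - s ^ n *\<^sub>R T ^ n) * (\<Sum>k<n. J (of_real s * om n k))
        = (\<Sum>k<n. \<Sum>j<n. cs ((of_real s * om n k) ^ j) * T ^ j)"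
      by (simp add: sum_distrib_left k)
    \<comment> \<open>After exchanging the sums, the inner sum over the roots of unity vanishes
      unless \<open>j = 0\<close>, which leaves \<open>n\<close> times the identity.\<close>
    also have "\<dots> = (\<Sum>j<n. cs (of_real s ^ j * (\<Sum>k<n. om n k ^ j)) * T ^ j)"
      by (subst sum.swap) (simp add: cs_sum sum_distrib_right sum_distrib_left power_mult_distrib)
    also have "\<dots> = (\<Sum>j<n. if j = 0 then real n *\<^sub>R 1 else 0)"
      by (intro sum.cong) (auto simp: om_def sum_powers_root_of_unity n
          cs_of_real_mult [of "real n" 1, simplified])
    also have "\<dots> = real n *\<^sub>R 1" using n by simp
    finally show ?thesis using n by (simp add: F_def)
  qed
  obtain d where d: "d > 0"
    "\<And>w w'. cmod w \<le> 1 \<Longrightarrow> cmod w' \<le> 1 \<Longrightarrow> dist w' w < d \<Longrightarrow> dist (J w') (J w) < 1/6"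
    using uJ [unfolded uniformly_continuous_on_def, rule_format, of "1/6"] by auto
  have FF: "norm (F n s' - F n s) \<le> 1/6"
    if "0 \<le> s" "s \<le> 1" "0 \<le> s'" "s' \<le> 1" "\<bar>s' - s\<bar> < d" "n > 0" for s s' n
  proof -
    have "norm (J (of_real s' * om n k) - J (of_real s * om n k)) \<le> 1/6" for k
    proof -
      have "dist (of_real s' * om n k) (of_real s * om n k) = \<bar>s' - s\<bar>"
        by (simp add: dist_norm left_diff_distrib [symmetric] norm_mult om_def flip: of_real_diff)
      then show ?thesis using d(2) [OF le1 le1, of s s' n k n k] that by (simp add: dist_norm)
    qed
    then have "norm (\<Sum>k<n. J (of_real s' * om n k) - J (of_real s * om n k)) \<le> real n * (1/6)"
      using sum_norm_bound [of "{..<n}" "\<lambda>k. J (of_real s' * om n k) - J (of_real s * om n k)" "1/6"]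
      by simp
    moreover have "F n s' - F n s = (\<Sum>k<n. J (of_real s' * om n k) - J (of_real s * om n k)) /\<^sub>R real n"
      by (simp add: F_def sum_subtractf scaleR_diff_right)
    ultimately show ?thesis using that by (simp add: field_simps)
  qed
  define P where "P s \<longleftrightarrow> (\<lambda>n. s ^ n * norm (T ^ n)) \<longlonglongrightarrow> 0" for s :: real
  \<comment> \<open>The constants chain as follows: \<open>norm A < 1/7\<close> gives
    \<open>norm (F n s - 1) \<le> (1/7) / (1 - 1/7) = 1/6\<close>; equicontinuity adds another 1/6;
    and a distance 1/3 from the identity at \<open>s'\<close> gives
    \<open>norm B \<le> (1/3) / (1 - 1/3) = 1/2\<close>.\<close>
  have step: "\<forall>\<^sub>F n in sequentially. s' ^ n * norm (T ^ n) \<le> 1/2"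
    if P: "P s" and s: "0 \<le> s" "s \<le> s'" "s' \<le> 1" "s' - s < d" for s s'
  proof -
    have "\<forall>\<^sub>F n in sequentially. s ^ n * norm (T ^ n) < 1/7"
      using P unfolding P_def by (rule order_tendstoD(2)) simp
    then show ?thesis using eventually_gt_at_top [of 0]
    proof eventually_elim
      case (elim n)
      define A where "A = s ^ n *\<^sub>R T ^ n"
      define B where "B = s' ^ n *\<^sub>R T ^ n"
      have "norm A < 1/7" using elim s by (simp add: A_def)
      have "F n s = 1 + A * F n s" using F [of s n] s elim by (simp add: A_def algebra_simps)
      then have "F n s - 1 = A * (F n s - 1) + A" by (simp add: algebra_simps)
      then have "norm (F n s - 1) \<le> norm A * norm (F n s - 1) + norm A"
        using norm_triangle_ineq [of "A * (F n s - 1)" A] norm_mult_ineq [of A "F n s - 1"]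
        by simp
      also have "\<dots> \<le> 1/7 * norm (F n s - 1) + 1/7"
        using \<open>norm A < 1/7\<close> by (intro add_mono mult_right_mono) auto
      finally have "norm (F n s - 1) \<le> 1/6" by simp
      moreover have "norm (F n s' - F n s) \<le> 1/6" using FF [of s s' n] s elim by simp
      ultimately have F3: "norm (F n s' - 1) \<le> 1/3"
        using norm_triangle_ineq [of "F n s' - F n s" "F n s - 1"] by simp
      have "F n s' = 1 + B * F n s'" using F [of s' n] s elim by (simp add: B_def algebra_simps)
      then have "B = (F n s' - 1) - B * (F n s' - 1)" by (simp add: algebra_simps)
      then have "norm B \<le> norm (F n s' - 1) + norm B * norm (F n s' - 1)"
        using norm_triangle_ineq4 [of "F n s' - 1" "B * (F n s' - 1)"]
          norm_mult_ineq [of B "F n s' - 1"] by simp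
      also have "\<dots> \<le> 1/3 + norm B * (1/3)" using F3 by (intro add_mono mult_left_mono) auto
      finally have "norm B \<le> 1/2" by simp
      then show ?case using s by (simp add: B_def)
    qed
  qed
  \<comment> \<open>A bound at \<open>s'\<close> turns into geometric decay at every smaller
    radius.\<close>
  have step2: "P s''" if ev: "\<forall>\<^sub>F n in sequentially. s' ^ n * norm (T ^ n) \<le> 1/2" and s: "0 \<le> s''" "s'' < s'"
    for s' s''
  proof -
    have "(\<lambda>n. (s'' / s') ^ n * (1/2)) \<longlonglongrightarrow> 0 * (1/2)"
      by (intro tendsto_intros LIMSEQ_power_zero) (use s in auto)
    then have lim: "(\<lambda>n. (s'' / s') ^ n * (1/2)) \<longlonglongrightarrow> 0" by simp
    have "\<forall>\<^sub>F n in sequentially. norm (s'' ^ n * norm (T ^ n)) \<le> (s'' / s') ^ n * (1/2)"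
      using ev
    proof eventually_elim
      case (elim n)
      have "norm (s'' ^ n * norm (T ^ n)) = (s'' / s') ^ n * (s' ^ n * norm (T ^ n))"
        using s by (simp add: power_divide)
      also have "\<dots> \<le> (s'' / s') ^ n * (1/2)" using s elim by (intro mult_left_mono) auto
      finally show ?case .
    qed
    then show ?thesis unfolding P_def by (rule Lim_null_comparison [OF _ lim])
  qed
  obtain m :: nat where m: "real m > 0" "2 / d < real m"
    using reals_Archimedean2 [of "2 / d"] d(1) by (metis divide_pos_pos less_trans zero_less_numeral)
  then have md: "2 / real m < d" using d(1) by (simp add: field_simps)
  \<comment> \<open>The grid has mesh \<open>1 / m\<close> with \<open>2 / m < d\<close>. An
    application of \<open>step\<close> reaches two cells ahead but returns only a bound; giving back
    one cell restores convergence to 0, so each round gains one cell.\<close>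
  have PP: "P (real k / real m)" if "k < m" for k
    using that
  proof (induction k)
    case 0
    have "\<forall>\<^sub>F n in sequentially. (0::real) ^ n * norm (T ^ n) = 0"
      using eventually_gt_at_top [of 0] by eventually_elim simp
    then show ?case by (simp add: P_def tendsto_eventually)
  next
    case (Suc k)
    have "\<forall>\<^sub>F n in sequentially. (real (k + 2) / real m) ^ n * norm (T ^ n) \<le> 1/2"
    proof (rule step [of "real k / real m"])
      have "real (k + 2) / real m - real k / real m = 2 / real m"
        by (simp add: diff_divide_distrib [symmetric])
      then show "real (k + 2) / real m - real k / real m < d" using md by simp
    qed (use Suc m in \<open>auto simp: divide_simps\<close>)
    then show ?case by (rule step2) (use m in \<open>auto simp: divide_simps\<close>)
  qed
  have "P (real (m - 1) / real m)" using m by (intro PP) auto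
  then have "\<forall>\<^sub>F n in sequentially. 1 ^ n * norm (T ^ n) \<le> 1/2"
  proof (rule step)
    have "1 - real (m - 1) / real m = 1 / real m" using m by (simp add: field_simps of_nat_diff)
    also have "\<dots> < 2 / real m" using m by (simp add: divide_strict_right_mono)
    finally show "1 - real (m - 1) / real m < d" using md by simp
  qed (use m in \<open>auto simp: divide_simps\<close>)
  then have "\<forall>\<^sub>F n in sequentially. n > 0 \<and> norm (T ^ n) < 1"
    using eventually_gt_at_top [of 0] by eventually_elim auto
  then show ?thesis using that eventually_happens' [OF sequentially_bot] by blast
qed

section \<open>Functions of class $C^k$ on a set\<close>

lemma has_vector_derivative_iff_slope:
  "(f has_vector_derivative D) (at t within S) \<longleftrightarrow>
   ((\<lambda>s. (f s - f t) /\<^sub>R (s - t)) \<longlongrightarrow> D) (at t within S)"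
proof -
  have eq: "norm ((1 / norm (s - t)) *\<^sub>R (f s - (f t + (s - t) *\<^sub>R D))) = norm ((f s - f t) /\<^sub>R (s - t) - D)"
    if "s \<noteq> t" for s
  proof -
    have "(f s - f t) /\<^sub>R (s - t) - D = (1 / (s - t)) *\<^sub>R (f s - (f t + (s - t) *\<^sub>R D))"
      using that by (simp add: scaleR_diff_right scaleR_add_right divide_inverse)
    then show ?thesis by simp
  qed
  have "(f has_vector_derivative D) (at t within S) \<longleftrightarrow>
    ((\<lambda>s. norm ((1 / norm (s - t)) *\<^sub>R (f s - (f t + (s - t) *\<^sub>R D)))) \<longlongrightarrow> 0) (at t within S)"
    unfolding has_vector_derivative_def has_derivative_within tendsto_norm_zero_iff
    by (simp add: bounded_linear_scaleR_left)
  also have "\<dots> \<longleftrightarrow> ((\<lambda>s. norm ((f s - f t) /\<^sub>R (s - t) - D)) \<longlongrightarrow> 0) (at t within S)"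
    by (intro filterlim_cong refl) (unfold eventually_at_filter, intro always_eventually allI impI, rule eq)
  also have "\<dots> \<longleftrightarrow> ((\<lambda>s. (f s - f t) /\<^sub>R (s - t)) \<longlongrightarrow> D) (at t within S)"
    unfolding tendsto_norm_zero_iff by (rule LIM_zero_iff)
  finally show ?thesis .
qed

lemma Ck_on_0: "Ck_on 0 S f \<longleftrightarrow> continuous_on S f"
proof
  assume "continuous_on S f"
  then show "Ck_on 0 S f" unfolding Ck_on_def by (intro exI [of _ "\<lambda>_. f"]) auto
qed (auto simp: Ck_on_def)

text \<open>Trades the sequence of derivatives for a recursion, the form in which the closure
  properties below are proved by induction on \<open>k\<close>.\<close>

lemma Ck_on_Suc:
  "Ck_on (Suc k) S f \<longleftrightarrow>
   (\<exists>f'. (\<forall>t\<in>S. (f has_vector_derivative f' t) (at t within S)) \<and> Ck_on k S f')"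
proof
  assume "Ck_on (Suc k) S f"
  then obtain D where D: "D 0 = f"
    "\<forall>j<Suc k. \<forall>t\<in>S. (D j has_vector_derivative D (Suc j) t) (at t within S)"
    "\<forall>j\<le>Suc k. continuous_on S (D j)" unfolding Ck_on_def by blast
  show "\<exists>f'. (\<forall>t\<in>S. (f has_vector_derivative f' t) (at t within S)) \<and> Ck_on k S f'"
  proof (intro exI conjI)
    show "\<forall>t\<in>S. (f has_vector_derivative D 1 t) (at t within S)" using D by fastforce
    show "Ck_on k S (D 1)" unfolding Ck_on_def
      by (rule exI [of _ "\<lambda>j. D (Suc j)"]) (use D in auto)
  qed
next
  assume "\<exists>f'. (\<forall>t\<in>S. (f has_vector_derivative f' t) (at t within S)) \<and> Ck_on k S f'"
  then obtain f' D where f': "\<forall>t\<in>S. (f has_vector_derivative f' t) (at t within S)"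
    and D: "D 0 = f'"
    "\<forall>j<k. \<forall>t\<in>S. (D j has_vector_derivative D (Suc j) t) (at t within S)"
    "\<forall>j\<le>k. continuous_on S (D j)" unfolding Ck_on_def by blast
  have "continuous_on S f"
    unfolding continuous_on_eq_continuous_within using f' has_vector_derivative_continuous by blast
  then show "Ck_on (Suc k) S f" unfolding Ck_on_def
    by (intro exI [of _ "\<lambda>j. case j of 0 \<Rightarrow> f | Suc i \<Rightarrow> D i"])
      (use f' D in \<open>auto split: nat.split simp: less_Suc_eq_le\<close>)
qed

lemma Ck_on_imp_continuous: "Ck_on k S f \<Longrightarrow> continuous_on S f"
  by (auto simp: Ck_on_def)

lemma Ck_on_mono: "Ck_on k S f \<Longrightarrow> j \<le> k \<Longrightarrow> Ck_on j S f"
  unfolding Ck_on_def by (elim exE, rule_tac x = D in exI) (auto dest: less_le_trans)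

lemma Ck_on_subset: "Ck_on k S f \<Longrightarrow> T \<subseteq> S \<Longrightarrow> Ck_on k T f"
  unfolding Ck_on_def by (elim exE, rule_tac x = D in exI)
    (auto intro: continuous_on_subset has_vector_derivative_within_subset)

lemma Ck_on_const: "Ck_on k S (\<lambda>_. c)"
  by (induction k arbitrary: c) (auto simp: Ck_on_0 Ck_on_Suc intro!: exI [of _ "\<lambda>_. 0"])

lemma Ck_on_add: "Ck_on k S f \<Longrightarrow> Ck_on k S g \<Longrightarrow> Ck_on k S (\<lambda>t. f t + g t)"
proof (induction k arbitrary: f g)
  case 0 then show ?case by (simp add: Ck_on_0 continuous_on_add)
next
  case (Suc k)
  then obtain f' g' where "\<forall>t\<in>S. (f has_vector_derivative f' t) (at t within S)" "Ck_on k S f'"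
    "\<forall>t\<in>S. (g has_vector_derivative g' t) (at t within S)" "Ck_on k S g'"
    by (auto simp: Ck_on_Suc)
  then show ?case unfolding Ck_on_Suc
    by (intro exI [of _ "\<lambda>t. f' t + g' t"]) (auto intro: Suc.IH has_vector_derivative_add)
qed

lemma Ck_on_bounded_linear: "bounded_linear h \<Longrightarrow> Ck_on k S f \<Longrightarrow> Ck_on k S (\<lambda>t. h (f t))"
proof (induction k arbitrary: f)
  case 0 then show ?case by (simp add: Ck_on_0 bounded_linear.continuous_on)
next
  case (Suc k)
  then obtain f' where "\<forall>t\<in>S. (f has_vector_derivative f' t) (at t within S)" "Ck_on k S f'"
    by (auto simp: Ck_on_Suc)
  then show ?case unfolding Ck_on_Suc
    by (intro exI [of _ "\<lambda>t. h (f' t)"])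
      (auto intro: Suc.IH Suc.prems bounded_linear.has_vector_derivative)
qed

lemma Ck_on_minus: "Ck_on k S f \<Longrightarrow> Ck_on k S (\<lambda>t. - f t)"
  by (rule Ck_on_bounded_linear) (simp add: bounded_linear_minus bounded_linear_ident)

lemma Ck_on_diff: "Ck_on k S f \<Longrightarrow> Ck_on k S g \<Longrightarrow> Ck_on k S (\<lambda>t. f t - g t)"
  using Ck_on_add [of k S f "\<lambda>t. - g t"] by (simp add: Ck_on_minus)

lemma Ck_on_bilinear:
  assumes "bounded_bilinear h"
  shows "Ck_on k S f \<Longrightarrow> Ck_on k S g \<Longrightarrow> Ck_on k S (\<lambda>t. h (f t) (g t))"
proof (induction k arbitrary: f g)
  case 0 then show ?case using assms by (simp add: Ck_on_0 bounded_bilinear.continuous_on)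
next
  case (Suc k)
  then obtain f' g' where *: "\<forall>t\<in>S. (f has_vector_derivative f' t) (at t within S)" "Ck_on k S f'"
    "\<forall>t\<in>S. (g has_vector_derivative g' t) (at t within S)" "Ck_on k S g'"
    by (auto simp: Ck_on_Suc)
  have "Ck_on k S f" "Ck_on k S g" using Suc.prems Ck_on_mono by (metis le_SucI order_refl)+
  then have "Ck_on k S (\<lambda>t. h (f t) (g' t) + h (f' t) (g t))"
    using * by (intro Ck_on_add Suc.IH)
  then show ?case unfolding Ck_on_Suc
    using * assms by (intro exI [of _ "\<lambda>t. h (f t) (g' t) + h (f' t) (g t)"])
      (auto intro: bounded_bilinear.has_vector_derivative)
qed

lemmas Ck_on_mult = Ck_on_bilinear [OF bounded_bilinear_mult]
lemmas Ck_on_app = Ck_on_bilinear [OF bounded_bilinear_app]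
text \<open>Bootstrapping: the derivative \<open>- (g t * f' t * g t)\<close> contains
  \<open>g\<close> itself, so each order of smoothness of \<open>g\<close> yields the next one, as
  long as \<open>f'\<close> permits.\<close>

lemma Ck_on_is_inverse:
  fixes f g :: "real \<Rightarrow> 'a::{real_normed_algebra,monoid_mult,banach}"
  assumes fg: "\<And>t. t \<in> S \<Longrightarrow> is_inverse (f t) (g t)"
  shows "Ck_on k S f \<Longrightarrow> Ck_on k S g"
proof (induction k)
  case 0 then show ?case using continuous_on_is_inverse [OF _ fg] by (simp add: Ck_on_0)
next
  case (Suc k)
  then obtain f' where f': "\<forall>t\<in>S. (f has_vector_derivative f' t) (at t within S)" "Ck_on k S f'"
    by (auto simp: Ck_on_Suc)
  have gk: "Ck_on k S g" using Suc Ck_on_mono by (metis le_SucI order_refl)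
  then have gc: "continuous_on S g" by (rule Ck_on_imp_continuous)
  have "(g has_vector_derivative - (g t * f' t * g t)) (at t within S)" if t: "t \<in> S" for t
    unfolding has_vector_derivative_iff_slope
  proof -
    have "((\<lambda>s. - (g s * ((f s - f t) /\<^sub>R (s - t)) * g t)) \<longlongrightarrow> - (g t * f' t * g t)) (at t within S)"
      using f'(1) t gc by (intro tendsto_intros) (auto simp: has_vector_derivative_iff_slope continuous_on_def)
    \<comment> \<open>The noncommutative form of the difference of reciprocals: placing
      \<open>g s\<close> on the left and \<open>g t\<close> on the right makes the identity
      exact.\<close>
    moreover have "- (g s * ((f s - f t) /\<^sub>R (s - t)) * g t) = (g s - g t) /\<^sub>R (s - t)"
      if s: "s \<in> S" for s
    proof -
      have "g s * f s = 1" "f t * g t = 1" using fg s t by (auto simp: is_inverse_def)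
      then have "g s * (f s - f t) * g t = g t - g s"
        by (simp add: right_diff_distrib left_diff_distrib mult.assoc)
      then have "- (g s * (f s - f t) * g t) = g s - g t" by simp
      then show ?thesis by (simp flip: scaleR_minus_right)
    qed
    then have "\<forall>\<^sub>F s in at t within S. - (g s * ((f s - f t) /\<^sub>R (s - t)) * g t) = (g s - g t) /\<^sub>R (s - t)"
      unfolding eventually_at_filter by (intro always_eventually) blast
    ultimately show "((\<lambda>s. (g s - g t) /\<^sub>R (s - t)) \<longlongrightarrow> - (g t * f' t * g t)) (at t within S)"
      by (rule Lim_transform_eventually)
  qed
  moreover have "Ck_on k S (\<lambda>t. - (g t * f' t * g t))"
    by (intro Ck_on_minus Ck_on_mult gk f')
  ultimately show ?case unfolding Ck_on_Suc
    by (intro exI [of _ "\<lambda>t. - (g t * f' t * g t)"] conjI ballI)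
qed

lemma Ck_on_Lipschitz:
  fixes f :: "real \<Rightarrow> 'a::real_normed_vector"
  assumes "Ck_on (Suc k) {a..b} f"
  obtains C where "C \<ge> 0" "\<And>s t. s \<in> {a..b} \<Longrightarrow> t \<in> {a..b} \<Longrightarrow> norm (f s - f t) \<le> C * \<bar>s - t\<bar>"
proof -
  obtain f' where f': "\<forall>t\<in>{a..b}. (f has_vector_derivative f' t) (at t within {a..b})"
    "Ck_on k {a..b} f'"
    using assms unfolding Ck_on_Suc by blast
  have cont: "continuous_on {a..b} f'" using f'(2) by (rule Ck_on_imp_continuous)
  have "bounded (f' ` {a..b})"
    using cont by (simp add: compact_continuous_image compact_imp_bounded)
  then obtain C where C: "C > 0" "\<And>t. t \<in> {a..b} \<Longrightarrow> norm (f' t) \<le> C"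
    unfolding bounded_pos by auto
  show ?thesis
  proof (rule that [of C])
    fix s t assume st: "s \<in> {a..b}" "t \<in> {a..b}"
    have "norm (f s - f t) \<le> C * norm (s - t)"
    proof (rule differentiable_bound [of "{a..b}" f "\<lambda>x h. h *\<^sub>R f' x"])
      show "(f has_derivative (\<lambda>h. h *\<^sub>R f' x)) (at x within {a..b})" if "x \<in> {a..b}" for x
        using f'(1) that by (simp add: has_vector_derivative_def)
      show "onorm (\<lambda>h. h *\<^sub>R f' x) \<le> C" if "x \<in> {a..b}" for x
        using mult_right_mono [OF C(2) [OF that] abs_ge_zero] by (intro onorm_le) (simp add: mult.commute)
    qed (use st in auto)
    then show "norm (f s - f t) \<le> C * \<bar>s - t\<bar>" by simp
  qed (use C in simp)
qed

section \<open>Spectral decomposition at a simple dominant eigenvalue\<close>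

lemma bij_is_inverse:
  fixes S :: "'b::banach endo"
  assumes "bij (app S)" shows "\<exists>G. is_inverse S G"
proof -
  have "bounded_linear (inv (app S))"
    by (rule bij_bounded_linear_inv [OF app.bounded_linear_right assms])
  then obtain G where G: "\<And>x. app G x = inv (app S) x" by (rule endo_of_bounded_linear) blast
  have "is_inverse S G" unfolding is_inverse_def
    by (intro conjI endo_eqI) (simp_all add: G surj_f_inv_f [OF bij_is_surj [OF assms]]
        inv_f_f [OF bij_is_inj [OF assms]])
  then show ?thesis ..
qed

lemma is_inverse_bij: "is_inverse S G \<Longrightarrow> bij (app S)"
  unfolding is_inverse_def
  by (rule o_bij [where g = "app G"]) (auto simp: fun_eq_iff simp flip: app_simps(3))

lemma is_inverse_minus:
  fixes a :: "'a::{ring,monoid_mult}"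
  shows "is_inverse a b \<Longrightarrow> is_inverse (- a) (- b)"
  by (simp add: is_inverse_def)

lemma is_inverse_mult:
  "is_inverse a b \<Longrightarrow> is_inverse c d \<Longrightarrow> is_inverse (a * c) (d * b)"
  unfolding is_inverse_def by (metis mult.assoc mult_1_left)

lemma is_inverse_cs: "c \<noteq> 0 \<Longrightarrow> is_inverse (cs c) (cs (1 / c))"
  by (simp add: is_inverse_def flip: cs_mult)

section \<open>Method of continuity for the resolvent outside the unit disk\<close>

lemma inj_closed_range_bounded_below:
  fixes S :: "'b::banach endo"
  assumes "closed (range (app S))" "\<And>x. app S x = 0 \<Longrightarrow> x = 0"
  obtains c where "c > 0" "\<And>x. c * norm x \<le> norm (app S x)"
proof -
  obtain C where C: "C > 0" "\<And>y. y \<in> range (app S) \<Longrightarrow> \<exists>x. app S x = y \<and> norm x \<le> C * norm y"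
    using closed_range_preimage_bound [OF app.bounded_linear_right assms(1)] by blast
  show ?thesis
  proof (rule that [of "1 / C"])
    fix x
    obtain x' where "app S x' = app S x" "norm x' \<le> C * norm (app S x)" using C(2) by blast
    moreover from this have "x' = x" using assms(2) [of "x' - x"] by (simp add: app.diff_right)
    ultimately show "1 / C * norm x \<le> norm (app S x)" using C(1) by (simp add: field_simps)
  qed (use C in simp)
qed

text \<open>The lower bound of \<open>S\<close> passes to \<open>S'\<close> with constant
  \<open>2 * c / 3\<close>, so the inverse of \<open>S'\<close> has norm at most
  \<open>3 / (2 * c)\<close>, whatever \<open>S'\<close> is. This a priori bound makes the Neumann
  series reach \<open>S\<close>: the product of norms is at most 1/2.\<close>

lemma bounded_below_near_invertible:
  fixes S S' :: "'b::banach endo"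
  assumes c: "c > 0" "\<And>x. c * norm x \<le> norm (app S x)"
    and S': "is_inverse S' G'" and near: "norm (S - S') \<le> c / 3"
  shows "\<exists>G. is_inverse S G"
proof -
  have "norm (app G' y) \<le> 3 / (2 * c) * norm y" for y
  proof -
    define x where "x = app G' y"
    have y: "y = app S' x" using S' by (simp add: x_def is_inverse_def flip: app_simps(3))
    have "norm (app (S - S') x) \<le> c / 3 * norm x"
      by (rule order_trans [OF norm_app]) (intro mult_right_mono near norm_ge_zero)
    moreover have "norm (app S x) \<le> norm y + norm (app (S - S') x)"
      using norm_triangle_ineq [of y "app (S - S') x"] by (simp add: y app.diff_left)
    ultimately have "2 * c / 3 * norm x \<le> norm y" using c(2) [of x] by linarith
    then show ?thesis using c(1) by (simp add: x_def field_simps)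
  qed
  then have "norm G' \<le> 3 / (2 * c)" using c(1) by (intro norm_endo_bound) auto
  then have "norm G' * norm (S - S') \<le> 3 / (2 * c) * (c / 3)"
    using near c(1) by (intro mult_mono) auto
  also have "\<dots> = 1/2" using c(1) by simp
  finally show ?thesis using is_inverse_perturb [OF S', of S "1/2"] by auto
qed

lemma dominated_invertible:
  fixes T :: "'b::complex_banach endo"
  assumes "norm T < cmod z" shows "\<exists>G. is_inverse (cs z - T) G"
proof -
  have z: "z \<noteq> 0" using assms by auto
  have "norm (cs (1 / z) * T) \<le> cmod (1 / z) * norm T"
    by (rule order_trans [OF norm_mult_ineq]) (intro mult_right_mono norm_cs norm_ge_zero)
  also have "\<dots> < 1" using assms z by (simp add: norm_divide field_simps)
  finally obtain y where "is_inverse (1 - cs (1 / z) * T) y" using neumann_series by blast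
  moreover have "cs z * (1 - cs (1 / z) * T) = cs z - T"
    using z by (simp add: right_diff_distrib mult.assoc [symmetric] flip: cs_mult)
  ultimately show ?thesis using is_inverse_mult [OF is_inverse_cs [OF z]] by metis
qed

text \<open>Method of continuity along the ray of multiples \<open>s * z\<close>, from a large
  \<open>s = b\<close>, where the Neumann series applies, down to \<open>s = 1\<close>. The ray
  stays outside the open unit disk and avoids 1, so the operators on it are injective with closed
  range, that is, bounded below; the lower bound makes invertibility spread along the connected
  interval.\<close>

lemma outer_resolvent:
  fixes T :: "'b::complex_banach endo"
  assumes cl: "\<And>z. cmod z \<ge> 1 \<Longrightarrow> closed (range (app (cs z - T)))"
    and inj: "\<And>z x. cmod z \<ge> 1 \<Longrightarrow> z \<noteq> 1 \<Longrightarrow> app T x = cscale z x \<Longrightarrow> x = 0"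
    and z: "cmod z \<ge> 1" "z \<noteq> 1"
  shows "\<exists>G. is_inverse (cs z - T) G"
proof -
  define S where "S s = cs (of_real s * z) - T" for s :: real
  define b where "b = max 1 (norm T + 1)"
  have b: "b \<ge> 1" "norm T < b" by (auto simp: b_def)
  have bb: "\<exists>c>0. \<forall>x. c * norm x \<le> norm (app (S s) x)" if s: "s \<ge> 1" for s
  proof -
    have m: "cmod (of_real s * z) \<ge> 1"
      using mult_mono [of 1 s 1 "cmod z"] s z by (simp add: norm_mult)
    have "of_real s * z \<noteq> 1"
    proof
      assume eq: "of_real s * z = 1"
      then have "s * cmod z = 1" using s by (metis abs_of_nonneg norm_mult norm_of_real norm_one order_trans zero_le_one)
      then have "s = 1" using s z mult_mono [of s s 1 "cmod z"] by auto
      then show False using eq z by simp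
    qed
    then have "x = 0" if "app (S s) x = 0" for x
      using inj [OF m] that by (simp add: S_def app.diff_left)
    then show ?thesis
      using inj_closed_range_bounded_below [of "S s"] cl [OF m] unfolding S_def by metis
  qed
  have diff: "S s - S s' = cs (of_real (s - s') * z)" for s s'
    by (simp add: S_def left_diff_distrib linear_diff [OF bounded_linear.linear [OF bounded_linear_cs]])
  have nd: "norm (S s - S s') \<le> \<bar>s - s'\<bar> * cmod z" for s s'
    unfolding diff by (rule order_trans [OF norm_cs]) (simp add: norm_mult flip: of_real_diff)
  have "\<exists>G. is_inverse (S 1) G"
  proof (rule connected_induction_simple [where P = "\<lambda>s. \<exists>G. is_inverse (S s) G" and S = "{1..b}" and a = b])
    have "cmod (of_real b * z) \<ge> b" using b z by (simp add: norm_mult mult_le_cancel_left1)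
    then show "\<exists>G. is_inverse (S b) G" unfolding S_def using b by (intro dominated_invertible) simp
    fix x :: real assume x: "x \<in> {1..b}"
    then obtain c where c: "c > 0" "\<And>y. c * norm y \<le> norm (app (S x) y)" using bb by auto
    \<comment> \<open>Within distance \<eta> of \<open>x\<close> the operator moves by at most
      \<open>c / 12\<close>, so the lower bound \<open>c / 2\<close> survives; two points of the
      ball differ by at most \<open>c / 6\<close>, which is a third of \<open>c / 2\<close> as
      \<open>bounded_below_near_invertible\<close> requires.\<close>
    define \<eta> where "\<eta> = c / (12 * cmod z)"
    have zp: "cmod z > 0" using z by linarith
    have \<eta>: "\<eta> > 0" unfolding \<eta>_def using c(1) zp by (intro divide_pos_pos mult_pos_pos) auto
    have loc: "c / 2 * norm y \<le> norm (app (S s) y)" if s: "\<bar>s - x\<bar> < \<eta>" for s y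
    proof -
      have "norm (app (S x - S s) y) \<le> (\<bar>x - s\<bar> * cmod z) * norm y"
        by (rule order_trans [OF norm_app]) (intro mult_right_mono nd norm_ge_zero)
      also have "\<dots> \<le> (\<eta> * cmod z) * norm y"
        using s by (intro mult_right_mono) auto
      also have "\<eta> * cmod z = c / 12" using z by (auto simp: \<eta>_def)
      finally have "norm (app (S x - S s) y) \<le> c / 12 * norm y" .
      moreover have "norm (app (S x) y) \<le> norm (app (S s) y) + norm (app (S x - S s) y)"
        using norm_triangle_ineq [of "app (S s) y" "app (S x - S s) y"] by (simp add: app.diff_left)
      moreover have "c / 2 * norm y \<le> c * norm y - c / 12 * norm y"
        using c by (simp add: left_diff_distrib [symmetric] mult_right_mono)
      ultimately show ?thesis using c(2) [of y] by linarith
    qed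
    show "\<exists>U. openin (top_of_set {1..b}) U \<and> x \<in> U \<and>
      (\<forall>s\<in>U. \<forall>s'\<in>U. (\<exists>G. is_inverse (S s) G) \<longrightarrow> (\<exists>G. is_inverse (S s') G))"
    proof (rule exI [of _ "ball x \<eta> \<inter> {1..b}"], intro conjI ballI impI)
      show "openin (top_of_set {1..b}) (ball x \<eta> \<inter> {1..b})"
        by (metis Int_commute open_ball openin_open_Int)
      show "x \<in> ball x \<eta> \<inter> {1..b}" using x \<eta> by simp
      fix s s' assume s: "s \<in> ball x \<eta> \<inter> {1..b}" "s' \<in> ball x \<eta> \<inter> {1..b}"
        and "\<exists>G. is_inverse (S s) G"
      then obtain G where G: "is_inverse (S s) G" by blast
      have d: "\<bar>s - x\<bar> < \<eta>" "\<bar>s' - x\<bar> < \<eta>" using s by (auto simp: dist_real_def)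
      have "norm (S s' - S s) \<le> (2 * \<eta>) * cmod z"
        using d by (intro order_trans [OF nd] mult_right_mono) auto
      also have "\<dots> = c / 2 / 3" using z by (auto simp: \<eta>_def)
      finally show "\<exists>G. is_inverse (S s') G"
        using c d G loc by (intro bounded_below_near_invertible [of "c / 2" "S s'" "S s" G]) auto
    qed
  qed (use b in auto)
  then show ?thesis by (simp add: S_def)
qed

section \<open>Splitting the space into the eigenline and the range of \<open>1 - T\<close>\<close>

definition rank_one :: "'b::complex_banach \<Rightarrow> ('b \<Rightarrow>\<^sub>L complex) \<Rightarrow> 'b endo" where
  "rank_one h p = Endo (Blinfun (\<lambda>x. cscale (blinfun_apply p x) h))"

lemma app_rank_one [simp]: "app (rank_one h p) x = cscale (blinfun_apply p x) h"
proof -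
  have "bounded_linear (\<lambda>x. cscale (blinfun_apply p x) h)"
    by (rule bounded_linear_compose [OF cscale.bounded_linear_left blinfun.bounded_linear_right])
  then show ?thesis by (simp add: rank_one_def bounded_linear_Blinfun_apply)
qed

lemma bounded_bilinear_rank_one: "bounded_bilinear rank_one"
proof
  show "\<exists>K. \<forall>h (p :: 'a \<Rightarrow>\<^sub>L complex). norm (rank_one h p) \<le> norm h * norm p * K"
  proof (intro exI [of _ 1] allI, rule norm_endo_bound)
    fix h and p :: "'a \<Rightarrow>\<^sub>L complex" and x :: 'a
    show "norm (app (rank_one h p) x) \<le> norm h * norm p * 1 * norm x"
      using mult_right_mono [OF norm_blinfun [of p x] norm_ge_zero [of h]]
      by (simp add: norm_cscale mult_ac)
  qed simp
qed (rule endo_eqI, simp add: cscale_add_right cscale_add_left cscale.scaleR_right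
    cscale.scaleR_left app.add_left app.scaleR_left blinfun.add_left blinfun.scaleR_left)+

text \<open>The shape in which (A2) is used: \<open>closed_range\<close> comes from the Fredholm
  property outside the essential spectrum, \<open>inj\<close> from the location of the eigenvalues,
  and \<open>simple\<close> excludes both a second eigenvector and a Jordan block of length
  two.\<close>

locale simple_dominant =
  fixes T :: "'b::complex_banach endo" and e :: 'b
  assumes clinT: "clin T"
    and closed_range: "\<And>z. cmod z \<ge> 1 \<Longrightarrow> closed (range (app (cs z - T)))"
    and inj: "\<And>z x. cmod z \<ge> 1 \<Longrightarrow> z \<noteq> 1 \<Longrightarrow> app T x = cscale z x \<Longrightarrow> x = 0"
    and e: "e \<noteq> 0" "app T e = e"
    and simple: "\<And>x. app (1 - T) (app (1 - T) x) = 0 \<Longrightarrow> \<exists>c. x = cscale c e"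
begin

abbreviation "D \<equiv> 1 - T"
definition R where "R = range (app D)"

lemma resolvent: assumes "cmod z \<ge> 1" "z \<noteq> 1" shows "\<exists>G. is_inverse (cs z - T) G"
proof (rule outer_resolvent)
  show "closed (range (app (cs z - T)))" if "1 \<le> cmod z" for z using that by (rule closed_range)
  show "x = 0" if "1 \<le> cmod z" "z \<noteq> 1" "app T x = cscale z x" for z x using that by (rule inj)
qed fact+

lemma clinD': "clin D" using clinT by (simp add: clin_commute left_diff_distrib right_diff_distrib)

lemma app_D_cscale: "app D (cscale c x) = cscale c (app D x)"
  using clinD' by (simp add: clin_def)

lemma app_D_e [simp]: "app D (cscale c e) = 0"
proof -
  have "app D e = 0" by (simp add: app.diff_left e)
  then show ?thesis by (simp only: app_D_cscale cscale.zero_right)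
qed

lemma kernel: "app D x = 0 \<Longrightarrow> \<exists>c. x = cscale c e"
  by (rule simple) (simp add: app.zero_right)

lemma closed_R: "closed R"
  using closed_range [of 1] by (simp add: R_def)

lemma R_add: "x \<in> R \<Longrightarrow> y \<in> R \<Longrightarrow> x + y \<in> R"
  unfolding R_def by clarify (metis app.add_right rangeI)
lemma R_diff: "x \<in> R \<Longrightarrow> y \<in> R \<Longrightarrow> x - y \<in> R"
  unfolding R_def by clarify (metis app.diff_right rangeI)
lemma R_cscale: "x \<in> R \<Longrightarrow> cscale c x \<in> R"
  unfolding R_def by clarify (metis app_D_cscale rangeI)
lemma R_D: "app D x \<in> R" by (simp add: R_def)

text \<open>A preimage of \<open>e\<close> under \<open>D\<close> would be a generalized eigenvector
  of order two.\<close>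

lemma e_notin_R: "cscale c e \<in> R \<Longrightarrow> c = 0"
proof (rule ccontr)
  assume ce: "cscale c e \<in> R" and c: "c \<noteq> 0"
  have "cscale (1 / c) (cscale c e) \<in> R" using ce by (rule R_cscale)
  moreover have "cscale (1 / c) (cscale c e) = e" using c by (simp add: cscale_cscale cscale_one)
  ultimately have "e \<in> R" by simp
  then obtain x where x: "app D x = e" by (auto simp: R_def)
  then have "app D (app D x) = 0" using app_D_e [of 1] by (simp add: cscale_one)
  then obtain a where "x = cscale a e" using simple by blast
  then show False using x e by simp
qed

text \<open>Preimages with controlled norm exist by closedness of the range, but they may lie
  outside \<open>R\<close> by a multiple of \<open>e\<close>. Since \<open>e\<close> has positive
  distance from the closed subspace \<open>R\<close>, that multiple is controlled too.\<close>

lemma bounded_below_on_R: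
  obtains C where "C > 0" "\<And>x. x \<in> R \<Longrightarrow> norm x \<le> C * norm (app D x)"
proof -
  obtain C where C: "C > 0" "\<And>y. y \<in> range (app D) \<Longrightarrow> \<exists>x. app D x = y \<and> norm x \<le> C * norm y"
    using closed_range_preimage_bound [OF app.bounded_linear_right closed_R [unfolded R_def]] by blast
  have "e \<notin> R" using e_notin_R [of 1] by (auto simp: cscale_one)
  then obtain d where d0: "d > 0" "ball e d \<subseteq> - R"
    using closed_R openE [of "- R" e] by auto
  have d: "d > 0" "\<And>y. y \<in> R \<Longrightarrow> d \<le> dist e y" using d0 by (auto simp: subset_iff not_less)
  have dc: "cmod c * d \<le> norm (cscale c e + y)" if y: "y \<in> R" for c y
  proof (cases "c = 0")
    case False
    have "cscale (- 1 / c) y \<in> R" using y by (rule R_cscale)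
    then have "d \<le> dist e (cscale (- 1 / c) y)" by (rule d)
    then have "cmod c * d \<le> cmod c * norm (e - cscale (- 1 / c) y)"
      by (intro mult_left_mono) (auto simp: dist_norm)
    also have "\<dots> = norm (cscale c (e - cscale (- 1 / c) y))" by (simp add: norm_cscale)
    also have "cscale c (e - cscale (- 1 / c) y) = cscale c e + y"
      using False by (simp add: cscale.diff_right cscale_add_right cscale_cscale cscale.minus_left cscale_one)
    finally show ?thesis .
  qed simp
  show ?thesis
  proof (rule that [of "C * (1 + norm e / d)"])
    show "0 < C * (1 + norm e / d)" using C d by (simp add: add_pos_nonneg)
    fix x assume x: "x \<in> R"
    obtain x' where x': "app D x' = app D x" "norm x' \<le> C * norm (app D x)" using C(2) by blast
    then obtain c where c: "x' - x = cscale c e" using kernel [of "x' - x"] by (auto simp: app.diff_right)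
    then have x'c: "x' = cscale c e + x" by (simp add: algebra_simps)
    have "cmod c \<le> norm x' / d" using dc [OF x, of c] d by (simp add: x'c pos_le_divide_eq)
    then have "cmod c * norm e \<le> norm x' / d * norm e" by (intro mult_right_mono) auto
    moreover have "norm x \<le> norm x' + norm (cscale c e)" using norm_triangle_ineq4 [of x' "cscale c e"]
      by (simp add: x'c)
    ultimately have "norm x \<le> norm x' * (1 + norm e / d)" by (simp add: norm_cscale algebra_simps)
    also have "\<dots> \<le> C * norm (app D x) * (1 + norm e / d)"
      using x' d by (intro mult_right_mono) auto
    finally show "norm x \<le> C * (1 + norm e / d) * norm (app D x)" by (simp add: mult_ac)
  qed
qed

text \<open>Regularization: solve \<open>app D x + E n *\<^sub>R x = y\<close> with the resolvent at
  \<open>1 + E n\<close>. The solutions lie in \<open>R\<close>, because the equation expresses them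
  through elements of \<open>R\<close>, and there the lower bound on \<open>D\<close> makes them
  bounded and Cauchy; the limit solves the equation without regularization. Together with
  \<open>kernel\<close> this gives the direct sum of the eigenline and \<open>R\<close>.\<close>

lemma D_onto_R: assumes y: "y \<in> R" shows "\<exists>x\<in>R. app D x = y"
proof -
  obtain C where C: "C > 0" "\<And>x. x \<in> R \<Longrightarrow> norm x \<le> C * norm (app D x)"
    using bounded_below_on_R by blast
  \<comment> \<open>Chosen so that \<open>C * E n \<le> 1/2\<close>: the regularizing term is
    absorbed in the lower bound, leaving \<open>norm (x n) \<le> 2 * C * norm y\<close>, and its own
    norm is then at most \<open>norm y / real (Suc n)\<close>.\<close>
  define E where "E n = 1 / (2 * C * real (Suc n))" for n
  have E: "E n > 0" for n using C by (simp add: E_def)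
  have "\<exists>x. app D x + E n *\<^sub>R x = y" for n
  proof -
    have "cmod (of_real (1 + E n)) \<ge> 1" using E [of n] by (simp del: of_real_add)
    moreover have "complex_of_real (1 + E n) \<noteq> 1" using E [of n] by (simp add: of_real_eq_1_iff del: of_real_add)
    ultimately obtain G where "is_inverse (cs (of_real (1 + E n)) - T) G"
      using resolvent by blast
    then have "app (cs (of_real (1 + E n)) - T) (app G y) = y"
      by (simp add: is_inverse_def flip: app_simps(3))
    then have "app D (app G y) + E n *\<^sub>R app G y = y"
      by (simp add: app.diff_left cscale_add_left cscale_one cscale_of_real algebra_simps)
    then show ?thesis ..
  qed
  then obtain x where x: "\<And>n. app D (x n) + E n *\<^sub>R x n = y" by metis
  have xR: "x n \<in> R" for n
  proof -
    have "E n *\<^sub>R x n = y - app D (x n)" using x [of n] by (simp add: algebra_simps)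
    then have "x n = cscale (of_real (1 / E n)) (y - app D (x n))"
      using E [of n] by (metis cscale_of_real divide_self_if less_irrefl mult.commute scaleR_one scaleR_scaleR times_divide_eq_right mult_1_right)
    then show ?thesis by (metis R_cscale R_diff R_D y)
  qed
  have EC: "C * E n \<le> 1/2" for n using C by (simp add: E_def divide_simps)
  have bnd: "norm (x n) \<le> 2 * C * norm y" for n
  proof -
    have "norm (app D (x n)) \<le> norm y + E n * norm (x n)"
      using norm_triangle_ineq4 [of y "E n *\<^sub>R x n"] x [of n] E [of n]
      by (metis abs_of_pos add_diff_cancel_right' norm_scaleR)
    then have "norm (x n) \<le> C * (norm y + E n * norm (x n))"
      using C(2) [OF xR, of n] C(1) by (meson mult_left_mono order_trans less_imp_le)
    also have "\<dots> \<le> C * norm y + 1/2 * norm (x n)"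
      using mult_right_mono [OF EC norm_ge_zero [of "x n"], of n] by (simp add: algebra_simps)
    finally show ?thesis by simp
  qed
  have cau: "norm (x n - x m) \<le> C * (norm y / real (Suc n) + norm y / real (Suc m))" for n m
  proof -
    have small: "norm (E n *\<^sub>R x n) \<le> norm y / real (Suc n)" for n
    proof -
      have "norm (E n *\<^sub>R x n) \<le> E n * (2 * C * norm y)"
        using E [of n] bnd [of n] by (simp add: mult_left_mono)
      also have "\<dots> = norm y / real (Suc n)" using C by (simp add: E_def)
      finally show ?thesis .
    qed
    have eq: "app D (x n - x m) = E m *\<^sub>R x m - E n *\<^sub>R x n"
      using x [of n] x [of m] by (simp add: app.diff_right algebra_simps)
    have "norm (app D (x n - x m)) \<le> norm (E m *\<^sub>R x m) + norm (E n *\<^sub>R x n)"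
      unfolding eq by (rule norm_triangle_ineq4)
    also have "\<dots> \<le> norm y / real (Suc m) + norm y / real (Suc n)"
      by (intro add_mono small)
    finally have "norm (app D (x n - x m)) \<le> norm y / real (Suc m) + norm y / real (Suc n)" .
    then show ?thesis using C(2) [OF R_diff [OF xR xR], of n m] C(1)
      by (smt (verit) mult_left_mono add.commute)
  qed
  have "Cauchy x"
  proof (rule metric_CauchyI)
    fix \<epsilon> :: real assume \<epsilon>: "\<epsilon> > 0"
    obtain M :: nat where M: "2 * C * norm y / \<epsilon> < real M" using reals_Archimedean2 by blast
    show "\<exists>M. \<forall>m\<ge>M. \<forall>n\<ge>M. dist (x m) (x n) < \<epsilon>"
    proof (intro exI allI impI)
      fix m n assume mn: "M \<le> m" "M \<le> n"
      have inv: "norm y / real (Suc k) \<le> norm y / real (Suc M)" if "M \<le> k" for k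
        using that by (intro divide_left_mono) auto
      have "dist (x m) (x n) \<le> C * (norm y / real (Suc m) + norm y / real (Suc n))"
        using cau by (simp add: dist_norm)
      also have "\<dots> \<le> C * (norm y / real (Suc M) + norm y / real (Suc M))"
        using C mn by (intro mult_left_mono add_mono inv) auto
      also have "\<dots> = 2 * C * norm y / real (Suc M)" by simp
      also have "\<dots> < \<epsilon>" using M \<epsilon> C by (simp add: divide_simps algebra_simps)
      finally show "dist (x m) (x n) < \<epsilon>" .
    qed
  qed
  then obtain x0 where x0: "x \<longlonglongrightarrow> x0" using Cauchy_convergent convergent_def by blast
  have "x0 \<in> R" using closed_R x0 xR closed_sequentially by blast
  moreover have "app D x0 = y"
  proof -
    have "E \<longlonglongrightarrow> 0" unfolding E_def using C(1) by real_asymp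
    then have "(\<lambda>n. app D (x n) + E n *\<^sub>R x n) \<longlonglongrightarrow> app D x0 + 0 *\<^sub>R x0"
      using x0 by (intro tendsto_intros)
    then show ?thesis unfolding x by (metis LIMSEQ_unique add.right_neutral scaleR_zero_left tendsto_const)
  qed
  ultimately show ?thesis by blast
qed

lemma decomposition: "\<exists>!c. x - cscale c e \<in> R"
proof (rule ex_ex1I)
  obtain y where y: "y \<in> R" "app D y = app D x" using D_onto_R [OF R_D] by blast
  then obtain c where "x - y = cscale c e" using kernel [of "x - y"] by (auto simp: app.diff_right)
  then have "x - cscale c e = y" by (simp add: algebra_simps)
  then show "\<exists>c. x - cscale c e \<in> R" using y by blast
  fix c d assume "x - cscale c e \<in> R" "x - cscale d e \<in> R"
  then have "cscale (d - c) e \<in> R" using R_diff by (fastforce simp: cscale.diff_left)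
  then show "c = d" using e_notin_R by fastforce
qed

text \<open>The coordinate along \<open>e\<close> in the decomposition. It is a left eigenvector of
  \<open>T\<close> for the eigenvalue 1 (\<open>coef_T\<close>), and \<open>rank_one e \<pi>\<close>
  is the spectral projection.\<close>

definition coef where "coef x = (THE c. x - cscale c e \<in> R)"

lemma coef_eq_iff: "coef x = c \<longleftrightarrow> x - cscale c e \<in> R"
  unfolding coef_def using theI' [OF decomposition [of x]] the1_equality [OF decomposition [of x]] by blast

lemma coef_R: "x - cscale (coef x) e \<in> R" using coef_eq_iff by blast

lemma coef_add: "coef (x + y) = coef x + coef y"
  unfolding coef_eq_iff using R_add [OF coef_R [of x] coef_R [of y]]
  by (simp add: cscale_add_left algebra_simps)

lemma coef_cscale: "coef (cscale c x) = c * coef x"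
  unfolding coef_eq_iff using R_cscale [OF coef_R [of x], of c]
  by (simp add: cscale.diff_right cscale_cscale)

lemma coef_e: "coef e = 1"
  unfolding coef_eq_iff using R_D [of 0] by (simp add: cscale_one app.zero_right)

lemma bounded_linear_coef: "bounded_linear coef"
proof -
  obtain C where C: "C > 0" "\<And>x. x \<in> R \<Longrightarrow> norm x \<le> C * norm (app D x)"
    using bounded_below_on_R by blast
  show ?thesis
  proof (rule bounded_linear_intro [where K = "(1 + C * norm D) / norm e"])
    show "coef (r *\<^sub>R x) = r *\<^sub>R coef x" for r x
      by (simp add: coef_cscale scaleR_conv_of_real flip: cscale_of_real)
    fix x
    \<comment> \<open>The component in \<open>R\<close>. As \<open>D\<close> annihilates the other
      component, \<open>bounded_below_on_R\<close> controls \<open>y\<close> by \<open>x\<close>,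
      and the coefficient follows by subtraction.\<close>
    define y where "y = x - cscale (coef x) e"
    have "app D y = app D x" by (simp add: y_def app.diff_right)
    then have "norm y \<le> C * (norm D * norm x)"
      using C(2) [of y] coef_R [of x] norm_app [of D x] C(1)
      by (metis mult_left_mono order_trans less_imp_le y_def)
    moreover have "norm (cscale (coef x) e) \<le> norm x + norm y"
      using norm_triangle_ineq4 [of x y] by (simp add: y_def)
    ultimately have "cmod (coef x) * norm e \<le> norm x * (1 + C * norm D)"
      by (simp add: norm_cscale algebra_simps)
    then show "norm (coef x) \<le> norm x * ((1 + C * norm D) / norm e)"
      using e by (simp add: pos_le_divide_eq)
  qed (simp add: coef_add)
qed

definition \<pi> where "\<pi> = Blinfun coef"

lemma apply_\<pi>: "blinfun_apply \<pi> x = coef x"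
  by (simp add: \<pi>_def bounded_linear_Blinfun_apply bounded_linear_coef)

lemma coef_T: "coef (app T x) = coef x"
proof -
  have "(x - cscale (coef x) e) - app D x \<in> R" by (intro R_diff coef_R R_D)
  then show ?thesis unfolding coef_eq_iff by (simp add: app.diff_left algebra_simps)
qed

lemma coef_D: "coef (app D x) = 0"
  unfolding coef_eq_iff by (simp add: R_D cscale.zero_left)

text \<open>Along the decomposition the operator is the identity on the eigenline and the bijective
  restriction of \<open>D\<close> on \<open>R\<close>.\<close>

lemma invertible_bordered: "\<exists>G. is_inverse (D + rank_one e \<pi>) G"
proof (rule bij_is_inverse, rule bijI)
  have eq: "app (D + rank_one e \<pi>) x = app D x + cscale (coef x) e" for x
    by (simp add: app.add_left apply_\<pi>)
  show "inj (app (D + rank_one e \<pi>))"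
  proof (rule injI)
    fix x x' assume "app (D + rank_one e \<pi>) x = app (D + rank_one e \<pi>) x'"
    then have "app (D + rank_one e \<pi>) (x - x') = 0" by (simp add: app.diff_right)
    then have z: "app D (x - x') + cscale (coef (x - x')) e = 0" by (simp only: eq)
    then have "coef (app D (x - x') + cscale (coef (x - x')) e) = coef (cscale 0 e)"
      by (simp add: cscale.zero_left)
    then have c0: "coef (x - x') = 0" by (simp only: coef_add coef_D coef_cscale coef_e) simp
    then have "app D (x - x') = 0" using z by (simp add: cscale.zero_left)
    then obtain c where "x - x' = cscale c e" using kernel by blast
    then show "x = x'" using c0 by (simp add: coef_cscale coef_e cscale.zero_left)
  qed
  show "surj (app (D + rank_one e \<pi>))"
    unfolding surj_def
  proof
    fix x
    obtain y where y: "y \<in> R" "app D y = x - cscale (coef x) e" using D_onto_R [OF coef_R] by blast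
    have "coef y = 0" unfolding coef_eq_iff using y by (simp add: cscale.zero_left)
    then have "app (D + rank_one e \<pi>) (y + cscale (coef x) e) = x"
      by (simp add: eq y app.add_right coef_add coef_cscale coef_e cscale.zero_left)
    then show "\<exists>u. x = app (D + rank_one e \<pi>) u" by metis
  qed
qed

text \<open>Subtracting the spectral projection moves the eigenvalue 1 to 0 and leaves the rest of
  the spectrum outside the open disk empty, so \<open>spectral_radius_less_one\<close> applies. With
  \<open>z = 1 / w\<close>, the case \<open>z = 1\<close> is the bordered operator; for other
  \<open>z\<close> the resolvent of \<open>T\<close> is corrected along the eigenline.\<close>

lemma complement_spectral_radius:
  obtains n where "n > 0" "norm ((T - rank_one e \<pi>) ^ n) < 1"
proof (rule spectral_radius_less_one [of "T - rank_one e \<pi>"])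
  show "clin (T - rank_one e \<pi>)"
    using clinT by (simp add: clin_def app.diff_left apply_\<pi> coef_cscale cscale.diff_right cscale_cscale)
  fix w :: complex assume w: "cmod w \<le> 1"
  show "\<exists>b. is_inverse (1 - cs w * (T - rank_one e \<pi>)) b"
  proof (cases "w = 0")
    case True then show ?thesis by (intro exI [of _ 1]) (simp add: is_inverse_def)
  next
    case w0: False
    define z where "z = 1 / w"
    have z: "cmod z \<ge> 1" "z \<noteq> 0" "w * z = 1" using w w0 by (auto simp: z_def norm_divide)
    have "\<exists>G. is_inverse (cs z - T + rank_one e \<pi>) G"
    proof (cases "z = 1")
      case True then show ?thesis using invertible_bordered by simp
    next
      case False
      then obtain G where G: "is_inverse (cs z - T) G" using resolvent z(1) by blast
      have eq: "app (cs z - T + rank_one e \<pi>) x = app (cs z - T) x + cscale (coef x) e" for x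
        by (simp add: app.add_left apply_\<pi>)
      have cz: "coef (app (cs z - T) x) = (z - 1) * coef x" for x
      proof -
        have "app (cs z - T) x + app T x = cscale z x" by (simp add: app.diff_left)
        then have "coef (app (cs z - T) x) + coef (app T x) = z * coef x"
          by (metis coef_add coef_cscale)
        then show ?thesis by (simp add: coef_T algebra_simps)
      qed
      show ?thesis
      proof (rule bij_is_inverse, rule bijI)
        show "inj (app (cs z - T + rank_one e \<pi>))"
        proof (rule injI)
          fix x x' assume "app (cs z - T + rank_one e \<pi>) x = app (cs z - T + rank_one e \<pi>) x'"
          then have "app (cs z - T + rank_one e \<pi>) (x - x') = 0" by (simp add: app.diff_right)
          then have 0: "app (cs z - T) (x - x') + cscale (coef (x - x')) e = 0" by (simp only: eq)
          then have "coef (app (cs z - T) (x - x') + cscale (coef (x - x')) e) = coef (cscale 0 e)"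
            by (simp add: cscale.zero_left)
          then have "z * coef (x - x') = 0"
            by (simp only: coef_add cz coef_cscale coef_e) (simp add: algebra_simps)
          then have "app (cs z - T) (x - x') = app (cs z - T) 0"
            using 0 z by (simp add: cscale.zero_left app.zero_right)
          then have "x - x' = 0" using bij_is_inj [OF is_inverse_bij [OF G]] by (metis injD)
          then show "x = x'" by simp
        qed
        show "surj (app (cs z - T + rank_one e \<pi>))"
          unfolding surj_def
        proof
          fix y
          \<comment> \<open>Applying \<open>coef\<close> to the equation to be solved gives
            \<open>(z - 1) * coef x + coef x = coef y\<close>, so the coefficient of the solution
            must be \<open>coef y / z\<close>.\<close>
          define a where "a = coef y / z"
          define x where "x = app G (y - cscale a e)"
          have x: "app (cs z - T) x = y - cscale a e"
            unfolding x_def using G by (simp add: is_inverse_def flip: app_simps(3))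
          have "(y - cscale a e) + cscale a e = y" by simp
          then have "coef (y - cscale a e) + a = coef y" by (metis coef_add coef_cscale coef_e mult.right_neutral)
          moreover have "coef (y - cscale a e) = (z - 1) * coef x" using cz [of x] x by simp
          ultimately have "(z - 1) * coef x = coef y - a" by (metis add_diff_cancel_right')
          also have "\<dots> = (z - 1) * a" using z by (simp add: a_def field_simps)
          finally have "coef x = a" using False by simp
          then have "app (cs z - T + rank_one e \<pi>) x = y" by (simp only: eq x) simp
          then show "\<exists>u. y = app (cs z - T + rank_one e \<pi>) u" by metis
        qed
      qed
    qed
    then obtain G where "is_inverse (cs z - T + rank_one e \<pi>) G" ..
    then have "is_inverse (cs w * (cs z - T + rank_one e \<pi>)) (G * cs (1 / w))"
      by (intro is_inverse_mult is_inverse_cs w0)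
    moreover have "cs w * (cs z - T + rank_one e \<pi>) = 1 - cs w * (T - rank_one e \<pi>)"
      using z by (simp add: right_diff_distrib distrib_left flip: cs_mult)
    ultimately show ?thesis by auto
  qed
qed

end

section \<open>Uniform bounds on powers\<close>

lemma norm_one_endo_le: "norm (1 :: 'b::real_normed_vector endo) \<le> 1"
  by (rule norm_endo_bound) auto

lemma norm_power_endo_le: "norm (T ^ n) \<le> norm (T :: 'b::real_normed_vector endo) ^ n"
  using norm_power_le [of T n] mult_right_mono [OF norm_one_endo_le, of "norm T ^ n"]
  by (metis (no_types) mult_1 norm_ge_zero order_trans zero_le_power)

text \<open>Write \<open>N = m * j + i\<close> with \<open>i < m\<close>. The blocks contribute
  \<open>q ^ j\<close>, which is at most \<open>root m q ^ N / q\<close>; the remaining factor is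
  bounded by \<open>B ^ m\<close> because \<open>1 \<le> B\<close>.\<close>

lemma power_norm_geometric_bound:
  fixes T :: "'b::real_normed_vector endo"
  assumes m: "m > 0" and q: "norm (T ^ m) \<le> q" "0 < q" "q < 1" and B: "norm T \<le> B" "1 \<le> B"
  shows "norm (T ^ N) \<le> B ^ m / q * root m q ^ N"
proof -
  define \<theta> where "\<theta> = root m q"
  have \<theta>: "0 < \<theta>" "\<theta> \<le> 1" "\<theta> ^ m = q" using m q by (simp_all add: \<theta>_def)
  define i j where "i = N mod m" and "j = N div m"
  have N: "N = m * j + i" by (simp add: i_def j_def)
  have i: "i < m" using m by (simp add: i_def)
  have "norm (T ^ N) \<le> norm ((T ^ m) ^ j) * norm (T ^ i)"
    unfolding N power_add power_mult by (rule norm_mult_ineq)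
  also have "\<dots> \<le> q ^ j * B ^ m"
  proof (rule mult_mono)
    show "norm ((T ^ m) ^ j) \<le> q ^ j"
      by (rule order_trans [OF norm_power_endo_le]) (intro power_mono q norm_ge_zero)
    have "norm (T ^ i) \<le> B ^ i"
      by (rule order_trans [OF norm_power_endo_le]) (intro power_mono B norm_ge_zero)
    also have "\<dots> \<le> B ^ m" using i B by (intro power_increasing) auto
    finally show "norm (T ^ i) \<le> B ^ m" .
  qed (use q B in auto)
  also have "q ^ j \<le> \<theta> ^ N / q"
  proof -
    have "\<theta> ^ m \<le> \<theta> ^ i" using i \<theta> by (intro power_decreasing) auto
    then have "q * q ^ j \<le> \<theta> ^ i * q ^ j" using \<theta> q by (intro mult_right_mono) auto
    also have "\<dots> = \<theta> ^ N" by (simp add: N power_add power_mult \<theta>)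
    finally show ?thesis using q by (simp add: field_simps)
  qed
  finally show ?thesis using B by (simp add: \<theta>_def mult.commute mult_right_mono)
qed

text \<open>That one fixed power has norm below 1 is an open condition on the operator, and by the
  previous lemma it already forces geometric decay with constants uniform in a
  neighbourhood.\<close>

lemma local_power_bound:
  fixes \<Lambda> :: "'c::metric_space \<Rightarrow> 'b::real_normed_vector endo"
  assumes c: "continuous_on S \<Lambda>" and t0: "t0 \<in> S" and m: "m > 0" "norm (\<Lambda> t0 ^ m) < 1"
  obtains d C \<theta> where "d > 0" "C \<ge> 0" "0 < \<theta>" "\<theta> < 1"
    "\<And>t N. t \<in> S \<Longrightarrow> dist t t0 < d \<Longrightarrow> norm (\<Lambda> t ^ N) \<le> C * \<theta> ^ N"
proof -
  obtain q where q: "norm (\<Lambda> t0 ^ m) < q" "q < 1" using m dense by blast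
  have q0: "q > 0" using q norm_ge_zero le_less_trans by blast
  have cp: "continuous_on S (\<lambda>t. \<Lambda> t ^ n)" for n
  proof (induction n)
    case (Suc n)
    then show ?case using continuous_on_mult [OF c Suc] by simp
  qed simp
  have l1: "((\<lambda>t. norm (\<Lambda> t ^ m)) \<longlongrightarrow> norm (\<Lambda> t0 ^ m)) (at t0 within S)"
    using cp [of m] t0 by (intro tendsto_norm) (auto simp: continuous_on_def)
  have l2: "((\<lambda>t. norm (\<Lambda> t)) \<longlongrightarrow> norm (\<Lambda> t0)) (at t0 within S)"
    using c t0 by (intro tendsto_norm) (auto simp: continuous_on_def)
  have "\<forall>\<^sub>F t in at t0 within S. norm (\<Lambda> t ^ m) < q \<and> norm (\<Lambda> t) < norm (\<Lambda> t0) + 1"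
    using order_tendstoD(2) [OF l1 q(1)] order_tendstoD(2) [OF l2, of "norm (\<Lambda> t0) + 1"]
    by (simp add: eventually_conj)
  then obtain d where d: "d > 0" "\<And>t. t \<in> S \<Longrightarrow> t \<noteq> t0 \<Longrightarrow> dist t t0 < d \<Longrightarrow>
      norm (\<Lambda> t ^ m) < q \<and> norm (\<Lambda> t) < norm (\<Lambda> t0) + 1"
    unfolding eventually_at by metis
  define B where "B = norm (\<Lambda> t0) + 1"
  show ?thesis
  proof (rule that [of d "B ^ m / q" "root m q"])
    fix t N assume t: "t \<in> S" "dist t t0 < d"
    have "norm (\<Lambda> t ^ m) \<le> q \<and> norm (\<Lambda> t) \<le> B"
      using d(2) [OF t(1) _ t(2)] q by (cases "t = t0") (auto simp: B_def)
    then show "norm (\<Lambda> t ^ N) \<le> B ^ m / q * root m q ^ N"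
      using m q q0 by (intro power_norm_geometric_bound) (auto simp: B_def)
  qed (use d m q q0 in \<open>auto simp: B_def\<close>)
qed

lemma compact_power_bound:
  fixes \<Lambda> :: "'c::metric_space \<Rightarrow> 'b::real_normed_vector endo"
  assumes S: "compact S" and c: "continuous_on S \<Lambda>"
    and m: "\<And>t. t \<in> S \<Longrightarrow> \<exists>m>0. norm (\<Lambda> t ^ m) < 1"
  obtains C \<theta> where "C \<ge> 0" "0 < \<theta>" "\<theta> < 1" "\<And>t N. t \<in> S \<Longrightarrow> norm (\<Lambda> t ^ N) \<le> C * \<theta> ^ N"
proof -
  have "\<exists>d C \<theta>. d > 0 \<and> C \<ge> 0 \<and> 0 < \<theta> \<and> \<theta> < 1 \<and>
      (\<forall>s N. s \<in> S \<longrightarrow> dist s t < d \<longrightarrow> norm (\<Lambda> s ^ N) \<le> C * \<theta> ^ N)" if "t \<in> S" for t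
    using m [OF that] local_power_bound [OF c that] by metis
  then obtain d C \<theta> where H: "\<And>t. t \<in> S \<Longrightarrow> d t > 0 \<and> C t \<ge> 0 \<and> 0 < \<theta> t \<and> \<theta> t < (1::real) \<and>
      (\<forall>s N. s \<in> S \<longrightarrow> dist s t < d t \<longrightarrow> norm (\<Lambda> s ^ N) \<le> C t * \<theta> t ^ N)" by metis
  have "S \<subseteq> (\<Union>t\<in>S. ball t (d t))" using H by force
  then obtain F where F: "F \<subseteq> S" "finite F" "S \<subseteq> (\<Union>t\<in>F. ball t (d t))"
    using compactE_image [OF S, of S "\<lambda>t. ball t (d t)"] by auto
  define C' where "C' = (\<Sum>t\<in>F. C t)"
  \<comment> \<open>Inserting 1/2 keeps the maximum defined and positive when \<open>S\<close>, and
    hence \<open>F\<close>, is empty.\<close>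
  define \<theta>' where "\<theta>' = Max (insert (1/2) (\<theta> ` F))"
  have \<theta>': "1/2 \<le> \<theta>'" "\<And>t. t \<in> F \<Longrightarrow> \<theta> t \<le> \<theta>'" "\<theta>' < 1"
  proof -
    have fin: "finite (insert (1/2) (\<theta> ` F))" using F by simp
    show "1/2 \<le> \<theta>'" unfolding \<theta>'_def by (rule Max_ge [OF fin]) simp
    show "\<theta> t \<le> \<theta>'" if "t \<in> F" for t unfolding \<theta>'_def by (rule Max_ge [OF fin]) (use that in simp)
    show "\<theta>' < 1" unfolding \<theta>'_def using fin F H by (subst Max_less_iff) auto
  qed
  show ?thesis
  proof (rule that [of C' \<theta>'])
    fix s N assume s: "s \<in> S"
    then obtain t where t: "t \<in> F" "dist s t < d t" using F by (auto simp: dist_commute)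
    have tS: "t \<in> S" using t F by auto
    have Ht: "0 < \<theta> t" "0 \<le> C t" using H [OF tS] by auto
    have "norm (\<Lambda> s ^ N) \<le> C t * \<theta> t ^ N" using H [OF tS] s t by auto
    also have "\<dots> \<le> C' * \<theta>' ^ N"
    proof (intro mult_mono power_mono)
      show "C t \<le> C'" unfolding C'_def using F H t by (intro member_le_sum) auto
    qed (use H Ht t \<theta>' F in \<open>auto simp: C'_def intro!: sum_nonneg\<close>)
    finally show "norm (\<Lambda> s ^ N) \<le> C' * \<theta>' ^ N" .
  qed (use \<theta>' F H in \<open>auto simp: C'_def intro!: sum_nonneg\<close>)
qed

lemma power_diff_telescope:
  fixes x y :: "'a::{ring,monoid_mult}"
  shows "x ^ n - y ^ n = (\<Sum>j<n. x ^ j * (x - y) * y ^ (n - 1 - j))"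
proof (induction n)
  case (Suc n)
  have "x ^ Suc n - y ^ Suc n = x ^ n * (x - y) + (x ^ n - y ^ n) * y"
    by (simp add: right_diff_distrib left_diff_distrib power_Suc2 del: power_Suc)
  also have "(x ^ n - y ^ n) * y = (\<Sum>j<n. x ^ j * (x - y) * y ^ (n - j))"
    unfolding Suc sum_distrib_right
    by (intro sum.cong refl) (simp add: mult.assoc power_Suc2 [symmetric] Suc_diff_Suc del: power_Suc)
  finally show ?case by simp
qed simp

section \<open>Perturbation of a simple eigenvalue\<close>

text \<open>\<open>G0\<close> inverts minus the bordered operator of \<open>simple_dominant\<close>;
  with this sign it inverts the linearization \<open>bord\<close> of the eigenvalue equation at
  0.\<close>

locale simple_eigenvalue_family =
  fixes L :: "real \<Rightarrow> 'b::complex_banach endo" and e :: 'b and \<pi> :: "'b \<Rightarrow>\<^sub>L complex"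
    and G0 :: "'b endo" and k :: nat and \<delta>0 :: real
  assumes clinL: "\<And>t. clin (L t)"
    and \<pi>_clin: "\<And>c x. blinfun_apply \<pi> (cscale c x) = c * blinfun_apply \<pi> x"
    and \<pi>_e: "blinfun_apply \<pi> e = 1" and Le: "app (L 0) e = e"
    and \<pi>L: "\<And>x. blinfun_apply \<pi> (app (L 0) x) = blinfun_apply \<pi> x"
    and inv0: "is_inverse (L 0 - 1 - rank_one e \<pi>) G0"
    and \<delta>0: "\<delta>0 > 0" and CkL: "Ck_on (Suc k) {-\<delta>0..\<delta>0} L"
begin

abbreviation "pi' \<equiv> blinfun_apply \<pi>"
definition "P = rank_one e \<pi>"
text \<open>One vector \<open>x\<close> carries both unknowns: its part in the kernel of \<pi>
  corrects the eigenvector and \<open>pi' x\<close> shifts the eigenvalue. The eigenvector is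
  thereby normalized by \<open>pi' (hv x) = 1\<close>, and the eigenvalue problem becomes one
  equation for \<open>x\<close> in the original space.\<close>

definition "hv x = e + (x - app P x)"
definition "lam x = 1 + pi' x"
text \<open>The derivative in \<open>x\<close> of
  \<open>app T (hv x) - cscale (lam x) (hv x)\<close> at a point where \<open>hv x = h\<close> and
  \<open>lam x = l\<close>.\<close>

definition "bord T h l = (T - cs l) * (1 - P) - rank_one h \<pi>"

lemma app_P: "app P x = cscale (pi' x) e" by (simp add: P_def)

lemma bord_0: "bord (L 0) e 1 = L 0 - 1 - P"
proof -
  have "(L 0 - 1) * P = 0"
    by (rule endo_eqI) (use clinL [of 0] in \<open>simp add: app_P app.diff_left clin_def Le\<close>)
  then show ?thesis by (simp add: bord_def right_diff_distrib P_def)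
qed

lemma inv_bord_0: "is_inverse (bord (L 0) e 1) G0"
  using inv0 by (simp add: bord_0 P_def)

lemma app_bord: "app (bord T h l) x = app T (x - app P x) - cscale l (x - app P x) - cscale (pi' x) h"
  by (simp add: bord_def app.diff_left)

lemma pi_hv: "pi' (hv x) = 1"
  by (simp add: hv_def app_P blinfun.add_right blinfun.diff_right \<pi>_clin \<pi>_e)

text \<open>The three terms are the linearization at the unperturbed eigenpair, a quadratic term,
  and the perturbation. Inverting the first turns the equation into a fixed point problem that
  contracts for small \<open>x\<close> and small perturbation.\<close>

lemma eigen_equation:
  "app (L t) (hv x) - cscale (lam x) (hv x) =
    app (bord (L 0) e 1) x - cscale (pi' x) (x - app P x) + app (L t - L 0) (hv x)"
  by (simp add: app_bord hv_def lam_def app.diff_left app.add_right app.diff_right Le cscale_add_left cscale_add_right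
      cscale_one cscale.diff_right algebra_simps)

definition K where "K = 1 + norm G0 + norm P + norm \<pi> + norm e"

lemma K: "1 \<le> K" "norm G0 \<le> K" "norm P \<le> K" "norm \<pi> \<le> K" "norm e \<le> K"
  by (simp_all add: K_def)

text \<open>The radius of the ball for the contraction: on it the quadratic term has Lipschitz
  constant \<open>4 * K ^ 3 * \<rho> = 1/4\<close> after application of \<open>G0\<close>.\<close>

definition \<rho> where "\<rho> = 1 / (16 * K ^ 3)"

lemma \<rho>: "\<rho> > 0" "4 * K ^ 3 * \<rho> = 1/4"
  using K(1) by (simp_all add: \<rho>_def)

lemma pi_le: "cmod (pi' x) \<le> K * norm x"
  by (rule order_trans [OF norm_blinfun]) (intro mult_right_mono K norm_ge_zero)

lemma compl_le: "norm (x - app P x) \<le> 2 * K * norm x"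
proof -
  have "norm (app P x) \<le> K * norm x"
    by (rule order_trans [OF norm_app]) (intro mult_right_mono K norm_ge_zero)
  moreover have "1 * norm x \<le> K * norm x" by (intro mult_right_mono K norm_ge_zero)
  ultimately show ?thesis using norm_triangle_ineq4 [of x "app P x"] by simp
qed

lemma G0_le: "norm (app G0 x) \<le> K * norm x"
  by (rule order_trans [OF norm_app]) (intro mult_right_mono K norm_ge_zero)

lemma eigenvector_exists:
  assumes small: "norm (L t - L 0) \<le> 1 / (32 * K ^ 5)"
  shows "\<exists>x. norm x \<le> \<rho> \<and> app (L t) (hv x) = cscale (lam x) (hv x)"
proof -
  \<comment> \<open>With this size of the perturbation,
    \<open>norm (f 0) \<le> K * K * \<epsilon> = \<rho> / 2\<close>, and its share
    \<open>2 * K * K * \<epsilon>\<close> of the Lipschitz constant is at most 1/4. Both shares add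
    up to 1/2, so \<open>f\<close> maps the ball into itself and contracts.\<close>
  define \<epsilon> where "\<epsilon> = 1 / (32 * K ^ 5)"
  define f where "f x = app G0 (cscale (pi' x) (x - app P x) - app (L t - L 0) (hv x))" for x
  have \<epsilon>: "K * K * \<epsilon> = \<rho> / 2" "2 * K * K * \<epsilon> \<le> 1/4"
  proof -
    show 1: "K * K * \<epsilon> = \<rho> / 2" using K(1) by (simp add: \<epsilon>_def \<rho>_def field_simps eval_nat_numeral)
    have "1 \<le> K ^ 3" using K(1) by (rule one_le_power)
    then have "\<rho> \<le> 1/4" unfolding \<rho>_def by (intro frac_le) auto
    then show "2 * K * K * \<epsilon> \<le> 1/4" using 1 by simp
  qed
  have lip: "dist (f x) (f y) \<le> 1/2 * dist x y" if x: "x \<in> cball 0 \<rho>" and y: "y \<in> cball 0 \<rho>" for x y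
  proof -
    have eq: "(cscale (pi' x) (x - app P x) - app (L t - L 0) (hv x)) - (cscale (pi' y) (y - app P y) - app (L t - L 0) (hv y))
       = cscale (pi' x) ((x - y) - app P (x - y)) + cscale (pi' (x - y)) (y - app P y) - app (L t - L 0) ((x - y) - app P (x - y))"
      by (simp add: hv_def blinfun.diff_right cscale.diff_left cscale.diff_right cscale_add_right
          app.diff_right app.diff_left app.add_right algebra_simps)
    have n1: "norm (cscale (pi' x) ((x - y) - app P (x - y))) \<le> (K * \<rho>) * (2 * K * norm (x - y))"
      unfolding norm_cscale using x K(1) \<rho>
      by (intro mult_mono compl_le order_trans [OF pi_le] mult_left_mono) auto
    have n2: "norm (cscale (pi' (x - y)) (y - app P y)) \<le> (K * norm (x - y)) * (2 * K * \<rho>)"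
      unfolding norm_cscale using y K(1) \<rho>
      by (intro mult_mono pi_le order_trans [OF compl_le] mult_left_mono) auto
    have n3: "norm (app (L t - L 0) ((x - y) - app P (x - y))) \<le> \<epsilon> * (2 * K * norm (x - y))"
      by (rule order_trans [OF norm_app]) (use small K(1) in \<open>intro mult_mono compl_le; simp add: \<epsilon>_def\<close>)
    have "dist (f x) (f y) = norm (app G0 ((cscale (pi' x) (x - app P x) - app (L t - L 0) (hv x)) - (cscale (pi' y) (y - app P y) - app (L t - L 0) (hv y))))"
      by (simp add: f_def dist_norm app.diff_right)
    also have "\<dots> \<le> K * (norm (cscale (pi' x) ((x - y) - app P (x - y))) + norm (cscale (pi' (x - y)) (y - app P y))
        + norm (app (L t - L 0) ((x - y) - app P (x - y))))"
      unfolding eq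
      by (rule order_trans [OF G0_le])
        (use K(1) in \<open>intro mult_left_mono order_trans [OF norm_triangle_ineq4] add_mono norm_triangle_ineq; simp\<close>)
    also have "\<dots> \<le> K * ((K * \<rho>) * (2 * K * norm (x - y)) + (K * norm (x - y)) * (2 * K * \<rho>) + \<epsilon> * (2 * K * norm (x - y)))"
      using K(1) n1 n2 n3 by (intro mult_left_mono add_mono) auto
    also have "\<dots> = (4 * K ^ 3 * \<rho> + 2 * K * K * \<epsilon>) * norm (x - y)"
      by (simp add: algebra_simps eval_nat_numeral)
    also have "\<dots> \<le> (1/4 + 1/4) * norm (x - y)" using \<epsilon> \<rho> by (intro mult_right_mono add_mono) auto
    finally show ?thesis by (simp add: dist_norm)
  qed
  have f0: "norm (f 0) \<le> \<rho> / 2"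
  proof -
    have f0: "f 0 = - app G0 (app (L t - L 0) e)"
      by (simp add: f_def hv_def blinfun.zero_right app.zero_right app.minus_right cscale.zero_left)
    have "norm (f 0) \<le> K * (\<epsilon> * K)" unfolding f0 norm_minus_cancel
      using K(1) by (intro order_trans [OF G0_le] mult_left_mono order_trans [OF norm_app] mult_mono K)
        (use small in \<open>auto simp: \<epsilon>_def\<close>)
    then show ?thesis using \<epsilon> by (simp add: mult_ac)
  qed
  have "\<exists>!x\<in>cball 0 \<rho>. f x = x"
  proof (rule Banach_fix [where c = "1/2"])
    show "f ` cball 0 \<rho> \<subseteq> cball 0 \<rho>"
    proof
      fix y assume "y \<in> f ` cball 0 \<rho>"
      then obtain x where x: "x \<in> cball 0 \<rho>" "y = f x" by blast
      have "dist (f x) (f 0) \<le> 1/2 * dist x 0" using x \<rho> by (intro lip) auto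
      then have "norm (f x - f 0) \<le> \<rho> / 2" using x by (simp add: dist_norm)
      then have "norm (f x) \<le> \<rho>" using f0 norm_triangle_ineq [of "f x - f 0" "f 0"] by simp
      then show "y \<in> cball 0 \<rho>" using x by simp
    qed
  qed (use \<rho> lip in \<open>auto simp: complete_eq_closed\<close>)
  then obtain x where x: "norm x \<le> \<rho>" "f x = x" by auto
  have "app (bord (L 0) e 1) (f x) = cscale (pi' x) (x - app P x) - app (L t - L 0) (hv x)"
    unfolding f_def using inv_bord_0 by (simp add: is_inverse_def flip: app_simps(3))
  then have "app (L t) (hv x) - cscale (lam x) (hv x) = 0" unfolding eigen_equation x(2) by simp
  then show ?thesis using x by auto
qed

text \<open>The value at 0 is prescribed, so that the chosen eigenpair there is \<open>e\<close>
  with eigenvalue 1 by definition rather than by uniqueness of the fixed point.\<close>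

definition X where "X t = (if t = 0 then 0 else SOME x. norm x \<le> \<rho> \<and> app (L t) (hv x) = cscale (lam x) (hv x))"
definition h where "h t = hv (X t)"
definition l where "l t = lam (X t)"

lemma X_spec:
  assumes "norm (L t - L 0) \<le> 1 / (32 * K ^ 5)"
  shows "norm (X t) \<le> \<rho>" "app (L t) (h t) = cscale (l t) (h t)"
proof -
  have "norm (X t) \<le> \<rho> \<and> app (L t) (hv (X t)) = cscale (lam (X t)) (hv (X t))"
  proof (cases "t = 0")
    case True
    then show ?thesis using \<rho>
      by (simp add: X_def hv_def lam_def Le blinfun.zero_right app.zero_right cscale_one)
  next
    case False
    then show ?thesis using someI_ex [OF eigenvector_exists [OF assms]] by (simp add: X_def)
  qed
  then show "norm (X t) \<le> \<rho>" "app (L t) (h t) = cscale (l t) (h t)" by (auto simp: h_def l_def)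
qed

lemma X_0: "X 0 = 0" "h 0 = e" "l 0 = 1"
  by (simp_all add: X_def h_def l_def hv_def lam_def blinfun.zero_right app.zero_right)

text \<open>The mixed arguments, \<open>L\<close> and \<open>l\<close> at \<open>s\<close> but
  \<open>h\<close> at \<open>t\<close>, are those of \<open>bord_difference\<close>. All three are
  close to their values at 0, so the operator is within Neumann distance 1/2 of the one inverted by
  \<open>G0\<close>, and the inverse is bounded uniformly.\<close>

lemma bord_near:
  assumes s: "norm (L s - L 0) \<le> 1 / (32 * K ^ 5)" and t: "norm (L t - L 0) \<le> 1 / (32 * K ^ 5)"
  obtains J where "is_inverse (bord (L s) (h t) (l s)) J" "norm J \<le> 2 * K"
proof -
  define \<epsilon> where "\<epsilon> = 1 / (32 * K ^ 5)"
  have \<epsilon>: "2 * K * K * \<epsilon> \<le> 1/4"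
  proof -
    have 1: "K * K * \<epsilon> = \<rho> / 2" using K(1) by (simp add: \<epsilon>_def \<rho>_def field_simps eval_nat_numeral)
    have "1 \<le> K ^ 3" using K(1) by (rule one_le_power)
    then have "\<rho> \<le> 1/4" unfolding \<rho>_def by (intro frac_le) auto
    then show "2 * K * K * \<epsilon> \<le> 1/4" using 1 by simp
  qed
  have Xs: "norm (X s) \<le> \<rho>" "norm (X t) \<le> \<rho>" using X_spec s t by auto
  have diff: "bord (L s) (h t) (l s) - bord (L 0) e 1
      = (L s - L 0 - cs (pi' (X s))) * (1 - P) - rank_one (h t - e) \<pi>"
    by (simp add: bord_def l_def lam_def cs_add bounded_bilinear.diff_left [OF bounded_bilinear_rank_one]
        left_diff_distrib right_diff_distrib algebra_simps)
  have n1: "norm (app ((L s - L 0 - cs (pi' (X s))) * (1 - P) - rank_one (h t - e) \<pi>) x)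
      \<le> ((\<epsilon> + K * \<rho>) * (2 * K) + K * (2 * K * \<rho>)) * norm x" for x
  proof -
    have "norm (app (L s - L 0 - cs (pi' (X s))) (x - app P x)) \<le> (\<epsilon> + K * \<rho>) * (2 * K * norm x)"
    proof (rule order_trans [OF norm_app], rule mult_mono)
      have "norm (cs (pi' (X s)) :: 'b endo) \<le> K * \<rho>"
        using Xs K(1) by (intro order_trans [OF norm_cs] order_trans [OF pi_le] mult_left_mono) auto
      then show "norm (L s - L 0 - cs (pi' (X s))) \<le> \<epsilon> + K * \<rho>"
        using s by (intro order_trans [OF norm_triangle_ineq4 add_mono]) (auto simp: \<epsilon>_def)
    qed (use compl_le K(1) \<rho> in \<open>auto simp: \<epsilon>_def\<close>)
    moreover have "norm (cscale (pi' x) (h t - e)) \<le> (K * norm x) * (2 * K * \<rho>)"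
      unfolding norm_cscale using Xs K(1)
      by (intro mult_mono pi_le) (auto simp: h_def hv_def intro!: order_trans [OF compl_le] mult_left_mono)
    moreover have "app (A * (1 - P) - rank_one w \<pi>) x = app A (x - app P x) - cscale (pi' x) w" for A w
      by (simp add: app.diff_left)
    ultimately have "norm (app ((L s - L 0 - cs (pi' (X s))) * (1 - P) - rank_one (h t - e) \<pi>) x)
      \<le> (\<epsilon> + K * \<rho>) * (2 * K * norm x) + (K * norm x) * (2 * K * \<rho>)"
      using norm_triangle_ineq4 [of "app (L s - L 0 - cs (pi' (X s))) (x - app P x)" "cscale (pi' x) (h t - e)"]
      by (simp only:)
    then show ?thesis by (simp only: distrib_right distrib_left mult_ac)
  qed
  have "norm (bord (L s) (h t) (l s) - bord (L 0) e 1) \<le> (\<epsilon> + K * \<rho>) * (2 * K) + K * (2 * K * \<rho>)"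
    unfolding diff using K(1) \<rho> by (intro norm_endo_bound n1) (auto simp: \<epsilon>_def)
  then have "norm G0 * norm (bord (L s) (h t) (l s) - bord (L 0) e 1) \<le> K * ((\<epsilon> + K * \<rho>) * (2 * K) + K * (2 * K * \<rho>))"
    using K by (intro mult_mono) auto
  also have "\<dots> = 2 * K * K * \<epsilon> + 4 * K ^ 3 * \<rho>" by (simp add: algebra_simps eval_nat_numeral)
  also have "\<dots> \<le> 1/2" using \<epsilon> \<rho> by simp
  finally obtain J where J: "is_inverse (bord (L s) (h t) (l s)) J" "norm (J - G0) \<le> norm G0 * ((1/2) / (1 - 1/2))"
    using is_inverse_perturb [OF inv_bord_0] by (metis half_bounded_equal field_sum_of_halves less_add_same_cancel1 zero_less_divide_1_iff zero_less_numeral zero_less_one)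
  have "norm J \<le> 2 * K" using J(2) norm_triangle_ineq [of "J - G0" G0] K(2) by simp
  with J that show ?thesis by blast
qed

text \<open>An exact difference formula: \<open>hv\<close> and \<open>lam\<close> are affine, so the
  only nonlinearity is their product, and evaluating one factor at \<open>t\<close> and the other at
  \<open>s\<close> absorbs it without remainder. With \<open>bord_near\<close> this bounds
  \<open>X t - X s\<close> by the increment of \<open>L\<close>.\<close>

lemma bord_difference:
  assumes s: "norm (L s - L 0) \<le> 1 / (32 * K ^ 5)" and t: "norm (L t - L 0) \<le> 1 / (32 * K ^ 5)"
  shows "app (bord (L s) (h t) (l s)) (X t - X s) = - app (L t - L s) (h t)"
proof -
  have 1: "(X t - X s) - app P (X t - X s) = h t - h s"
    by (simp add: h_def hv_def app.diff_right)
  have 2: "pi' (X t - X s) = l t - l s" by (simp add: l_def lam_def blinfun.diff_right)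
  have "app (bord (L s) (h t) (l s)) (X t - X s) =
      app (L s) (h t) - cscale (l t) (h t) - (app (L s) (h s) - cscale (l s) (h s))"
    unfolding app_bord 1 2 by (simp add: app.diff_right cscale.diff_right cscale.diff_left)
  also have "\<dots> = - app (L t - L s) (h t)"
    using X_spec(2) [OF s] X_spec(2) [OF t] by (simp add: app.diff_left)
  finally show ?thesis .
qed

text \<open>The exact difference formula first gives Lipschitz continuity of \<open>X\<close> and
  then the derivative \<open>app (J s) (- app (L' s) (h s))\<close>. The functions \<open>J\<close>,
  \<open>h\<close> and \<open>l\<close> are built from \<open>L\<close> and \<open>X\<close>, so
  this formula raises the order of smoothness of \<open>X\<close> by one at each induction step
  until that of \<open>L\<close> is reached.\<close>

lemma X_smooth:
  assumes \<delta>: "0 < \<delta>" "\<delta> \<le> \<delta>0" and small: "\<And>t. t \<in> {-\<delta>..\<delta>} \<Longrightarrow> norm (L t - L 0) \<le> 1 / (32 * K ^ 5)"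
    and J: "\<And>t. t \<in> {-\<delta>..\<delta>} \<Longrightarrow> is_inverse (bord (L t) (h t) (l t)) (J t)"
  shows "Ck_on (Suc k) {-\<delta>..\<delta>} X" "Ck_on (Suc k) {-\<delta>..\<delta>} J"
    "Ck_on (Suc k) {-\<delta>..\<delta>} h" "Ck_on (Suc k) {-\<delta>..\<delta>} l"
proof -
  define I where "I = {-\<delta>..\<delta>}"
  have CkLI: "Ck_on (Suc k) I L" using CkL by (rule Ck_on_subset) (use \<delta> in \<open>auto simp: I_def\<close>)
  obtain CL where CL: "CL \<ge> 0" "\<And>s t. s \<in> I \<Longrightarrow> t \<in> I \<Longrightarrow> norm (L s - L t) \<le> CL * \<bar>s - t\<bar>"
    using Ck_on_Lipschitz [OF CkLI [unfolded I_def]] unfolding I_def by blast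
  have h_bd: "norm (h t) \<le> K + 2 * K * \<rho>" if "t \<in> I" for t
  proof -
    have "norm (X t) \<le> \<rho>" using X_spec small that by (auto simp: I_def)
    then have "norm (X t - app P (X t)) \<le> 2 * K * \<rho>"
      using K(1) by (intro order_trans [OF compl_le] mult_left_mono) auto
    then show ?thesis unfolding h_def hv_def by (intro order_trans [OF norm_triangle_ineq] add_mono K)
  qed
  define CX where "CX = 2 * K * (CL * (K + 2 * K * \<rho>))"
  have X_lip: "norm (X t - X s) \<le> CX * \<bar>t - s\<bar>" if s: "s \<in> I" and t: "t \<in> I" for s t
  proof -
    have small': "norm (L s - L 0) \<le> 1 / (32 * K ^ 5)" "norm (L t - L 0) \<le> 1 / (32 * K ^ 5)"
      using s t small by (auto simp: I_def)
    obtain B where B: "is_inverse (bord (L s) (h t) (l s)) B" "norm B \<le> 2 * K"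
      using bord_near [OF small'] .
    have "app B (app (bord (L s) (h t) (l s)) (X t - X s)) = X t - X s"
      using B by (simp add: is_inverse_def flip: app_simps(3))
    then have "X t - X s = - app B (app (L t - L s) (h t))"
      unfolding bord_difference [OF small'] by (simp add: app.minus_right)
    then have "norm (X t - X s) \<le> norm B * norm (app (L t - L s) (h t))"
      using norm_app by simp
    also have "\<dots> \<le> (2 * K) * ((CL * \<bar>t - s\<bar>) * (K + 2 * K * \<rho>))"
      using B K(1) CL \<rho> t s
      by (intro mult_mono order_trans [OF norm_app] h_bd CL) auto
    finally show ?thesis by (simp add: CX_def mult_ac)
  qed
  have CX0: "0 \<le> CX" using K(1) CL \<rho> by (simp add: CX_def)
  have X_cont: "continuous_on I X"
    by (rule lipschitz_on_continuous_on [of CX])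
      (use X_lip CX0 in \<open>auto simp: lipschitz_on_def dist_norm dist_real_def\<close>)
  have h_Ck: "Ck_on j I h" if "Ck_on j I X" for j
    unfolding h_def hv_def
    by (intro Ck_on_add Ck_on_const Ck_on_diff that Ck_on_bounded_linear [OF app.bounded_linear_right])
  have l_Ck: "Ck_on j I l" if "Ck_on j I X" for j
    unfolding l_def lam_def
    by (intro Ck_on_add Ck_on_const that Ck_on_bounded_linear [OF blinfun.bounded_linear_right])
  have J_Ck: "Ck_on j I J" if X: "Ck_on j I X" and j: "j \<le> Suc k" for j
  proof (rule Ck_on_is_inverse)
    show "is_inverse (bord (L t) (h t) (l t)) (J t)" if "t \<in> I" for t using J that by (simp add: I_def)
    show "Ck_on j I (\<lambda>t. bord (L t) (h t) (l t))" unfolding bord_def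
      by (intro Ck_on_diff Ck_on_mult Ck_on_const Ck_on_mono [OF CkLI j]
          Ck_on_bounded_linear [OF bounded_linear_cs] l_Ck h_Ck X
          Ck_on_bounded_linear [OF bounded_bilinear.bounded_linear_left [OF bounded_bilinear_rank_one]])
  qed
  obtain L' where L': "\<And>t. t \<in> I \<Longrightarrow> (L has_vector_derivative L' t) (at t within I)" "Ck_on k I L'"
    using CkLI by (auto simp: Ck_on_Suc)
  have h_cont: "continuous_on I h" using h_Ck [of 0] X_cont by (simp add: Ck_on_0)
  have X_deriv: "(X has_vector_derivative app (J s) (- app (L' s) (h s))) (at s within I)" if s: "s \<in> I" for s
    unfolding has_vector_derivative_iff_slope
  proof -
    have hs: "(h \<longlongrightarrow> h s) (at s within I)" using h_cont s by (auto simp: continuous_on_def)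
    \<comment> \<open>The difference quotient of \<open>X\<close> is only known to be bounded at
      this point; multiplied by the increment of \<open>h\<close>, which tends to 0, it vanishes in
      the limit.\<close>
    have e2: "((\<lambda>t. cscale (pi' ((X t - X s) /\<^sub>R (t - s))) (h t - h s)) \<longlongrightarrow> 0) (at s within I)"
    proof (rule Lim_null_comparison)
      have "((\<lambda>t. (K * CX) * norm (h t - h s)) \<longlongrightarrow> (K * CX) * norm (h s - h s)) (at s within I)"
        by (intro tendsto_intros hs)
      then show "((\<lambda>t. (K * CX) * norm (h t - h s)) \<longlongrightarrow> 0) (at s within I)" by simp
      show "\<forall>\<^sub>F t in at s within I. norm (cscale (pi' ((X t - X s) /\<^sub>R (t - s))) (h t - h s)) \<le> (K * CX) * norm (h t - h s)"
        unfolding eventually_at_filter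
      proof (intro always_eventually allI impI)
        fix t assume t: "t \<noteq> s" "t \<in> I"
        have "inverse \<bar>t - s\<bar> * norm (X t - X s) \<le> inverse \<bar>t - s\<bar> * (CX * \<bar>t - s\<bar>)"
          by (intro mult_left_mono X_lip [OF s t(2)]) simp
        also have "\<dots> = CX" using t by simp
        finally have "norm ((X t - X s) /\<^sub>R (t - s)) \<le> CX" by simp
        then have "cmod (pi' ((X t - X s) /\<^sub>R (t - s))) \<le> K * CX"
          using K(1) by (intro order_trans [OF pi_le] mult_left_mono) auto
        then show "norm (cscale (pi' ((X t - X s) /\<^sub>R (t - s))) (h t - h s)) \<le> (K * CX) * norm (h t - h s)"
          unfolding norm_cscale by (rule mult_right_mono) simp
      qed
    qed
    have e1: "((\<lambda>t. - app ((L t - L s) /\<^sub>R (t - s)) (h t)) \<longlongrightarrow> - app (L' s) (h s)) (at s within I)"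
      using L'(1) [OF s] unfolding has_vector_derivative_iff_slope
      by (intro tendsto_minus bounded_bilinear.tendsto [OF bounded_bilinear_app] hs)
    have "((\<lambda>t. app (J s) (- app ((L t - L s) /\<^sub>R (t - s)) (h t) + cscale (pi' ((X t - X s) /\<^sub>R (t - s))) (h t - h s)))
        \<longlongrightarrow> app (J s) (- app (L' s) (h s) + 0)) (at s within I)"
      by (intro bounded_linear.tendsto [OF app.bounded_linear_right] tendsto_add e1 e2)
    moreover have "\<forall>\<^sub>F t in at s within I. app (J s) (- app ((L t - L s) /\<^sub>R (t - s)) (h t) + cscale (pi' ((X t - X s) /\<^sub>R (t - s))) (h t - h s))
        = (X t - X s) /\<^sub>R (t - s)"
      unfolding eventually_at_filter
    proof (intro always_eventually allI impI)
      fix t assume t: "t \<noteq> s" "t \<in> I"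
      have small': "norm (L s - L 0) \<le> 1 / (32 * K ^ 5)" "norm (L t - L 0) \<le> 1 / (32 * K ^ 5)"
        using s t small by (auto simp: I_def)
      \<comment> \<open>Replacing \<open>h t\<close> by \<open>h s\<close> makes the operator
        independent of \<open>t\<close>, hence inverted by \<open>J s\<close>, and costs exactly the
        term treated in \<open>e2\<close>.\<close>
      have "app (bord (L s) (h s) (l s)) (X t - X s) = - app (L t - L s) (h t) + cscale (pi' (X t - X s)) (h t - h s)"
      proof -
        have "app (bord (L s) (h s) (l s)) u = app (bord (L s) (h t) (l s)) u + cscale (pi' u) (h t - h s)" for u
          unfolding app_bord cscale.diff_right by simp
        then show ?thesis by (simp only: bord_difference [OF small'])
      qed
      then have "app (J s) (- app (L t - L s) (h t) + cscale (pi' (X t - X s)) (h t - h s)) = X t - X s"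
        using J [of s] s by (metis I_def app_simps(2) app_simps(3) is_inverse_def)
      then have "(X t - X s) /\<^sub>R (t - s) = app (J s) (- app (L t - L s) (h t) + cscale (pi' (X t - X s)) (h t - h s)) /\<^sub>R (t - s)"
        by simp
      also have "\<dots> = app (J s) (- app ((L t - L s) /\<^sub>R (t - s)) (h t) + cscale (pi' ((X t - X s) /\<^sub>R (t - s))) (h t - h s))"
        by (simp only: app.scaleR_right [symmetric] scaleR_add_right scaleR_minus_right app.scaleR_left
            blinfun.scaleR_right cscale.scaleR_left)
      finally show "app (J s) (- app ((L t - L s) /\<^sub>R (t - s)) (h t) + cscale (pi' ((X t - X s) /\<^sub>R (t - s))) (h t - h s))
        = (X t - X s) /\<^sub>R (t - s)" by simp
    qed
    ultimately show "((\<lambda>t. (X t - X s) /\<^sub>R (t - s)) \<longlongrightarrow> app (J s) (- app (L' s) (h s))) (at s within I)"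
      by (simp add: Lim_transform_eventually)
  qed
  have X_Ck: "j \<le> Suc k \<Longrightarrow> Ck_on j I X" for j
  proof (induction j)
    case 0 then show ?case using X_cont by (simp add: Ck_on_0)
  next
    case (Suc j)
    then have X: "Ck_on j I X" by simp
    have "Ck_on j I (\<lambda>s. app (J s) (- app (L' s) (h s)))"
      using Suc by (intro Ck_on_app J_Ck X Ck_on_minus h_Ck Ck_on_mono [OF L'(2)]) auto
    then show ?case unfolding Ck_on_Suc
      by (intro exI [of _ "\<lambda>s. app (J s) (- app (L' s) (h s))"] conjI ballI X_deriv)
  qed
  show "Ck_on (Suc k) {-\<delta>..\<delta>} X" "Ck_on (Suc k) {-\<delta>..\<delta>} J"
    "Ck_on (Suc k) {-\<delta>..\<delta>} h" "Ck_on (Suc k) {-\<delta>..\<delta>} l"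
    using X_Ck J_Ck h_Ck l_Ck by (auto simp: I_def)
qed

end

section \<open>Smoothing with a Gaussian kernel\<close>

lemma gaussian_fourier:
  assumes \<tau>: "\<tau> > 0"
  shows "(CLINT t|lborel. of_real (exp (- (\<tau>\<^sup>2 * t\<^sup>2) / 2)) * iexp (t * x))
    = of_real (2 * pi * normal_density 0 \<tau> x)"
proof -
  have "(CLINT u|lborel. std_normal_density u *\<^sub>R iexp (x / \<tau> * u)) = of_real (exp (- (x / \<tau>)\<^sup>2 / 2))"
    using fun_cong [OF char_std_normal_distribution, of "x / \<tau>"]
    unfolding char_def by (subst (asm) integral_density) auto
  then have "\<bar>\<tau>\<bar> *\<^sub>R (CLINT t|lborel. std_normal_density (0 + \<tau> * t) *\<^sub>R iexp (x / \<tau> * (0 + \<tau> * t)))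
     = of_real (exp (- (x / \<tau>)\<^sup>2 / 2))"
    using \<tau> by (subst (asm) lborel_integral_real_affine [where c = \<tau> and t = 0]) auto
  moreover have "std_normal_density (0 + \<tau> * t) *\<^sub>R iexp (x / \<tau> * (0 + \<tau> * t)) =
      of_real (1 / sqrt (2 * pi)) * (of_real (exp (- (\<tau>\<^sup>2 * t\<^sup>2) / 2)) * iexp (t * x))" for t
    using \<tau> by (simp add: normal_density_def scaleR_conv_of_real power_mult_distrib mult_ac)
  ultimately have "of_real (\<tau> / sqrt (2 * pi)) * (CLINT t|lborel. of_real (exp (- (\<tau>\<^sup>2 * t\<^sup>2) / 2)) * iexp (t * x))
     = of_real (exp (- (x / \<tau>)\<^sup>2 / 2))"
    using \<tau> by (simp add: scaleR_conv_of_real)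
  then have "(CLINT t|lborel. of_real (exp (- (\<tau>\<^sup>2 * t\<^sup>2) / 2)) * iexp (t * x))
     = of_real (sqrt (2 * pi) / \<tau> * exp (- (x / \<tau>)\<^sup>2 / 2))"
    using \<tau> by (simp add: field_simps)
  also have "sqrt (2 * pi) / \<tau> * exp (- (x / \<tau>)\<^sup>2 / 2) = 2 * pi * normal_density 0 \<tau> x"
  proof -
    define S where "S = sqrt (2 * pi)"
    have S: "S > 0" "S * S = 2 * pi" by (simp_all add: S_def)
    have s: "sqrt (2 * pi * \<tau>\<^sup>2) = S * \<tau>" using \<tau> by (simp add: S_def real_sqrt_mult)
    have e: "exp (- (x / \<tau>)\<^sup>2 / 2) = exp (- (x - 0)\<^sup>2 / (2 * \<tau>\<^sup>2))" by (simp add: power_divide mult.commute)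
    show ?thesis unfolding normal_density_def s e S_def [symmetric]
      unfolding S(2) [symmetric]
      using S(1) \<tau> by (simp add: field_simps)
  qed
  finally show ?thesis .
qed

lemma integrable_gaussian:
  assumes "c > 0" shows "integrable lborel (\<lambda>t::real. exp (- (c * t\<^sup>2)))"
proof -
  have "integrable lborel (\<lambda>t. sqrt (pi / c) * normal_density 0 (sqrt (1 / (2 * c))) t)"
    using assms by (intro integrable_mult_right integrable_normal_density) simp
  also have "(\<lambda>t. sqrt (pi / c) * normal_density 0 (sqrt (1 / (2 * c))) t) = (\<lambda>t. exp (- (c * t\<^sup>2)))"
    using assms by (auto simp: normal_density_def fun_eq_iff field_simps real_sqrt_divide)
  finally show ?thesis .
qed

text \<open>The Fourier transform of the indicator of \<open>{a..b}\<close>. Of the two bounds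
  below, the length gives integrability for fixed \<open>a\<close> and \<open>b\<close>, while
  \<open>2 / \<bar>t\<bar>\<close> is uniform in \<open>a\<close> and survives the passage to minus
  infinity.\<close>

definition interval_kernel :: "real \<Rightarrow> real \<Rightarrow> real \<Rightarrow> complex" where
  "interval_kernel a b t = (CLINT x:{a..b}|lborel. iexp (- (t * x)))"

lemma interval_kernel_measurable [measurable]: "interval_kernel a b \<in> borel_measurable borel"
  unfolding interval_kernel_def set_lebesgue_integral_def by measurable

lemma norm_interval_kernel_le_length: assumes "a \<le> b" shows "cmod (interval_kernel a b t) \<le> b - a"
proof -
  have "cmod (interval_kernel a b t) \<le> (LINT x|lborel. indicator {a..b} x)"
    unfolding interval_kernel_def set_lebesgue_integral_def
    by (rule order_trans [OF integral_norm_bound]) (auto intro!: integral_mono_AE' simp: indicator_def)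
  then show ?thesis using assms by simp
qed

lemma norm_interval_kernel_le: assumes "a \<le> b" "t \<noteq> 0" shows "cmod (interval_kernel a b t) \<le> 2 / \<bar>t\<bar>"
proof -
  define F where "F x = \<i> / of_real t * iexp (- (t * x))" for x
  have "(F has_vector_derivative iexp (- (t * x))) (at x within {a..b})" for x
    unfolding F_def using assms
    by (auto intro!: derivative_eq_intros has_vector_derivative_real_field simp: field_simps)
  then have "interval_kernel a b t = F b - F a"
    unfolding interval_kernel_def set_lebesgue_integral_def
    using assms by (intro integral_FTC_Icc) (auto intro!: continuous_intros)
  then have "cmod (interval_kernel a b t) \<le> cmod (F b) + cmod (F a)" by (simp add: norm_triangle_ineq4)
  then show ?thesis by (simp add: F_def norm_mult norm_divide)
qed

lemma gaussian_interval_fourier: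
  assumes \<tau>: "\<tau> > 0" and ab: "a \<le> b"
  shows "(CLINT t|lborel. interval_kernel a b t * (of_real (exp (- (\<tau>\<^sup>2 * t\<^sup>2) / 2)) * iexp (t * y)))
    = of_real (2 * pi * (LINT x|lborel. indicator {a..b} x * normal_density 0 \<tau> (x - y)))"
proof -
  define f where "f = (\<lambda>(x, t). indicator {a..b} x *\<^sub>R
    (iexp (- (t * x)) * (of_real (exp (- (\<tau>\<^sup>2 * t\<^sup>2) / 2)) * iexp (t * y))))"
  have [measurable]: "f \<in> borel_measurable (lborel \<Otimes>\<^sub>M lborel)" unfolding f_def by measurable
  have ie: "integrable lborel (\<lambda>t. exp (- (\<tau>\<^sup>2 * t\<^sup>2) / 2))"
    using integrable_gaussian [of "\<tau>\<^sup>2 / 2"] \<tau> by simp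
  have nf: "norm (f (x, t)) = indicator {a..b} x * exp (- (\<tau>\<^sup>2 * t\<^sup>2) / 2)" for x t
    by (simp add: f_def norm_mult indicator_def)
  have int: "integrable (lborel \<Otimes>\<^sub>M lborel) f"
  proof (rule lborel_pair.Fubini_integrable)
    show "integrable lborel (\<lambda>x. LINT t|lborel. norm (f (x, t)))" unfolding nf using ab by simp
    show "AE x in lborel. integrable lborel (\<lambda>t. f (x, t))"
    proof (rule AE_I2)
      fix x
      show "integrable lborel (\<lambda>t. f (x, t))"
        by (rule Bochner_Integration.integrable_bound [OF integrable_mult_right [OF ie, of "indicator {a..b} x"]])
          (auto simp: nf)
    qed
  qed simp
  have "(CLINT t|lborel. interval_kernel a b t * (of_real (exp (- (\<tau>\<^sup>2 * t\<^sup>2) / 2)) * iexp (t * y)))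
     = (CLINT t|lborel. CLINT x|lborel. f (x, t))"
    unfolding interval_kernel_def set_lebesgue_integral_def f_def
    by (intro Bochner_Integration.integral_cong refl)
      (simp flip: integral_mult_left_zero add: mult_scaleR_left)
  also have "\<dots> = (CLINT x|lborel. CLINT t|lborel. f (x, t))"
    using lborel_pair.Fubini_integral [of "\<lambda>x t. f (x, t)"] int by simp
  also have "\<dots> = (CLINT x|lborel. of_real (2 * pi * (indicator {a..b} x * normal_density 0 \<tau> (x - y))))"
  proof (intro Bochner_Integration.integral_cong refl)
    fix x
    have "(CLINT t|lborel. f (x, t)) = indicator {a..b} x *\<^sub>R
       (CLINT t|lborel. of_real (exp (- (\<tau>\<^sup>2 * t\<^sup>2) / 2)) * iexp (t * (y - x)))"
    proof -
      have "iexp (- (t * x)) * iexp (t * y) = iexp (t * (y - x))" for t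
        by (simp add: exp_add [symmetric] algebra_simps)
      then have "iexp (- (t * x)) * (G * iexp (t * y)) = G * iexp (t * (y - x))" for t and G :: complex
        by (metis mult.left_commute)
      then have "f (x, t) = indicator {a..b} x *\<^sub>R (of_real (exp (- (\<tau>\<^sup>2 * t\<^sup>2) / 2)) * iexp (t * (y - x)))" for t
        unfolding f_def prod.case by (simp only:)
      then show ?thesis by simp
    qed
    also have "\<dots> = indicator {a..b} x *\<^sub>R of_real (2 * pi * normal_density 0 \<tau> (y - x))"
      by (simp only: gaussian_fourier [OF \<tau>])
    also have "normal_density 0 \<tau> (y - x) = normal_density 0 \<tau> (x - y)"
      by (simp add: normal_density_def power2_commute)
    finally show "(CLINT t|lborel. f (x, t)) = of_real (2 * pi * (indicator {a..b} x * normal_density 0 \<tau> (x - y)))"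
      by (simp add: scaleR_conv_of_real)
  qed
  finally show ?thesis by (simp only: integral_complex_of_real integral_mult_right_zero)
qed

lemma (in pair_sigma_finite) integrable_prod_mult:
  fixes f :: "'a \<Rightarrow> real" and g :: "'b \<Rightarrow> real"
  assumes f: "integrable M1 f" and g: "integrable M2 g"
  shows "integrable (M1 \<Otimes>\<^sub>M M2) (\<lambda>(x, y). f x * g y)"
proof (rule Fubini_integrable)
  have [measurable]: "f \<in> borel_measurable M1" "g \<in> borel_measurable M2" using f g by auto
  show "(\<lambda>(x, y). f x * g y) \<in> borel_measurable (M1 \<Otimes>\<^sub>M M2)" by measurable
  show "integrable M1 (\<lambda>x. LINT y|M2. norm (case (x, y) of (x, y) \<Rightarrow> f x * g y))"
    using f by (simp add: abs_mult)
qed (use g in simp)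

text \<open>Stated with a weight \<open>w\<close> and a map \<open>Y\<close> so that it covers both
  sides of the comparison: \<open>w = 1\<close> on the probability space for the distribution
  function, and a density \<open>w = g\<close> on the line with \<open>Y\<close> the identity for
  its approximation. Increments between \<open>a\<close> and \<open>b\<close> are used because their
  Fourier kernel is bounded at \<open>t = 0\<close>; a distribution function alone would give a
  singularity \<open>1 / t\<close>.\<close>

lemma smoothed_increment_fourier:
  fixes M :: "'a measure" and w Y :: "'a \<Rightarrow> real"
  assumes M: "sigma_finite_measure M" and w: "integrable M w" and Y [measurable]: "Y \<in> borel_measurable M"
    and \<tau>: "\<tau> > 0" and ab: "a \<le> b"
  defines "W \<equiv> \<lambda>x. LINT \<omega>|M. w \<omega> * indicator {..x} (Y \<omega>)"
  shows "of_real (2 * pi * (LINT u|lborel. normal_density 0 \<tau> u * (W (b - u) - W (a - u))))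
    = (CLINT t|lborel. interval_kernel a b t * of_real (exp (- (\<tau>\<^sup>2 * t\<^sup>2) / 2)) *
         (CLINT \<omega>|M. of_real (w \<omega>) * iexp (t * Y \<omega>)))"
proof -
  interpret M: sigma_finite_measure M by fact
  interpret P: pair_sigma_finite M "lborel :: real measure" ..
  have wm [measurable]: "w \<in> borel_measurable M" using w by auto
  define f where "f = (\<lambda>(\<omega>, t). of_real (w \<omega>) * (interval_kernel a b t * (of_real (exp (- (\<tau>\<^sup>2 * t\<^sup>2) / 2)) * iexp (t * Y \<omega>))))"
  have fm [measurable]: "f \<in> borel_measurable (M \<Otimes>\<^sub>M lborel)" unfolding f_def by measurable
  have ie: "integrable lborel (\<lambda>t. exp (- (\<tau>\<^sup>2 * t\<^sup>2) / 2))"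
    using integrable_gaussian [of "\<tau>\<^sup>2 / 2"] \<tau> by simp
  have nf: "norm (f (\<omega>, t)) \<le> \<bar>w \<omega>\<bar> * (b - a) * exp (- (\<tau>\<^sup>2 * t\<^sup>2) / 2)" for \<omega> t
  proof -
    have "norm (f (\<omega>, t)) = \<bar>w \<omega>\<bar> * cmod (interval_kernel a b t) * exp (- (\<tau>\<^sup>2 * t\<^sup>2) / 2)"
      by (simp add: f_def norm_mult)
    then show ?thesis using norm_interval_kernel_le_length [OF ab] by (simp add: mult_left_mono mult_right_mono)
  qed
  define g where "g = (\<lambda>(\<omega>, u). normal_density 0 \<tau> u * (w \<omega> * indicator {a<..b} (Y \<omega> + u)))"
  have gm [measurable]: "g \<in> borel_measurable (M \<Otimes>\<^sub>M lborel)" unfolding g_def by measurable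
  have ng: "norm (g (\<omega>, u)) \<le> \<bar>w \<omega>\<bar> * normal_density 0 \<tau> u" for \<omega> u
    by (simp add: g_def abs_mult indicator_def)
  have intf: "integrable (M \<Otimes>\<^sub>M lborel) f"
  proof (rule Bochner_Integration.integrable_bound)
    show "integrable (M \<Otimes>\<^sub>M lborel) (\<lambda>(\<omega>, t). \<bar>w \<omega>\<bar> * (b - a) * exp (- (\<tau>\<^sup>2 * t\<^sup>2) / 2))"
      by (rule P.integrable_prod_mult [OF _ ie]) (use w in auto)
    show "AE x in M \<Otimes>\<^sub>M lborel. norm (f x) \<le> norm ((\<lambda>(\<omega>, t). \<bar>w \<omega>\<bar> * (b - a) * exp (- (\<tau>\<^sup>2 * t\<^sup>2) / 2)) x)"
      using nf ab by (intro AE_I2) (auto simp: abs_mult)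
  qed simp
  have intg: "integrable (M \<Otimes>\<^sub>M lborel) g"
  proof (rule Bochner_Integration.integrable_bound)
    show "integrable (M \<Otimes>\<^sub>M lborel) (\<lambda>(\<omega>, t). \<bar>w \<omega>\<bar> * normal_density 0 \<tau> t)"
      by (rule P.integrable_prod_mult) (use w \<tau> in auto)
    show "AE x in M \<Otimes>\<^sub>M lborel. norm (g x) \<le> norm ((\<lambda>(\<omega>, t). \<bar>w \<omega>\<bar> * normal_density 0 \<tau> t) x)"
      using ng by (intro AE_I2) (auto simp: abs_mult)
  qed simp
  have wi: "integrable M (\<lambda>\<omega>. w \<omega> * indicator {..x} (Y \<omega>))" for x
    by (rule Bochner_Integration.integrable_bound [OF w]) (auto simp: indicator_def)
  have "(LINT u|lborel. normal_density 0 \<tau> u * (W (b - u) - W (a - u))) = (LINT u|lborel. LINT \<omega>|M. g (\<omega>, u))"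
  proof (intro Bochner_Integration.integral_cong refl)
    fix u
    have "W (b - u) - W (a - u) = (LINT \<omega>|M. w \<omega> * indicator {..b - u} (Y \<omega>) - w \<omega> * indicator {..a - u} (Y \<omega>))"
      unfolding W_def by (intro Bochner_Integration.integral_diff [symmetric] wi)
    also have "\<dots> = (LINT \<omega>|M. w \<omega> * indicator {a<..b} (Y \<omega> + u))"
      using ab by (intro Bochner_Integration.integral_cong refl) (auto simp: indicator_def)
    finally show "normal_density 0 \<tau> u * (W (b - u) - W (a - u)) = (LINT \<omega>|M. g (\<omega>, u))"
      by (simp add: g_def)
  qed
  also have "\<dots> = (LINT \<omega>|M. LINT u|lborel. g (\<omega>, u))"
    using P.Fubini_integral [of "\<lambda>x t. g (x, t)"] intg by simp
  also have "\<dots> = (LINT \<omega>|M. w \<omega> * (LINT x|lborel. indicator {a..b} x * normal_density 0 \<tau> (x - Y \<omega>)))"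
  proof (intro Bochner_Integration.integral_cong refl)
    fix \<omega>
    have "(LINT u|lborel. g (\<omega>, u)) = (LINT x|lborel. g (\<omega>, - Y \<omega> + 1 * x))"
      by (subst lborel_integral_real_affine [where c = 1 and t = "- Y \<omega>"]) auto
    also have "\<dots> = (LINT x|lborel. w \<omega> * (indicator {a..b} x * normal_density 0 \<tau> (x - Y \<omega>)))"
    proof (rule integral_cong_AE)
      have "AE x in lborel. x \<noteq> a" by (rule AE_lborel_singleton)
      then show "AE x in lborel. g (\<omega>, - Y \<omega> + 1 * x) = w \<omega> * (indicator {a..b} x * normal_density 0 \<tau> (x - Y \<omega>))"
        by eventually_elim (auto simp: g_def indicator_def)
    qed (auto simp: g_def)
    finally show "(LINT u|lborel. g (\<omega>, u)) = w \<omega> * (LINT x|lborel. indicator {a..b} x * normal_density 0 \<tau> (x - Y \<omega>))"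
      by simp
  qed
  finally have "complex_of_real (2 * pi * (LINT u|lborel. normal_density 0 \<tau> u * (W (b - u) - W (a - u))))
     = (CLINT \<omega>|M. of_real (w \<omega>) * of_real (2 * pi * (LINT x|lborel. indicator {a..b} x * normal_density 0 \<tau> (x - Y \<omega>))))"
    by (simp add: mult.left_commute flip: of_real_mult integral_mult_right_zero)
  also have "\<dots> = (CLINT \<omega>|M. CLINT t|lborel. f (\<omega>, t))"
    unfolding gaussian_interval_fourier [OF \<tau> ab, symmetric] f_def by simp
  also have "\<dots> = (CLINT t|lborel. CLINT \<omega>|M. f (\<omega>, t))"
    using P.Fubini_integral [of "\<lambda>x t. f (x, t)"] intf by simp
  also have "\<dots> = (CLINT t|lborel. interval_kernel a b t * of_real (exp (- (\<tau>\<^sup>2 * t\<^sup>2) / 2)) *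
         (CLINT \<omega>|M. of_real (w \<omega>) * iexp (t * Y \<omega>)))"
  proof (intro Bochner_Integration.integral_cong refl)
    fix t
    have "(CLINT \<omega>|M. f (\<omega>, t)) = (CLINT \<omega>|M. (interval_kernel a b t * of_real (exp (- (\<tau>\<^sup>2 * t\<^sup>2) / 2))) *
        (of_real (w \<omega>) * iexp (t * Y \<omega>)))"
      by (simp add: f_def mult_ac)
    then show "(CLINT \<omega>|M. f (\<omega>, t)) = interval_kernel a b t * of_real (exp (- (\<tau>\<^sup>2 * t\<^sup>2) / 2)) *
         (CLINT \<omega>|M. of_real (w \<omega>) * iexp (t * Y \<omega>))"
      by (simp only: integral_mult_right_zero)
  qed
  finally show ?thesis .
qed

lemma weighted_cdf_at_bot:
  fixes w Y :: "'a \<Rightarrow> real"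
  assumes w: "integrable M w" and Y [measurable]: "Y \<in> borel_measurable M"
  shows "((\<lambda>x. LINT \<omega>|M. w \<omega> * indicator {..x} (Y \<omega>)) \<longlongrightarrow> 0) at_bot"
proof -
  have [measurable]: "w \<in> borel_measurable M" using w by auto
  have "((\<lambda>x. LINT \<omega>|M. w \<omega> * indicator {..-x} (Y \<omega>)) \<longlongrightarrow> (LINT \<omega>|M. 0 :: real)) at_top"
  proof (rule integral_dominated_convergence_at_top [where w = "\<lambda>\<omega>. \<bar>w \<omega>\<bar>"])
    show "AE \<omega> in M. ((\<lambda>x. w \<omega> * indicator {..-x} (Y \<omega>)) \<longlongrightarrow> 0) at_top"
    proof (rule AE_I2)
      fix \<omega>
      have "\<forall>\<^sub>F x in at_top. w \<omega> * indicator {..-x} (Y \<omega>) = 0"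
        using eventually_gt_at_top [of "- Y \<omega>"] by eventually_elim (auto simp: indicator_def)
      then show "((\<lambda>x. w \<omega> * indicator {..-x} (Y \<omega>)) \<longlongrightarrow> 0) at_top" by (rule tendsto_eventually)
    qed
    show "\<forall>\<^sub>F x in at_top. AE \<omega> in M. norm (w \<omega> * indicator {..-x} (Y \<omega>)) \<le> \<bar>w \<omega>\<bar>"
      by (intro always_eventually allI AE_I2) (auto simp: indicator_def)
  qed (use w in \<open>auto intro!: integrable_abs\<close>)
  then show ?thesis unfolding filterlim_at_bot_mirror by simp
qed

text \<open>Serves to let \<open>a\<close> tend to minus infinity in the smoothed increments, which
  recovers the smoothed difference itself.\<close>

lemma convolution_at_bot:
  fixes k f :: "real \<Rightarrow> real"
  assumes k: "integrable lborel k" and fm [measurable]: "f \<in> borel_measurable borel"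
    and f: "\<And>x. \<bar>f x\<bar> \<le> B" and lim: "(f \<longlongrightarrow> 0) at_bot"
  shows "((\<lambda>a. LINT u|lborel. k u * f (a - u)) \<longlongrightarrow> 0) at_bot"
proof -
  have [measurable]: "k \<in> borel_measurable borel" using borel_measurable_integrable [OF k] by simp
  have "((\<lambda>a. LINT u|lborel. k u * f (- a - u)) \<longlongrightarrow> (LINT u|(lborel :: real measure). 0 :: real)) at_top"
  proof (rule integral_dominated_convergence_at_top)
    show "AE u in lborel. ((\<lambda>a. k u * f (- a - u)) \<longlongrightarrow> 0) at_top"
    proof (rule AE_I2)
      fix u :: real
      have "filterlim (\<lambda>a. - a - u) at_bot at_top" by real_asymp
      then have "((\<lambda>a. f (- a - u)) \<longlongrightarrow> 0) at_top" using lim by (rule filterlim_compose [rotated])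
      then show "((\<lambda>a. k u * f (- a - u)) \<longlongrightarrow> 0) at_top" by (rule tendsto_mult_right_zero)
    qed
    show "\<forall>\<^sub>F a in at_top. AE u in lborel. norm (k u * f (- a - u)) \<le> \<bar>k u\<bar> * B"
      by (intro always_eventually allI AE_I2) (simp add: abs_mult mult_left_mono f)
    show "integrable lborel (\<lambda>u. \<bar>k u\<bar> * B)" using k by simp
  qed measurable
  then show ?thesis unfolding filterlim_at_bot_mirror by simp
qed

text \<open>Chebyshev's inequality at two standard deviations. What matters is that 3/4 exceeds 1/2,
  which keeps \<open>2 * p - 1\<close> away from 0 in \<open>smoothing_sup_bound\<close>.\<close>

lemma normal_density_tail:
  assumes \<tau>: "\<tau> > 0"
  shows "3/4 \<le> (LINT u|lborel. normal_density 0 \<tau> u * indicator {-2*\<tau>..2*\<tau>} u)"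
proof -
  have m2: "has_bochner_integral lborel (\<lambda>x. normal_density 0 \<tau> x * x ^ 2) (\<tau>\<^sup>2)"
    using normal_moment_even [OF \<tau>, of 0 1] by (simp add: fact_numeral eval_nat_numeral)
  have i: "integrable lborel (\<lambda>u. normal_density 0 \<tau> u * indicator {-2*\<tau>..2*\<tau>} u)"
    by (rule Bochner_Integration.integrable_bound [OF integrable_normal_density [OF \<tau>, of 0]])
      (auto simp: indicator_def)
  have i2: "integrable lborel (\<lambda>u. normal_density 0 \<tau> u * u\<^sup>2 / (4 * \<tau>\<^sup>2))"
    using m2 by (auto simp: has_bochner_integral_iff)
  have "1 = (LINT u|lborel. normal_density 0 \<tau> u)" using \<tau> by simp
  also have "\<dots> \<le> (LINT u|lborel. normal_density 0 \<tau> u * indicator {-2*\<tau>..2*\<tau>} u + normal_density 0 \<tau> u * u\<^sup>2 / (4 * \<tau>\<^sup>2))"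
  proof (rule integral_mono)
    fix u :: real
    show "normal_density 0 \<tau> u \<le> normal_density 0 \<tau> u * indicator {-2*\<tau>..2*\<tau>} u + normal_density 0 \<tau> u * u\<^sup>2 / (4 * \<tau>\<^sup>2)"
    proof (cases "u \<in> {-2*\<tau>..2*\<tau>}")
      case False
      then have "2 * \<tau> \<le> \<bar>u\<bar>" by auto
      then have "(2 * \<tau>)\<^sup>2 \<le> u\<^sup>2" using \<tau> by (metis abs_le_square_iff abs_of_pos mult_pos_pos zero_less_numeral)
      then have "1 \<le> u\<^sup>2 / (4 * \<tau>\<^sup>2)" using \<tau> by (simp add: power_mult_distrib)
      then have "normal_density 0 \<tau> u * 1 \<le> normal_density 0 \<tau> u * (u\<^sup>2 / (4 * \<tau>\<^sup>2))" by (intro mult_left_mono) auto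
      then show ?thesis using False by simp
    qed simp
  qed (use i i2 \<tau> in auto)
  also have "\<dots> = (LINT u|lborel. normal_density 0 \<tau> u * indicator {-2*\<tau>..2*\<tau>} u) + \<tau>\<^sup>2 / (4 * \<tau>\<^sup>2)"
    using i i2 m2 by (simp add: has_bochner_integral_iff)
  also have "\<tau>\<^sup>2 / (4 * \<tau>\<^sup>2) = 1/4" using \<tau> by simp
  finally show ?thesis by simp
qed

text \<open>The supremum $B$ of $|\Delta|$ is nearly attained on a whole interval of length $4\tau$, since
  $F$ is monotone and $G$ is Lipschitz; averaging over that interval cannot lose more than a fraction of it.\<close>

lemma smoothing_sup_bound:
  fixes F G :: "real \<Rightarrow> real"
  assumes F: "mono F" and G: "\<And>x y. \<bar>G x - G y\<bar> \<le> m * \<bar>x - y\<bar>"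
    and bdd: "\<And>x. \<bar>F x - G x\<bar> \<le> B0" and \<tau>: "\<tau> > 0"
    and sm: "\<And>b. \<bar>LINT u|lborel. normal_density 0 \<tau> u * (F (b - u) - G (b - u))\<bar> \<le> \<eta>"
  shows "\<bar>F x - G x\<bar> \<le> 2 * \<eta> + 8 * m * \<tau>"
proof -
  define \<Delta> where "\<Delta> x = F x - G x" for x
  define B where "B = (SUP x. \<bar>\<Delta> x\<bar>)"
  have bdda: "bdd_above (range (\<lambda>x. \<bar>\<Delta> x\<bar>))" using bdd by (intro bdd_aboveI2) (auto simp: \<Delta>_def)
  have B: "\<bar>\<Delta> x\<bar> \<le> B" for x unfolding B_def by (intro cSUP_upper bdda) auto
  have m: "m \<ge> 0" using G [of 1 0] by simp
  have "m-lipschitz_on UNIV G" using m G by (auto simp: lipschitz_on_def dist_real_def)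
  then have [measurable]: "G \<in> borel_measurable borel"
    by (intro borel_measurable_continuous_onI lipschitz_on_continuous_on)
  have [measurable]: "F \<in> borel_measurable borel" by (rule borel_measurable_mono [OF F])
  have [measurable]: "\<Delta> \<in> borel_measurable borel" unfolding \<Delta>_def by measurable
  define I where "I = {-2*\<tau>..2*\<tau>}"
  have I [measurable]: "I \<in> sets borel" by (simp add: I_def)
  define k where "k = normal_density 0 \<tau>"
  have k [measurable]: "k \<in> borel_measurable borel" "integrable lborel k" "\<And>u. k u \<ge> 0"
    "integral\<^sup>L lborel k = 1"
    using \<tau> by (auto simp: k_def)
  define p where "p = (LINT u|lborel. k u * indicator I u)"
  have p: "3/4 \<le> p" using normal_density_tail [OF \<tau>] by (simp add: p_def k_def I_def)
  have ik: "integrable lborel (\<lambda>u. k u * indicator I u)"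
    by (rule Bochner_Integration.integrable_bound [OF k(2)]) (auto simp: indicator_def)
  \<comment> \<open>If the signed difference is at least \<open>d\<close> on the window and at least
    \<open>- B\<close> elsewhere, its average is at least \<open>p * d - (1 - p) * B\<close>, which
    equals \<open>p * (d + B) - B\<close>.\<close>
  have key: "p * (d + B) - B \<le> \<eta>"
    if d: "\<And>u. u \<in> I \<Longrightarrow> d \<le> s * \<Delta> (b - u)" and s: "\<bar>s\<bar> = 1" for s b d
  proof -
    have sB: "- B \<le> s * \<Delta> x" for x
      using B [of x] s by (metis abs_mult abs_le_D2 minus_le_iff mult_1)
    have i\<Delta>: "integrable lborel (\<lambda>u. k u * \<Delta> (b - u))"
    proof (rule Bochner_Integration.integrable_bound)
      show "integrable lborel (\<lambda>u. B * k u)" using k by simp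
      show "AE u in lborel. norm (k u * \<Delta> (b - u)) \<le> norm (B * k u)"
      proof (rule AE_I2)
        fix u
        have "k u * \<bar>\<Delta> (b - u)\<bar> \<le> k u * B" using k B by (intro mult_left_mono) auto
        then show "norm (k u * \<Delta> (b - u)) \<le> norm (B * k u)" using k(3) [of u]
          using B [of 0] by (simp add: abs_mult mult.commute)
      qed
    qed measurable
    have "p * (d + B) - B = (LINT u|lborel. (d + B) * (k u * indicator I u) - B * k u)"
      using ik k by (simp add: p_def)
    also have "\<dots> \<le> (LINT u|lborel. s * (k u * \<Delta> (b - u)))"
    proof (rule integral_mono)
      fix u
      show "(d + B) * (k u * indicator I u) - B * k u \<le> s * (k u * \<Delta> (b - u))"
      proof (cases "u \<in> I")
        case True
        then show ?thesis using mult_left_mono [OF d [OF True] k(3) [of u]] by (simp add: algebra_simps)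
      next
        case False
        then show ?thesis using mult_left_mono [OF sB [of "b - u"] k(3) [of u]] by (simp add: algebra_simps)
      qed
    qed (use ik k i\<Delta> in auto)
    also have "\<dots> = s * (LINT u|lborel. k u * \<Delta> (b - u))" by simp
    also have "\<dots> \<le> \<eta>" using sm [of b] s unfolding k_def \<Delta>_def
      by (metis abs_le_D1 abs_mult mult_1)
    finally show ?thesis .
  qed
  \<comment> \<open>The window, of length \<open>4 * \<tau>\<close>, is placed to the right of
    \<open>x\<close> if the difference is nonnegative there and to the left otherwise: monotonicity
    of \<open>F\<close> then works in the right direction, and \<open>G\<close> loses at most
    \<open>4 * m * \<tau>\<close>.\<close>
  have main: "p * (\<bar>\<Delta> x\<bar> - 4 * m * \<tau> + B) - B \<le> \<eta>" for x
  proof (cases "\<Delta> x \<ge> 0")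
    case True
    show ?thesis
    proof (rule key [where s = 1 and b = "x + 2 * \<tau>"])
      fix u assume u: "u \<in> I"
      then have "x \<le> x + 2 * \<tau> - u" by (simp add: I_def)
      then have "F x \<le> F (x + 2 * \<tau> - u)" using F by (simp add: mono_def)
      moreover have "\<bar>G (x + 2 * \<tau> - u) - G x\<bar> \<le> m * (4 * \<tau>)"
        using u m by (intro order_trans [OF G] mult_left_mono) (auto simp: I_def)
      ultimately show "\<bar>\<Delta> x\<bar> - 4 * m * \<tau> \<le> 1 * \<Delta> (x + 2 * \<tau> - u)"
        using True by (simp add: \<Delta>_def)
    qed simp
  next
    case False
    show ?thesis
    proof (rule key [where s = "-1" and b = "x - 2 * \<tau>"])
      fix u assume u: "u \<in> I"
      then have "x - 2 * \<tau> - u \<le> x" by (simp add: I_def)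
      then have "F (x - 2 * \<tau> - u) \<le> F x" using F by (simp add: mono_def)
      moreover have "\<bar>G (x - 2 * \<tau> - u) - G x\<bar> \<le> m * (4 * \<tau>)"
        using u m by (intro order_trans [OF G] mult_left_mono) (auto simp: I_def)
      ultimately show "\<bar>\<Delta> x\<bar> - 4 * m * \<tau> \<le> - 1 * \<Delta> (x - 2 * \<tau> - u)"
        using False by (simp add: \<Delta>_def)
    qed simp
  qed
  have "B \<le> (\<eta> + B) / p + 4 * m * \<tau> - B"
    unfolding B_def
  proof (rule cSUP_least)
    fix x
    show "\<bar>\<Delta> x\<bar> \<le> (\<eta> + (SUP x. \<bar>\<Delta> x\<bar>)) / p + 4 * m * \<tau> - (SUP x. \<bar>\<Delta> x\<bar>)"
      using main [of x] p unfolding B_def [symmetric] by (simp add: field_simps)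
  qed simp
  \<comment> \<open>Solving for \<open>B\<close>: the coefficient left over is
    \<open>2 * p - 1\<close>, at least 1/2, which produces the factor 2 in front of \<eta> and the
    final constant 8.\<close>
  then have "B * p \<le> ((\<eta> + B) / p + 4 * m * \<tau> - B) * p" using p by (intro mult_right_mono) auto
  also have "\<dots> = \<eta> + B + 4 * m * \<tau> * p - B * p" using p by (simp add: field_simps)
  finally have 1: "B * (2 * p - 1) \<le> \<eta> + 4 * m * \<tau> * p" by (simp add: algebra_simps)
  have "0 \<le> B" using B [of 0] by simp
  then have 2: "B * (1/2) \<le> B * (2 * p - 1)" using p by (intro mult_left_mono) auto
  have "p \<le> (LINT u|lborel. k u)"
    unfolding p_def using k ik by (intro integral_mono) (auto simp: indicator_def)
  then have "4 * m * \<tau> * p \<le> 4 * m * \<tau> * 1" using m \<tau> k by (intro mult_left_mono) auto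
  then have "B \<le> 2 * \<eta> + 8 * m * \<tau>" using 1 2 by linarith
  then show ?thesis using B [of x] by (simp add: \<Delta>_def)
qed

text \<open>An Esseen inequality with Gaussian damping in place of a sharp frequency cutoff. The
  integrable majorant \<open>H\<close> is left free so that it can be assembled range by range; the
  function \<open>g\<close> may change sign, since only its boundedness is used to make its
  primitive Lipschitz.\<close>

theorem smoothing_inequality:
  fixes M :: "'a measure" and Y :: "'a \<Rightarrow> real" and g :: "real \<Rightarrow> real"
  assumes M: "prob_space M" and Y [measurable]: "Y \<in> borel_measurable M"
    and g: "integrable lborel g" and gm: "\<And>y. \<bar>g y\<bar> \<le> m" and \<tau>: "\<tau> > 0"
    and H: "integrable lborel H"
    and bound: "\<And>t. t \<noteq> 0 \<Longrightarrow>
      cmod ((CLINT \<omega>|M. iexp (t * Y \<omega>)) - (CLINT y|lborel. of_real (g y) * iexp (t * y)))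
        / \<bar>t\<bar> * exp (- (\<tau>\<^sup>2 * t\<^sup>2) / 2) \<le> H t"
  shows "\<bar>measure M {\<omega> \<in> space M. Y \<omega> \<le> x} - (LINT y|lborel. g y * indicator {..x} y)\<bar>
    \<le> (LINT t|lborel. H t) + 8 * m * \<tau>"
proof -
  interpret prob_space M by fact
  define F :: "real \<Rightarrow> real" where "F x = (LINT \<omega>|M. 1 * indicator {..x} (Y \<omega>))" for x
  define G where "G x = (LINT y|lborel. g y * indicator {..x} y)" for x
  have F_eq: "F x = measure M {\<omega> \<in> space M. Y \<omega> \<le> x}" for x
  proof -
    have "F x = (LINT \<omega>|M. indicator {\<omega> \<in> space M. Y \<omega> \<le> x} \<omega>)"
      unfolding F_def by (intro Bochner_Integration.integral_cong refl) (auto simp: indicator_def)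
    then show ?thesis by simp
  qed
  have g_meas [measurable]: "g \<in> borel_measurable borel" using borel_measurable_integrable [OF g] by simp
  have ig: "integrable lborel (\<lambda>y. g y * indicator A y)" if "A \<in> sets borel" for A
    by (rule Bochner_Integration.integrable_bound [OF g]) (use that in \<open>auto simp: indicator_def\<close>)
  have Fmono: "mono F" unfolding F_eq by (intro monoI finite_measure_mono) auto
  have G_lip1: "\<bar>G y - G x\<bar> \<le> m * (y - x)" if xy: "x \<le> y" for x y
  proof -
    have "G y - G x = (LINT u|lborel. g u * indicator {..y} u - g u * indicator {..x} u)"
      unfolding G_def by (intro Bochner_Integration.integral_diff [symmetric] ig) auto
    also have "\<dots> = (LINT u|lborel. g u * indicator {x<..y} u)"
      using xy by (intro Bochner_Integration.integral_cong refl) (auto simp: indicator_def)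
    finally have "\<bar>G y - G x\<bar> \<le> (LINT u|lborel. \<bar>g u * indicator {x<..y} u\<bar>)"
      using integral_norm_bound [of lborel "\<lambda>u. g u * indicator {x<..y} u"] by simp
    also have "\<dots> \<le> (LINT u|lborel. m * indicator {x<..y} u)"
    proof (intro integral_mono integrable_abs ig integrable_mult_right)
      show "\<bar>g u * indicator {x<..y} u\<bar> \<le> m * indicator {x<..y} u" for u using gm [of u] by (auto simp: indicator_def)
      show "integrable lborel (indicator {x<..y} :: real \<Rightarrow> real)"
        using xy by (intro integrable_real_indicator) auto
    qed simp_all
    finally show ?thesis using xy by simp
  qed
  have G_lip: "\<bar>G x - G y\<bar> \<le> m * \<bar>x - y\<bar>" for x y
    using G_lip1 [of x y] G_lip1 [of y x] by (cases "x \<le> y") (auto simp: abs_minus_commute)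
  have m: "m \<ge> 0" using gm [of 0] by simp
  define B0 where "B0 = 1 + (LINT y|lborel. \<bar>g y\<bar>)"
  have bdd: "\<bar>F x - G x\<bar> \<le> B0" for x
  proof -
    have "0 \<le> F x" "F x \<le> 1" by (simp_all add: F_eq)
    moreover have "\<bar>G x\<bar> \<le> (LINT u|lborel. \<bar>g u * indicator {..x} u\<bar>)"
      unfolding G_def using integral_norm_bound [of lborel "\<lambda>u. g u * indicator {..x} u"] by simp
    moreover have "\<dots> \<le> (LINT u|lborel. \<bar>g u\<bar>)"
      using g by (intro integral_mono integrable_abs ig) (auto simp: indicator_def)
    ultimately show ?thesis by (simp add: B0_def)
  qed
  have idm: "(\<lambda>x::real. x) \<in> borel_measurable lborel" by simp
  define k where "k = normal_density 0 \<tau>"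
  have k [measurable]: "k \<in> borel_measurable borel" "integrable lborel k" "\<And>u. k u \<ge> 0"
    "integral\<^sup>L lborel k = 1"
    using \<tau> by (auto simp: k_def)
  have "m-lipschitz_on UNIV G" using m G_lip by (auto simp: lipschitz_on_def dist_real_def)
  then have [measurable]: "G \<in> borel_measurable borel"
    by (intro borel_measurable_continuous_onI lipschitz_on_continuous_on)
  have [measurable]: "F \<in> borel_measurable borel" by (rule borel_measurable_mono [OF Fmono])
  define \<Delta> where "\<Delta> x = F x - G x" for x
  have [measurable]: "\<Delta> \<in> borel_measurable borel" unfolding \<Delta>_def by measurable
  have k\<Delta>_bd: "norm (k u * \<Delta> x) \<le> k u * B0" for u x
    using mult_left_mono [OF bdd [of x] k(3) [of u]] k(3) [of u] by (simp add: \<Delta>_def abs_mult)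
  have ikB: "integrable lborel (\<lambda>u. k u * B0)" using k by simp
  have ik\<Delta>: "integrable lborel (\<lambda>u. k u * \<Delta> (b - u))" for b
  proof (rule Bochner_Integration.integrable_bound [OF ikB])
    show "AE u in lborel. norm (k u * \<Delta> (b - u)) \<le> norm (k u * B0)"
      by (intro AE_I2, rule order_trans [OF k\<Delta>_bd]) (simp only: real_norm_def abs_ge_self)
  qed measurable
  define \<phi> where "\<phi> t = (CLINT \<omega>|M. of_real 1 * iexp (t * Y \<omega>))" for t
  define \<gamma> where "\<gamma> t = (CLINT y|lborel. of_real (g y) * iexp (t * y))" for t
  \<comment> \<open>The kernel bound \<open>2 / \<bar>t\<bar>\<close> makes the right-hand side
    independent of both endpoints.\<close>
  have incr: "\<bar>(LINT u|lborel. k u * \<Delta> (b - u)) - (LINT u|lborel. k u * \<Delta> (a - u))\<bar> \<le> (LINT t|lborel. H t) / pi"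
    if ab: "a \<le> b" for a b
  proof -
    have ikF: "integrable lborel (\<lambda>u. k u * (F (b - u) - F (a - u)))"
    proof (rule Bochner_Integration.integrable_bound)
      show "integrable lborel (\<lambda>u. 2 * k u)" using k by simp
      show "AE u in lborel. norm (k u * (F (b - u) - F (a - u))) \<le> norm (2 * k u)"
      proof (rule AE_I2)
        fix u
        have "\<bar>F (b - u) - F (a - u)\<bar> \<le> 2"
          using prob_le_1 measure_nonneg unfolding F_eq by (smt (verit))
        then show "norm (k u * (F (b - u) - F (a - u))) \<le> norm (2 * k u)"
          using k(3) [of u] by (simp add: abs_mult mult_left_mono mult.commute)
      qed
    qed measurable
    define E where "E t = interval_kernel a b t * of_real (exp (- (\<tau>\<^sup>2 * t\<^sup>2) / 2))" for t
    have bnd: "cmod (E t * (\<phi> t - \<gamma> t)) \<le> 2 * H t" if t: "t \<noteq> 0" for t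
    proof -
      have "cmod (E t * (\<phi> t - \<gamma> t)) = cmod (interval_kernel a b t) * (exp (- (\<tau>\<^sup>2 * t\<^sup>2) / 2) * cmod (\<phi> t - \<gamma> t))"
        by (simp add: E_def norm_mult)
      also have "\<dots> \<le> 2 / \<bar>t\<bar> * (exp (- (\<tau>\<^sup>2 * t\<^sup>2) / 2) * cmod (\<phi> t - \<gamma> t))"
        by (intro mult_right_mono norm_interval_kernel_le ab t) auto
      also have "\<dots> = 2 * (cmod (\<phi> t - \<gamma> t) / \<bar>t\<bar> * exp (- (\<tau>\<^sup>2 * t\<^sup>2) / 2))" by simp
      also have "\<dots> \<le> 2 * H t" using bound [OF t] by (intro mult_left_mono) (auto simp: \<phi>_def \<gamma>_def)
      finally show ?thesis .
    qed
    have \<phi>m [measurable]: "\<phi> \<in> borel_measurable borel" unfolding \<phi>_def by measurable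
    have \<gamma>m [measurable]: "\<gamma> \<in> borel_measurable borel" unfolding \<gamma>_def by measurable
    have Em [measurable]: "E \<in> borel_measurable borel" unfolding E_def by measurable
    have ie: "integrable lborel (\<lambda>t. (b - a) * exp (- (\<tau>\<^sup>2 * t\<^sup>2) / 2) * C)" for C :: real
      using integrable_gaussian [of "\<tau>\<^sup>2 / 2"] \<tau> by simp
    have Eb: "cmod (E t) \<le> (b - a) * exp (- (\<tau>\<^sup>2 * t\<^sup>2) / 2)" for t
      using norm_interval_kernel_le_length [OF ab] by (simp add: E_def norm_mult mult_right_mono)
    have bdE: "integrable lborel (\<lambda>t. E t * f t)" if f: "\<And>t. cmod (f t) \<le> C" and [measurable]: "f \<in> borel_measurable borel"
      for f and C :: real
    proof (rule Bochner_Integration.integrable_bound [OF ie [of C]])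
      show "AE t in lborel. norm (E t * f t) \<le> norm ((b - a) * exp (- (\<tau>\<^sup>2 * t\<^sup>2) / 2) * C)"
      proof (rule AE_I2)
        fix t
        have "norm (E t * f t) \<le> (b - a) * exp (- (\<tau>\<^sup>2 * t\<^sup>2) / 2) * C"
          unfolding norm_mult using ab by (intro mult_mono Eb f) auto
        then show "norm (E t * f t) \<le> norm ((b - a) * exp (- (\<tau>\<^sup>2 * t\<^sup>2) / 2) * C)"
          by (metis abs_ge_self order_trans real_norm_def)
      qed
    qed measurable
    have \<phi>b: "cmod (\<phi> t) \<le> 1" for t
      unfolding \<phi>_def by (rule order_trans [OF integral_norm_bound]) (simp add: prob_space)
    have \<gamma>b: "cmod (\<gamma> t) \<le> (LINT y|lborel. \<bar>g y\<bar>)" for t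
      unfolding \<gamma>_def by (rule order_trans [OF integral_norm_bound]) (simp add: norm_mult)
    have "complex_of_real (2 * pi * (LINT u|lborel. k u * (F (b - u) - F (a - u)))) = (CLINT t|lborel. E t * \<phi> t)"
      unfolding F_def k_def E_def \<phi>_def
      by (rule smoothed_increment_fourier [OF _ _ Y \<tau> ab]) (auto intro: sigma_finite_measure_axioms)
    moreover have "complex_of_real (2 * pi * (LINT u|lborel. k u * (G (b - u) - G (a - u)))) = (CLINT t|lborel. E t * \<gamma> t)"
      unfolding G_def k_def E_def \<gamma>_def
      using smoothed_increment_fourier [OF _ g idm \<tau> ab] by (simp add: sigma_finite_lborel)
    ultimately have "complex_of_real (2 * pi * ((LINT u|lborel. k u * (F (b - u) - F (a - u))) - (LINT u|lborel. k u * (G (b - u) - G (a - u)))))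
       = (CLINT t|lborel. E t * \<phi> t - E t * \<gamma> t)"
      using bdE [OF \<phi>b \<phi>m] bdE [OF \<gamma>b \<gamma>m] by (simp add: right_diff_distrib)
    also have "(LINT u|lborel. k u * (F (b - u) - F (a - u))) - (LINT u|lborel. k u * (G (b - u) - G (a - u)))
       = (LINT u|lborel. k u * \<Delta> (b - u)) - (LINT u|lborel. k u * \<Delta> (a - u))"
    proof -
      have d: "k u * (G (b - u) - G (a - u)) = k u * (F (b - u) - F (a - u)) - (k u * \<Delta> (b - u) - k u * \<Delta> (a - u))" for u
        by (simp add: \<Delta>_def algebra_simps)
      show ?thesis unfolding d using ikF ik\<Delta> by simp
    qed
    finally have "cmod (complex_of_real (2 * pi * ((LINT u|lborel. k u * \<Delta> (b - u)) - (LINT u|lborel. k u * \<Delta> (a - u)))))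
       = cmod (CLINT t|lborel. E t * (\<phi> t - \<gamma> t))" by (simp add: right_diff_distrib)
    also have "\<dots> \<le> (LINT t|lborel. 2 * H t)"
    proof (rule order_trans [OF integral_norm_bound], rule integral_mono_AE)
      show "integrable lborel (\<lambda>t. norm (E t * (\<phi> t - \<gamma> t)))"
        using bdE [OF \<phi>b \<phi>m] bdE [OF \<gamma>b \<gamma>m] by (simp add: right_diff_distrib)
      show "AE t in lborel. norm (E t * (\<phi> t - \<gamma> t)) \<le> 2 * H t"
        using AE_lborel_singleton [of 0] by eventually_elim (rule bnd)
    qed (use H in simp)
    finally have "\<bar>2 * pi * ((LINT u|lborel. k u * \<Delta> (b - u)) - (LINT u|lborel. k u * \<Delta> (a - u)))\<bar> \<le> 2 * (LINT t|lborel. H t)"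
      by (simp only: norm_of_real integral_mult_right_zero)
    then have "2 * pi * \<bar>(LINT u|lborel. k u * \<Delta> (b - u)) - (LINT u|lborel. k u * \<Delta> (a - u))\<bar> \<le> 2 * (LINT t|lborel. H t)"
      unfolding abs_mult by simp
    then show ?thesis by (simp add: field_simps)
  qed
  have lim: "((\<lambda>a. LINT u|lborel. k u * \<Delta> (a - u)) \<longlongrightarrow> 0) at_bot"
  proof (rule convolution_at_bot [OF k(2)])
    have "((\<lambda>x. \<Delta> x) \<longlongrightarrow> 0 - 0) at_bot"
      unfolding \<Delta>_def F_def G_def
      by (intro tendsto_diff weighted_cdf_at_bot [OF _ Y] weighted_cdf_at_bot [OF g idm])
        (auto simp: sets_lborel)
    then show "(\<Delta> \<longlongrightarrow> 0) at_bot" by simp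
    show "\<bar>\<Delta> x\<bar> \<le> B0" for x using bdd by (simp add: \<Delta>_def)
  qed measurable
  \<comment> \<open>Letting \<open>a\<close> tend to minus infinity removes the second term, because
    the smoothed difference vanishes there.\<close>
  have sm: "\<bar>LINT u|lborel. k u * \<Delta> (b - u)\<bar> \<le> (LINT t|lborel. H t) / pi" for b
  proof (rule tendsto_upperbound)
    show "((\<lambda>a. \<bar>(LINT u|lborel. k u * \<Delta> (b - u)) - (LINT u|lborel. k u * \<Delta> (a - u))\<bar>) \<longlongrightarrow>
       \<bar>LINT u|lborel. k u * \<Delta> (b - u)\<bar>) at_bot"
      using tendsto_rabs [OF tendsto_diff [OF tendsto_const lim]] by simp
    show "\<forall>\<^sub>F a in at_bot. \<bar>(LINT u|lborel. k u * \<Delta> (b - u)) - (LINT u|lborel. k u * \<Delta> (a - u))\<bar> \<le> (LINT t|lborel. H t) / pi"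
      using eventually_le_at_bot [of b] by eventually_elim (rule incr)
  qed simp
  have "\<bar>F x - G x\<bar> \<le> 2 * ((LINT t|lborel. H t) / pi) + 8 * m * \<tau>"
    by (rule smoothing_sup_bound [OF Fmono G_lip bdd \<tau>]) (use sm in \<open>simp add: k_def \<Delta>_def\<close>)
  also have "2 * ((LINT t|lborel. H t) / pi) \<le> (LINT t|lborel. H t)"
  proof -
    have "0 \<le> (LINT t|lborel. H t) / pi" using sm [of 0] by linarith
    then have "0 \<le> (LINT t|lborel. H t)" using pi_gt_zero by (auto simp: zero_le_divide_iff)
    then have "2 * (LINT t|lborel. H t) \<le> pi * (LINT t|lborel. H t)" using pi_ge_two by (intro mult_right_mono) auto
    then show ?thesis by (simp add: field_simps)
  qed
  finally show ?thesis unfolding F_eq G_def by simp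
qed

section \<open>Taylor polynomials with Peano remainder\<close>

lemma poly_antiderivative:
  fixes p :: "complex poly"
  obtains P where "pderiv P = p" "poly P 0 = c"
proof
  define P where "P = pCons c (\<Sum>i\<le>degree p. monom (coeff p i / of_nat (Suc i)) i)"
  have "coeff (\<Sum>i\<le>degree p. monom (coeff p i / of_nat (Suc i)) i) n = coeff p n / of_nat (Suc n)" for n
    by (cases "n \<le> degree p") (simp_all add: coeff_sum coeff_monom coeff_eq_0 not_le)
  then show "pderiv P = p" by (intro poly_eqI) (simp add: P_def coeff_pderiv del: of_nat_Suc)
  show "poly P 0 = c" by (simp add: P_def)
qed

text \<open>Induction by integrating the polynomial of \<open>f'\<close> and applying the mean value
  inequality. The remainder is of Peano type, small compared with the n-th power, with just
  \<open>n\<close> derivatives available; the o-term of the final expansion rests on this.\<close>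

lemma taylor_peano:
  fixes f :: "real \<Rightarrow> complex"
  assumes "\<delta> > 0" "Ck_on n {-\<delta>..\<delta>} f"
  shows "\<exists>p. poly p 0 = f 0 \<and>
    (\<forall>\<epsilon>>0. \<exists>d>0. d \<le> \<delta> \<and> (\<forall>s. \<bar>s\<bar> \<le> d \<longrightarrow> cmod (f s - poly p (of_real s)) \<le> \<epsilon> * \<bar>s\<bar> ^ n))"
  using assms(2)
proof (induction n arbitrary: f)
  case 0
  show ?case
  proof (intro exI [of _ "[:f 0:]"] conjI allI impI)
    fix \<epsilon> :: real assume \<epsilon>: "\<epsilon> > 0"
    have "continuous_on {-\<delta>..\<delta>} f" using 0 by (simp add: Ck_on_0)
    then obtain d where d: "d > 0" "\<And>s. s \<in> {-\<delta>..\<delta>} \<Longrightarrow> dist s 0 < d \<Longrightarrow> dist (f s) (f 0) < \<epsilon>"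
      using \<epsilon> assms(1) unfolding continuous_on_iff by (metis atLeastAtMost_iff less_eq_real_def neg_le_0_iff_le)
    show "\<exists>d>0. d \<le> \<delta> \<and> (\<forall>s. \<bar>s\<bar> \<le> d \<longrightarrow> cmod (f s - poly [:f 0:] (of_real s)) \<le> \<epsilon> * \<bar>s\<bar> ^ 0)"
    proof (intro exI [of _ "min \<delta> (d/2)"] conjI allI impI)
      fix s assume s: "\<bar>s\<bar> \<le> min \<delta> (d/2)"
      then have "s \<in> {-\<delta>..\<delta>}" "dist s 0 < d" using d(1) by (auto simp: abs_le_iff)
      from d(2) [OF this] show "cmod (f s - poly [:f 0:] (of_real s)) \<le> \<epsilon> * \<bar>s\<bar> ^ 0"
        by (simp add: dist_norm)
    qed (use d assms(1) in auto)
  qed simp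
next
  case (Suc n)
  then obtain f' where f': "\<And>t. t \<in> {-\<delta>..\<delta>} \<Longrightarrow> (f has_vector_derivative f' t) (at t within {-\<delta>..\<delta>})"
    "Ck_on n {-\<delta>..\<delta>} f'" unfolding Ck_on_Suc by blast
  obtain p' where p': "\<And>\<epsilon>. \<epsilon> > 0 \<Longrightarrow> \<exists>d>0. d \<le> \<delta> \<and> (\<forall>s. \<bar>s\<bar> \<le> d \<longrightarrow> cmod (f' s - poly p' (of_real s)) \<le> \<epsilon> * \<bar>s\<bar> ^ n)"
    using Suc.IH [OF f'(2)] by blast
  obtain p where p: "pderiv p = p'" "poly p 0 = f 0" using poly_antiderivative by blast
  show ?case
  proof (intro exI [of _ p] conjI allI impI p)
    fix \<epsilon> :: real assume \<epsilon>: "\<epsilon> > 0"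
    obtain d where d: "d > 0" "d \<le> \<delta>" "\<And>s. \<bar>s\<bar> \<le> d \<Longrightarrow> cmod (f' s - poly p' (of_real s)) \<le> \<epsilon> * \<bar>s\<bar> ^ n"
      using p' [OF \<epsilon>] by blast
    show "\<exists>d>0. d \<le> \<delta> \<and> (\<forall>s. \<bar>s\<bar> \<le> d \<longrightarrow> cmod (f s - poly p (of_real s)) \<le> \<epsilon> * \<bar>s\<bar> ^ Suc n)"
    proof (intro exI [of _ d] conjI allI impI d)
      fix s assume s: "\<bar>s\<bar> \<le> d"
      \<comment> \<open>A symmetric interval treats both signs of \<open>s\<close> at once.\<close>
      define S where "S = {- \<bar>s\<bar>..\<bar>s\<bar>}"
      define g where "g t = f t - poly p (of_real t)" for t
      have "(g has_vector_derivative (f' t - poly p' (of_real t))) (at t within S)" if t: "t \<in> S" for t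
        unfolding g_def
      proof (rule has_vector_derivative_diff)
        show "(f has_vector_derivative f' t) (at t within S)"
          by (rule has_vector_derivative_within_subset [OF f'(1)]) (use t s d in \<open>auto simp: S_def\<close>)
        have "(poly p has_field_derivative poly p' (of_real t)) (at (of_real t))"
          using poly_DERIV [of p "of_real t"] p by simp
        then show "((\<lambda>t. poly p (of_real t)) has_vector_derivative poly p' (of_real t)) (at t within S)"
          by (rule has_vector_derivative_real_field)
      qed
      moreover have "onorm (\<lambda>h. h *\<^sub>R (f' t - poly p' (of_real t))) \<le> \<epsilon> * \<bar>s\<bar> ^ n" if t: "t \<in> S" for t
      proof (rule onorm_le)
        fix h :: real
        have "cmod (f' t - poly p' (of_real t)) \<le> \<epsilon> * \<bar>t\<bar> ^ n" using d(3) t s by (auto simp: S_def)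
        also have "\<dots> \<le> \<epsilon> * \<bar>s\<bar> ^ n" using \<epsilon> t by (intro mult_left_mono power_mono) (auto simp: S_def)
        finally show "norm (h *\<^sub>R (f' t - poly p' (of_real t))) \<le> \<epsilon> * \<bar>s\<bar> ^ n * norm h"
          by (simp add: mult.commute mult_left_mono)
      qed
      ultimately have "norm (g s - g 0) \<le> (\<epsilon> * \<bar>s\<bar> ^ n) * norm (s - 0)"
        unfolding has_vector_derivative_def
        by (intro differentiable_bound [of S g "\<lambda>t h. h *\<^sub>R (f' t - poly p' (of_real t))"])
          (auto simp: S_def)
      then show "cmod (f s - poly p (of_real s)) \<le> \<epsilon> * \<bar>s\<bar> ^ Suc n"
        by (simp add: g_def p mult_ac)
    qed
  qed
qed

lemma Ck_on_inverse_complex: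
  fixes f :: "real \<Rightarrow> complex"
  assumes "Ck_on k S f" "\<And>t. t \<in> S \<Longrightarrow> f t \<noteq> 0"
  shows "Ck_on k S (\<lambda>t. inverse (f t))"
  by (rule Ck_on_is_inverse [OF _ assms(1)]) (use assms(2) in \<open>simp add: is_inverse_def\<close>)

lemma Ck_on_Ln:
  fixes f :: "real \<Rightarrow> complex"
  assumes f: "Ck_on (Suc k) S f" and S: "\<And>t. t \<in> S \<Longrightarrow> f t \<notin> \<real>\<^sub>\<le>\<^sub>0"
  shows "Ck_on (Suc k) S (\<lambda>t. Ln (f t))"
proof -
  obtain f' where f': "\<And>t. t \<in> S \<Longrightarrow> (f has_vector_derivative f' t) (at t within S)" "Ck_on k S f'"
    using f unfolding Ck_on_Suc by blast
  have "f t \<noteq> 0" if "t \<in> S" for t using S [OF that] by auto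
  then have "Ck_on k S (\<lambda>t. f' t * inverse (f t))"
    using f by (intro Ck_on_mult f' Ck_on_inverse_complex) (auto intro: Ck_on_mono)
  moreover have "((\<lambda>t. Ln (f t)) has_vector_derivative (f' t * inverse (f t))) (at t within S)" if t: "t \<in> S" for t
    using field_vector_diff_chain_within [OF f'(1) [OF t] has_field_derivative_at_within [OF has_field_derivative_Ln [OF S [OF t]]]]
    by (simp add: o_def)
  ultimately show ?thesis unfolding Ck_on_Suc
    by (intro exI [of _ "\<lambda>t. f' t * inverse (f t)"] conjI ballI)
qed

section \<open>Polynomial bounds\<close>

lemma poly_bound_unit:
  fixes p :: "complex poly"
  obtains C where "C \<ge> 0" "\<And>s. \<bar>s\<bar> \<le> 1 \<Longrightarrow> cmod (poly p (of_real s)) \<le> C"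
proof
  fix s :: real assume s: "\<bar>s\<bar> \<le> 1"
  have "cmod (poly p (of_real s)) \<le> (\<Sum>i\<le>degree p. cmod (coeff p i * of_real s ^ i))"
    unfolding poly_altdef by (rule norm_sum)
  also have "\<dots> \<le> (\<Sum>i\<le>degree p. cmod (coeff p i))"
  proof (rule sum_mono)
    fix i
    have "\<bar>s\<bar> ^ i \<le> 1" using s by (simp add: power_le_one)
    then show "cmod (coeff p i * of_real s ^ i) \<le> cmod (coeff p i)"
      by (simp add: norm_mult norm_power mult_left_le)
  qed
  finally show "cmod (poly p (of_real s)) \<le> (\<Sum>i\<le>degree p. cmod (coeff p i))" .
qed (auto intro: sum_nonneg)

lemma poly_eq_truncation_plus_shift:
  fixes p :: "'a::comm_ring_1 poly"
  shows "poly p x = (\<Sum>j<n. coeff p j * x ^ j) + x ^ n * poly (poly_shift n p) x"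
proof (induction n)
  case (Suc n)
  have "poly_shift n p = pCons (coeff p n) (poly_shift (Suc n) p)"
    by (rule poly_eqI) (simp add: coeff_poly_shift coeff_pCons split: nat.split)
  then have "poly (poly_shift n p) x = coeff p n + x * poly (poly_shift (Suc n) p) x" by simp
  then show ?case unfolding Suc by (simp add: algebra_simps)
qed simp

lemma poly_truncation_bound:
  fixes p :: "complex poly"
  obtains C where "C \<ge> 0" "\<And>s. \<bar>s\<bar> \<le> 1 \<Longrightarrow>
    cmod (poly p (of_real s) - (\<Sum>j\<le>r. coeff p j * of_real s ^ j)) \<le> C * \<bar>s\<bar> ^ Suc r"
proof -
  obtain C where C: "C \<ge> 0" "\<And>s. \<bar>s\<bar> \<le> 1 \<Longrightarrow> cmod (poly (poly_shift (Suc r) p) (of_real s)) \<le> C"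
    using poly_bound_unit by blast
  show ?thesis
  proof
    fix s :: real assume s: "\<bar>s\<bar> \<le> 1"
    have "poly p (of_real s) - (\<Sum>j\<le>r. coeff p j * of_real s ^ j)
      = of_real s ^ Suc r * poly (poly_shift (Suc r) p) (of_real s)"
      using poly_eq_truncation_plus_shift [of p "of_real s" "Suc r"] by (simp add: lessThan_Suc_atMost)
    then show "cmod (poly p (of_real s) - (\<Sum>j\<le>r. coeff p j * of_real s ^ j)) \<le> C * \<bar>s\<bar> ^ Suc r"
      using mult_right_mono [OF C(2) [OF s], of "\<bar>s\<bar> ^ Suc r"] by (simp add: norm_mult norm_power mult.commute)
  qed (rule C)
qed

text \<open>Trades a power for an arbitrarily small share of a Gaussian exponent; this is how
  polynomial factors are disposed of throughout.\<close>

lemma power_le_exp_square: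
  fixes c :: real assumes c: "c > 0"
  obtains C where "C \<ge> 0" "\<And>x. \<bar>x\<bar> ^ k \<le> C * exp (c * x\<^sup>2)"
proof
  fix x :: real
  define y where "y = c * x\<^sup>2"
  have y: "y \<ge> 0" using c by (simp add: y_def)
  have "y ^ k / fact k \<le> exp y"
  proof -
    have "(\<Sum>n\<in>{k}. y ^ n /\<^sub>R fact n) \<le> (\<Sum>n. y ^ n /\<^sub>R fact n)"
      by (rule sum_le_suminf [OF summable_exp_generic]) (use y in auto)
    then show ?thesis by (simp add: exp_def divide_inverse mult.commute)
  qed
  then have "(x\<^sup>2) ^ k \<le> fact k / c ^ k * exp y"
    using c unfolding y_def power_mult_distrib by (simp add: field_simps)
  moreover have "\<bar>x\<bar> ^ k \<le> 1 + (x\<^sup>2) ^ k"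
  proof (cases "\<bar>x\<bar> \<le> 1")
    case True
    then have "\<bar>x\<bar> ^ k \<le> 1" by (simp add: power_le_one)
    moreover have "0 \<le> (x\<^sup>2) ^ k" by simp
    ultimately show ?thesis by linarith
  next
    case False
    then have "\<bar>x\<bar> ^ k \<le> \<bar>x\<bar> ^ (2 * k)" by (intro power_increasing) auto
    also have "\<dots> = (x\<^sup>2) ^ k" unfolding power_mult power2_abs ..
    finally show ?thesis by simp
  qed
  moreover have "1 \<le> exp y" using y by simp
  ultimately show "\<bar>x\<bar> ^ k \<le> (1 + fact k / c ^ k) * exp (c * x\<^sup>2)"
    unfolding y_def [symmetric] distrib_right by linarith
qed (use c in simp)

lemma poly_le_exp_square:
  fixes p :: "real poly" assumes c: "c > 0"
  obtains C where "C \<ge> 0" "\<And>x. \<bar>poly p x\<bar> \<le> C * exp (c * x\<^sup>2)"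
proof -
  have "\<exists>C\<ge>0. \<forall>x. \<bar>x\<bar> ^ k \<le> C * exp (c * x\<^sup>2)" for k using power_le_exp_square [OF c] by metis
  then obtain C where C: "\<And>k. C k \<ge> 0" "\<And>k x. \<bar>x\<bar> ^ k \<le> C k * exp (c * x\<^sup>2)" by metis
  show ?thesis
  proof
    fix x
    have "\<bar>poly p x\<bar> \<le> (\<Sum>i\<le>degree p. \<bar>coeff p i * x ^ i\<bar>)" unfolding poly_altdef by (rule sum_abs)
    also have "\<dots> \<le> (\<Sum>i\<le>degree p. \<bar>coeff p i\<bar> * (C i * exp (c * x\<^sup>2)))"
      by (intro sum_mono) (simp add: abs_mult power_abs mult_left_mono C)
    also have "\<dots> = (\<Sum>i\<le>degree p. \<bar>coeff p i\<bar> * C i) * exp (c * x\<^sup>2)"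
      by (simp add: sum_distrib_right mult.assoc)
    finally show "\<bar>poly p x\<bar> \<le> (\<Sum>i\<le>degree p. \<bar>coeff p i\<bar> * C i) * exp (c * x\<^sup>2)" .
  qed (use C in \<open>auto intro!: sum_nonneg\<close>)
qed

section \<open>Expanding the exponential\<close>

text \<open>In the expansion of \<open>exp (t^2 * s * q s) * b s\<close> by powers of the exponent,
  this is the factor of \<open>t ^ (2 * m)\<close>. It is a polynomial in \<open>s\<close> that
  starts at order \<open>m\<close>.\<close>

definition edge_poly :: "complex poly \<Rightarrow> complex poly \<Rightarrow> nat \<Rightarrow> complex poly" where
  "edge_poly q b m = smult (1 / fact m) (monom 1 m * q ^ m * b)"

lemma coeff_edge_poly_less: "j < m \<Longrightarrow> coeff (edge_poly q b m) j = 0"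
proof -
  assume j: "j < m"
  have "monom 1 m dvd monom 1 m * (q ^ m * b)" by simp
  then have "coeff (monom 1 m * (q ^ m * b)) j = 0" using j by (subst (asm) monom_1_dvd_iff') blast
  then show ?thesis by (simp add: edge_poly_def mult.assoc)
qed

lemma poly_edge_poly: "poly (edge_poly q b m) s = (s * poly q s) ^ m / fact m * poly b s"
  by (simp add: edge_poly_def poly_monom power_mult_distrib)

text \<open>The case of interest is \<open>s = t / sqrt N\<close>, where
  \<open>N * s^2 = t^2\<close> eliminates \<open>N\<close>: the cubic and higher part of the
  exponent becomes \<open>t^2 * s * q s\<close>, and \<open>y\<close> is \<open>N\<close> times the
  Taylor remainder of the logarithm of the eigenvalue. The constant \<open>c\<close> is free, so
  that the growth \<open>exp (2 * c * t^2)\<close> can be beaten later by the Gaussian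
  factor.\<close>

lemma edgeworth_local:
  fixes q b :: "complex poly" and c :: real
  assumes c: "c > 0" and r: "r \<ge> 1"
  obtains d0 C where "d0 > 0" "d0 \<le> 1" "C \<ge> 0"
    "\<And>\<epsilon> s t y a. 0 \<le> \<epsilon> \<Longrightarrow> \<epsilon> \<le> 1 \<Longrightarrow> \<bar>s\<bar> \<le> d0 \<Longrightarrow> cmod y \<le> \<epsilon> * t\<^sup>2 * \<bar>s\<bar> ^ r \<Longrightarrow>
      cmod (a - poly b (of_real s)) \<le> \<epsilon> * \<bar>s\<bar> ^ r \<Longrightarrow>
      cmod (exp (of_real (t\<^sup>2) * (of_real s * poly q (of_real s)) + y) * a
        - (\<Sum>m\<le>r. of_real (t\<^sup>2) ^ m * (\<Sum>j\<le>r. coeff (edge_poly q b m) j * of_real s ^ j)))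
      \<le> C * exp (2 * c * t\<^sup>2) * (\<epsilon> * \<bar>s\<bar> ^ r + \<bar>s\<bar> ^ Suc r)"
proof -
  obtain Cq where Cq: "Cq \<ge> 0" "\<And>s. \<bar>s\<bar> \<le> 1 \<Longrightarrow> cmod (poly q (of_real s)) \<le> Cq"
    using poly_bound_unit by blast
  obtain Cb where Cb: "Cb \<ge> 0" "\<And>s. \<bar>s\<bar> \<le> 1 \<Longrightarrow> cmod (poly b (of_real s)) \<le> Cb"
    using poly_bound_unit by blast
  have "\<exists>C\<ge>0. \<forall>s. \<bar>s\<bar> \<le> 1 \<longrightarrow> cmod (poly (edge_poly q b m) (of_real s) - (\<Sum>j\<le>r. coeff (edge_poly q b m) j * of_real s ^ j))
      \<le> C * \<bar>s\<bar> ^ Suc r" for m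
    using poly_truncation_bound [of "edge_poly q b m" r] by metis
  then obtain Cm where Cm: "\<And>m. Cm m \<ge> 0" "\<And>m s. \<bar>s\<bar> \<le> 1 \<Longrightarrow>
      cmod (poly (edge_poly q b m) (of_real s) - (\<Sum>j\<le>r. coeff (edge_poly q b m) j * of_real s ^ j)) \<le> Cm m * \<bar>s\<bar> ^ Suc r"
    by metis
  have "\<exists>K\<ge>0. \<forall>x. \<bar>x\<bar> ^ k \<le> K * exp (c * x\<^sup>2)" for k using power_le_exp_square [OF c] by metis
  then obtain K where K: "\<And>k. K k \<ge> 0" "\<And>k x. \<bar>x\<bar> ^ k \<le> K k * exp (c * x\<^sup>2)" by metis
  have K2: "(x\<^sup>2) ^ k \<le> K (2 * k) * exp (c * x\<^sup>2)" for k and x :: real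
    using K(2) [where k = "2 * k" and x = x] by (simp add: power_mult)
  \<comment> \<open>Makes the two exponents together at most \<open>c * t\<^sup>2\<close>: the
    polynomial contributes \<open>\<bar>s\<bar> * Cq\<close> and the remainder at most
    \<open>\<bar>s\<bar>\<close>, each times \<open>t\<^sup>2\<close>.\<close>
  define d0 where "d0 = min 1 (c / (Cq + 1))"
  define C where "C = K 2 * (Cb + 1) + 1 + K (2 * Suc r) * Cq ^ Suc r * Cb + (\<Sum>m\<le>r. K (2 * m) * Cm m)"
  show ?thesis
  proof (rule that [of d0 C])
    show "d0 > 0" "d0 \<le> 1" using c Cq by (auto simp: d0_def)
    have S0: "0 \<le> (\<Sum>m\<le>r. K (2 * m) * Cm m)" using K Cm by (intro sum_nonneg) auto
    show C0: "C \<ge> 0" unfolding C_def using K Cq Cb S0 by (intro add_nonneg_nonneg) auto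
    fix \<epsilon> s t :: real and y a :: complex
    assume \<epsilon>: "0 \<le> \<epsilon>" "\<epsilon> \<le> 1" and s: "\<bar>s\<bar> \<le> d0" and y: "cmod y \<le> \<epsilon> * t\<^sup>2 * \<bar>s\<bar> ^ r"
      and a: "cmod (a - poly b (of_real s)) \<le> \<epsilon> * \<bar>s\<bar> ^ r"
    have s1: "\<bar>s\<bar> \<le> 1" using s by (simp add: d0_def)
    define x where "x = of_real (t\<^sup>2) * (of_real s * poly q (of_real s))"
    define E where "E = exp (c * t\<^sup>2)"
    have E: "E \<ge> 1" "exp (2 * c * t\<^sup>2) = E * E" using c by (auto simp: E_def exp_add [symmetric])
    have sr: "\<bar>s\<bar> ^ r \<le> \<bar>s\<bar>" using s1 r power_decreasing [of 1 r "\<bar>s\<bar>"] by simp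
    have nx: "cmod x \<le> t\<^sup>2 * \<bar>s\<bar> * Cq"
      unfolding x_def norm_mult norm_of_real using Cq(2) [OF s1] by (simp add: mult_left_mono mult.assoc)
    have "\<epsilon> * (t\<^sup>2 * \<bar>s\<bar> ^ r) \<le> 1 * (t\<^sup>2 * \<bar>s\<bar>)"
      using \<epsilon> sr by (intro mult_mono) auto
    then have ny: "cmod y \<le> t\<^sup>2 * \<bar>s\<bar>" using y by (simp add: mult.assoc)
    have "\<bar>s\<bar> * (Cq + 1) \<le> c / (Cq + 1) * (Cq + 1)"
      using s Cq by (intro mult_right_mono) (auto simp: d0_def)
    then have "\<bar>s\<bar> * (Cq + 1) \<le> c" using Cq by simp
    then have "t\<^sup>2 * (\<bar>s\<bar> * (Cq + 1)) \<le> t\<^sup>2 * c" by (intro mult_left_mono) auto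
    then have nxy: "cmod x + cmod y \<le> c * t\<^sup>2" using nx ny by (simp add: algebra_simps)
    have "cmod x \<le> c * t\<^sup>2" using nxy norm_ge_zero [of y] by linarith
    then have ex: "exp (cmod x) \<le> E" by (simp add: E_def)
    have exy: "exp (cmod x) * exp (cmod y) \<le> E" unfolding E_def exp_add [symmetric] using nxy by simp
    have ba: "cmod a \<le> Cb + 1"
    proof -
      have "\<epsilon> * \<bar>s\<bar> ^ r \<le> 1 * 1" using \<epsilon> s1 by (intro mult_mono) (auto simp: power_le_one)
      then show ?thesis using a Cb(2) [OF s1] norm_triangle_ineq [of "a - poly b (of_real s)" "poly b (of_real s)"] by simp
    qed
    \<comment> \<open>Four sources of error: the remainder in the exponent (\<open>T1\<close>), the
      remainder of the prefactor (\<open>T2\<close>), the truncated exponential series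
      (\<open>T3\<close>) and the truncated polynomials in \<open>s\<close> (\<open>T4\<close>). The
      first two are small through \<epsilon>, the last two through an extra power of
      \<open>s\<close>. The bound \<open>E * E\<close> leaves one factor for the exponential and one
      for powers of \<open>t\<close>.\<close>
    have T1: "cmod ((exp (x + y) - exp x) * a) \<le> K 2 * (Cb + 1) * (E * E) * (\<epsilon> * \<bar>s\<bar> ^ r)"
    proof -
      have "cmod (exp y - 1) \<le> exp (cmod y) * cmod y" using Taylor_exp_field [of y 0] by simp
      then have "cmod (exp x * (exp y - 1)) \<le> exp (cmod x) * (exp (cmod y) * cmod y)"
        unfolding norm_mult by (intro mult_mono norm_exp) auto
      then have 1: "cmod (exp (x + y) - exp x) \<le> (exp (cmod x) * exp (cmod y)) * cmod y"
        by (simp add: exp_add right_diff_distrib mult.assoc)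
      also have "\<dots> \<le> E * (\<epsilon> * t\<^sup>2 * \<bar>s\<bar> ^ r)" using E by (intro mult_mono exy y) auto
      also have "\<dots> = E * (t\<^sup>2 * (\<epsilon> * \<bar>s\<bar> ^ r))" by simp
      also have "\<dots> \<le> E * ((K 2 * E) * (\<epsilon> * \<bar>s\<bar> ^ r))"
        using K2 [of t 1] E \<epsilon> by (intro mult_left_mono mult_right_mono) (auto simp: E_def)
      finally have n1: "cmod (exp (x + y) - exp x) \<le> E * ((K 2 * E) * (\<epsilon> * \<bar>s\<bar> ^ r))" .
      have "cmod ((exp (x + y) - exp x) * a) \<le> (E * ((K 2 * E) * (\<epsilon> * \<bar>s\<bar> ^ r))) * (Cb + 1)"
        unfolding norm_mult by (rule mult_mono [OF n1 ba order_trans [OF norm_ge_zero n1] norm_ge_zero])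
      then show ?thesis by (simp add: mult_ac)
    qed
    have T2: "cmod (exp x * (a - poly b (of_real s))) \<le> 1 * (E * E) * (\<epsilon> * \<bar>s\<bar> ^ r)"
    proof -
      have "cmod (exp x * (a - poly b (of_real s))) \<le> E * (\<epsilon> * \<bar>s\<bar> ^ r)"
        unfolding norm_mult using ex E by (intro mult_mono a order_trans [OF norm_exp]) auto
      also have "\<dots> \<le> (E * E) * (\<epsilon> * \<bar>s\<bar> ^ r)" using E \<epsilon> by (intro mult_right_mono) (auto simp: mult_le_cancel_left1)
      finally show ?thesis by simp
    qed
    have T3: "cmod ((exp x - (\<Sum>m\<le>r. x ^ m / fact m)) * poly b (of_real s)) \<le> K (2 * Suc r) * Cq ^ Suc r * Cb * (E * E) * \<bar>s\<bar> ^ Suc r"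
    proof -
      have "cmod (exp x - (\<Sum>m\<le>r. x ^ m / fact m)) \<le> exp (cmod x) * cmod x ^ Suc r / fact r"
        by (rule Taylor_exp_field)
      also have "\<dots> \<le> exp (cmod x) * cmod x ^ Suc r"
        using divide_left_mono [of 1 "fact r" "exp (cmod x) * cmod x ^ Suc r"] by (simp add: fact_ge_1)
      also have "\<dots> \<le> E * (t\<^sup>2 * \<bar>s\<bar> * Cq) ^ Suc r"
        using ex E by (intro mult_mono power_mono nx) auto
      also have "\<dots> = E * ((t\<^sup>2) ^ Suc r * (\<bar>s\<bar> ^ Suc r * Cq ^ Suc r))"
        by (simp only: power_mult_distrib mult.assoc)
      also have "\<dots> \<le> E * ((K (2 * Suc r) * E) * (\<bar>s\<bar> ^ Suc r * Cq ^ Suc r))"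
        using K2 [of t "Suc r"] E Cq by (intro mult_left_mono mult_right_mono) (auto simp: E_def)
      finally have n1: "cmod (exp x - (\<Sum>m\<le>r. x ^ m / fact m))
          \<le> E * ((K (2 * Suc r) * E) * (\<bar>s\<bar> ^ Suc r * Cq ^ Suc r))" .
      have "cmod ((exp x - (\<Sum>m\<le>r. x ^ m / fact m)) * poly b (of_real s))
          \<le> (E * ((K (2 * Suc r) * E) * (\<bar>s\<bar> ^ Suc r * Cq ^ Suc r))) * Cb"
        unfolding norm_mult by (rule mult_mono [OF n1 Cb(2) [OF s1] order_trans [OF norm_ge_zero n1] norm_ge_zero])
      then show ?thesis by (simp add: mult_ac)
    qed
    have xm: "x ^ m / fact m * poly b (of_real s) = of_real (t\<^sup>2) ^ m * poly (edge_poly q b m) (of_real s)" for m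
      unfolding poly_edge_poly x_def by (simp add: power_mult_distrib)
    have T4: "cmod ((\<Sum>m\<le>r. x ^ m / fact m) * poly b (of_real s)
        - (\<Sum>m\<le>r. of_real (t\<^sup>2) ^ m * (\<Sum>j\<le>r. coeff (edge_poly q b m) j * of_real s ^ j)))
      \<le> (\<Sum>m\<le>r. K (2 * m) * Cm m) * (E * E) * \<bar>s\<bar> ^ Suc r"
    proof -
      have "(\<Sum>m\<le>r. x ^ m / fact m) * poly b (of_real s)
        - (\<Sum>m\<le>r. of_real (t\<^sup>2) ^ m * (\<Sum>j\<le>r. coeff (edge_poly q b m) j * of_real s ^ j))
        = (\<Sum>m\<le>r. of_real (t\<^sup>2) ^ m * (poly (edge_poly q b m) (of_real s) - (\<Sum>j\<le>r. coeff (edge_poly q b m) j * of_real s ^ j)))"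
        by (simp only: sum_distrib_right xm right_diff_distrib sum_subtractf)
      also have "cmod \<dots> \<le> (\<Sum>m\<le>r. cmod (of_real (t\<^sup>2) ^ m * (poly (edge_poly q b m) (of_real s) - (\<Sum>j\<le>r. coeff (edge_poly q b m) j * of_real s ^ j))))"
        by (rule norm_sum)
      also have "\<dots> \<le> (\<Sum>m\<le>r. (K (2 * m) * (E * E)) * (Cm m * \<bar>s\<bar> ^ Suc r))"
      proof (rule sum_mono)
        fix m
        have "(t\<^sup>2) ^ m \<le> K (2 * m) * E" using K2 [of t m] by (simp add: E_def)
        also have "\<dots> \<le> K (2 * m) * (E * E)" using K E by (intro mult_left_mono) (auto simp: mult_le_cancel_left1)
        finally have "cmod (of_real (t\<^sup>2) ^ m) \<le> K (2 * m) * (E * E)" by (simp add: norm_power)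
        then show "cmod (of_real (t\<^sup>2) ^ m * (poly (edge_poly q b m) (of_real s) - (\<Sum>j\<le>r. coeff (edge_poly q b m) j * of_real s ^ j)))
          \<le> (K (2 * m) * (E * E)) * (Cm m * \<bar>s\<bar> ^ Suc r)"
          unfolding norm_mult using K E by (intro mult_mono Cm(2) s1) auto
      qed
      also have "\<dots> = (\<Sum>m\<le>r. K (2 * m) * Cm m) * (E * E) * \<bar>s\<bar> ^ Suc r"
        by (simp add: sum_distrib_right sum_distrib_left mult_ac)
      finally show ?thesis .
    qed
    have dec: "exp (x + y) * a - (\<Sum>m\<le>r. of_real (t\<^sup>2) ^ m * (\<Sum>j\<le>r. coeff (edge_poly q b m) j * of_real s ^ j))
      = (exp (x + y) - exp x) * a + exp x * (a - poly b (of_real s)) + (exp x - (\<Sum>m\<le>r. x ^ m / fact m)) * poly b (of_real s)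
        + ((\<Sum>m\<le>r. x ^ m / fact m) * poly b (of_real s)
          - (\<Sum>m\<le>r. of_real (t\<^sup>2) ^ m * (\<Sum>j\<le>r. coeff (edge_poly q b m) j * of_real s ^ j)))"
      by (simp add: algebra_simps)
    have "cmod (exp (x + y) * a - (\<Sum>m\<le>r. of_real (t\<^sup>2) ^ m * (\<Sum>j\<le>r. coeff (edge_poly q b m) j * of_real s ^ j)))
      \<le> K 2 * (Cb + 1) * (E * E) * (\<epsilon> * \<bar>s\<bar> ^ r) + 1 * (E * E) * (\<epsilon> * \<bar>s\<bar> ^ r)
        + K (2 * Suc r) * Cq ^ Suc r * Cb * (E * E) * \<bar>s\<bar> ^ Suc r + (\<Sum>m\<le>r. K (2 * m) * Cm m) * (E * E) * \<bar>s\<bar> ^ Suc r"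
      unfolding dec by (intro norm_triangle_mono T1 T2 T3 T4)
    also have "\<dots> = (K 2 * (Cb + 1) + 1) * ((E * E) * (\<epsilon> * \<bar>s\<bar> ^ r))
       + (K (2 * Suc r) * Cq ^ Suc r * Cb + (\<Sum>m\<le>r. K (2 * m) * Cm m)) * ((E * E) * \<bar>s\<bar> ^ Suc r)"
      by (simp only: distrib_right mult.assoc add.assoc)
    also have "\<dots> \<le> C * ((E * E) * (\<epsilon> * \<bar>s\<bar> ^ r)) + C * ((E * E) * \<bar>s\<bar> ^ Suc r)"
      using K Cq Cb S0 E \<epsilon> by (intro add_mono mult_right_mono) (auto simp: C_def)
    also have "\<dots> = C * (E * E) * (\<epsilon> * \<bar>s\<bar> ^ r + \<bar>s\<bar> ^ Suc r)" by (simp only: distrib_left mult.assoc)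
    finally show "cmod (exp (of_real (t\<^sup>2) * (of_real s * poly q (of_real s)) + y) * a
        - (\<Sum>m\<le>r. of_real (t\<^sup>2) ^ m * (\<Sum>j\<le>r. coeff (edge_poly q b m) j * of_real s ^ j)))
      \<le> C * exp (2 * c * t\<^sup>2) * (\<epsilon> * \<bar>s\<bar> ^ r + \<bar>s\<bar> ^ Suc r)"
      unfolding E x_def .
  qed
qed

section \<open>Derivatives of the Gaussian density\<close>

text \<open>The polynomial factor in the k-th derivative of the normal density of variance
  \<open>v\<close>, that is, the Hermite polynomial in \<open>y / sqrt v\<close> times
  \<open>(-1)^k * v powr (-k/2)\<close>. Keeping the sign inside makes antiderivatives and Fourier
  transforms free of sign corrections.\<close>

fun hermite :: "real \<Rightarrow> nat \<Rightarrow> real poly" where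
  "hermite v 0 = 1"
| "hermite v (Suc k) = pderiv (hermite v k) - smult (1 / v) (pCons 0 (hermite v k))"

lemma gauss_n_eq_normal_density: "v > 0 \<Longrightarrow> gauss_n v = normal_density 0 (sqrt v)"
  by (simp add: gauss_n_def normal_density_def fun_eq_iff)

lemma gauss_n_pos: "v > 0 \<Longrightarrow> gauss_n v y > 0"
  by (simp add: gauss_n_def)

lemma gauss_n_measurable [measurable]: "gauss_n v \<in> borel_measurable borel"
  unfolding gauss_n_def [abs_def] by measurable

lemma borel_measurable_poly [measurable]: "poly (p :: real poly) \<in> borel_measurable borel"
  by (intro borel_measurable_continuous_onI continuous_intros)

lemma poly_gauss_bound:
  assumes v: "v > 0"
  obtains C where "C \<ge> 0" "\<And>y. \<bar>poly p y * gauss_n v y\<bar> \<le> C * exp (- (y\<^sup>2 / (4 * v)))"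
proof -
  obtain C where C: "C \<ge> 0" "\<And>x. \<bar>poly p x\<bar> \<le> C * exp (1 / (4 * v) * x\<^sup>2)"
    using poly_le_exp_square [of "1 / (4 * v)" p] v by auto
  show ?thesis
  proof
    fix y
    have "\<bar>poly p y * gauss_n v y\<bar> \<le> (C * exp (1 / (4 * v) * y\<^sup>2)) * gauss_n v y"
      using C(2) [of y] gauss_n_pos [OF v, of y] by (simp add: abs_mult mult_right_mono)
    also have "\<dots> = C / sqrt (2 * pi * v) * exp (- (y\<^sup>2 / (4 * v)))"
      using v by (simp add: gauss_n_def exp_add [symmetric] field_simps)
    finally show "\<bar>poly p y * gauss_n v y\<bar> \<le> C / sqrt (2 * pi * v) * exp (- (y\<^sup>2 / (4 * v)))" .
  qed (use C v in simp)
qed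

lemma integrable_poly_gauss:
  assumes v: "v > 0" shows "integrable lborel (\<lambda>y. poly p y * gauss_n v y)"
proof -
  obtain C where C: "C \<ge> 0" "\<And>y. \<bar>poly p y * gauss_n v y\<bar> \<le> C * exp (- (y\<^sup>2 / (4 * v)))"
    using poly_gauss_bound [OF v] by blast
  have "integrable lborel (\<lambda>y. C * exp (- (y\<^sup>2 / (4 * v))))"
    using integrable_gaussian [of "1 / (4 * v)"] v by simp
  then show ?thesis
    by (rule Bochner_Integration.integrable_bound) (use C in \<open>auto intro!: AE_I2\<close>)
qed

lemma poly_gauss_tendsto:
  assumes v: "v > 0"
  shows "((\<lambda>y. poly p y * gauss_n v y) \<longlongrightarrow> 0) at_top" "((\<lambda>y. poly p y * gauss_n v y) \<longlongrightarrow> 0) at_bot"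
proof -
  obtain C where C: "C \<ge> 0" "\<And>y. \<bar>poly p y * gauss_n v y\<bar> \<le> C * exp (- (y\<^sup>2 / (4 * v)))"
    using poly_gauss_bound [OF v] by blast
  have "((\<lambda>y. C * exp (- (y\<^sup>2 / (4 * v)))) \<longlongrightarrow> 0) at_top" using v by real_asymp
  then show "((\<lambda>y. poly p y * gauss_n v y) \<longlongrightarrow> 0) at_top"
    by (rule Lim_null_comparison [rotated]) (use C in auto)
  have "((\<lambda>y. C * exp (- (y\<^sup>2 / (4 * v)))) \<longlongrightarrow> 0) at_bot" using v by real_asymp
  then show "((\<lambda>y. poly p y * gauss_n v y) \<longlongrightarrow> 0) at_bot"
    by (rule Lim_null_comparison [rotated]) (use C in auto)
qed

lemma hermite_derivative:
  assumes v: "v > 0"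
  shows "((\<lambda>y. poly (hermite v k) y * gauss_n v y) has_real_derivative
    poly (hermite v (Suc k)) y * gauss_n v y) (at y)"
proof -
  have "(gauss_n v has_real_derivative - (y / v) * gauss_n v y) (at y)"
    unfolding gauss_n_def [abs_def] using v
    by (auto intro!: derivative_eq_intros simp: field_simps power2_eq_square)
  then show ?thesis
    using v by (auto intro!: derivative_eq_intros poly_DERIV simp: algebra_simps)
qed

lemma hermite_integral:
  assumes v: "v > 0"
  shows "(LINT y|lborel. poly (hermite v (Suc k)) y * gauss_n v y * indicator {..z} y)
    = poly (hermite v k) z * gauss_n v z"
proof -
  let ?F = "\<lambda>y. poly (hermite v k) y * gauss_n v y"
  let ?f = "\<lambda>y. poly (hermite v (Suc k)) y * gauss_n v y"
  have "(LBINT y=-\<infinity>..ereal z. ?f y) = ?F z - 0"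
  proof (rule interval_integral_FTC_integrable)
    show "(?F has_vector_derivative ?f x) (at x)" for x
      using hermite_derivative [OF v] by (simp only: has_real_derivative_iff_has_vector_derivative)
    show "isCont ?f x" for x unfolding gauss_n_def by (intro continuous_intros) (use v in auto)
    show "set_integrable lborel (einterval (- \<infinity>) (ereal z)) ?f"
      unfolding set_integrable_def
      by (rule integrable_mult_indicator) (simp_all add: integrable_poly_gauss [OF v] del: hermite.simps)
    show "((?F \<circ> real_of_ereal) \<longlongrightarrow> 0) (at_right (- \<infinity>))"
      using poly_gauss_tendsto(2) [OF v] by (simp add: ereal_tendsto_simps)
    have "isCont ?F z" using hermite_derivative [OF v] DERIV_isCont by blast
    then have "(?F \<longlongrightarrow> ?F z) (at_left z)" by (simp add: isCont_def filterlim_at_split)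
    then show "((?F \<circ> real_of_ereal) \<longlongrightarrow> ?F z) (at_left (ereal z))"
      by (simp add: ereal_tendsto_simps)
  qed simp
  also have "(LBINT y=-\<infinity>..ereal z. ?f y) = (LINT y|lborel. ?f y * indicator {..z} y)"
    unfolding interval_lebesgue_integral_def set_lebesgue_integral_def
    by (simp, rule integral_cong_AE)
      (use AE_lborel_singleton [of z] in \<open>auto simp: indicator_def einterval_def elim!: eventually_mono\<close>)
  finally show ?thesis by simp
qed

lemma gauss_N_eq:
  "gauss_N v z = (LINT y|lborel. gauss_n v y * indicator {..z} y)"
  unfolding gauss_N_def interval_lebesgue_integral_def set_lebesgue_integral_def
  by (simp, rule integral_cong_AE)
    (use AE_lborel_singleton [of z] in \<open>auto simp: indicator_def einterval_def elim!: eventually_mono\<close>)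

text \<open>Read as a function of \<open>y\<close>, the density is a multiple of the damping factor
  in \<open>gaussian_fourier\<close> with parameter \<open>sqrt (1 / v)\<close>, so the inversion
  formula used for smoothing gives this transform too.\<close>

lemma gauss_n_fourier:
  assumes v: "v > 0"
  shows "(CLINT y|lborel. of_real (gauss_n v y) * iexp (t * y)) = of_real (exp (- (v * t\<^sup>2) / 2))"
proof -
  have "1 / v > 0" using v by simp
  have eq: "gauss_n v y = 1 / sqrt (2 * pi * v) * exp (- ((sqrt (1 / v))\<^sup>2 * y\<^sup>2) / 2)" for y
    using v by (simp add: gauss_n_def)
  have "(CLINT y|lborel. of_real (gauss_n v y) * iexp (t * y))
     = (CLINT y|lborel. of_real (1 / sqrt (2 * pi * v)) * (of_real (exp (- ((sqrt (1 / v))\<^sup>2 * y\<^sup>2) / 2)) * iexp (y * t)))"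
    unfolding eq by (intro Bochner_Integration.integral_cong refl) (simp only: of_real_mult mult.assoc mult.commute [of t])
  also have "\<dots> = of_real (1 / sqrt (2 * pi * v)) * of_real (2 * pi * normal_density 0 (sqrt (1 / v)) t)"
    using v by (subst integral_mult_right_zero, subst gaussian_fourier) auto
  also have "\<dots> = of_real (1 / sqrt (2 * pi * v) * (2 * pi * normal_density 0 (sqrt (1 / v)) t))"
    by (simp only: of_real_mult)
  also have "1 / sqrt (2 * pi * v) * (2 * pi * normal_density 0 (sqrt (1 / v)) t) = exp (- (v * t\<^sup>2) / 2)"
  proof -
    have "sqrt (2 * pi * v) * sqrt (2 * pi / v) = sqrt ((2 * pi)\<^sup>2)"
      using v by (simp only: real_sqrt_mult [symmetric]) (simp add: power2_eq_square)
    then have "sqrt (2 * pi * v) * sqrt (2 * pi / v) = 2 * pi" unfolding real_sqrt_abs by simp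
    then show ?thesis using v by (simp add: normal_density_def field_simps)
  qed
  finally show ?thesis .
qed

lemma hermite_fourier:
  assumes v: "v > 0"
  shows "(CLINT y|lborel. of_real (poly (hermite v k) y * gauss_n v y) * iexp (t * y))
    = (- \<i> * of_real t) ^ k * of_real (exp (- (v * t\<^sup>2) / 2))"
proof (induction k)
  case 0 then show ?case using gauss_n_fourier [OF v] by simp
next
  case (Suc k)
  let ?F = "\<lambda>y. of_real (poly (hermite v k) y * gauss_n v y) * iexp (t * y)"
  let ?g = "\<lambda>y. of_real (poly (hermite v (Suc k)) y * gauss_n v y) * iexp (t * y)"
  let ?f = "\<lambda>y. ?g y + \<i> * of_real t * ?F y"
  have int: "integrable lborel (\<lambda>y. of_real (poly p y * gauss_n v y) * iexp (t * y))" for p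
    by (rule Bochner_Integration.integrable_bound [OF integrable_poly_gauss [OF v, of p]]) (auto simp: norm_mult)
  have intf: "integrable lborel ?f" by (intro Bochner_Integration.integrable_add integrable_mult_right int)
  \<comment> \<open>Integration by parts in the form that the total derivative of \<open>?F\<close>
    integrates to 0: \<open>?f\<close> is that derivative.\<close>
  have z: "(LBINT y=-\<infinity>..\<infinity>. ?f y) = 0 - 0"
  proof (rule interval_integral_FTC_integrable)
    fix x
    have "((\<lambda>y. complex_of_real (poly (hermite v k) y * gauss_n v y)) has_vector_derivative
        of_real (poly (hermite v (Suc k)) x * gauss_n v x)) (at x)"
      using hermite_derivative [OF v, of k x]
      by (intro has_vector_derivative_of_real) (simp only: has_real_derivative_iff_has_vector_derivative)
    moreover have "((\<lambda>y. iexp (t * y)) has_vector_derivative (\<i> * of_real t * iexp (t * x))) (at x)"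
      by (auto intro!: derivative_eq_intros has_vector_derivative_real_field)
    ultimately have "(?F has_vector_derivative (of_real (poly (hermite v k) x * gauss_n v x) * (\<i> * of_real t * iexp (t * x))
        + of_real (poly (hermite v (Suc k)) x * gauss_n v x) * iexp (t * x))) (at x)"
      by (rule has_vector_derivative_mult)
    then show "(?F has_vector_derivative ?f x) (at x)" by (simp only: mult_ac add_ac)
    show "isCont ?f x" unfolding gauss_n_def by (intro continuous_intros) (use v in auto)
  next
    show "set_integrable lborel (einterval (- \<infinity>) \<infinity>) ?f"
      using intf by (simp add: set_integrable_def)
    have lim: "((\<lambda>y. ?F y) \<longlongrightarrow> 0) F" if "((\<lambda>y. poly (hermite v k) y * gauss_n v y) \<longlongrightarrow> 0) F" for F
      by (rule Lim_null_comparison [OF _ tendsto_norm_zero [OF that]]) (simp add: norm_mult abs_mult)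
    show "((?F \<circ> real_of_ereal) \<longlongrightarrow> 0) (at_right (- \<infinity>))"
      using lim [OF poly_gauss_tendsto(2) [OF v]] by (simp only: ereal_tendsto_simps)
    show "((?F \<circ> real_of_ereal) \<longlongrightarrow> 0) (at_left \<infinity>)"
      using lim [OF poly_gauss_tendsto(1) [OF v]] by (simp only: ereal_tendsto_simps)
  qed simp
  have "(CLINT y|lborel. ?g y) + \<i> * of_real t * (CLINT y|lborel. ?F y) = (CLINT y|lborel. ?f y)"
    by (simp only: Bochner_Integration.integral_add [OF int integrable_mult_right [OF int]] integral_mult_right_zero)
  also have "\<dots> = 0" using z by (simp add: interval_lebesgue_integral_def set_lebesgue_integral_def)
  finally have "(CLINT y|lborel. ?g y) = - \<i> * of_real t * (CLINT y|lborel. ?F y)" by (simp add: add_eq_0_iff)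
  then show ?case unfolding Suc by (simp only: power_Suc mult.assoc)
qed

section \<open>Identifying the first two cumulants from the central limit theorem\<close>

text \<open>Convergence leaves no room for the growing term. The modulus determines the real parts;
  what remains is a phase that must converge to 1, and this excludes rotation at rate
  \<open>sqrt N\<close> as well as a constant phase.\<close>

lemma exp_limit_identifies:
  fixes c1 c2 :: complex and v :: real
  assumes lim: "\<And>t::real. (\<lambda>N. exp (of_real (sqrt (real N) * t) * c1 + of_real (t\<^sup>2) * c2))
      \<longlonglongrightarrow> of_real (exp (- (v * t\<^sup>2) / 2))"
  shows "c1 = 0" "c2 = - of_real (v / 2)"
proof -
  have "(\<lambda>N. cmod (exp (of_real (sqrt (real N) * 1) * c1 + of_real (1\<^sup>2) * c2)))
      \<longlonglongrightarrow> cmod (of_real (exp (- (v * 1\<^sup>2) / 2)))"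
    by (intro tendsto_norm lim)
  then have "(\<lambda>N. ln (exp (sqrt (real N) * Re c1 + Re c2))) \<longlonglongrightarrow> ln (exp (- v / 2))"
    by (intro tendsto_ln) (simp_all add: norm_exp)
  then have l1: "(\<lambda>N. sqrt (real N) * Re c1 + Re c2) \<longlonglongrightarrow> - v / 2" by simp
  have "(\<lambda>N. (sqrt (real N) * Re c1 + Re c2) * (1 / sqrt (real N)) - Re c2 * (1 / sqrt (real N)))
       \<longlonglongrightarrow> (- v / 2) * 0 - Re c2 * 0"
    by (intro tendsto_diff tendsto_mult l1 tendsto_const) real_asymp+
  moreover have "\<forall>\<^sub>F N in sequentially. (sqrt (real N) * Re c1 + Re c2) * (1 / sqrt (real N)) - Re c2 * (1 / sqrt (real N)) = Re c1"
    using eventually_gt_at_top [of 0] by eventually_elim (simp add: field_simps)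
  ultimately have "(\<lambda>N::nat. Re c1) \<longlonglongrightarrow> 0" by (simp add: tendsto_cong)
  then have r1: "Re c1 = 0" by (simp add: LIMSEQ_const_iff)
  then have r2: "Re c2 = - v / 2" using l1 by (simp add: LIMSEQ_const_iff)
  have c1: "c1 = \<i> * of_real (Im c1)" using r1 by (simp add: complex_eq_iff)
  have osc: "(\<lambda>N. cis (sqrt (real N) * t * Im c1 + t\<^sup>2 * Im c2)) \<longlonglongrightarrow> 1" for t :: real
  proof -
    have "exp (of_real (sqrt (real N) * t) * c1 + of_real (t\<^sup>2) * c2)
      = of_real (exp (- (v * t\<^sup>2) / 2)) * cis (sqrt (real N) * t * Im c1 + t\<^sup>2 * Im c2)" for N
    proof -
      have "of_real (sqrt (real N) * t) * c1 + of_real (t\<^sup>2) * c2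
         = of_real (- (v * t\<^sup>2) / 2) + \<i> * of_real (sqrt (real N) * t * Im c1 + t\<^sup>2 * Im c2)"
        using r1 r2 by (simp add: complex_eq_iff)
      then show ?thesis by (simp only: exp_add cis_conv_exp exp_of_real)
    qed
    then have "(\<lambda>N. of_real (exp (- (v * t\<^sup>2) / 2)) * cis (sqrt (real N) * t * Im c1 + t\<^sup>2 * Im c2))
       \<longlonglongrightarrow> of_real (exp (- (v * t\<^sup>2) / 2))" using lim [of t] by simp
    from tendsto_mult [OF this tendsto_const [of "inverse (of_real (exp (- (v * t\<^sup>2) / 2)))"]]
    show ?thesis by (simp add: field_simps)
  qed
  have osc1: "cis (t * Im c1) = 1" for t :: real
  proof -
    \<comment> \<open>Along the squares \<open>sqrt N\<close> runs through the integers, so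
      consecutive terms of a convergent sequence differ by a fixed rotation, which must be
      trivial.\<close>
    have sq: "strict_mono (\<lambda>n::nat. n\<^sup>2)" by (intro strict_monoI power_strict_mono) auto
    have "(\<lambda>n. cis (sqrt (real (n\<^sup>2)) * t * Im c1 + t\<^sup>2 * Im c2)) \<longlonglongrightarrow> 1"
      using LIMSEQ_subseq_LIMSEQ [OF osc sq] by (simp add: o_def)
    then have a: "(\<lambda>n. cis (real n * t * Im c1 + t\<^sup>2 * Im c2)) \<longlonglongrightarrow> 1" by simp
    from LIMSEQ_Suc [OF a] have "(\<lambda>n. cis (real n * t * Im c1 + t\<^sup>2 * Im c2) * cis (t * Im c1)) \<longlonglongrightarrow> 1"
      by (simp add: cis_mult algebra_simps)
    moreover have "(\<lambda>n. cis (real n * t * Im c1 + t\<^sup>2 * Im c2) * cis (t * Im c1)) \<longlonglongrightarrow> 1 * cis (t * Im c1)"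
      by (intro tendsto_intros a)
    ultimately show ?thesis using LIMSEQ_unique by fastforce
  qed
  have i1: "Im c1 = 0"
  proof (rule ccontr)
    assume "Im c1 \<noteq> 0" then show False using osc1 [of "pi / Im c1"] by simp
  qed
  then show "c1 = 0" using r1 by (simp add: complex_eq_iff)
  have osc2: "cis (t\<^sup>2 * Im c2) = 1" for t :: real using osc [of t] i1 by (simp add: LIMSEQ_const_iff)
  have "Im c2 = 0"
  proof (rule ccontr)
    assume n: "Im c2 \<noteq> 0"
    \<comment> \<open>The argument \<open>t\<close> is chosen so that \<open>t^2 * Im c2\<close> is
      plus or minus pi, where \<open>cis\<close> equals -1.\<close>
    have "cis ((sqrt (pi / \<bar>Im c2\<bar>))\<^sup>2 * Im c2) = 1" by (rule osc2)
    moreover have "(sqrt (pi / \<bar>Im c2\<bar>))\<^sup>2 * Im c2 = pi \<or> (sqrt (pi / \<bar>Im c2\<bar>))\<^sup>2 * Im c2 = - pi"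
      using n by (auto simp: abs_if)
    ultimately show False by (auto simp: complex_eq_iff)
  qed
  then show "c2 = - of_real (v / 2)" using r2 by (simp add: complex_eq_iff)
qed

section \<open>Spectral asymptotics of the powers\<close>

lemma clin_diff: "clin S \<Longrightarrow> clin T \<Longrightarrow> clin (S - T)"
  by (simp add: clin_def app.diff_left cscale.diff_right)

lemma clin_mult: "clin S \<Longrightarrow> clin T \<Longrightarrow> clin (S * T)"
  by (simp add: clin_def)

lemma clin_1: "clin 1" by (simp add: clin_def)

lemma clin_cs: "clin (cs c)" by (simp add: clin_def cscale_cscale mult.commute)

lemma clin_rank_one: "(\<And>c x. blinfun_apply p (cscale c x) = c * blinfun_apply p x) \<Longrightarrow> clin (rank_one h p)"
  by (simp add: clin_def cscale_cscale)

text \<open>The left eigenfunctional comes from the same bordered inverse as the eigenvector, so the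
  rank-one spectral part of \<open>L t\<close> can be removed explicitly and the rest has
  geometrically decaying powers near 0. The second estimate compares the remainder at
  \<open>t\<close> with that at 0 and telescopes the difference of N-th powers, hence the factors
  \<open>real N\<close> and \<open>\<bar>t\<bar>\<close>.\<close>

lemma (in simple_eigenvalue_family) leading_eigenvalue_expansion:
  fixes \<phi> :: "'b \<Rightarrow>\<^sub>L complex" and v :: 'b
  assumes \<phi>: "\<And>c x. blinfun_apply \<phi> (cscale c x) = c * blinfun_apply \<phi> x"
    and m: "m > 0" "norm ((L 0 - rank_one e \<pi>) ^ m) < 1"
  obtains \<delta> C \<theta> \<kappa> a where "\<delta> > 0" "0 < \<theta>" "\<theta> < 1" "C \<ge> 0"
    "Ck_on (Suc k) {-\<delta>..\<delta>} \<kappa>" "Ck_on (Suc k) {-\<delta>..\<delta>} a" "\<kappa> 0 = 1"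
    "\<And>N t. N \<ge> 1 \<Longrightarrow> \<bar>t\<bar> \<le> \<delta> \<Longrightarrow> cmod (blinfun_apply \<phi> (app (L t ^ N) v) - \<kappa> t ^ N * a t) \<le> C * \<theta> ^ N"
    "\<And>N t. N \<ge> 1 \<Longrightarrow> \<bar>t\<bar> \<le> \<delta> \<Longrightarrow> cmod ((blinfun_apply \<phi> (app (L t ^ N) v) - \<kappa> t ^ N * a t)
        - (blinfun_apply \<phi> (app (L 0 ^ N) v) - \<kappa> 0 ^ N * a 0)) \<le> C * real N * \<theta> ^ N * \<bar>t\<bar>"
proof -
  have "continuous_on {-\<delta>0..\<delta>0} L" using CkL by (rule Ck_on_imp_continuous)
  moreover have "0 \<in> {-\<delta>0..\<delta>0}" "0 < 1 / (32 * K ^ 5)" using \<delta>0 K(1) by auto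
  ultimately obtain d where d: "d > 0" "\<And>t. t \<in> {-\<delta>0..\<delta>0} \<Longrightarrow> dist t 0 < d \<Longrightarrow> dist (L t) (L 0) < 1 / (32 * K ^ 5)"
    unfolding continuous_on_iff by blast
  define \<delta>1 where "\<delta>1 = min \<delta>0 (d / 2)"
  have \<delta>1: "0 < \<delta>1" "\<delta>1 \<le> \<delta>0" "\<delta>1 < d" using d \<delta>0 by (auto simp: \<delta>1_def)
  define I where "I = {-\<delta>1..\<delta>1}"
  have I0: "0 \<in> I" using \<delta>1 by (simp add: I_def)
  have small: "norm (L t - L 0) \<le> 1 / (32 * K ^ 5)" if "t \<in> I" for t
  proof -
    have "t \<in> {-\<delta>0..\<delta>0}" "dist t 0 < d" using that \<delta>1 by (auto simp: I_def)
    then show ?thesis using d(2) [of t] by (simp add: dist_norm)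
  qed
  have "\<exists>B. is_inverse (bord (L t) (h t) (l t)) B" if "t \<in> I" for t
    using bord_near [OF small [OF that] small [OF that]] by blast
  then obtain J where J: "\<And>t. t \<in> I \<Longrightarrow> is_inverse (bord (L t) (h t) (l t)) (J t)" by metis
  have Ck: "Ck_on (Suc k) I J" "Ck_on (Suc k) I h" "Ck_on (Suc k) I l"
    using X_smooth [OF \<delta>1(1,2), of J] small J by (auto simp: I_def)
  \<comment> \<open>On the kernel of \<pi> the bordered operator acts as
    \<open>L t - cs (l t)\<close>, and it sends \<open>- e\<close> to \<open>h t\<close>. Hence
    \<pi> after its inverse kills the range of \<open>L t - cs (l t)\<close> and takes the value -1
    at \<open>h t\<close>; the minus sign normalizes it.\<close>
  define pt where "pt t = - (\<pi> o\<^sub>L op_of (J t))" for t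
  have pt: "blinfun_apply (pt t) x = - pi' (app (J t) x)" for t x
    by (simp add: pt_def blinfun.minus_left app.rep_eq)
  have bl: "bounded_linear (\<lambda>B. - (\<pi> o\<^sub>L op_of B))"
    by (intro bounded_linear_minus bounded_linear_compose [OF bounded_bilinear.bounded_linear_right [OF bounded_bilinear_blinfun_compose] bounded_linear_op_of])
  have Ck_pt: "Ck_on (Suc k) I pt" unfolding pt_def by (rule Ck_on_bounded_linear [OF bl Ck(1)])
  have pt_clin: "blinfun_apply (pt t) (cscale c x) = c * blinfun_apply (pt t) x" if "t \<in> I" for t c x
  proof -
    have "clin (bord (L t) (h t) (l t))" unfolding bord_def P_def
      by (intro clin_diff clin_mult clinL clin_cs clin_1 clin_rank_one \<pi>_clin)
    then have "clin (J t)" by (rule clin_inverse [OF _ J [OF that]])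
    then show ?thesis by (simp add: pt clin_def \<pi>_clin)
  qed
  have eig: "app (L t) (h t) = cscale (l t) (h t)" if "t \<in> I" for t using X_spec(2) [OF small [OF that]] .
  have pi_h: "pi' (h t) = 1" for t by (simp add: h_def pi_hv)
  have J_app: "app (J t) (app (bord (L t) (h t) (l t)) u) = u" if "t \<in> I" for t u
    using J [OF that] by (simp add: is_inverse_def flip: app_simps(3))
  have pt_h: "blinfun_apply (pt t) (h t) = 1" if t: "t \<in> I" for t
  proof -
    have "app (bord (L t) (h t) (l t)) (- e) = h t"
      by (simp add: app_bord app_P app.minus_right blinfun.minus_right \<pi>_e cscale.minus_left cscale_one
          app.zero_right cscale.zero_right)
    then have "app (J t) (h t) = - e" using J_app [OF t, of "- e"] by simp
    then show ?thesis by (simp add: pt blinfun.minus_right \<pi>_e)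
  qed
  have pt_L: "blinfun_apply (pt t) (app (L t) y) = l t * blinfun_apply (pt t) y" if t: "t \<in> I" for t y
  proof -
    define u where "u = y - cscale (pi' y) (h t)"
    have pu: "pi' u = 0" by (simp add: u_def blinfun.diff_right \<pi>_clin pi_h)
    have "app (L t) (cscale (pi' y) (h t)) = cscale (l t) (cscale (pi' y) (h t))"
      using clinL [of t] eig [OF t] by (simp add: clin_def cscale_cscale mult.commute)
    then have "app (bord (L t) (h t) (l t)) u = app (L t) y - cscale (l t) y"
      by (simp add: app_bord app_P pu cscale.zero_left) (simp add: u_def app.diff_right cscale.diff_right)
    then have "app (J t) (app (L t) y - cscale (l t) y) = u" using J_app [OF t, of u] by simp
    then have "blinfun_apply (pt t) (app (L t) y - cscale (l t) y) = 0" by (simp add: pt pu)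
    then show ?thesis by (simp add: blinfun.diff_right pt_clin [OF t])
  qed
  \<comment> \<open>\<open>L t\<close> without its spectral part. \<open>pt t\<close> vanishes on
    its range, so it never interacts with the eigenline again and powers split.\<close>
  define \<Lambda> where "\<Lambda> t = L t - cs (l t) * rank_one (h t) (pt t)" for t
  have \<Lambda>_app: "app (\<Lambda> t) x = app (L t) x - cscale (l t * blinfun_apply (pt t) x) (h t)" for t x
    by (simp add: \<Lambda>_def app.diff_left cscale_cscale)
  have pt_\<Lambda>: "blinfun_apply (pt t) (app (\<Lambda> t) x) = 0" if "t \<in> I" for t x
    by (simp add: \<Lambda>_app blinfun.diff_right pt_L pt_clin pt_h that)
  \<comment> \<open>The splitting starts with the first power: for exponent 0 the eigenline would be
    counted twice. This is the reason for \<open>N \<ge> 1\<close> in the conclusions.\<close>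
  have power: "app (L t ^ Suc n) x = cscale (l t ^ Suc n * blinfun_apply (pt t) x) (h t) + app (\<Lambda> t ^ Suc n) x"
    if t: "t \<in> I" for t n x
  proof (induction n)
    case 0 then show ?case by (simp add: \<Lambda>_app)
  next
    case (Suc n)
    define y where "y = app (\<Lambda> t ^ Suc n) x"
    define c where "c = l t ^ Suc n * blinfun_apply (pt t) x"
    have "blinfun_apply (pt t) y = 0" unfolding y_def by (simp add: pt_\<Lambda> t)
    then have Ly: "app (L t) y = app (\<Lambda> t) y" by (simp add: \<Lambda>_app cscale.zero_left)
    have "app (L t ^ Suc (Suc n)) x = app (L t) (cscale c (h t) + y)"
      using Suc by (simp add: c_def y_def)
    also have "\<dots> = cscale c (app (L t) (h t)) + app (\<Lambda> t) y"
      using clinL [of t] Ly by (simp add: app.add_right clin_def)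
    also have "\<dots> = cscale (l t ^ Suc (Suc n) * blinfun_apply (pt t) x) (h t) + app (\<Lambda> t ^ Suc (Suc n)) x"
      by (simp add: eig [OF t] cscale_cscale c_def y_def mult_ac)
    finally show ?case .
  qed
  define a where "a t = blinfun_apply (pt t) v * blinfun_apply \<phi> (h t)" for t
  have err: "blinfun_apply \<phi> (app (L t ^ N) v) - l t ^ N * a t = blinfun_apply \<phi> (app (\<Lambda> t ^ N) v)"
    if "t \<in> I" "N \<ge> 1" for t N
    using power [OF that(1), of "N - 1" v] that(2) by (simp add: a_def blinfun.add_right \<phi>)
  have Ck_a: "Ck_on (Suc k) I a" unfolding a_def
    by (intro Ck_on_mult Ck_on_bounded_linear [OF blinfun.bounded_linear_right Ck(2)]
        Ck_on_bounded_linear [OF blinfun.bounded_linear_left Ck_pt])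
  have Ck_\<Lambda>: "Ck_on (Suc k) I \<Lambda>" unfolding \<Lambda>_def
    by (intro Ck_on_diff Ck_on_mult Ck_on_subset [OF CkL] Ck_on_bounded_linear [OF bounded_linear_cs Ck(3)]
        Ck_on_bilinear [OF bounded_bilinear_rank_one] Ck(2) Ck_pt) (use \<delta>1 in \<open>auto simp: I_def\<close>)
  have pt0: "blinfun_apply (pt 0) x = pi' x" for x
  proof -
    have J0: "J 0 = G0" using J [OF I0] inv_bord_0 is_inverse_unique by (simp add: X_0)
    define y where "y = app G0 x"
    have x: "x = app (bord (L 0) e 1) y" using inv_bord_0 by (simp add: y_def is_inverse_def flip: app_simps(3))
    have "pi' x = - pi' y" unfolding x bord_0
      by (simp add: app.diff_left blinfun.diff_right \<pi>L app_P \<pi>_clin \<pi>_e)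
    then show ?thesis by (simp add: pt J0 y_def)
  qed
  have \<Lambda>0: "\<Lambda> 0 = L 0 - rank_one e \<pi>"
    by (rule endo_eqI) (simp add: \<Lambda>_app app.diff_left X_0 pt0)
  obtain d2 C \<theta> where d2: "d2 > 0" "C \<ge> 0" "0 < \<theta>" "\<theta> < 1"
    "\<And>t N. t \<in> I \<Longrightarrow> dist t 0 < d2 \<Longrightarrow> norm (\<Lambda> t ^ N) \<le> C * \<theta> ^ N"
    using local_power_bound [OF Ck_on_imp_continuous [OF Ck_\<Lambda>] I0 m(1)] m(2) unfolding \<Lambda>0 by metis
  obtain CL where CL: "CL \<ge> 0" "\<And>s t. s \<in> I \<Longrightarrow> t \<in> I \<Longrightarrow> norm (\<Lambda> s - \<Lambda> t) \<le> CL * \<bar>s - t\<bar>"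
    using Ck_on_Lipschitz [OF Ck_\<Lambda> [unfolded I_def]] unfolding I_def by blast
  define \<delta> where "\<delta> = min \<delta>1 (d2 / 2)"
  have \<delta>: "\<delta> > 0" "\<delta> \<le> \<delta>1" "\<delta> < d2" using \<delta>1 d2 by (auto simp: \<delta>_def)
  have bd: "t \<in> I" "dist t 0 < d2" if "\<bar>t\<bar> \<le> \<delta>" for t
    using that \<delta> by (auto simp: I_def abs_le_iff)
  have bd0: "0 \<in> I" "dist 0 (0::real) < d2" using I0 d2 by auto
  have app_le: "cmod (blinfun_apply \<phi> (app T v)) \<le> norm \<phi> * norm v * B" if "norm T \<le> B" for T B
  proof -
    have "cmod (blinfun_apply \<phi> (app T v)) \<le> norm \<phi> * (norm T * norm v)"
      by (rule order_trans [OF norm_blinfun]) (intro mult_left_mono norm_app norm_ge_zero)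
    also have "\<dots> \<le> norm \<phi> * (B * norm v)" using that by (intro mult_left_mono mult_right_mono) auto
    finally show ?thesis by (simp add: mult_ac)
  qed
  define C1 where "C1 = norm \<phi> * norm v * C"
  \<comment> \<open>Each telescoped product has \<open>N - 1\<close> factors besides the increment,
    so one power of \<theta> is missing and is restored by the division.\<close>
  define C2 where "C2 = norm \<phi> * norm v * (C * C * CL / \<theta>)"
  have C12: "0 \<le> C1" "0 \<le> C2" using d2 CL by (auto simp: C1_def C2_def)
  show ?thesis
  proof (rule that [of \<delta> \<theta> "C1 + C2" l a])
    have sub: "{-\<delta>..\<delta>} \<subseteq> I" using \<delta> by (auto simp: I_def)
    show "Ck_on (Suc k) {-\<delta>..\<delta>} l" by (rule Ck_on_subset [OF Ck(3) sub])
    show "Ck_on (Suc k) {-\<delta>..\<delta>} a" by (rule Ck_on_subset [OF Ck_a sub])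
    fix N t assume N: "N \<ge> (1::nat)" and t: "\<bar>t\<bar> \<le> \<delta>"
    have "cmod (blinfun_apply \<phi> (app (L t ^ N) v) - l t ^ N * a t) \<le> norm \<phi> * norm v * (C * \<theta> ^ N)"
      unfolding err [OF bd(1) [OF t] N] by (intro app_le d2(5) bd t)
    also have "\<dots> \<le> (C1 + C2) * \<theta> ^ N" using C12 d2 by (simp add: C1_def distrib_right mult.assoc)
    finally show "cmod (blinfun_apply \<phi> (app (L t ^ N) v) - l t ^ N * a t) \<le> (C1 + C2) * \<theta> ^ N" .
    have "norm (\<Lambda> t ^ N - \<Lambda> 0 ^ N) \<le> real N * (C * C * CL / \<theta> * \<theta> ^ N * \<bar>t\<bar>)"
      unfolding power_diff_telescope
    proof (rule order_trans [OF sum_norm_bound])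
      fix j assume j: "j \<in> {..<N}"
      have "norm (\<Lambda> t ^ j * (\<Lambda> t - \<Lambda> 0) * \<Lambda> 0 ^ (N - 1 - j)) \<le> (norm (\<Lambda> t ^ j) * norm (\<Lambda> t - \<Lambda> 0)) * norm (\<Lambda> 0 ^ (N - 1 - j))"
        by (intro order_trans [OF norm_mult_ineq] mult_right_mono norm_mult_ineq norm_ge_zero)
      also have "\<dots> \<le> ((C * \<theta> ^ j) * (CL * \<bar>t - 0\<bar>)) * (C * \<theta> ^ (N - 1 - j))"
        using d2 CL by (intro mult_mono d2(5) CL(2) bd t bd0) auto
      also have "\<dots> = C * C * CL / \<theta> * (\<theta> * (\<theta> ^ j * \<theta> ^ (N - 1 - j))) * \<bar>t\<bar>"
        using d2(3) by (simp add: field_simps)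
      also have "\<theta> * (\<theta> ^ j * \<theta> ^ (N - 1 - j)) = \<theta> ^ N"
        using j by (simp only: power_Suc [symmetric] power_add [symmetric]) simp
      finally show "norm (\<Lambda> t ^ j * (\<Lambda> t - \<Lambda> 0) * \<Lambda> 0 ^ (N - 1 - j)) \<le> C * C * CL / \<theta> * \<theta> ^ N * \<bar>t\<bar>" .
    qed simp
    then have "cmod (blinfun_apply \<phi> (app (\<Lambda> t ^ N - \<Lambda> 0 ^ N) v)) \<le> norm \<phi> * norm v * (real N * (C * C * CL / \<theta> * \<theta> ^ N * \<bar>t\<bar>))"
      by (rule app_le)
    also have "\<dots> = C2 * (real N * \<theta> ^ N * \<bar>t\<bar>)" by (simp add: C2_def)
    also have "\<dots> \<le> (C1 + C2) * (real N * \<theta> ^ N * \<bar>t\<bar>)" using C12 d2 by (intro mult_right_mono) auto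
    finally show "cmod ((blinfun_apply \<phi> (app (L t ^ N) v) - l t ^ N * a t)
        - (blinfun_apply \<phi> (app (L 0 ^ N) v) - l 0 ^ N * a 0)) \<le> (C1 + C2) * real N * \<theta> ^ N * \<bar>t\<bar>"
      unfolding err [OF bd(1) [OF t] N] err [OF bd0(1) N]
      by (simp add: app.diff_left blinfun.diff_right mult.assoc)
  qed (use \<delta> d2 C12 X_0 in auto)
qed

section \<open>Polynomial decay at high frequencies\<close>

lemma eventually_powr_ge: "c > 0 \<Longrightarrow> \<forall>\<^sub>F N::nat in sequentially. C \<le> real N powr c"
proof -
  assume c: "c > 0"
  have "filterlim (\<lambda>N::nat. real N powr c) at_top sequentially" using c by real_asymp
  then show ?thesis by (simp add: filterlim_at_top)
qed

text \<open>Splitting $N$ into $k$ blocks of length about $N/k$ raises the polynomial decay rate of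
  (A4) to any prescribed power, at the price of an arbitrarily small decrease of $r_1$.\<close>

lemma polynomial_decay_boost:
  fixes T :: "'c \<Rightarrow> 'b::real_normed_vector endo" and f :: "'c \<Rightarrow> real"
  assumes r2: "r2 > 0" and r1: "\<rho> < r1" "0 < \<rho>" and q: "q > 0"
    and A: "\<And>N t. real N > N0 \<Longrightarrow> K \<le> f t \<Longrightarrow> f t \<le> real N powr r1 \<Longrightarrow> norm (T t ^ N) \<le> real N powr (- r2)"
  shows "\<forall>\<^sub>F N in sequentially. \<forall>t. K \<le> f t \<longrightarrow> f t \<le> real N powr \<rho> \<longrightarrow> norm (T t ^ N) \<le> real N powr (- q)"
proof -
  \<comment> \<open>The number of blocks: \<open>r2 * real k \<ge> 2 * q\<close> is twice the
    required rate, and the surplus \<open>r2 * real k - q\<close> pays for the constants produced by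
    shortening the blocks.\<close>
  define k where "k = nat \<lceil>2 * q / r2\<rceil> + 1"
  have k: "k \<ge> 1" "2 * q \<le> r2 * real k"
  proof -
    have "2 * q / r2 \<le> real k" unfolding k_def by linarith
    then show "2 * q \<le> r2 * real k" using r2 by (simp add: field_simps)
  qed (simp add: k_def)
  \<comment> \<open>For large \<open>N\<close> the block length \<open>N div k\<close> is at least
    \<open>N / (2 * k)\<close>, the factor 2 covering the loss by rounding and the threshold
    \<open>N0\<close>.\<close>
  define c where "c = 2 * real k"
  have c: "c > 0" using k by (simp add: c_def)
  have e1: "\<forall>\<^sub>F N::nat in sequentially. c powr r1 \<le> real N powr (r1 - \<rho>)"
    using r1 by (intro eventually_powr_ge) simp
  have e2: "\<forall>\<^sub>F N::nat in sequentially. c powr (r2 * real k) \<le> real N powr (r2 * real k - q)"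
    using k q by (intro eventually_powr_ge) simp
  have e3: "\<forall>\<^sub>F N::nat in sequentially. c * (1 + \<bar>N0\<bar>) \<le> real N powr 1"
    by (intro eventually_powr_ge) simp
  from e1 e2 e3 eventually_ge_at_top [of 1] show ?thesis
  proof eventually_elim
    case (elim N)
    show ?case
    proof (intro allI impI)
      fix t assume t: "K \<le> f t" "f t \<le> real N powr \<rho>"
      have N: "real N > 0" "c * (1 + \<bar>N0\<bar>) \<le> real N" using elim by auto
      define m where "m = N div k"
      \<comment> \<open>The last block takes the remainder of the division; it is at least as long
        as the others, so the decay hypothesis applies to it as well.\<close>
      define m' where "m' = N - (k - 1) * m"
      have km: "k * m \<le> N" by (simp add: m_def)
      have split: "(k - 1) * m + m = k * m" using k by (simp add: algebra_simps)
      have m': "m \<le> m'" "N = (k - 1) * m + m'" using km split by (simp_all add: m'_def)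
      have "real N < real k * (real m + 1)"
      proof -
        have "N < k * (m + 1)" using dividend_less_times_div [of k N] k by (simp add: m_def)
        then show ?thesis by (metis of_nat_1 of_nat_add of_nat_less_iff of_nat_mult)
      qed
      then have "real N / real k < real m + 1" using k by (simp add: field_simps)
      moreover have "1 + \<bar>N0\<bar> \<le> real N / c" using N c by (simp add: field_simps)
      moreover have "real N / real k = 2 * (real N / c)" by (simp add: c_def)
      ultimately have mN: "real N / c \<le> real m" "real m > N0" by linarith+
      have Nc: "real N / c > 0" using N c by simp
      have "real N powr \<rho> \<le> (real N / c) powr r1"
      proof -
        have "c powr r1 * real N powr \<rho> \<le> real N powr (r1 - \<rho>) * real N powr \<rho>"
          using elim by (intro mult_right_mono) auto
        also have "\<dots> = real N powr r1" by (simp add: powr_add [symmetric])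
        finally show ?thesis using c N by (simp add: powr_divide field_simps)
      qed
      also have "\<dots> \<le> real m powr r1" using mN Nc r1 by (intro powr_mono2) auto
      finally have t1: "f t \<le> real m powr r1" using t by simp
      also have "\<dots> \<le> real m' powr r1" using m' r1 by (intro powr_mono2) auto
      finally have t2: "f t \<le> real m' powr r1" .
      have dec: "real j powr (- r2) \<le> (real N / c) powr (- r2)" if "m \<le> j" for j
        using that mN Nc r2 by (intro powr_mono2') auto
      have n1: "norm (T t ^ m) \<le> (real N / c) powr (- r2)"
        using A [OF mN(2) t(1) t1] dec [of m] by simp
      have n2: "norm (T t ^ m') \<le> (real N / c) powr (- r2)"
        using A [OF _ t(1) t2] dec [OF m'(1)] mN m' by simp
      have "norm (T t ^ N) \<le> norm ((T t ^ m) ^ (k - 1)) * norm (T t ^ m')"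
        unfolding m'(2) power_add mult.commute [of "k - 1"] power_mult by (rule norm_mult_ineq)
      also have "\<dots> \<le> ((real N / c) powr (- r2)) ^ (k - 1) * (real N / c) powr (- r2)"
        by (intro mult_mono order_trans [OF norm_power_endo_le] power_mono n1 n2) auto
      also have "\<dots> = ((real N / c) powr (- r2)) ^ k" using k by (simp add: power_eq_if)
      also have "\<dots> = (real N / c) powr (- (r2 * real k))"
      proof -
        have "(real N / c) powr (- r2) > 0" unfolding powr_gt_zero using Nc by linarith
        then have "((real N / c) powr (- r2)) ^ k = ((real N / c) powr (- r2)) powr real k"
          by (simp only: powr_realpow)
        then show ?thesis by (simp add: powr_powr)
      qed
      also have "\<dots> = c powr (r2 * real k) * real N powr (- (r2 * real k))"
        using N c by (simp add: powr_divide powr_minus field_simps)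
      also have "\<dots> \<le> real N powr (r2 * real k - q) * real N powr (- (r2 * real k))"
        using elim by (intro mult_right_mono) auto
      also have "\<dots> = real N powr (- q)" by (simp add: powr_add [symmetric])
      finally show "norm (T t ^ N) \<le> real N powr (- q)" .
    qed
  qed
qed

section \<open>Spectral hypotheses expressed in the algebra of operators\<close>

lemma clinear_op_iff_clin: "clinear_op T \<longleftrightarrow> clin (Endo T)"
  by (simp add: clinear_op_def clin_def)

lemma opow_eq: "opow T N = app (Endo T ^ N)"
  unfolding opow_def app_power by (rule arg_cong [where f = "\<lambda>f. f ^^ N"]) (simp add: fun_eq_iff)

lemma norm_endo_eq_onorm: "norm T = onorm (app T)"
  by transfer (rule norm_blinfun.rep_eq)

lemma cspectrum_resolvent:
  assumes "z \<notin> cspectrum T" shows "\<exists>G. is_inverse (cs z - Endo T) G"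
proof -
  have "app (cs z - Endo T) = (\<lambda>x. cscale z x - blinfun_apply T x)" by (simp add: fun_eq_iff app.diff_left)
  then show ?thesis using assms by (intro bij_is_inverse) (simp add: cspectrum_def)
qed

text \<open>For \<open>w \<noteq> 0\<close> in the closed unit disk \<open>1 - w T\<close> is
  \<open>w\<close> times the resolvent operator at \<open>1 / w\<close>, which lies outside the
  spectrum; so the criterion of \<open>spectral_radius_less_one\<close> is met.\<close>

lemma cspectrum_power_small:
  assumes T: "clinear_op T" and sp: "cspectrum T \<subseteq> ball 0 1"
  shows "\<exists>m>0. norm (Endo T ^ m) < 1"
proof -
  have "\<exists>b. is_inverse (1 - cs w * Endo T) b" if w: "cmod w \<le> 1" for w
  proof (cases "w = 0")
    case True then show ?thesis by (intro exI [of _ 1]) (simp add: is_inverse_def)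
  next
    case False
    then have "1 / w \<notin> cspectrum T" using sp w by (auto simp: norm_divide)
    then obtain G where "is_inverse (cs (1 / w) - Endo T) G" using cspectrum_resolvent by blast
    then have "is_inverse (cs w * (cs (1 / w) - Endo T)) (G * cs (1 / w))"
      by (intro is_inverse_mult is_inverse_cs False)
    moreover have "cs w * (cs (1 / w) - Endo T) = 1 - cs w * Endo T"
      using False by (simp add: right_diff_distrib flip: cs_mult)
    ultimately show ?thesis by auto
  qed
  then show ?thesis using spectral_radius_less_one [of "Endo T"] T unfolding clinear_op_iff_clin by metis
qed

lemma simple_dominantI:
  fixes T :: "'b::complex_banach \<Rightarrow>\<^sub>L 'b"
  assumes T: "clinear_op T"
    and simple: "simple_eigenvalue T 1"
    and other: "\<And>z. is_eigenvalue T z \<Longrightarrow> z \<noteq> 1 \<Longrightarrow> cmod z < 1"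
    and ess: "\<exists>\<rho><1. ess_spectrum T \<subseteq> cball 0 \<rho>"
  obtains e where "simple_dominant (Endo T) e"
proof -
  have TT: "app (cs z - Endo T) = (\<lambda>x. cscale z x - blinfun_apply T x)" for z by (simp add: fun_eq_iff app.diff_left)
  obtain e where e: "gen_eigenspace T 1 = {cscale c e | c. True}" using simple by (auto simp: simple_eigenvalue_def)
  obtain x where x: "x \<noteq> 0" "blinfun_apply T x = cscale 1 x"
    using simple by (auto simp: simple_eigenvalue_def is_eigenvalue_def)
  have "((\<lambda>y. blinfun_apply T y - cscale 1 y) ^^ 1) x = 0" using x by simp
  then have "x \<in> gen_eigenspace T 1" unfolding gen_eigenspace_def by blast
  then obtain c where c: "x = cscale c e" using e by auto
  have e0: "e \<noteq> 0" "c \<noteq> 0" using x c by (auto simp: cscale.zero_right cscale.zero_left)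
  have "cscale c (blinfun_apply T e) = cscale c e"
    using x T by (simp add: c clinear_op_def cscale_one)
  then have "cscale (1 / c) (cscale c (blinfun_apply T e)) = cscale (1 / c) (cscale c e)" by simp
  then have Te: "blinfun_apply T e = e" using e0 by (simp add: cscale_cscale cscale_one)
  have "simple_dominant (Endo T) e"
  proof
    show "clin (Endo T)" using T by (simp add: clinear_op_iff_clin)
    show "e \<noteq> 0" "app (Endo T) e = e" using e0 Te by auto
    show "closed (range (app (cs z - Endo T)))" if z: "1 \<le> cmod z" for z
    proof -
      have "z \<notin> ess_spectrum T" using ess z by force
      then show ?thesis unfolding TT by (simp add: ess_spectrum_def fredholm_def)
    qed
    show "x = 0" if "1 \<le> cmod z" "z \<noteq> 1" "app (Endo T) x = cscale z x" for z x
      using other [of z] that by (auto simp: is_eigenvalue_def)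
    show "\<exists>c. x = cscale c e" if "app (1 - Endo T) (app (1 - Endo T) x) = 0" for x
    proof -
      have "((\<lambda>y. blinfun_apply T y - cscale 1 y) ^^ 2) x = 0"
        using that by (simp add: numeral_2_eq_2 cscale_one app.diff_left app.diff_right algebra_simps
            blinfun.diff_right)
      then have "x \<in> gen_eigenspace T 1" unfolding gen_eigenspace_def by blast
      then show ?thesis using e by auto
    qed
  qed
  then show ?thesis by (rule that)
qed

lemma spectral_expansion:
  fixes L :: "real \<Rightarrow> 'b::complex_banach \<Rightarrow>\<^sub>L 'b" and \<phi> :: "'b \<Rightarrow>\<^sub>L complex" and v :: 'b
  assumes clin: "\<And>t. clinear_op (L t)" and \<phi>: "clinear_fun \<phi>"
    and \<delta>0: "\<delta>0 > 0" "Ck_on (Suc k) {-\<delta>0..\<delta>0} L"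
    and simple: "simple_eigenvalue (L 0) 1"
    and other: "\<And>z. is_eigenvalue (L 0) z \<Longrightarrow> z \<noteq> 1 \<Longrightarrow> cmod z < 1"
    and ess: "\<exists>\<rho><1. ess_spectrum (L 0) \<subseteq> cball 0 \<rho>"
  obtains \<delta> C \<theta> \<kappa> a where "\<delta> > 0" "0 < \<theta>" "\<theta> < 1" "C \<ge> 0"
    "Ck_on (Suc k) {-\<delta>..\<delta>} \<kappa>" "Ck_on (Suc k) {-\<delta>..\<delta>} a" "\<kappa> 0 = 1"
    "\<And>N t. N \<ge> 1 \<Longrightarrow> \<bar>t\<bar> \<le> \<delta> \<Longrightarrow> cmod (blinfun_apply \<phi> (opow (L t) N v) - \<kappa> t ^ N * a t) \<le> C * \<theta> ^ N"
    "\<And>N t. N \<ge> 1 \<Longrightarrow> \<bar>t\<bar> \<le> \<delta> \<Longrightarrow> cmod ((blinfun_apply \<phi> (opow (L t) N v) - \<kappa> t ^ N * a t)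
        - (blinfun_apply \<phi> (opow (L 0) N v) - \<kappa> 0 ^ N * a 0)) \<le> C * real N * \<theta> ^ N * \<bar>t\<bar>"
proof -
  obtain e where "simple_dominant (Endo (L 0)) e" using simple_dominantI [OF clin simple other ess] .
  then interpret D: simple_dominant "Endo (L 0)" e .
  obtain G where G: "is_inverse (1 - Endo (L 0) + rank_one e D.\<pi>) G" using D.invertible_bordered by blast
  obtain m where m: "m > 0" "norm ((Endo (L 0) - rank_one e D.\<pi>) ^ m) < 1" using D.complement_spectral_radius .
  have inv: "is_inverse (Endo (L 0) - 1 - rank_one e D.\<pi>) (- G)"
    using is_inverse_minus [OF G] by (simp add: algebra_simps)
  interpret F: simple_eigenvalue_family "\<lambda>t. Endo (L t)" e "D.\<pi>" "- G" k \<delta>0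
  proof
    show "Ck_on (Suc k) {-\<delta>0..\<delta>0} (\<lambda>t. Endo (L t))" by (rule Ck_on_bounded_linear [OF bounded_linear_Endo \<delta>0(2)])
  qed (use clin inv \<delta>0 D.e in \<open>simp_all add: clinear_op_iff_clin D.apply_\<pi> D.coef_cscale D.coef_e D.coef_T del: app_Endo\<close>)
  show ?thesis
    by (rule F.leading_eigenvalue_expansion [of \<phi> m v, folded opow_eq])
      (use \<phi> m that in \<open>auto simp: clinear_fun_def\<close>)
qed

lemma intermediate_decay:
  fixes L :: "real \<Rightarrow> 'b::complex_banach \<Rightarrow>\<^sub>L 'b" and \<phi> :: "'b \<Rightarrow>\<^sub>L complex" and v :: 'b
  assumes clin: "\<And>t. clinear_op (L t)" and cont: "continuous_on UNIV L"
    and A3: "\<And>t. t \<noteq> 0 \<Longrightarrow> cspectrum (L t) \<subseteq> ball 0 1" and \<delta>: "\<delta> > 0"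
  obtains C \<theta> where "C \<ge> 0" "0 < \<theta>" "\<theta> < 1"
    "\<And>N t. \<delta> \<le> \<bar>t\<bar> \<Longrightarrow> \<bar>t\<bar> \<le> K \<Longrightarrow> cmod (blinfun_apply \<phi> (opow (L t) N v)) \<le> C * \<theta> ^ N"
proof -
  define S where "S = {-K..-\<delta>} \<union> {\<delta>..K}"
  have "compact S" by (simp add: S_def compact_Un)
  moreover have "continuous_on S (\<lambda>t. Endo (L t))"
    using bounded_linear.continuous_on [OF bounded_linear_Endo cont] by (rule continuous_on_subset) simp
  moreover have "\<exists>m>0. norm (Endo (L t) ^ m) < 1" if "t \<in> S" for t
    using that \<delta> by (intro cspectrum_power_small clin A3) (auto simp: S_def)
  ultimately obtain C \<theta> where C: "C \<ge> 0" "0 < \<theta>" "\<theta> < 1" "\<And>t N. t \<in> S \<Longrightarrow> norm (Endo (L t) ^ N) \<le> C * \<theta> ^ N"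
    using compact_power_bound by blast
  show ?thesis
  proof (rule that [of "norm \<phi> * norm v * C" \<theta>])
    fix N t assume "\<delta> \<le> \<bar>t\<bar>" "\<bar>t\<bar> \<le> K"
    then have "t \<in> S" by (auto simp: S_def abs_if split: if_splits)
    have "cmod (blinfun_apply \<phi> (opow (L t) N v)) \<le> norm \<phi> * (norm (Endo (L t) ^ N) * norm v)"
      unfolding opow_eq by (rule order_trans [OF norm_blinfun]) (intro mult_left_mono norm_app norm_ge_zero)
    also have "\<dots> \<le> norm \<phi> * ((C * \<theta> ^ N) * norm v)" using C(4) [OF \<open>t \<in> S\<close>] by (intro mult_left_mono mult_right_mono) auto
    finally show "cmod (blinfun_apply \<phi> (opow (L t) N v)) \<le> norm \<phi> * norm v * C * \<theta> ^ N" by (simp add: mult_ac)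
  qed (use C in auto)
qed

section \<open>The Edgeworth expansion from bounds on the characteristic function\<close>

lemma integral_gaussian:
  assumes c: "c > 0" shows "(LINT t|lborel. exp (- (c * t\<^sup>2))) = sqrt (pi / c)"
proof -
  have "(\<lambda>t. sqrt (pi / c) * normal_density 0 (sqrt (1 / (2 * c))) t) = (\<lambda>t. exp (- (c * t\<^sup>2)))"
    using c by (auto simp: normal_density_def fun_eq_iff field_simps real_sqrt_divide)
  then have "(LINT t|lborel. exp (- (c * t\<^sup>2))) = (LINT t|lborel. sqrt (pi / c) * normal_density 0 (sqrt (1 / (2 * c))) t)"
    by simp
  then show ?thesis using c by simp
qed

lemma powr_mult_power_tendsto_0:
  fixes \<theta> :: real assumes "0 < \<theta>" "\<theta> < 1"
  shows "(\<lambda>N. real N powr c * \<theta> ^ N) \<longlonglongrightarrow> 0"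
  using assms by real_asymp

lemma powr_mult_exp_tendsto_0:
  fixes c :: real assumes "\<eta> > 0"
  shows "(\<lambda>N. real N powr c * exp (- (real N powr (2 * \<eta>) / 4))) \<longlonglongrightarrow> 0"
  using assms by real_asymp

text \<open>What the operators supply, with no operator left in sight: \<mu> is the logarithm of the
  leading eigenvalue, and \<open>K0\<close> separates the compact range of frequencies from the
  polynomial one. The remainders have orders \<open>r + 2\<close> and \<open>r\<close> because that
  of \<mu> is multiplied by \<open>N\<close> and \<open>N * s^2 = t^2\<close> uses up two orders,
  leaving order \<open>r\<close> in both cases.\<close>

locale edgeworth = prob_space M for M :: "'a measure" +
  fixes S :: "nat \<Rightarrow> 'a \<Rightarrow> real" and A v :: real and q b :: "complex poly" and r :: nat
    and \<mu> a :: "real \<Rightarrow> complex" and \<delta>0 C0 \<theta>0 K0 \<rho> :: real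
  assumes S_meas [measurable]: "\<And>N. S N \<in> borel_measurable M"
    and v: "v > 0" and b0: "poly b 0 = 1" and r: "r \<ge> 1"
    and near: "\<And>\<epsilon>. \<epsilon> > 0 \<Longrightarrow> \<exists>d>0. \<forall>s. \<bar>s\<bar> \<le> d \<longrightarrow>
       cmod (\<mu> s - (\<i> * of_real (A * s) - of_real (v * s\<^sup>2 / 2) + of_real s ^ 3 * poly q (of_real s))) \<le> \<epsilon> * \<bar>s\<bar> ^ (r + 2) \<and>
       cmod (a s - poly b (of_real s)) \<le> \<epsilon> * \<bar>s\<bar> ^ r"
    and approx: "\<delta>0 > 0" "C0 \<ge> 0" "0 < \<theta>0" "\<theta>0 < 1"
       "\<And>N s. N \<ge> 1 \<Longrightarrow> \<bar>s\<bar> \<le> \<delta>0 \<Longrightarrow>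
         cmod ((CLINT \<omega>|M. iexp (s * S N \<omega>)) - exp (of_nat N * \<mu> s) * a s) \<le> C0 * real N * \<theta>0 ^ N * \<bar>s\<bar>"
    and mid: "\<And>d. d > 0 \<Longrightarrow> \<exists>C \<theta>. 0 \<le> C \<and> 0 < \<theta> \<and> \<theta> < 1 \<and>
       (\<forall>N s. d \<le> \<bar>s\<bar> \<longrightarrow> \<bar>s\<bar> \<le> K0 \<longrightarrow> cmod (CLINT \<omega>|M. iexp (s * S N \<omega>)) \<le> C * \<theta> ^ N)"
    and high: "K0 > 0" "\<rho> > (real r - 1) / 2" "\<And>Q. Q > 0 \<Longrightarrow> \<forall>\<^sub>F N in sequentially. \<forall>s. K0 \<le> \<bar>s\<bar> \<longrightarrow> \<bar>s\<bar> \<le> real N powr \<rho> \<longrightarrow>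
       cmod (CLINT \<omega>|M. iexp (s * S N \<omega>)) \<le> real N powr (- Q)"
begin

definition "Y N \<omega> = (S N \<omega> - real N * A) / sqrt (real N)"
definition "\<psi> N s = (CLINT \<omega>|M. iexp (s * S N \<omega>))"
definition "\<phi> N t = (CLINT \<omega>|M. iexp (t * Y N \<omega>))"
definition "D m j = coeff (edge_poly q b m) j"
text \<open>The truncated expansion on the Fourier side at \<open>u = 1 / sqrt N\<close>, with
  \<open>s = t * u\<close> substituted.\<close>

definition "E u t = of_real (exp (- (v * t\<^sup>2) / 2)) *
  (\<Sum>m\<le>r. \<Sum>j\<le>r. D m j * of_real (t ^ (2 * m + j) * u ^ j))"
text \<open>A real density has a transform invariant under conjugation combined with
  \<open>t\<close> going to \<open>- t\<close>. Averaging \<open>E\<close> over this symmetry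
  amounts to taking real parts of the coefficients once a power of the imaginary unit is moved to
  \<open>t\<close>.\<close>

definition "\<kappa> m j = Re (D m j * (- \<i>) ^ (2 * m + j))"
text \<open>The approximating signed density. The sign \<open>(-1) ^ j\<close> converts the powers
  of \<open>- \<i> * t\<close> produced by \<open>hermite_fourier\<close> into those of
  \<open>\<i> * t\<close>.\<close>

definition "g u y = (\<Sum>m\<le>r. \<Sum>j\<le>r. \<kappa> m j * u ^ j * (-1) ^ j * (poly (hermite v (2 * m + j)) y * gauss_n v y))"
text \<open>Passing from density to distribution function lowers the order of the derivative by one;
  for \<open>p \<ge> 1\<close> the index \<open>2 * m + p - 1\<close> does not truncate.\<close>

definition "P p = (\<Sum>m\<le>r. smult (\<kappa> m p * (-1) ^ p) (hermite v (2 * m + p - 1)))"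

lemma Y_meas [measurable]: "Y N \<in> borel_measurable M"
  unfolding Y_def by measurable

lemma \<phi>_eq: assumes "N \<ge> 1"
  shows "\<phi> N t = exp (- (\<i> * of_real (A * sqrt (real N) * t))) * \<psi> N (t / sqrt (real N))"
proof -
  have "iexp (t * Y N \<omega>) = exp (- (\<i> * of_real (A * sqrt (real N) * t))) * iexp (t / sqrt (real N) * S N \<omega>)" for \<omega>
  proof -
    have "t * Y N \<omega> = - (A * sqrt (real N) * t) + t / sqrt (real N) * S N \<omega>"
      using assms by (simp add: Y_def field_simps)
    then have "\<i> * of_real (t * Y N \<omega>) = - (\<i> * of_real (A * sqrt (real N) * t)) + \<i> * of_real (t / sqrt (real N) * S N \<omega>)"
      by (simp only: of_real_add of_real_minus distrib_left mult_minus_right)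
    then show ?thesis by (simp only: exp_add)
  qed
  then show ?thesis unfolding \<phi>_def \<psi>_def by (simp only: integral_mult_right_zero)
qed

lemma norm_\<phi>_eq: "N \<ge> 1 \<Longrightarrow> cmod (\<phi> N t) = cmod (\<psi> N (t / sqrt (real N)))"
  by (simp add: \<phi>_eq norm_mult)

lemma \<phi>_cnj: "\<phi> N (- t) = cnj (\<phi> N t)"
proof -
  have "cnj (\<phi> N t) = (CLINT \<omega>|M. cnj (iexp (t * Y N \<omega>)))" unfolding \<phi>_def by (rule Bochner_Integration.integral_cnj [symmetric])
  then show ?thesis by (simp add: \<phi>_def exp_cnj)
qed

lemma norm_\<phi>_le_1: "cmod (\<phi> N t) \<le> 1"
  unfolding \<phi>_def by (rule order_trans [OF integral_norm_bound]) (simp add: prob_space)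

lemma symmetrize_term:
  "(d * of_real (t ^ k * u) + cnj (d * of_real ((- t) ^ k * u))) / 2 =
     of_real (Re (d * (- \<i>) ^ k) * u) * (\<i> * of_real t) ^ k"
proof -
  have re: "of_real (Re z) = (z + cnj z) / 2" for z by (simp add: complex_eq_iff)
  have ii: "(- \<i>) ^ k * \<i> ^ k = (1 :: complex)" by (simp flip: power_mult_distrib)
  have mi: "\<i> ^ k * \<i> ^ k = ((- 1) ^ k :: complex)" by (simp flip: power_mult_distrib)
  have "of_real (Re (d * (- \<i>) ^ k)) * \<i> ^ k = (d * ((- \<i>) ^ k * \<i> ^ k) + cnj d * (\<i> ^ k * \<i> ^ k)) / 2"
  proof -
    have c: "cnj (d * (- \<i>) ^ k) = cnj d * \<i> ^ k" by simp
    show ?thesis unfolding re c by (simp add: algebra_simps)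
  qed
  then have *: "of_real (Re (d * (- \<i>) ^ k)) * \<i> ^ k = (d + cnj d * (- 1) ^ k) / 2" by (simp only: ii mi mult_1_right)
  have "of_real (Re (d * (- \<i>) ^ k) * u) * (\<i> * of_real t) ^ k
      = (of_real (Re (d * (- \<i>) ^ k)) * \<i> ^ k) * of_real (u * t ^ k)"
    by (simp add: power_mult_distrib mult_ac)
  also have "\<dots> = (d * of_real (t ^ k * u) + cnj (d * of_real ((- t) ^ k * u))) / 2"
    unfolding * by (simp add: power_minus [of t] distrib_right distrib_left mult_ac add_divide_distrib)
  finally show ?thesis by simp
qed

lemma integrable_g: "integrable lborel (g u)"
  unfolding g_def [abs_def]
  by (intro Bochner_Integration.integrable_sum integrable_mult_right integrable_poly_gauss v)

lemma g_fourier: "(CLINT y|lborel. of_real (g u y) * iexp (t * y)) = (E u t + cnj (E u (- t))) / 2"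
proof -
  define h where "h k y = of_real (poly (hermite v k) y * gauss_n v y) * iexp (t * y)" for k y
  have int: "integrable lborel (h k)" for k
    unfolding h_def
    by (rule Bochner_Integration.integrable_bound [OF integrable_poly_gauss [OF v, of "hermite v k"]])
      (auto simp: norm_mult abs_mult)
  have hf: "(CLINT y|lborel. h k y) = (- \<i> * of_real t) ^ k * of_real (exp (- (v * t\<^sup>2) / 2))" for k
    unfolding h_def by (rule hermite_fourier [OF v])
  have "of_real (g u y) * iexp (t * y) = (\<Sum>m\<le>r. \<Sum>j\<le>r. of_real (\<kappa> m j * u ^ j * (-1) ^ j) * h (2 * m + j) y)" for y
    by (simp add: g_def h_def sum_distrib_right mult.assoc)
  then have "(CLINT y|lborel. of_real (g u y) * iexp (t * y)) =
     (CLINT y|lborel. (\<Sum>m\<le>r. \<Sum>j\<le>r. of_real (\<kappa> m j * u ^ j * (-1) ^ j) * h (2 * m + j) y))" by simp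
  also have "\<dots> = (\<Sum>m\<le>r. \<Sum>j\<le>r. of_real (\<kappa> m j * u ^ j * (-1) ^ j) * (CLINT y|lborel. h (2 * m + j) y))"
    by (simp only: Bochner_Integration.integral_sum int Bochner_Integration.integrable_sum integrable_mult_right integral_mult_right_zero)
  also have "\<dots> = (\<Sum>m\<le>r. \<Sum>j\<le>r. of_real (exp (- (v * t\<^sup>2) / 2)) * (of_real (\<kappa> m j * u ^ j) * (\<i> * of_real t) ^ (2 * m + j)))"
  proof (intro sum.cong refl)
    fix m j
    have "(- \<i> * of_real t) ^ (2 * m + j) = (-1) ^ j * (\<i> * of_real t) ^ (2 * m + j)"
    proof -
      have "(- \<i> * complex_of_real t) = (-1) * (\<i> * of_real t)" by simp
      then have "(- \<i> * complex_of_real t) ^ (2 * m + j) = (-1) ^ (2 * m + j) * (\<i> * of_real t) ^ (2 * m + j)"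
        by (simp only: power_mult_distrib)
      then show ?thesis by (simp add: power_add power_mult)
    qed
    moreover have "(-1) ^ j * (-1) ^ j = (1 :: complex)" by (simp flip: power_mult_distrib)
    ultimately show "of_real (\<kappa> m j * u ^ j * (-1) ^ j) * (CLINT y|lborel. h (2 * m + j) y)
      = of_real (exp (- (v * t\<^sup>2) / 2)) * (of_real (\<kappa> m j * u ^ j) * (\<i> * of_real t) ^ (2 * m + j))"
      unfolding hf by (simp add: mult_ac)
  qed
  also have "\<dots> = (\<Sum>m\<le>r. \<Sum>j\<le>r. of_real (exp (- (v * t\<^sup>2) / 2)) *
      ((D m j * of_real (t ^ (2 * m + j) * u ^ j) + cnj (D m j * of_real ((- t) ^ (2 * m + j) * u ^ j))) / 2))"
    unfolding symmetrize_term \<kappa>_def ..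
  also have "\<dots> = (E u t + cnj (E u (- t))) / 2"
    by (simp add: E_def sum_distrib_left distrib_left sum.distrib add_divide_distrib sum_divide_distrib)
  finally show ?thesis .
qed

text \<open>As \<open>edge_poly q b m\<close> starts at order \<open>m\<close>, only
  \<open>m = 0\<close> contributes at \<open>u = 0\<close>, and \<open>b\<close> has constant term
  1: the leading term is the Gaussian itself.\<close>

lemma \<kappa>_0: "\<kappa> m 0 = (if m = 0 then 1 else 0)"
  using coeff_edge_poly_less [of 0 m q b] b0
  by (auto simp: \<kappa>_def D_def edge_poly_def poly_0_coeff_0)

lemma g_cdf: "(LINT y|lborel. g u y * indicator {..z} y) = gauss_N v z + (\<Sum>p=1..r. poly (P p) z * u ^ p) * gauss_n v z"
proof -
  define c where "c k = (LINT y|lborel. poly (hermite v k) y * gauss_n v y * indicator {..z} y)" for k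
  have int: "integrable lborel (\<lambda>y. poly (hermite v k) y * gauss_n v y * indicator {..z} y)" for k
    by (rule Bochner_Integration.integrable_bound [OF integrable_poly_gauss [OF v, of "hermite v k"]])
      (auto simp: indicator_def)
  have c0: "c 0 = gauss_N v z" by (simp add: c_def gauss_N_eq)
  have cS: "c k = poly (hermite v (k - 1)) z * gauss_n v z" if "k \<ge> 1" for k
    using hermite_integral [OF v, of "k - 1" z] that by (simp add: c_def del: hermite.simps)
  have "g u y * indicator {..z} y = (\<Sum>m\<le>r. \<Sum>j\<le>r. (\<kappa> m j * u ^ j * (-1) ^ j) *
      (poly (hermite v (2 * m + j)) y * gauss_n v y * indicator {..z} y))" for y
    by (simp add: g_def sum_distrib_right mult.assoc)
  then have "(LINT y|lborel. g u y * indicator {..z} y) = (\<Sum>m\<le>r. \<Sum>j\<le>r. (\<kappa> m j * u ^ j * (-1) ^ j) * c (2 * m + j))"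
    by (simp only: c_def Bochner_Integration.integral_sum int Bochner_Integration.integrable_sum integrable_mult_right integral_mult_right_zero)
  also have "\<dots> = (\<Sum>j\<le>r. \<Sum>m\<le>r. (\<kappa> m j * u ^ j * (-1) ^ j) * c (2 * m + j))" by (rule sum.swap)
  also have "\<dots> = (\<Sum>m\<le>r. \<kappa> m 0 * c (2 * m)) + (\<Sum>j=1..r. \<Sum>m\<le>r. (\<kappa> m j * u ^ j * (-1) ^ j) * c (2 * m + j))"
  proof -
    have "(\<Sum>j\<le>r. f j) = f 0 + (\<Sum>j=1..r. f j)" for f :: "nat \<Rightarrow> real"
      by (simp add: sum.atMost_shift sum.atLeast1_atMost_eq)
    from this [of "\<lambda>j. \<Sum>m\<le>r. (\<kappa> m j * u ^ j * (-1) ^ j) * c (2 * m + j)"] show ?thesis by simp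
  qed
  also have "(\<Sum>m\<le>r. \<kappa> m 0 * c (2 * m)) = (\<Sum>m\<le>r. if m = 0 then gauss_N v z else 0)"
    by (intro sum.cong refl) (simp add: \<kappa>_0 c0)
  also have "\<dots> = gauss_N v z" by simp
  also have "(\<Sum>j=1..r. \<Sum>m\<le>r. (\<kappa> m j * u ^ j * (-1) ^ j) * c (2 * m + j)) = (\<Sum>p=1..r. poly (P p) z * u ^ p) * gauss_n v z"
    unfolding sum_distrib_right
  proof (intro sum.cong refl)
    fix j assume "j \<in> {1..r}"
    then have "(\<Sum>m\<le>r. (\<kappa> m j * u ^ j * (-1) ^ j) * c (2 * m + j)) =
       (\<Sum>m\<le>r. (\<kappa> m j * u ^ j * (-1) ^ j) * (poly (hermite v (2 * m + j - 1)) z * gauss_n v z))"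
      by (intro sum.cong refl) (simp add: cS)
    also have "\<dots> = poly (P j) z * u ^ j * gauss_n v z"
      by (simp add: P_def poly_sum sum_distrib_right sum_distrib_left mult_ac)
    finally show "(\<Sum>m\<le>r. (\<kappa> m j * u ^ j * (-1) ^ j) * c (2 * m + j)) = poly (P j) z * u ^ j * gauss_n v z" .
  qed
  finally show ?thesis .
qed

lemma g_bounded: obtains C where "C \<ge> 0" "\<And>u y. 0 \<le> u \<Longrightarrow> u \<le> 1 \<Longrightarrow> \<bar>g u y\<bar> \<le> C"
proof -
  have "\<exists>C\<ge>0. \<forall>y. \<bar>poly (hermite v k) y * gauss_n v y\<bar> \<le> C" for k
  proof -
    obtain C where C: "C \<ge> 0" "\<And>y. \<bar>poly (hermite v k) y * gauss_n v y\<bar> \<le> C * exp (- (y\<^sup>2 / (4 * v)))"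
      using poly_gauss_bound [OF v] by blast
    have "C * exp (- (y\<^sup>2 / (4 * v))) \<le> C * 1" for y using C(1) v by (intro mult_left_mono) auto
    then show ?thesis using C by (metis mult.right_neutral order_trans)
  qed
  then obtain C where C: "\<And>k. C k \<ge> 0" "\<And>k y. \<bar>poly (hermite v k) y * gauss_n v y\<bar> \<le> C k" by metis
  show ?thesis
  proof (rule that [of "\<Sum>m\<le>r. \<Sum>j\<le>r. \<bar>\<kappa> m j\<bar> * C (2 * m + j)"])
    show "0 \<le> (\<Sum>m\<le>r. \<Sum>j\<le>r. \<bar>\<kappa> m j\<bar> * C (2 * m + j))" using C by (intro sum_nonneg) auto
    fix u y :: real assume u: "0 \<le> u" "u \<le> 1"
    have "\<bar>\<kappa> m j * u ^ j * (-1) ^ j * (poly (hermite v (2 * m + j)) y * gauss_n v y)\<bar> \<le> \<bar>\<kappa> m j\<bar> * C (2 * m + j)" for m j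
    proof -
      have "\<bar>\<kappa> m j * u ^ j * (-1) ^ j * (poly (hermite v (2 * m + j)) y * gauss_n v y)\<bar>
        = (\<bar>\<kappa> m j\<bar> * u ^ j) * \<bar>poly (hermite v (2 * m + j)) y * gauss_n v y\<bar>"
        using u by (simp add: abs_mult power_abs)
      also have "\<dots> \<le> (\<bar>\<kappa> m j\<bar> * 1) * C (2 * m + j)"
        using u C by (intro mult_mono mult_left_mono) (auto simp: power_le_one)
      finally show ?thesis by simp
    qed
    then show "\<bar>g u y\<bar> \<le> (\<Sum>m\<le>r. \<Sum>j\<le>r. \<bar>\<kappa> m j\<bar> * C (2 * m + j))"
      unfolding g_def by (intro order_trans [OF sum_abs] sum_mono) auto
  qed
qed

text \<open>The powers of \<open>t\<close> cost half of the Gaussian exponent.\<close>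

lemma E_bound: obtains C where "C \<ge> 0" "\<And>u t. 0 \<le> u \<Longrightarrow> u \<le> 1 \<Longrightarrow> cmod (E u t) \<le> C * exp (- (v / 4 * t\<^sup>2))"
proof -
  have "\<exists>C\<ge>0. \<forall>x. \<bar>x\<bar> ^ k \<le> C * exp (v / 4 * x\<^sup>2)" for k
    using power_le_exp_square [of "v / 4" k] v by auto
  then obtain C where C: "\<And>k. C k \<ge> 0" "\<And>k x. \<bar>x\<bar> ^ k \<le> C k * exp (v / 4 * x\<^sup>2)" by metis
  show ?thesis
  proof (rule that [of "\<Sum>m\<le>r. \<Sum>j\<le>r. cmod (D m j) * C (2 * m + j)"])
    show "0 \<le> (\<Sum>m\<le>r. \<Sum>j\<le>r. cmod (D m j) * C (2 * m + j))" using C by (intro sum_nonneg) auto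
    fix u t :: real assume u: "0 \<le> u" "u \<le> 1"
    have "cmod (D m j * of_real (t ^ (2 * m + j) * u ^ j)) \<le> cmod (D m j) * C (2 * m + j) * exp (v / 4 * t\<^sup>2)" for m j
    proof -
      have "cmod (D m j * of_real (t ^ (2 * m + j) * u ^ j)) = cmod (D m j) * (\<bar>t\<bar> ^ (2 * m + j) * u ^ j)"
        using u by (simp add: norm_mult norm_power abs_mult power_abs)
      also have "\<dots> \<le> cmod (D m j) * ((C (2 * m + j) * exp (v / 4 * t\<^sup>2)) * 1)"
        using u C by (intro mult_left_mono mult_mono) (auto simp: power_le_one)
      finally show ?thesis by simp
    qed
    then have "cmod (\<Sum>m\<le>r. \<Sum>j\<le>r. D m j * of_real (t ^ (2 * m + j) * u ^ j)) \<le> (\<Sum>m\<le>r. \<Sum>j\<le>r. cmod (D m j) * C (2 * m + j) * exp (v / 4 * t\<^sup>2))"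
      by (intro order_trans [OF norm_sum] sum_mono) auto
    also have "\<dots> = (\<Sum>m\<le>r. \<Sum>j\<le>r. cmod (D m j) * C (2 * m + j)) * exp (v / 4 * t\<^sup>2)"
      by (simp add: sum_distrib_right)
    finally have "cmod (E u t) \<le> exp (- (v * t\<^sup>2) / 2) * ((\<Sum>m\<le>r. \<Sum>j\<le>r. cmod (D m j) * C (2 * m + j)) * exp (v / 4 * t\<^sup>2))"
      unfolding E_def norm_mult by (intro mult_mono) auto
    also have "\<dots> = (\<Sum>m\<le>r. \<Sum>j\<le>r. cmod (D m j) * C (2 * m + j)) * (exp (- (v * t\<^sup>2) / 2) * exp (v / 4 * t\<^sup>2))"
      by (simp only: mult_ac)
    also have "exp (- (v * t\<^sup>2) / 2) * exp (v / 4 * t\<^sup>2) = exp (- (v / 4 * t\<^sup>2))" by (simp flip: exp_add)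
    finally show "cmod (E u t) \<le> (\<Sum>m\<le>r. \<Sum>j\<le>r. cmod (D m j) * C (2 * m + j)) * exp (- (v / 4 * t\<^sup>2))" .
  qed
qed

text \<open>The order of quantifiers matters: \<open>C\<close> is independent of \<epsilon>, and
  only the radius \<open>d\<close> shrinks with it. This turns the Peano remainders into an
  o-term.\<close>

lemma near_bound:
  obtains C where "C \<ge> 0" "\<And>\<epsilon>. 0 < \<epsilon> \<Longrightarrow> \<epsilon> \<le> 1 \<Longrightarrow> \<exists>d>0. d \<le> \<delta>0 \<and> d \<le> 1 \<and> (\<forall>N t. N \<ge> 1 \<longrightarrow> t \<noteq> 0 \<longrightarrow> \<bar>t\<bar> / sqrt (real N) \<le> d \<longrightarrow>
     cmod (\<phi> N t - E (1 / sqrt (real N)) t) / \<bar>t\<bar> \<le>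
       C * (\<epsilon> * (1 / sqrt (real N)) ^ r + (1 / sqrt (real N)) ^ Suc r) * exp (- (v / 8 * t\<^sup>2)) + C0 * real N * \<theta>0 ^ N)"
proof -
  have v8: "v / 8 > 0" using v by simp
  obtain d0 C where loc: "d0 > 0" "d0 \<le> 1" "C \<ge> 0"
    "\<And>\<epsilon> s t y a. 0 \<le> \<epsilon> \<Longrightarrow> \<epsilon> \<le> 1 \<Longrightarrow> \<bar>s\<bar> \<le> d0 \<Longrightarrow> cmod y \<le> \<epsilon> * t\<^sup>2 * \<bar>s\<bar> ^ r \<Longrightarrow>
      cmod (a - poly b (of_real s)) \<le> \<epsilon> * \<bar>s\<bar> ^ r \<Longrightarrow>
      cmod (exp (of_real (t\<^sup>2) * (of_real s * poly q (of_real s)) + y) * a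
        - (\<Sum>m\<le>r. of_real (t\<^sup>2) ^ m * (\<Sum>j\<le>r. coeff (edge_poly q b m) j * of_real s ^ j)))
      \<le> C * exp (2 * (v / 8) * t\<^sup>2) * (\<epsilon> * \<bar>s\<bar> ^ r + \<bar>s\<bar> ^ Suc r)"
  proof (rule edgeworth_local [OF v8 r, where q = q and b = b], goal_cases)
    case (1 d0 C)
    show ?case by (rule 1(1)) (fact 1)+
  qed
  \<comment> \<open>Division by \<open>\<bar>t\<bar>\<close> lowers the powers \<open>r\<close> and
    \<open>r + 1\<close> of \<open>t\<close> to \<open>r - 1\<close> and \<open>r\<close>; the first
    is harmless at 0 because \<open>r \<ge> 1\<close>.\<close>
  obtain K1 where K1: "K1 \<ge> 0" "\<And>x. \<bar>x\<bar> ^ (r - 1) \<le> K1 * exp (v / 8 * x\<^sup>2)" using power_le_exp_square [OF v8] by blast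
  obtain K2 where K2: "K2 \<ge> 0" "\<And>x. \<bar>x\<bar> ^ r \<le> K2 * exp (v / 8 * x\<^sup>2)" using power_le_exp_square [OF v8] by blast
  show ?thesis
  proof (rule that [of "C * (K1 + K2)"])
    show "0 \<le> C * (K1 + K2)" using loc K1 K2 by simp
    fix \<epsilon> :: real assume \<epsilon>: "0 < \<epsilon>" "\<epsilon> \<le> 1"
    obtain d1 where d1: "d1 > 0" "\<And>s. \<bar>s\<bar> \<le> d1 \<Longrightarrow>
       cmod (\<mu> s - (\<i> * of_real (A * s) - of_real (v * s\<^sup>2 / 2) + of_real s ^ 3 * poly q (of_real s))) \<le> \<epsilon> * \<bar>s\<bar> ^ (r + 2) \<and>
       cmod (a s - poly b (of_real s)) \<le> \<epsilon> * \<bar>s\<bar> ^ r" using near [OF \<epsilon>(1)] by blast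
    define d where "d = min d1 (min d0 \<delta>0)"
    show "\<exists>d>0. d \<le> \<delta>0 \<and> d \<le> 1 \<and> (\<forall>N t. N \<ge> 1 \<longrightarrow> t \<noteq> 0 \<longrightarrow> \<bar>t\<bar> / sqrt (real N) \<le> d \<longrightarrow>
     cmod (\<phi> N t - E (1 / sqrt (real N)) t) / \<bar>t\<bar> \<le>
       C * (K1 + K2) * (\<epsilon> * (1 / sqrt (real N)) ^ r + (1 / sqrt (real N)) ^ Suc r) * exp (- (v / 8 * t\<^sup>2)) + C0 * real N * \<theta>0 ^ N)"
    proof (intro exI [of _ d] conjI allI impI)
      show "d > 0" "d \<le> \<delta>0" "d \<le> 1" using d1 loc approx by (auto simp: d_def)
      fix N :: nat and t :: real
      assume N: "N \<ge> 1" and t: "t \<noteq> 0" and td: "\<bar>t\<bar> / sqrt (real N) \<le> d"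
      define u where "u = 1 / sqrt (real N)"
      define s where "s = t * u"
      have u: "0 < u" "u \<le> 1" "real N * u\<^sup>2 = 1" "real N * u = sqrt (real N)"
        using N by (auto simp: u_def power_divide real_div_sqrt)
      have s_eq: "t / sqrt (real N) = s" by (simp add: s_def u_def)
      have sd: "\<bar>s\<bar> \<le> d1" "\<bar>s\<bar> \<le> d0" "\<bar>s\<bar> \<le> \<delta>0" using td by (auto simp: s_def u_def d_def abs_mult)
      have su: "\<bar>s\<bar> = \<bar>t\<bar> * u" using u by (simp add: s_def abs_mult)
      \<comment> \<open>The Taylor remainder of the exponent after \<open>N\<close> summands. Since
        \<open>real N * s\<^sup>2 = t\<^sup>2\<close>, its order drops from \<open>r + 2\<close> to
        \<open>r\<close>, as \<open>edgeworth_local\<close> expects.\<close>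
      define y where "y = of_nat N * (\<mu> s - (\<i> * of_real (A * s) - of_real (v * s\<^sup>2 / 2) + of_real s ^ 3 * poly q (of_real s)))"
      have Ns2: "real N * s\<^sup>2 = t\<^sup>2" using u by (simp add: s_def power_mult_distrib)
      have "cmod y \<le> real N * (\<epsilon> * \<bar>s\<bar> ^ (r + 2))"
        unfolding y_def norm_mult norm_of_nat using d1(2) [OF sd(1)] by (intro mult_left_mono) auto
      also have "\<dots> = \<epsilon> * (real N * s\<^sup>2) * \<bar>s\<bar> ^ r" by (simp add: power_add power2_eq_square)
      finally have y: "cmod y \<le> \<epsilon> * t\<^sup>2 * \<bar>s\<bar> ^ r" by (simp only: Ns2)
      have "of_nat N * \<mu> s = of_nat N * (\<i> * of_real (A * s)) - of_real (v * (real N * s\<^sup>2) / 2)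
          + of_real (real N * s\<^sup>2) * (of_real s * poly q (of_real s)) + y"
        by (simp add: y_def algebra_simps power2_eq_square power3_eq_cube)
      also have "of_nat N * (\<i> * of_real (A * s)) = \<i> * of_real (A * sqrt (real N) * t)"
        unfolding u(4) [symmetric] by (simp add: s_def)
      finally have Nmu: "- (\<i> * of_real (A * sqrt (real N) * t)) + of_nat N * \<mu> s
         = of_real (- (v * t\<^sup>2) / 2) + (of_real (t\<^sup>2) * (of_real s * poly q (of_real s)) + y)"
        unfolding Ns2 by simp
      have E_eq: "E u t = of_real (exp (- (v * t\<^sup>2) / 2)) *
          (\<Sum>m\<le>r. of_real (t\<^sup>2) ^ m * (\<Sum>j\<le>r. coeff (edge_poly q b m) j * of_real s ^ j))"
      proof -
        have "of_real (t ^ (2 * m + j) * u ^ j) = of_real (t\<^sup>2) ^ m * (of_real s ^ j :: complex)" for m j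
        proof -
          have "t ^ (2 * m + j) * u ^ j = (t\<^sup>2) ^ m * s ^ j"
            unfolding power_add power_mult s_def by (simp only: power_mult_distrib mult.assoc)
          then show ?thesis by (simp only: of_real_mult of_real_power)
        qed
        then show ?thesis unfolding E_def D_def by (simp only: sum_distrib_left mult.left_commute)
      qed
      define W where "W = exp (of_real (t\<^sup>2) * (of_real s * poly q (of_real s)) + y) * a s
        - (\<Sum>m\<le>r. of_real (t\<^sup>2) ^ m * (\<Sum>j\<le>r. coeff (edge_poly q b m) j * of_real s ^ j))"
      have W: "cmod W \<le> C * exp (2 * (v / 8) * t\<^sup>2) * (\<epsilon> * \<bar>s\<bar> ^ r + \<bar>s\<bar> ^ Suc r)"
        unfolding W_def using \<epsilon> d1(2) [OF sd(1)] by (intro loc(4) sd(2) y) auto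
      have main: "exp (- (\<i> * of_real (A * sqrt (real N) * t))) * (exp (of_nat N * \<mu> s) * a s) - E u t
         = of_real (exp (- (v * t\<^sup>2) / 2)) * W"
      proof -
        have "exp (- (\<i> * of_real (A * sqrt (real N) * t))) * exp (of_nat N * \<mu> s)
          = of_real (exp (- (v * t\<^sup>2) / 2)) * exp (of_real (t\<^sup>2) * (of_real s * poly q (of_real s)) + y)"
          unfolding exp_add [symmetric] Nmu by (simp only: exp_add exp_of_real)
        then show ?thesis unfolding W_def E_eq by (simp only: mult.assoc [symmetric] right_diff_distrib)
      qed
      have err: "cmod (\<phi> N t - exp (- (\<i> * of_real (A * sqrt (real N) * t))) * (exp (of_nat N * \<mu> s) * a s)) \<le> C0 * real N * \<theta>0 ^ N * \<bar>s\<bar>"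
      proof -
        have "\<phi> N t - exp (- (\<i> * of_real (A * sqrt (real N) * t))) * (exp (of_nat N * \<mu> s) * a s)
          = exp (- (\<i> * of_real (A * sqrt (real N) * t))) * (\<psi> N s - exp (of_nat N * \<mu> s) * a s)"
          unfolding \<phi>_eq [OF N] s_eq by (simp only: right_diff_distrib)
        then show ?thesis using approx(5) [OF N sd(3)] by (simp add: norm_mult \<psi>_def)
      qed
      have "cmod (\<phi> N t - E u t) \<le> exp (- (v * t\<^sup>2) / 2) * (C * exp (2 * (v / 8) * t\<^sup>2) * (\<epsilon> * \<bar>s\<bar> ^ r + \<bar>s\<bar> ^ Suc r))
          + C0 * real N * \<theta>0 ^ N * \<bar>s\<bar>"
      proof -
        have "cmod (of_real (exp (- (v * t\<^sup>2) / 2)) * W) \<le> exp (- (v * t\<^sup>2) / 2) * (C * exp (2 * (v / 8) * t\<^sup>2) * (\<epsilon> * \<bar>s\<bar> ^ r + \<bar>s\<bar> ^ Suc r))"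
          unfolding norm_mult using W by (simp add: mult_left_mono)
        note W' = this
        have "cmod (x - z) \<le> p + p'" if "cmod (y - z) \<le> p" "cmod (x - y) \<le> p'" for x y z p p'
          using norm_triangle_ineq [of "x - y" "y - z"] that by simp
        note tri = this
        show ?thesis
          by (rule tri [OF _ err]) (simp only: main W')
      qed
      then have "cmod (\<phi> N t - E u t) / \<bar>t\<bar> \<le> (exp (- (v * t\<^sup>2) / 2) * (C * exp (2 * (v / 8) * t\<^sup>2) * (\<epsilon> * \<bar>s\<bar> ^ r + \<bar>s\<bar> ^ Suc r))
          + C0 * real N * \<theta>0 ^ N * \<bar>s\<bar>) / \<bar>t\<bar>"
        by (rule divide_right_mono) simp
      also have "\<dots> = exp (- (v * t\<^sup>2) / 2) * (C * exp (2 * (v / 8) * t\<^sup>2) * (\<epsilon> * (\<bar>t\<bar> ^ (r - 1) * u ^ r) + \<bar>t\<bar> ^ r * u ^ Suc r))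
          + C0 * real N * \<theta>0 ^ N * u"
      proof -
        have "\<bar>s\<bar> ^ r / \<bar>t\<bar> = \<bar>t\<bar> ^ (r - 1) * u ^ r" "\<bar>s\<bar> ^ Suc r / \<bar>t\<bar> = \<bar>t\<bar> ^ r * u ^ Suc r" "\<bar>s\<bar> / \<bar>t\<bar> = u"
          using t r by (cases r; simp add: su power_mult_distrib)+
        moreover have "(x * (y * (\<epsilon> * p + p')) + z * p'') / \<bar>t\<bar> = x * (y * (\<epsilon> * (p / \<bar>t\<bar>) + p' / \<bar>t\<bar>)) + z * (p'' / \<bar>t\<bar>)"
          for x y z p p' p'' by (simp add: add_divide_distrib distrib_left)
        ultimately show ?thesis by (simp only:)
      qed
      also have "\<dots> \<le> exp (- (v * t\<^sup>2) / 2) * (C * exp (2 * (v / 8) * t\<^sup>2) *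
           (((K1 + K2) * exp (v / 8 * t\<^sup>2)) * (\<epsilon> * u ^ r + u ^ Suc r))) + C0 * real N * \<theta>0 ^ N * 1"
      proof (intro add_mono mult_left_mono)
        have "\<epsilon> * (\<bar>t\<bar> ^ (r - 1) * u ^ r) + \<bar>t\<bar> ^ r * u ^ Suc r \<le> \<epsilon> * ((K1 * exp (v / 8 * t\<^sup>2)) * u ^ r) + (K2 * exp (v / 8 * t\<^sup>2)) * u ^ Suc r"
          using \<epsilon> u by (intro add_mono mult_left_mono mult_right_mono K1 K2) auto
        also have "\<dots> \<le> \<epsilon> * (((K1 + K2) * exp (v / 8 * t\<^sup>2)) * u ^ r) + ((K1 + K2) * exp (v / 8 * t\<^sup>2)) * u ^ Suc r"
          using \<epsilon> u K1(1) K2(1) by (intro add_mono mult_left_mono mult_right_mono) auto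
        also have "\<dots> = ((K1 + K2) * exp (v / 8 * t\<^sup>2)) * (\<epsilon> * u ^ r + u ^ Suc r)" by (simp add: algebra_simps)
        finally show "\<epsilon> * (\<bar>t\<bar> ^ (r - 1) * u ^ r) + \<bar>t\<bar> ^ r * u ^ Suc r \<le> ((K1 + K2) * exp (v / 8 * t\<^sup>2)) * (\<epsilon> * u ^ r + u ^ Suc r)" .
      qed (use loc approx u in auto)
      also have "exp (- (v * t\<^sup>2) / 2) * (C * exp (2 * (v / 8) * t\<^sup>2) * (((K1 + K2) * exp (v / 8 * t\<^sup>2)) * (\<epsilon> * u ^ r + u ^ Suc r)))
         = C * (K1 + K2) * (\<epsilon> * u ^ r + u ^ Suc r) * (exp (- (v * t\<^sup>2) / 2) * exp (2 * (v / 8) * t\<^sup>2) * exp (v / 8 * t\<^sup>2))"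
        by (simp only: mult_ac)
      \<comment> \<open>The budget of exponents: -v/2 from the Gaussian, +v/4 from
        \<open>edgeworth_local\<close> with \<open>c = v / 8\<close>, and +v/8 from the powers of
        \<open>t\<close>.\<close>
      also have "exp (- (v * t\<^sup>2) / 2) * exp (2 * (v / 8) * t\<^sup>2) * exp (v / 8 * t\<^sup>2) = exp (- (v / 8 * t\<^sup>2))"
        by (simp flip: exp_add)
      finally show "cmod (\<phi> N t - E (1 / sqrt (real N)) t) / \<bar>t\<bar> \<le>
       C * (K1 + K2) * (\<epsilon> * (1 / sqrt (real N)) ^ r + (1 / sqrt (real N)) ^ Suc r) * exp (- (v / 8 * t\<^sup>2)) + C0 * real N * \<theta>0 ^ N"
        by (simp add: u_def)
    qed
  qed
qed

end

lemma integral_indicator_symmetric: "b \<ge> 0 \<Longrightarrow> (LINT t|lborel. c * indicator {- b..b :: real} t) = 2 * c * b"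
  by simp

context edgeworth
begin

text \<open>Beyond \<open>\<bar>t\<bar> * u = d\<close> a factor
  \<open>(\<bar>t\<bar> * u / d) ^ Suc r\<close> may be inserted for free. It supplies one power of
  \<open>u\<close> more than the order of the expansion, and its powers of \<open>t\<close> vanish
  in the Gaussian.\<close>

lemma far_bound:
  obtains C where "C \<ge> 0" "\<And>d u t. 0 < d \<Longrightarrow> 0 < u \<Longrightarrow> u \<le> 1 \<Longrightarrow> d < \<bar>t\<bar> * u \<Longrightarrow>
    cmod (E u t) / \<bar>t\<bar> \<le> C / d ^ Suc r * u ^ Suc r * exp (- (v / 8 * t\<^sup>2))"
proof -
  obtain CE where CE: "CE \<ge> 0" "\<And>u t. 0 \<le> u \<Longrightarrow> u \<le> 1 \<Longrightarrow> cmod (E u t) \<le> CE * exp (- (v / 4 * t\<^sup>2))"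
    using E_bound by blast
  have v8: "v / 8 > 0" using v by simp
  obtain K3 where K3: "K3 \<ge> 0" "\<And>x. \<bar>x\<bar> ^ r \<le> K3 * exp (v / 8 * x\<^sup>2)" using power_le_exp_square [OF v8] by blast
  show ?thesis
  proof (rule that [of "CE * K3"])
    show "0 \<le> CE * K3" using CE K3 by simp
    fix d u t :: real assume d: "0 < d" and u: "0 < u" "u \<le> 1" and dt: "d < \<bar>t\<bar> * u"
    have t: "\<bar>t\<bar> > 0" using d dt by (auto simp: zero_less_abs_iff)
    have "1 ^ Suc r \<le> (\<bar>t\<bar> * u / d) ^ Suc r" using d dt by (intro power_mono) (auto simp: field_simps)
    then have "1 / \<bar>t\<bar> \<le> (\<bar>t\<bar> * u / d) ^ Suc r / \<bar>t\<bar>" using t by (intro divide_right_mono) auto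
    also have "\<dots> = \<bar>t\<bar> ^ r * (u ^ Suc r / d ^ Suc r)" using t by (simp add: power_mult_distrib power_divide)
    also have "\<dots> \<le> (K3 * exp (v / 8 * t\<^sup>2)) * (u ^ Suc r / d ^ Suc r)" using u d by (intro mult_right_mono K3) auto
    finally have 1: "1 / \<bar>t\<bar> \<le> (K3 * exp (v / 8 * t\<^sup>2)) * (u ^ Suc r / d ^ Suc r)" .
    have "cmod (E u t) * (1 / \<bar>t\<bar>) \<le> (CE * exp (- (v / 4 * t\<^sup>2))) * ((K3 * exp (v / 8 * t\<^sup>2)) * (u ^ Suc r / d ^ Suc r))"
      using CE u by (intro mult_mono 1 CE(2)) auto
    also have "\<dots> = CE * K3 / d ^ Suc r * u ^ Suc r * (exp (- (v / 4 * t\<^sup>2)) * exp (v / 8 * t\<^sup>2))"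
      by (simp add: field_simps)
    also have "exp (- (v / 4 * t\<^sup>2)) * exp (v / 8 * t\<^sup>2) = exp (- (v / 8 * t\<^sup>2))"
      by (simp flip: exp_add)
    finally show "cmod (E u t) / \<bar>t\<bar> \<le> CE * K3 / d ^ Suc r * u ^ Suc r * exp (- (v / 8 * t\<^sup>2))" by simp
  qed
qed

text \<open>A characteristic function already has the conjugation symmetry, so replacing
  \<open>E\<close> by its symmetrization, the transform of the real density \<open>g u\<close>, does
  not enlarge the error.\<close>

lemma symmetrized_difference:
  assumes "\<And>t. t \<noteq> 0 \<Longrightarrow> cmod (\<phi> N t - E u t) / \<bar>t\<bar> * w t \<le> H t"
    and "\<And>t. H (- t) = H t" "\<And>t. w (- t) = w t" "\<And>t. w t \<ge> 0" and t: "t \<noteq> 0"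
  shows "cmod (\<phi> N t - (CLINT y|lborel. of_real (g u y) * iexp (t * y))) / \<bar>t\<bar> * w t \<le> H t"
proof -
  have eq: "\<phi> N t - (E u t + cnj (E u (- t))) / 2 = ((\<phi> N t - E u t) + cnj (\<phi> N (- t) - E u (- t))) / 2"
    by (simp add: \<phi>_cnj field_simps)
  have "cmod (\<phi> N t - (E u t + cnj (E u (- t))) / 2) \<le> (cmod (\<phi> N t - E u t) + cmod (\<phi> N (- t) - E u (- t))) / 2"
    unfolding eq using norm_triangle_ineq [of "\<phi> N t - E u t" "cnj (\<phi> N (- t) - E u (- t))"]
    by (simp only: norm_divide complex_mod_cnj norm_numeral divide_right_mono)
  then have "cmod (\<phi> N t - (E u t + cnj (E u (- t))) / 2) / \<bar>t\<bar> * w t \<le>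
      (cmod (\<phi> N t - E u t) + cmod (\<phi> N (- t) - E u (- t))) / 2 / \<bar>t\<bar> * w t"
    using assms(4) by (intro mult_right_mono divide_right_mono) auto
  also have "\<dots> = (cmod (\<phi> N t - E u t) / \<bar>t\<bar> * w t + cmod (\<phi> N (- t) - E u (- t)) / \<bar>- t\<bar> * w (- t)) / 2"
    using t by (simp add: assms(3) field_simps)
  also have "\<dots> \<le> (H t + H (- t)) / 2"
    using t by (intro divide_right_mono add_mono assms(1)) auto
  finally show ?thesis unfolding g_fourier by (simp only: assms(2)) simp
qed

text \<open>The smoothing inequality reduces the claim to a majorant \<open>H\<close> of the damped
  Fourier difference. Every part of its integral decays faster than \<open>N powr (-r/2)\<close>
  except the one carrying \<epsilon>, which is made small by shrinking the neighbourhood of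
  0.\<close>

theorem expansion:
  assumes \<epsilon>0: "\<epsilon>0 > 0"
  shows "\<forall>\<^sub>F N in sequentially. \<forall>z. \<bar>prob {\<omega> \<in> space M. Y N \<omega> \<le> z} - gauss_N v z
      - (\<Sum>p=1..r. poly (P p) z / real N powr (real p / 2)) * gauss_n v z\<bar> \<le> \<epsilon>0 * real N powr (- real r / 2)"
proof -
  obtain Cg where Cg: "Cg \<ge> 0" "\<And>u y. 0 \<le> u \<Longrightarrow> u \<le> 1 \<Longrightarrow> \<bar>g u y\<bar> \<le> Cg" using g_bounded by blast
  obtain Cn where Cn: "Cn \<ge> 0" "\<And>\<epsilon>. 0 < \<epsilon> \<Longrightarrow> \<epsilon> \<le> 1 \<Longrightarrow> \<exists>d>0. d \<le> \<delta>0 \<and> d \<le> 1 \<and> (\<forall>N t. N \<ge> 1 \<longrightarrow> t \<noteq> 0 \<longrightarrow> \<bar>t\<bar> / sqrt (real N) \<le> d \<longrightarrow>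
     cmod (\<phi> N t - E (1 / sqrt (real N)) t) / \<bar>t\<bar> \<le>
       Cn * (\<epsilon> * (1 / sqrt (real N)) ^ r + (1 / sqrt (real N)) ^ Suc r) * exp (- (v / 8 * t\<^sup>2)) + C0 * real N * \<theta>0 ^ N)"
    using near_bound by metis
  obtain CF where CF: "CF \<ge> 0" "\<And>d u t. 0 < d \<Longrightarrow> 0 < u \<Longrightarrow> u \<le> 1 \<Longrightarrow> d < \<bar>t\<bar> * u \<Longrightarrow>
    cmod (E u t) / \<bar>t\<bar> \<le> CF / d ^ Suc r * u ^ Suc r * exp (- (v / 8 * t\<^sup>2))"
    using far_bound by metis
  define cI where "cI = sqrt (pi / (v / 8))"
  have cI: "cI > 0" using v by (simp add: cI_def)
  \<comment> \<open>Half of \<epsilon>0 is reserved for this term, the other half for the remainder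
    \<open>R\<close>; the added 1 avoids division by 0.\<close>
  define \<epsilon> where "\<epsilon> = min 1 (\<epsilon>0 / (2 * (Cn * cI + 1)))"
  have \<epsilon>: "0 < \<epsilon>" "\<epsilon> \<le> 1" using \<epsilon>0 Cn cI by (auto simp: \<epsilon>_def add_nonneg_pos)
  have \<epsilon>half: "Cn * \<epsilon> * cI \<le> \<epsilon>0 / 2"
  proof -
    have p: "Cn * cI + 1 > 0" using Cn cI by (simp add: add_nonneg_pos)
    have "(Cn * cI) * \<epsilon> \<le> (Cn * cI + 1) * (\<epsilon>0 / (2 * (Cn * cI + 1)))"
      using Cn cI \<epsilon> by (intro mult_mono) (auto simp: \<epsilon>_def)
    also have "\<dots> = \<epsilon>0 / 2" using p by (simp add: field_simps)
    finally show ?thesis by (simp add: mult_ac)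
  qed
  obtain d where d: "d > 0" "\<And>N t. N \<ge> 1 \<Longrightarrow> t \<noteq> 0 \<Longrightarrow> \<bar>t\<bar> / sqrt (real N) \<le> d \<Longrightarrow>
     cmod (\<phi> N t - E (1 / sqrt (real N)) t) / \<bar>t\<bar> \<le>
       Cn * (\<epsilon> * (1 / sqrt (real N)) ^ r + (1 / sqrt (real N)) ^ Suc r) * exp (- (v / 8 * t\<^sup>2)) + C0 * real N * \<theta>0 ^ N"
    using Cn(2) [OF \<epsilon>] by auto
  obtain Cm \<theta>m where Cm: "0 \<le> Cm" "0 < \<theta>m" "\<theta>m < 1"
    "\<And>N s. d \<le> \<bar>s\<bar> \<Longrightarrow> \<bar>s\<bar> \<le> K0 \<Longrightarrow> cmod (\<psi> N s) \<le> Cm * \<theta>m ^ N"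
    using mid [OF d(1)] unfolding \<psi>_def by blast
  define C4 where "C4 = CF / d ^ Suc r"
  have C4: "C4 \<ge> 0" using CF d by (simp add: C4_def)
  \<comment> \<open>Half of the excess of \<open>\<rho> + 1/2\<close> over \<open>r / 2\<close>.
    Thus the width \<tau> is smaller than \<open>N powr (-r/2)\<close> by
    \<open>N powr (-\<eta>)\<close>, while \<open>\<tau> N * T N = N powr \<eta>\<close> still
    grows, so the damping beyond \<open>T N\<close> beats every power.\<close>
  define \<eta> where "\<eta> = (\<rho> + 1/2 - real r / 2) / 2"
  have \<eta>: "\<eta> > 0" using high(2) by (simp add: \<eta>_def field_simps)
  \<comment> \<open>Makes the contribution of the high frequencies, multiplied by
    \<open>N powr (r/2)\<close>, equal to a constant times \<open>N powr (-1)\<close>.\<close>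
  define Q where "Q = \<rho> + real r / 2 + 1"
  have "0 \<le> (real r - 1) / 2" using r by simp
  then have \<rho>: "\<rho> > 0" using high(2) by linarith
  then have Q: "Q > 0" by (simp add: Q_def)
  define \<tau> where "\<tau> N = real N powr (- (real r / 2 + \<eta>))" for N
  define T where "T N = real N powr (\<rho> + 1/2)" for N
  define w where "w N t = exp (- ((\<tau> N)\<^sup>2 * t\<^sup>2) / 2)" for N t
  define a1 where "a1 N = Cn * (\<epsilon> * (1 / sqrt (real N)) ^ r + (1 / sqrt (real N)) ^ Suc r) + C4 * (1 / sqrt (real N)) ^ Suc r" for N
  define a2 where "a2 N = C0 * real N * \<theta>0 ^ N" for N
  define a3 where "a3 N = Cm * \<theta>m ^ N / (d * sqrt (real N))" for N
  define a4 where "a4 N = real N powr (- Q) / (K0 * sqrt (real N))" for N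
  define a5 where "a5 N = exp (- ((\<tau> N)\<^sup>2 * (T N)\<^sup>2) / 4) / T N" for N
  \<comment> \<open>The terms stand for: the Gaussian tails of the expansion, near and far
    (\<open>a1\<close>); the spectral remainder near 0 (\<open>a2\<close>); compact frequencies
    (\<open>a3\<close>); frequencies up to \<open>T N\<close> (\<open>a4\<close>); and those beyond
    (\<open>a5\<close>). All terms are nonnegative, so the ranges may overlap.\<close>
  define H where "H N t = a1 N * exp (- (v / 8 * t\<^sup>2)) + a2 N * indicator {- (d * sqrt (real N))..d * sqrt (real N)} t
     + a3 N * indicator {- (K0 * sqrt (real N))..K0 * sqrt (real N)} t + a4 N * indicator {- T N..T N} t
     + a5 N * exp (- ((\<tau> N)\<^sup>2 / 4 * t\<^sup>2))" for N t
  \<comment> \<open>The total error without its \<epsilon> term, scaled by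
    \<open>N powr (r/2)\<close>.\<close>
  define R where "R N = real N powr (real r / 2) * ((Cn + C4) * (1 / sqrt (real N)) ^ Suc r * cI
     + 2 * a2 N * (d * sqrt (real N)) + 2 * a3 N * (K0 * sqrt (real N)) + 2 * a4 N * T N
     + a5 N * sqrt (pi / ((\<tau> N)\<^sup>2 / 4)) + 8 * Cg * \<tau> N)" for N
  have pow: "(1 / sqrt (real N)) ^ j = real N powr (- (real j / 2))" if "N \<ge> 1" for N j :: nat
  proof -
    have N: "real N > 0" using that by simp
    have "1 / sqrt (real N) = real N powr (- (1/2))"
      using N powr_minus [of "real N" "1/2"] powr_half_sqrt [of "real N"] by (simp only: divide_inverse mult_1_left less_imp_le)
    moreover have "real N powr (- (1/2)) > 0" using N by simp
    ultimately have "(1 / sqrt (real N)) ^ j = (real N powr (- (1/2))) powr real j" by (simp only: powr_realpow)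
    then show ?thesis by (simp add: powr_powr)
  qed
  have R0: "R \<longlonglongrightarrow> 0"
  proof -
    have e: "\<forall>\<^sub>F N in sequentially. (Cn + C4) * cI * real N powr (- (1/2))
       + 2 * C0 * d * (real N powr (real r / 2 + 3/2) * \<theta>0 ^ N)
       + 2 * Cm * K0 / d * (real N powr (real r / 2) * \<theta>m ^ N)
       + 2 / K0 * real N powr (- 1)
       + 2 * sqrt pi * (real N powr (real r / 2 - \<eta>) * exp (- (real N powr (2 * \<eta>) / 4)))
       + 8 * Cg * real N powr (- \<eta>) = R N"
      using eventually_ge_at_top [of 1]
    proof eventually_elim
      case (elim N)
      then have N: "real N > 0" by simp
      have sq: "sqrt (real N) = real N powr (1/2)" using N by (simp add: powr_half_sqrt)
      have p1: "real N powr (real r / 2) * ((Cn + C4) * (1 / sqrt (real N)) ^ Suc r * cI) = (Cn + C4) * cI * real N powr (- (1/2))"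
      proof -
        have "real N powr (real r / 2) * real N powr (- (real (Suc r) / 2)) = real N powr (- (1/2))"
          by (simp flip: powr_add) (simp add: field_simps)
        then show ?thesis unfolding pow [OF elim] by (simp add: mult_ac)
      qed
      have p2: "real N powr (real r / 2) * (2 * a2 N * (d * sqrt (real N))) = 2 * C0 * d * (real N powr (real r / 2 + 3/2) * \<theta>0 ^ N)"
      proof -
        have "real N powr (real r / 2 + 3/2) = real N powr (real r / 2 + (1 + 1/2))" by simp
        also have "\<dots> = real N powr (real r / 2) * (real N * sqrt (real N))"
          unfolding powr_add sq using N by simp
        finally show ?thesis by (simp add: a2_def)
      qed
      have p3: "real N powr (real r / 2) * (2 * a3 N * (K0 * sqrt (real N))) = 2 * Cm * K0 / d * (real N powr (real r / 2) * \<theta>m ^ N)"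
        using N d(1) by (simp add: a3_def)
      have p4: "real N powr (real r / 2) * (2 * a4 N * T N) = 2 / K0 * real N powr (- 1)"
      proof -
        have "real N powr (real r / 2) * (real N powr (- Q) * T N / sqrt (real N)) = real N powr (real r / 2 + (- Q) + (\<rho> + 1/2) - 1/2)"
          unfolding T_def sq powr_diff powr_add by simp
        also have "real r / 2 + (- Q) + (\<rho> + 1/2) - 1/2 = - 1" by (simp add: Q_def)
        finally have "real N powr (real r / 2) * (real N powr (- Q) * T N / sqrt (real N)) = real N powr (- 1)" .
        moreover have "real N powr (real r / 2) * (2 * a4 N * T N) = 2 / K0 * (real N powr (real r / 2) * (real N powr (- Q) * T N / sqrt (real N)))"
          by (simp add: a4_def)
        ultimately show ?thesis by (simp only:)
      qed
      have \<tau>T: "\<tau> N * T N = real N powr \<eta>"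
      proof -
        have "- (real r / 2 + \<eta>) + (\<rho> + 1/2) = \<eta>" by (simp add: \<eta>_def field_simps)
        then show ?thesis unfolding \<tau>_def T_def by (simp only: powr_add [symmetric])
      qed
      have pos: "\<tau> N > 0" "T N > 0" using N by (simp_all add: \<tau>_def T_def)
      have p5: "real N powr (real r / 2) * (a5 N * sqrt (pi / ((\<tau> N)\<^sup>2 / 4))) = 2 * sqrt pi * (real N powr (real r / 2 - \<eta>) * exp (- (real N powr (2 * \<eta>) / 4)))"
      proof -
        have "sqrt (pi / ((\<tau> N)\<^sup>2 / 4)) = 2 * sqrt pi / \<tau> N"
          using pos by (simp add: real_sqrt_divide real_sqrt_mult)
        moreover have "(\<tau> N)\<^sup>2 * (T N)\<^sup>2 = real N powr (2 * \<eta>)"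
        proof -
          have "(\<tau> N)\<^sup>2 * (T N)\<^sup>2 = real N powr \<eta> * real N powr \<eta>" by (simp add: \<tau>T [symmetric] power2_eq_square)
          then show ?thesis by (simp flip: powr_add)
        qed
        ultimately have "a5 N * sqrt (pi / ((\<tau> N)\<^sup>2 / 4)) = 2 * sqrt pi * (exp (- (real N powr (2 * \<eta>) / 4)) / (\<tau> N * T N))"
          by (simp add: a5_def mult_ac)
        then show ?thesis unfolding \<tau>T by (simp add: powr_diff)
      qed
      have p6: "real N powr (real r / 2) * (8 * Cg * \<tau> N) = 8 * Cg * real N powr (- \<eta>)"
      proof -
        have "real N powr (real r / 2) * \<tau> N = real N powr (- \<eta>)" unfolding \<tau>_def by (simp flip: powr_add)
        then show ?thesis by simp
      qed
      show ?case unfolding R_def distrib_left p1 p2 p3 p4 p5 p6 ..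
    qed
    have t1: "(\<lambda>N. real N powr (- (1/2))) \<longlonglongrightarrow> 0" by real_asymp
    have t2: "(\<lambda>N. real N powr (- 1)) \<longlonglongrightarrow> 0" by real_asymp
    have t3: "(\<lambda>N. real N powr (- \<eta>)) \<longlonglongrightarrow> 0" using \<eta> by real_asymp
    have "(\<lambda>N. (Cn + C4) * cI * real N powr (- (1/2))
       + 2 * C0 * d * (real N powr (real r / 2 + 3/2) * \<theta>0 ^ N)
       + 2 * Cm * K0 / d * (real N powr (real r / 2) * \<theta>m ^ N)
       + 2 / K0 * real N powr (- 1)
       + 2 * sqrt pi * (real N powr (real r / 2 - \<eta>) * exp (- (real N powr (2 * \<eta>) / 4)))
       + 8 * Cg * real N powr (- \<eta>)) \<longlonglongrightarrow> (Cn + C4) * cI * 0 + 2 * C0 * d * 0 + 2 * Cm * K0 / d * 0 + 2 / K0 * 0 + 2 * sqrt pi * 0 + 8 * Cg * 0"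
      by (intro tendsto_add tendsto_mult tendsto_const t1 t2 t3 powr_mult_power_tendsto_0 powr_mult_exp_tendsto_0 approx Cm \<eta>)
    then have "R \<longlonglongrightarrow> (Cn + C4) * cI * 0 + 2 * C0 * d * 0 + 2 * Cm * K0 / d * 0 + 2 / K0 * 0 + 2 * sqrt pi * 0 + 8 * Cg * 0"
      using e by (rule Lim_transform_eventually)
    then show ?thesis by simp
  qed
  have "\<forall>\<^sub>F N in sequentially. R N < \<epsilon>0 / 2" using R0 \<epsilon>0 by (intro order_tendstoD(2)) auto
  then show ?thesis using high(3) [OF Q] eventually_ge_at_top [of 1]
  proof eventually_elim
    case (elim N)
    then have N: "N \<ge> 1" "real N > 0" by auto
    define u where "u = 1 / sqrt (real N)"
    have u: "0 < u" "u \<le> 1" using N by (auto simp: u_def)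
    have pos: "\<tau> N > 0" "T N > 0" using N by (simp_all add: \<tau>_def T_def)
    have apos: "a1 N \<ge> 0" "a2 N \<ge> 0" "a3 N \<ge> 0" "a4 N \<ge> 0" "a5 N \<ge> 0"
      using Cn C4 \<epsilon> approx Cm d high(1) pos
      by (auto simp: a1_def a2_def a3_def a4_def a5_def intro!: add_nonneg_nonneg mult_nonneg_nonneg)
    have w1: "0 < w N t" "w N t \<le> 1" for t by (simp_all add: w_def)
    have Tu: "T N = real N powr \<rho> * sqrt (real N)" using N by (simp add: T_def powr_add powr_half_sqrt)
    have bound: "cmod (\<phi> N t - E u t) / \<bar>t\<bar> * w N t \<le> H N t" if t: "t \<noteq> 0" for t
    proof (cases "\<bar>t\<bar> / sqrt (real N) \<le> d")
      case True
      then have tin: "t \<in> {- (d * sqrt (real N))..d * sqrt (real N)}" using N by (auto simp: field_simps abs_le_iff)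
      have "cmod (\<phi> N t - E u t) / \<bar>t\<bar> * w N t \<le> cmod (\<phi> N t - E u t) / \<bar>t\<bar> * 1"
        by (intro mult_left_mono w1) auto
      also have "\<dots> \<le> Cn * (\<epsilon> * u ^ r + u ^ Suc r) * exp (- (v / 8 * t\<^sup>2)) + a2 N"
        using d(2) [OF N(1) t True] by (simp add: u_def a2_def)
      also have "\<dots> \<le> a1 N * exp (- (v / 8 * t\<^sup>2)) + a2 N"
        using C4 u by (intro add_mono mult_right_mono) (auto simp: a1_def u_def)
      also have "\<dots> \<le> H N t" using tin apos unfolding H_def by simp
      finally show ?thesis .
    next
      case False
      then have far: "d < \<bar>t\<bar> * u" by (simp add: u_def)
      have tpos: "\<bar>t\<bar> > 0" using t by simp
      have tl: "d * sqrt (real N) \<le> \<bar>t\<bar>" using False N by (simp add: field_simps)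
      have dN: "d * sqrt (real N) > 0" using d N by simp
      have Epart: "cmod (E u t) / \<bar>t\<bar> * w N t \<le> a1 N * exp (- (v / 8 * t\<^sup>2))"
      proof -
        have "cmod (E u t) / \<bar>t\<bar> * w N t \<le> cmod (E u t) / \<bar>t\<bar> * 1" by (intro mult_left_mono w1) auto
        also have "\<dots> \<le> C4 * u ^ Suc r * exp (- (v / 8 * t\<^sup>2))" using CF(2) [OF d(1) u far] by (simp add: C4_def)
        also have "\<dots> \<le> a1 N * exp (- (v / 8 * t\<^sup>2))"
          using Cn \<epsilon> u by (intro mult_right_mono) (auto simp: a1_def u_def)
        finally show ?thesis .
      qed
      have \<phi>\<psi>: "cmod (\<phi> N t) = cmod (\<psi> N (t * u))" using norm_\<phi>_eq [OF N(1), of t] by (simp add: u_def)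
      have tu: "\<bar>t * u\<bar> = \<bar>t\<bar> * u" using u by (simp add: abs_mult)
      have nn: "0 \<le> a3 N * indicator {- (K0 * sqrt (real N))..K0 * sqrt (real N)} t"
          "0 \<le> a4 N * indicator {- T N..T N} t" "0 \<le> a5 N * exp (- ((\<tau> N)\<^sup>2 / 4 * t\<^sup>2))"
        using apos by auto
      have \<phi>part: "cmod (\<phi> N t) / \<bar>t\<bar> * w N t \<le> a3 N * indicator {- (K0 * sqrt (real N))..K0 * sqrt (real N)} t
          + a4 N * indicator {- T N..T N} t + a5 N * exp (- ((\<tau> N)\<^sup>2 / 4 * t\<^sup>2))"
      proof (cases "\<bar>t\<bar> \<le> K0 * sqrt (real N)")
        case True
        then have "\<bar>t * u\<bar> \<le> K0" using N by (simp add: tu u_def field_simps)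
        then have 1: "cmod (\<phi> N t) \<le> Cm * \<theta>m ^ N" unfolding \<phi>\<psi> using far by (intro Cm(4)) (auto simp: tu)
        have "cmod (\<phi> N t) / \<bar>t\<bar> * w N t \<le> cmod (\<phi> N t) / \<bar>t\<bar> * 1" by (intro mult_left_mono w1) auto
        also have "\<dots> \<le> Cm * \<theta>m ^ N / (d * sqrt (real N))"
          using 1 tl dN Cm by (simp add: frac_le)
        also have "\<dots> = a3 N" by (simp add: a3_def)
        finally have "cmod (\<phi> N t) / \<bar>t\<bar> * w N t \<le> a3 N * indicator {- (K0 * sqrt (real N))..K0 * sqrt (real N)} t"
          using True by (auto simp: abs_le_iff)
        then show ?thesis using nn by linarith
      next
        case K: False
        then have tK: "K0 * sqrt (real N) \<le> \<bar>t\<bar>" by simp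
        then have tuK: "K0 \<le> \<bar>t * u\<bar>" using N by (simp add: tu u_def field_simps)
        show ?thesis
        proof (cases "\<bar>t\<bar> \<le> T N")
          case True
          then have "\<bar>t * u\<bar> \<le> real N powr \<rho>" using N by (simp add: tu u_def Tu field_simps)
          then have 1: "cmod (\<phi> N t) \<le> real N powr (- Q)"
            unfolding \<phi>\<psi> \<psi>_def by (intro elim(2) [rule_format] tuK)
          have "cmod (\<phi> N t) / \<bar>t\<bar> * w N t \<le> cmod (\<phi> N t) / \<bar>t\<bar> * 1" by (intro mult_left_mono w1) auto
          also have "\<dots> \<le> real N powr (- Q) / (K0 * sqrt (real N))"
            using 1 tK high(1) N by (simp add: frac_le)
          also have "\<dots> = a4 N" by (simp add: a4_def)
          finally have "cmod (\<phi> N t) / \<bar>t\<bar> * w N t \<le> a4 N * indicator {- T N..T N} t"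
            using True by (auto simp: abs_le_iff)
          then show ?thesis using nn by linarith
        next
          case tT: False
          \<comment> \<open>The damping exponent is split in two halves: one yields the small factor
            at the cutoff, the other keeps the majorant integrable.\<close>
          have e: "w N t \<le> exp (- ((\<tau> N)\<^sup>2 * (T N)\<^sup>2) / 4) * exp (- ((\<tau> N)\<^sup>2 / 4 * t\<^sup>2))"
          proof -
            have "(T N)\<^sup>2 \<le> t\<^sup>2" using tT pos by (metis abs_le_square_iff abs_of_pos less_imp_le not_le)
            then have "(\<tau> N)\<^sup>2 * (T N)\<^sup>2 \<le> (\<tau> N)\<^sup>2 * t\<^sup>2" by (intro mult_left_mono) auto
            then show ?thesis by (simp add: w_def flip: exp_add)
          qed
          have "cmod (\<phi> N t) / \<bar>t\<bar> \<le> 1 / T N" using norm_\<phi>_le_1 [of N t] tT pos by (intro frac_le) auto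
          then have "cmod (\<phi> N t) / \<bar>t\<bar> * w N t \<le> (1 / T N) * (exp (- ((\<tau> N)\<^sup>2 * (T N)\<^sup>2) / 4) * exp (- ((\<tau> N)\<^sup>2 / 4 * t\<^sup>2)))"
            using pos w1(1) [of t] by (intro mult_mono e) auto
          also have "\<dots> = a5 N * exp (- ((\<tau> N)\<^sup>2 / 4 * t\<^sup>2))" by (simp add: a5_def)
          finally show ?thesis using nn by linarith
        qed
      qed
      have "cmod (\<phi> N t - E u t) / \<bar>t\<bar> * w N t \<le> (cmod (\<phi> N t) + cmod (E u t)) / \<bar>t\<bar> * w N t"
        using w1(1) [of t] by (intro mult_right_mono divide_right_mono norm_triangle_ineq4) auto
      also have "\<dots> = cmod (\<phi> N t) / \<bar>t\<bar> * w N t + cmod (E u t) / \<bar>t\<bar> * w N t"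
        by (simp add: add_divide_distrib distrib_right)
      also have "\<dots> \<le> H N t"
      proof -
        have "0 \<le> a2 N * indicator {- (d * sqrt (real N))..d * sqrt (real N)} t" using apos by simp
        then show ?thesis using Epart \<phi>part unfolding H_def by linarith
      qed
      finally show ?thesis .
    qed
    have Hint: "integrable lborel (H N)"
    proof -
      have "integrable lborel (indicator {- b..b} :: real \<Rightarrow> real)" for b
        by (intro integrable_real_indicator) (auto simp: emeasure_lborel_Icc_eq)
      moreover have "integrable lborel (\<lambda>t. exp (- (v / 8 * t\<^sup>2)))" "integrable lborel (\<lambda>t. exp (- ((\<tau> N)\<^sup>2 / 4 * t\<^sup>2)))"
        by (rule integrable_gaussian, use v pos in simp)+
      ultimately show ?thesis unfolding H_def [abs_def]
        by (intro Bochner_Integration.integrable_add integrable_mult_right)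
    qed
    have Hval: "(LINT t|lborel. H N t) = a1 N * cI + 2 * a2 N * (d * sqrt (real N)) + 2 * a3 N * (K0 * sqrt (real N))
        + 2 * a4 N * T N + a5 N * sqrt (pi / ((\<tau> N)\<^sup>2 / 4))"
    proof -
      have i1: "integrable lborel (indicator {- b..b} :: real \<Rightarrow> real)" for b
        by (intro integrable_real_indicator) (auto simp: emeasure_lborel_Icc_eq)
      have i2: "integrable lborel (\<lambda>t. exp (- (v / 8 * t\<^sup>2)))" "integrable lborel (\<lambda>t. exp (- ((\<tau> N)\<^sup>2 / 4 * t\<^sup>2)))"
        by (rule integrable_gaussian, use v pos in simp)+
      have i3: "(LINT t|lborel. exp (- (v / 8 * t\<^sup>2))) = cI" unfolding cI_def using v by (intro integral_gaussian) simp
      have i4: "(LINT t|lborel. exp (- ((\<tau> N)\<^sup>2 / 4 * t\<^sup>2))) = sqrt (pi / ((\<tau> N)\<^sup>2 / 4))"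
        using pos by (intro integral_gaussian) simp
      have nn: "0 \<le> d * sqrt (real N)" "0 \<le> K0 * sqrt (real N)" "0 \<le> T N" using d high(1) pos by auto
      show ?thesis unfolding H_def
        by (simp only: Bochner_Integration.integral_add Bochner_Integration.integrable_add integrable_mult_right
            i1 i2 i3 i4 integral_indicator_symmetric [OF nn(1)] integral_indicator_symmetric [OF nn(2)]
            integral_indicator_symmetric [OF nn(3)] integral_mult_right_zero [of _ "a1 N"] integral_mult_right_zero [of _ "a5 N"])
    qed
    have total: "(LINT t|lborel. H N t) + 8 * Cg * \<tau> N \<le> \<epsilon>0 * real N powr (- real r / 2)"
    proof -
      have pr: "real N powr (- (real r / 2)) * real N powr (real r / 2) = 1" using N by (simp flip: powr_add)
      have ur: "(1 / sqrt (real N)) ^ r = real N powr (- (real r / 2))" by (rule pow [OF N(1)])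
      have "(LINT t|lborel. H N t) + 8 * Cg * \<tau> N = Cn * \<epsilon> * cI * real N powr (- (real r / 2)) +
         ((Cn + C4) * (1 / sqrt (real N)) ^ Suc r * cI
     + 2 * a2 N * (d * sqrt (real N)) + 2 * a3 N * (K0 * sqrt (real N)) + 2 * a4 N * T N
     + a5 N * sqrt (pi / ((\<tau> N)\<^sup>2 / 4)) + 8 * Cg * \<tau> N)"
        unfolding Hval a1_def ur by (simp only: distrib_left distrib_right mult_ac add_ac)
      also have "\<dots> = (Cn * \<epsilon> * cI + R N) * real N powr (- (real r / 2))"
      proof -
        define Z where "Z = (Cn + C4) * (1 / sqrt (real N)) ^ Suc r * cI
     + 2 * a2 N * (d * sqrt (real N)) + 2 * a3 N * (K0 * sqrt (real N)) + 2 * a4 N * T N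
     + a5 N * sqrt (pi / ((\<tau> N)\<^sup>2 / 4)) + 8 * Cg * \<tau> N"
        have "R N * real N powr (- (real r / 2)) = (real N powr (- (real r / 2)) * real N powr (real r / 2)) * Z"
          unfolding R_def Z_def by (simp only: mult_ac)
        then have "R N * real N powr (- (real r / 2)) = Z" unfolding pr by simp
        then show ?thesis unfolding Z_def [symmetric] by (simp only: distrib_right)
      qed
      also have "\<dots> \<le> (\<epsilon>0 / 2 + \<epsilon>0 / 2) * real N powr (- (real r / 2))"
        using \<epsilon>half elim(1) by (intro mult_right_mono add_mono) auto
      finally show ?thesis by simp
    qed
    show ?case
    proof
      fix z
      have "\<bar>prob {\<omega> \<in> space M. Y N \<omega> \<le> z} - (LINT y|lborel. g u y * indicator {..z} y)\<bar> \<le> (LINT t|lborel. H N t) + 8 * Cg * \<tau> N"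
      proof (rule smoothing_inequality [OF prob_space_axioms Y_meas integrable_g _ pos(1) Hint])
        show "\<bar>g u y\<bar> \<le> Cg" for y using u by (intro Cg) auto
        fix t :: real assume t: "t \<noteq> 0"
        have "H N (- t) = H N t" for t by (simp add: H_def indicator_def minus_le_iff le_minus_iff conj_commute)
        moreover have "w N (- t) = w N t" for t by (simp add: w_def)
        ultimately show "cmod ((CLINT \<omega>|M. iexp (t * Y N \<omega>)) - (CLINT y|lborel. of_real (g u y) * iexp (t * y))) / \<bar>t\<bar>
            * exp (- ((\<tau> N)\<^sup>2 * t\<^sup>2) / 2) \<le> H N t"
          using symmetrized_difference [of N u "w N" "H N" t, OF bound _ _ _ t] w1(1)
          unfolding \<phi>_def w_def by (simp add: less_imp_le)
      qed
      moreover have "(\<Sum>p=1..r. poly (P p) z * u ^ p) = (\<Sum>p=1..r. poly (P p) z / real N powr (real p / 2))"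
        unfolding u_def pow [OF N(1)] by (simp only: powr_minus divide_inverse)
      ultimately show "\<bar>prob {\<omega> \<in> space M. Y N \<omega> \<le> z} - gauss_N v z
        - (\<Sum>p=1..r. poly (P p) z / real N powr (real p / 2)) * gauss_n v z\<bar> \<le> \<epsilon>0 * real N powr (- real r / 2)"
        using total unfolding g_cdf by (simp add: diff_diff_eq)
    qed
  qed
qed

end

section \<open>From the operator family to the expansion\<close>

text \<open>Near 0 the eigenvalue stays within distance 1 of its value 1, hence in the right half
  plane, where the principal logarithm is smooth and vanishes at 1.\<close>

lemma logarithm_expansion:
  fixes \<kappa> a :: "real \<Rightarrow> complex"
  assumes \<delta>: "\<delta> > 0" and \<kappa>: "Ck_on (r + 2) {-\<delta>..\<delta>} \<kappa>" "\<kappa> 0 = 1"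
    and a: "Ck_on (r + 2) {-\<delta>..\<delta>} a" "a 0 = 1"
  obtains \<delta>1 \<mu> p b where "0 < \<delta>1" "\<delta>1 \<le> \<delta>" "\<And>t. \<bar>t\<bar> \<le> \<delta>1 \<Longrightarrow> exp (\<mu> t) = \<kappa> t" "poly p 0 = 0" "poly b 0 = 1"
    "\<And>\<epsilon>. \<epsilon> > 0 \<Longrightarrow> \<exists>d>0. \<forall>s. \<bar>s\<bar> \<le> d \<longrightarrow> cmod (\<mu> s - poly p (of_real s)) \<le> \<epsilon> * \<bar>s\<bar> ^ (r + 2) \<and>
       cmod (a s - poly b (of_real s)) \<le> \<epsilon> * \<bar>s\<bar> ^ r"
proof -
  have "continuous_on {-\<delta>..\<delta>} \<kappa>" by (rule Ck_on_imp_continuous [OF \<kappa>(1)])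
  then obtain e where e: "e > 0" "\<And>t. t \<in> {-\<delta>..\<delta>} \<Longrightarrow> dist t 0 < e \<Longrightarrow> dist (\<kappa> t) (\<kappa> 0) < 1"
    using \<delta> unfolding continuous_on_iff by (metis atLeastAtMost_iff less_imp_le neg_le_0_iff_le zero_less_one)
  define \<delta>1 where "\<delta>1 = min \<delta> (e / 2)"
  have \<delta>1: "\<delta>1 > 0" "\<delta>1 \<le> \<delta>" using \<delta> e by (auto simp: \<delta>1_def)
  have sub: "{-\<delta>1..\<delta>1} \<subseteq> {-\<delta>..\<delta>}" using \<delta>1 by auto
  have slit: "\<kappa> t \<notin> \<real>\<^sub>\<le>\<^sub>0" if "t \<in> {-\<delta>1..\<delta>1}" for t
  proof
    assume "\<kappa> t \<in> \<real>\<^sub>\<le>\<^sub>0"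
    then have "Re (\<kappa> t) \<le> 0" by (simp add: complex_nonpos_Reals_iff)
    moreover have "dist t 0 < e" "t \<in> {-\<delta>..\<delta>}" using that e(1) \<delta> by (auto simp: \<delta>1_def dist_real_def)
    then have "cmod (\<kappa> t - 1) < 1" using e(2) [of t] by (simp add: \<kappa> dist_norm)
    then have "\<bar>Re (\<kappa> t - 1)\<bar> < 1" using abs_Re_le_cmod [of "\<kappa> t - 1"] by linarith
    ultimately show False by simp
  qed
  define \<mu> where "\<mu> t = Ln (\<kappa> t)" for t
  have "Ck_on (Suc (r + 1)) {-\<delta>1..\<delta>1} \<kappa>" using Ck_on_subset [OF \<kappa>(1) sub] by simp
  then have "Ck_on (Suc (r + 1)) {-\<delta>1..\<delta>1} \<mu>" unfolding \<mu>_def by (rule Ck_on_Ln [OF _ slit])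
  then have \<mu>: "Ck_on (r + 2) {-\<delta>1..\<delta>1} \<mu>" by simp
  have a': "Ck_on r {-\<delta>1..\<delta>1} a" by (rule Ck_on_mono [OF Ck_on_subset [OF a(1) sub]]) simp
  obtain p where p: "poly p 0 = \<mu> 0" "\<And>\<epsilon>. \<epsilon> > 0 \<Longrightarrow> \<exists>d>0. d \<le> \<delta>1 \<and> (\<forall>s. \<bar>s\<bar> \<le> d \<longrightarrow> cmod (\<mu> s - poly p (of_real s)) \<le> \<epsilon> * \<bar>s\<bar> ^ (r + 2))"
    using taylor_peano [OF \<delta>1(1) \<mu>] by auto
  obtain b where b: "poly b 0 = a 0" "\<And>\<epsilon>. \<epsilon> > 0 \<Longrightarrow> \<exists>d>0. d \<le> \<delta>1 \<and> (\<forall>s. \<bar>s\<bar> \<le> d \<longrightarrow> cmod (a s - poly b (of_real s)) \<le> \<epsilon> * \<bar>s\<bar> ^ r)"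
    using taylor_peano [OF \<delta>1(1) a'] by auto
  show ?thesis
  proof (rule that [OF \<delta>1])
    show "exp (\<mu> t) = \<kappa> t" if "\<bar>t\<bar> \<le> \<delta>1" for t
    proof -
      have "t \<in> {-\<delta>1..\<delta>1}" using that by (simp add: abs_le_iff minus_le_iff)
      from slit [OF this] have "\<kappa> t \<noteq> 0" by auto
      then show ?thesis by (simp add: \<mu>_def)
    qed
    show "poly p 0 = 0" using p(1) \<kappa>(2) by (simp add: \<mu>_def)
    show "poly b 0 = 1" using b(1) a(2) by simp
    fix \<epsilon> :: real assume "\<epsilon> > 0"
    obtain d1 where d1: "d1 > 0" "\<And>s. \<bar>s\<bar> \<le> d1 \<Longrightarrow> cmod (\<mu> s - poly p (of_real s)) \<le> \<epsilon> * \<bar>s\<bar> ^ (r + 2)"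
      using p(2) [OF \<open>\<epsilon> > 0\<close>] by auto
    obtain d2 where d2: "d2 > 0" "\<And>s. \<bar>s\<bar> \<le> d2 \<Longrightarrow> cmod (a s - poly b (of_real s)) \<le> \<epsilon> * \<bar>s\<bar> ^ r"
      using b(2) [OF \<open>\<epsilon> > 0\<close>] by auto
    show "\<exists>d>0. \<forall>s. \<bar>s\<bar> \<le> d \<longrightarrow> cmod (\<mu> s - poly p (of_real s)) \<le> \<epsilon> * \<bar>s\<bar> ^ (r + 2) \<and>
       cmod (a s - poly b (of_real s)) \<le> \<epsilon> * \<bar>s\<bar> ^ r"
      using d1 d2 by (intro exI [of _ "min d1 d2"]) auto
  qed
qed

lemma weak_conv_gauss_char:
  assumes M: "prob_space M" and Y: "\<And>N. Y N \<in> borel_measurable M" and v: "v > 0"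
    and conv: "weak_conv_m (\<lambda>N. distr M borel (Y N)) (density lborel (gauss_n v))"
  shows "(\<lambda>N. (CLINT \<omega>|M. iexp (t * Y N \<omega>))) \<longlonglongrightarrow> of_real (exp (- (v * t\<^sup>2) / 2))"
proof -
  interpret prob_space M by fact
  have dens: "density lborel (gauss_n v) = density lborel (normal_density 0 (sqrt v))"
    using v by (simp add: gauss_n_eq_normal_density)
  have "prob_space (density lborel (gauss_n v))" unfolding dens by (rule prob_space_normal_density) (use v in simp)
  then have lim: "real_distribution (density lborel (gauss_n v))"
    by (simp add: real_distribution_def real_distribution_axioms_def)
  have "(\<lambda>N. char (distr M borel (Y N)) t) \<longlonglongrightarrow> char (density lborel (gauss_n v)) t"
    by (rule levy_continuity1 [OF _ lim conv]) (rule real_distribution_distr [OF Y])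
  moreover have "char (distr M borel (Y N)) t = (CLINT \<omega>|M. iexp (t * Y N \<omega>))" for N
    unfolding char_def by (rule integral_distr [OF Y]) measurable
  moreover have "char (density lborel (gauss_n v)) t = of_real (exp (- (v * t\<^sup>2) / 2))"
  proof -
    have "char (density lborel (gauss_n v)) t = (CLINT y|lborel. gauss_n v y *\<^sub>R iexp (t * y))"
      unfolding char_def using gauss_n_pos [OF v] by (intro integral_density) (auto simp: less_imp_le)
    also have "\<dots> = (CLINT y|lborel. of_real (gauss_n v y) * iexp (t * y))" by (simp only: scaleR_conv_of_real)
    finally show ?thesis unfolding gauss_n_fourier [OF v] .
  qed
  ultimately show ?thesis by (simp only:)
qed

text \<open>At \<open>s = t / sqrt N\<close> the exponent \<open>N * \<mu> s\<close> is
  \<open>sqrt N * t * c1 + t^2 * c2\<close> up to a null sequence, while the central limit theorem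
  prescribes the limit of the centred characteristic function; \<open>exp_limit_identifies\<close>
  then reads off both coefficients.\<close>

lemma clt_taylor_coefficients:
  fixes S :: "nat \<Rightarrow> 'a \<Rightarrow> real" and \<mu> a :: "real \<Rightarrow> complex" and p b :: "complex poly"
  assumes M: "prob_space M" and S: "\<And>N. S N \<in> borel_measurable M" and v: "v > 0" and r: "r \<ge> 1"
    and conv: "weak_conv_m (\<lambda>N. distr M borel (\<lambda>\<omega>. (S N \<omega> - real N * A) / sqrt (real N))) (density lborel (gauss_n v))"
    and \<delta>: "\<delta> > 0" and \<theta>: "0 < \<theta>" "\<theta> < 1"
    and approx: "\<And>N s. N \<ge> 1 \<Longrightarrow> \<bar>s\<bar> \<le> \<delta> \<Longrightarrow>
         cmod ((CLINT \<omega>|M. iexp (s * S N \<omega>)) - exp (of_nat N * \<mu> s) * a s) \<le> C * real N * \<theta> ^ N * \<bar>s\<bar>"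
    and p: "poly p 0 = 0" and b: "poly b 0 = 1"
    and near: "\<And>\<epsilon>. \<epsilon> > 0 \<Longrightarrow> \<exists>d>0. \<forall>s. \<bar>s\<bar> \<le> d \<longrightarrow> cmod (\<mu> s - poly p (of_real s)) \<le> \<epsilon> * \<bar>s\<bar> ^ (r + 2) \<and>
       cmod (a s - poly b (of_real s)) \<le> \<epsilon> * \<bar>s\<bar> ^ r"
  shows "poly p x = \<i> * of_real A * x - of_real (v / 2) * x\<^sup>2 + x ^ 3 * poly (poly_shift 3 p) x"
proof -
  define c1 where "c1 = coeff p 1"
  define c2 where "c2 = coeff p 2"
  define q where "q = poly_shift 3 p"
  have px: "poly p x = c1 * x + c2 * x\<^sup>2 + x ^ 3 * poly q x" for x
    using p poly_eq_truncation_plus_shift [of p x 3]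
    by (simp add: c1_def c2_def q_def eval_nat_numeral poly_0_coeff_0 algebra_simps)
  have lim: "(\<lambda>N. exp (of_real (sqrt (real N) * t) * (c1 - \<i> * of_real A) + of_real (t\<^sup>2) * c2)) \<longlonglongrightarrow> of_real (exp (- (v * t\<^sup>2) / 2))" for t
  proof -
    define s where "s N = t / sqrt (real N)" for N
    define U where "U N = exp (- (\<i> * of_real (A * sqrt (real N) * t)))" for N
    have U1: "cmod (U N) = 1" for N by (simp add: U_def)
    have s0: "s \<longlonglongrightarrow> 0" unfolding s_def [abs_def] by real_asymp
    then have cs0: "(\<lambda>N. of_real (s N) :: complex) \<longlonglongrightarrow> 0" using tendsto_of_real [OF s0] by simp
    have pq: "(\<lambda>N. poly w (of_real (s N))) \<longlonglongrightarrow> poly w 0" for w :: "complex poly"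
      by (rule tendsto_poly [OF cs0])
    obtain d where d: "d > 0" "\<And>s. \<bar>s\<bar> \<le> d \<Longrightarrow> cmod (\<mu> s - poly p (of_real s)) \<le> 1 * \<bar>s\<bar> ^ (r + 2)"
        "\<And>s. \<bar>s\<bar> \<le> d \<Longrightarrow> cmod (a s - poly b (of_real s)) \<le> 1 * \<bar>s\<bar> ^ r"
      using near [OF zero_less_one] by blast
    have small: "\<forall>\<^sub>F N in sequentially. \<bar>s N\<bar> \<le> e" if "e > 0" for e
      using tendstoD [OF s0 that] by (rule eventually_mono) (simp add: dist_real_def)
    have sr: "(\<lambda>N. \<bar>s N\<bar> ^ r) \<longlonglongrightarrow> 0" using tendsto_rabs [OF s0] r by (intro tendsto_null_power) auto
    have Ns: "real N * (s N)\<^sup>2 = t\<^sup>2" "of_nat N * of_real (s N) = (of_real (sqrt (real N) * t) :: complex)" if "N \<ge> 1" for N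
    proof -
      show "real N * (s N)\<^sup>2 = t\<^sup>2" using that by (simp add: s_def power_divide)
      have "real N * s N = sqrt (real N) * t" using that by (simp add: s_def real_div_sqrt flip: times_divide_eq_left)
      then show "of_nat N * of_real (s N) = (of_real (sqrt (real N) * t) :: complex)"
        by (metis of_real_mult of_real_of_nat_eq)
    qed
    have a1: "(\<lambda>N. a (s N)) \<longlonglongrightarrow> 1"
    proof -
      have "(\<lambda>N. a (s N) - poly b (of_real (s N))) \<longlonglongrightarrow> 0"
        by (rule Lim_null_comparison [OF _ sr]) (use small [OF d(1)] d(3) in \<open>auto elim!: eventually_mono\<close>)
      from tendsto_add [OF this pq [of b]] show ?thesis by (simp add: b)
    qed
    have \<phi>: "(CLINT \<omega>|M. iexp (t * ((S N \<omega> - real N * A) / sqrt (real N)))) = U N * (CLINT \<omega>|M. iexp (s N * S N \<omega>))" if N: "N \<ge> 1" for N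
    proof -
      have "iexp (t * ((S N \<omega> - real N * A) / sqrt (real N))) = U N * iexp (s N * S N \<omega>)" for \<omega>
      proof -
        have "t * ((S N \<omega> - real N * A) / sqrt (real N)) = - (A * sqrt (real N) * t) + s N * S N \<omega>"
          using N by (simp add: s_def field_simps)
        then have "\<i> * of_real (t * ((S N \<omega> - real N * A) / sqrt (real N))) = - (\<i> * of_real (A * sqrt (real N) * t)) + \<i> * of_real (s N * S N \<omega>)"
          by (simp only: of_real_add of_real_minus distrib_left mult_minus_right)
        then show ?thesis unfolding U_def by (simp only: exp_add)
      qed
      then show ?thesis by (simp only: integral_mult_right_zero)
    qed
    have "(\<lambda>N. (CLINT \<omega>|M. iexp (t * ((S N \<omega> - real N * A) / sqrt (real N))))) \<longlonglongrightarrow> of_real (exp (- (v * t\<^sup>2) / 2))"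
      by (rule weak_conv_gauss_char [OF M _ v conv]) (use S in measurable)
    moreover have "(\<lambda>N. (CLINT \<omega>|M. iexp (t * ((S N \<omega> - real N * A) / sqrt (real N)))) - U N * (exp (of_nat N * \<mu> (s N)) * a (s N))) \<longlonglongrightarrow> 0"
    proof (rule Lim_null_comparison)
      show "\<forall>\<^sub>F N in sequentially. cmod ((CLINT \<omega>|M. iexp (t * ((S N \<omega> - real N * A) / sqrt (real N)))) - U N * (exp (of_nat N * \<mu> (s N)) * a (s N))) \<le> C * real N * \<theta> ^ N * \<bar>s N\<bar>"
        using small [OF \<delta>] eventually_ge_at_top [of 1]
      proof eventually_elim
        case (elim N)
        show ?case unfolding \<phi> [OF elim(2)] right_diff_distrib [symmetric] norm_mult U1
          using approx [OF elim(2,1)] by (simp only: mult_1_left)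
      qed
      have "(\<lambda>N. real N * \<theta> ^ N) \<longlonglongrightarrow> 0" using \<theta> by real_asymp
      from tendsto_mult [OF tendsto_mult [OF tendsto_const [of C] this] tendsto_rabs [OF s0]]
      show "(\<lambda>N. C * real N * \<theta> ^ N * \<bar>s N\<bar>) \<longlonglongrightarrow> 0" by (simp add: mult.assoc)
    qed
    ultimately have "(\<lambda>N. U N * (exp (of_nat N * \<mu> (s N)) * a (s N))) \<longlonglongrightarrow> of_real (exp (- (v * t\<^sup>2) / 2))"
      by (rule Lim_transform2)
    from tendsto_divide [OF this a1]
    have "(\<lambda>N. U N * (exp (of_nat N * \<mu> (s N)) * a (s N)) / a (s N)) \<longlonglongrightarrow> of_real (exp (- (v * t\<^sup>2) / 2))" by simp
    \<comment> \<open>The part of the exponent beyond second order. It tends to 0, so multiplying by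
      \<open>exp (- y N)\<close> leaves the limit unchanged and makes the exponent exactly quadratic
      in \<open>t\<close>.\<close>
    moreover define y where "y N = of_nat N * (\<mu> (s N) - (c1 * of_real (s N) + c2 * (of_real (s N))\<^sup>2))" for N
    have "y \<longlonglongrightarrow> 0"
    proof -
      have "(\<lambda>N. of_nat N * (\<mu> (s N) - poly p (of_real (s N)))) \<longlonglongrightarrow> 0"
      proof (rule Lim_null_comparison)
        show "\<forall>\<^sub>F N in sequentially. cmod (of_nat N * (\<mu> (s N) - poly p (of_real (s N)))) \<le> t\<^sup>2 * \<bar>s N\<bar> ^ r"
          using small [OF d(1)] eventually_ge_at_top [of 1]
        proof eventually_elim
          case (elim N)
          have "cmod (of_nat N * (\<mu> (s N) - poly p (of_real (s N)))) \<le> real N * (1 * \<bar>s N\<bar> ^ (r + 2))"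
            unfolding norm_mult norm_of_nat by (intro mult_left_mono d(2) elim) simp
          also have "\<dots> = (real N * (s N)\<^sup>2) * \<bar>s N\<bar> ^ r" by (simp add: power_add power2_eq_square)
          finally show ?case unfolding Ns(1) [OF elim(2)] .
        qed
        show "(\<lambda>N. t\<^sup>2 * \<bar>s N\<bar> ^ r) \<longlonglongrightarrow> 0" using tendsto_mult_right_zero [OF sr] by simp
      qed
      moreover have "(\<lambda>N. of_real (t\<^sup>2) * (of_real (s N) * poly q (of_real (s N)))) \<longlonglongrightarrow> 0"
        by (intro tendsto_mult_right_zero) (use tendsto_mult [OF cs0 pq [of q]] in simp)
      ultimately have "(\<lambda>N. of_nat N * (\<mu> (s N) - poly p (of_real (s N))) + of_real (t\<^sup>2) * (of_real (s N) * poly q (of_real (s N)))) \<longlonglongrightarrow> 0 + 0"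
        by (rule tendsto_add)
      moreover have "\<forall>\<^sub>F N in sequentially. of_nat N * (\<mu> (s N) - poly p (of_real (s N))) + of_real (t\<^sup>2) * (of_real (s N) * poly q (of_real (s N))) = y N"
        using eventually_ge_at_top [of 1]
      proof eventually_elim
        case (elim N)
        show ?case unfolding y_def px Ns(1) [OF elim, symmetric] by (simp add: power2_eq_square power3_eq_cube algebra_simps)
      qed
      ultimately have "y \<longlonglongrightarrow> 0 + 0" by (rule Lim_transform_eventually)
      then show ?thesis by simp
    qed
    then have "(\<lambda>N. exp (- y N)) \<longlonglongrightarrow> exp (- 0)" by (intro tendsto_exp tendsto_minus)
    ultimately have "(\<lambda>N. U N * (exp (of_nat N * \<mu> (s N)) * a (s N)) / a (s N) * exp (- y N)) \<longlonglongrightarrow> of_real (exp (- (v * t\<^sup>2) / 2)) * exp (- 0)"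
      by (rule tendsto_mult)
    moreover have "\<forall>\<^sub>F N in sequentially. U N * (exp (of_nat N * \<mu> (s N)) * a (s N)) / a (s N) * exp (- y N)
       = exp (of_real (sqrt (real N) * t) * (c1 - \<i> * of_real A) + of_real (t\<^sup>2) * c2)"
      using tendsto_imp_eventually_ne [OF a1 one_neq_zero] eventually_ge_at_top [of 1]
    proof eventually_elim
      case (elim N)
      have n: "of_real (t\<^sup>2) = of_nat N * (of_real (s N))\<^sup>2" unfolding Ns(1) [OF elim(2), symmetric] by simp
      have "of_real (sqrt (real N) * t) * (c1 - \<i> * of_real A) + of_real (t\<^sup>2) * c2
        = - (\<i> * of_real (A * sqrt (real N) * t)) + of_nat N * \<mu> (s N) + (- y N)"
      proof -
        have "- (\<i> * of_real (A * sqrt (real N) * t)) = - (\<i> * of_real A) * of_real (sqrt (real N) * t)" by simp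
        then show ?thesis unfolding y_def n Ns(2) [OF elim(2), symmetric] by (simp add: algebra_simps)
      qed
      then show ?case unfolding U_def using elim(1) by (simp only: exp_add) simp
    qed
    ultimately show ?thesis using Lim_transform_eventually by fastforce
  qed
  have "c1 = \<i> * of_real A" "c2 = - of_real (v / 2)" using exp_limit_identifies [OF lim] by auto
  then show ?thesis unfolding px q_def by simp
qed

theorem theorem2p1:
  fixes M :: "'a measure"
    and X :: "nat \<Rightarrow> 'a \<Rightarrow> real"
    and L :: "real \<Rightarrow> ('b::complex_banach \<Rightarrow>\<^sub>L 'b)"
    and v :: "'b" and l :: "'b \<Rightarrow>\<^sub>L complex"
    and r :: nat and A \<sigma>2 :: real
  defines "S \<equiv> (\<lambda>N \<omega>. \<Sum>n=1..N. X n \<omega>)"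
  assumes prob: "prob_space M"
    and X_meas: "\<And>n. X n \<in> borel_measurable M"
    and r_ge: "r \<ge> 2"
    and L_clin: "\<And>t. clinear_op (L t)"
    and l_clin: "clinear_fun l"
    and char: "\<And>t N. N \<ge> 1 \<Longrightarrow>
       prob_space.expectation M (\<lambda>\<omega>. cis (t * S N \<omega>)) = blinfun_apply l (opow (L t) N v)"
    \<comment> \<open>(A1) with \<open>s = r + 2\<close>\<close>
    and A1_cont: "continuous_on UNIV L"
    and A1_diff: "\<exists>\<delta>>0. Ck_on (r + 2) {-\<delta>..\<delta>} L"
    \<comment> \<open>(A2)\<close>
    and A2_isol: "isolated_in_spectrum (L 0) 1"
    and A2_simple: "simple_eigenvalue (L 0) 1"
    and A2_other: "\<And>z. is_eigenvalue (L 0) z \<Longrightarrow> z \<noteq> 1 \<Longrightarrow> cmod z < 1"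
    and A2_ess: "\<exists>\<rho><1. ess_spectrum (L 0) \<subseteq> cball 0 \<rho>"
    \<comment> \<open>(A3)\<close>
    and A3: "\<And>t. t \<noteq> 0 \<Longrightarrow> cspectrum (L t) \<subseteq> ball 0 1"
    \<comment> \<open>(A4) with \<open>r1 > (r-1)/2\<close>\<close>
    and A4: "\<exists>K r1 r2 N0. K > 0 \<and> r1 > 0 \<and> r2 > 0 \<and> N0 > 0 \<and> r1 > (real r - 1) / 2 \<and>
       (\<forall>N::nat. \<forall>t. real N > N0 \<longrightarrow> K \<le> \<bar>t\<bar> \<longrightarrow> \<bar>t\<bar> \<le> real N powr r1 \<longrightarrow>
          onorm (opow (L t) N) \<le> real N powr (- r2))"
    \<comment> \<open>CLT with mean \<open>A\<close> and variance \<open>\<sigma>2 > 0\<close>\<close>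
    and CLT: "weak_conv_m (\<lambda>N. distr M borel (\<lambda>\<omega>. (S N \<omega> - real N * A) / sqrt (real N)))
                (density lborel (gauss_n \<sigma>2))"
    and sigma_pos: "\<sigma>2 > 0"
  shows "\<exists>P :: nat \<Rightarrow> real poly. \<forall>\<epsilon>>0. \<forall>\<^sub>F N in sequentially. \<forall>z::real.
     \<bar>measure M {\<omega>\<in>space M. (S N \<omega> - real N * A) / sqrt (real N) \<le> z} - gauss_N \<sigma>2 z
       - (\<Sum>p=1..r. poly (P p) z / real N powr (real p / 2)) * gauss_n \<sigma>2 z\<bar>
     \<le> \<epsilon> * real N powr (- real r / 2)"
proof -
  interpret prob_space M by (rule prob)
  have S_meas: "S N \<in> borel_measurable M" for N
    unfolding S_def by (intro borel_measurable_sum X_meas)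
  have char': "(CLINT \<omega>|M. iexp (t * S N \<omega>)) = blinfun_apply l (opow (L t) N v)" if "N \<ge> 1" for t N
    using char [OF that, of t] by (simp only: cis_conv_exp)
  have char0: "blinfun_apply l (opow (L 0) N v) = 1" if "N \<ge> 1" for N
    using char [OF that, of 0] by (simp add: prob_space)
  obtain \<delta>0 where \<delta>0: "\<delta>0 > 0" "Ck_on (Suc (r + 1)) {-\<delta>0..\<delta>0} L" using A1_diff by auto
  obtain \<delta> C \<theta> \<kappa> a where \<delta>: "\<delta> > 0" and \<theta>: "0 < \<theta>" "\<theta> < 1" and C: "C \<ge> 0"
    and smooth: "Ck_on (Suc (r + 1)) {-\<delta>..\<delta>} \<kappa>" "Ck_on (Suc (r + 1)) {-\<delta>..\<delta>} a" and \<kappa>0: "\<kappa> 0 = 1"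
    and b1: "\<And>N t. N \<ge> 1 \<Longrightarrow> \<bar>t\<bar> \<le> \<delta> \<Longrightarrow> cmod (blinfun_apply l (opow (L t) N v) - \<kappa> t ^ N * a t) \<le> C * \<theta> ^ N"
    and b2: "\<And>N t. N \<ge> 1 \<Longrightarrow> \<bar>t\<bar> \<le> \<delta> \<Longrightarrow> cmod ((blinfun_apply l (opow (L t) N v) - \<kappa> t ^ N * a t)
        - (blinfun_apply l (opow (L 0) N v) - \<kappa> 0 ^ N * a 0)) \<le> C * real N * \<theta> ^ N * \<bar>t\<bar>"
  proof (rule spectral_expansion [OF L_clin l_clin \<delta>0 A2_simple A2_other A2_ess, of v], goal_cases)
    case (3 \<delta> C \<theta> \<kappa> a) show ?case by (rule 3(1)) (fact 3)+
  qed
  \<comment> \<open>At \<open>t = 0\<close> the characteristic function and \<kappa> are both 1, so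
    the first error bound holds for the constant \<open>1 - a 0\<close> and decays as N
    grows.\<close>
  have a0: "a 0 = 1"
  proof -
    have "(\<lambda>N. C * \<theta> ^ N) \<longlonglongrightarrow> C * 0" using \<theta> by (intro tendsto_mult tendsto_const LIMSEQ_realpow_zero) auto
    moreover have "cmod (1 - a 0) \<le> C * \<theta> ^ N" if "N \<ge> 1" for N
      using b1 [OF that, of 0] \<delta> that by (simp add: char0 \<kappa>0)
    ultimately have "cmod (1 - a 0) \<le> C * 0" by (intro LIMSEQ_le_const) auto
    then show ?thesis by simp
  qed
  have smooth': "Ck_on (r + 2) {-\<delta>..\<delta>} \<kappa>" "Ck_on (r + 2) {-\<delta>..\<delta>} a" using smooth by simp_all
  obtain \<delta>1 \<mu> p b where \<delta>1: "0 < \<delta>1" "\<delta>1 \<le> \<delta>" and \<mu>: "\<And>t. \<bar>t\<bar> \<le> \<delta>1 \<Longrightarrow> exp (\<mu> t) = \<kappa> t"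
    and p: "poly p 0 = 0" and b: "poly b 0 = 1"
    and near: "\<And>\<epsilon>. \<epsilon> > 0 \<Longrightarrow> \<exists>d>0. \<forall>s. \<bar>s\<bar> \<le> d \<longrightarrow> cmod (\<mu> s - poly p (of_real s)) \<le> \<epsilon> * \<bar>s\<bar> ^ (r + 2) \<and>
       cmod (a s - poly b (of_real s)) \<le> \<epsilon> * \<bar>s\<bar> ^ r"
  proof (rule logarithm_expansion [OF \<delta> smooth'(1) \<kappa>0 smooth'(2) a0], goal_cases)
    case (1 \<delta>1 \<mu> p b) show ?case by (rule 1(1)) (fact 1)+
  qed
  have approx: "cmod ((CLINT \<omega>|M. iexp (s * S N \<omega>)) - exp (of_nat N * \<mu> s) * a s) \<le> C * real N * \<theta> ^ N * \<bar>s\<bar>"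
    if "N \<ge> 1" "\<bar>s\<bar> \<le> \<delta>1" for N s
    using b2 [OF that(1), of s] that \<delta>1 unfolding char' [OF that(1)] exp_of_nat_mult \<mu> [OF that(2)]
    by (simp add: char0 \<kappa>0 a0)
  have pe: "poly p x = \<i> * of_real A * x - of_real (\<sigma>2 / 2) * x\<^sup>2 + x ^ 3 * poly (poly_shift 3 p) x" for x
    using clt_taylor_coefficients [OF prob S_meas sigma_pos _ CLT \<delta>1(1) \<theta> approx p b near] r_ge by simp
  obtain K r1 r2 N0 where K: "K > 0" and r1: "r1 > (real r - 1) / 2" and r2: "r2 > 0"
    and A4': "\<And>N t. real N > N0 \<Longrightarrow> K \<le> \<bar>t\<bar> \<Longrightarrow> \<bar>t\<bar> \<le> real N powr r1 \<Longrightarrow> onorm (opow (L t) N) \<le> real N powr (- r2)"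
    using A4 by metis
  \<comment> \<open>The midpoint leaves room on both sides: above \<open>(r - 1) / 2\<close> for the
    smoothing scale, below \<open>r1\<close> for boosting the decay rate.\<close>
  define \<rho> where "\<rho> = ((real r - 1) / 2 + r1) / 2"
  have \<rho>: "\<rho> > (real r - 1) / 2" "\<rho> < r1" "0 < \<rho>" using r1 r_ge by (auto simp: \<rho>_def field_simps)
  have high: "\<forall>\<^sub>F N in sequentially. \<forall>s. K \<le> \<bar>s\<bar> \<longrightarrow> \<bar>s\<bar> \<le> real N powr \<rho> \<longrightarrow>
       cmod (CLINT \<omega>|M. iexp (s * S N \<omega>)) \<le> real N powr (- Q)" if Q: "Q > 0" for Q
  proof -
    \<comment> \<open>The extra power in \<open>Q + 1\<close> absorbs the constant
      \<open>norm l * norm v\<close>, eventually at most \<open>N\<close>.\<close>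
    have decay: "\<forall>\<^sub>F N in sequentially. \<forall>t. K \<le> \<bar>t\<bar> \<longrightarrow> \<bar>t\<bar> \<le> real N powr \<rho> \<longrightarrow> norm (Endo (L t) ^ N) \<le> real N powr (- (Q + 1))"
      by (rule polynomial_decay_boost [OF r2 \<rho>(2,3), where ?N0.0 = N0])
        (use Q A4' in \<open>simp_all add: norm_endo_eq_onorm opow_eq\<close>)
    have "\<forall>\<^sub>F N in sequentially. norm l * norm v \<le> real N"
      using filterlim_real_sequentially by (simp add: filterlim_at_top)
    with decay eventually_ge_at_top [of 1] show ?thesis
    proof eventually_elim
      case (elim N)
      show ?case
      proof (intro allI impI)
        fix s assume s: "K \<le> \<bar>s\<bar>" "\<bar>s\<bar> \<le> real N powr \<rho>"
        have "cmod (CLINT \<omega>|M. iexp (s * S N \<omega>)) \<le> norm l * (norm (Endo (L s) ^ N) * norm v)"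
          unfolding char' [OF elim(2)] opow_eq by (rule order_trans [OF norm_blinfun]) (intro mult_left_mono norm_app norm_ge_zero)
        also have "\<dots> = norm (Endo (L s) ^ N) * (norm l * norm v)" by (simp only: mult_ac)
        also have "\<dots> \<le> real N powr (- (Q + 1)) * real N"
          using elim(1,3) s by (intro mult_mono) auto
        also have "\<dots> = real N powr (- Q)" using elim(2) by (simp add: powr_diff powr_minus_divide field_simps powr_add)
        finally show "cmod (CLINT \<omega>|M. iexp (s * S N \<omega>)) \<le> real N powr (- Q)" .
      qed
    qed
  qed
  have mid: "\<exists>C \<theta>. 0 \<le> C \<and> 0 < \<theta> \<and> \<theta> < 1 \<and>
       (\<forall>N s. d \<le> \<bar>s\<bar> \<longrightarrow> \<bar>s\<bar> \<le> K \<longrightarrow> cmod (CLINT \<omega>|M. iexp (s * S N \<omega>)) \<le> C * \<theta> ^ N)" if d: "d > 0" for d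
  proof -
    obtain C \<theta> where C: "C \<ge> 0" "0 < \<theta>" "\<theta> < 1"
      "\<And>N t. d \<le> \<bar>t\<bar> \<Longrightarrow> \<bar>t\<bar> \<le> K \<Longrightarrow> cmod (blinfun_apply l (opow (L t) N v)) \<le> C * \<theta> ^ N"
      using intermediate_decay [OF L_clin A1_cont A3 d, of K l v] by blast
    \<comment> \<open>The bound is required for all \<open>N\<close>, while the operator formula
      starts at 1. For the empty sum the integral is 1, which \<open>C + 1\<close> covers.\<close>
    have "cmod (CLINT \<omega>|M. iexp (s * S N \<omega>)) \<le> (C + 1) * \<theta> ^ N" if s: "d \<le> \<bar>s\<bar>" "\<bar>s\<bar> \<le> K" for N s
    proof (cases "N \<ge> 1")
      case True
      have "C * \<theta> ^ N \<le> (C + 1) * \<theta> ^ N" using C by (intro mult_right_mono) auto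
      then show ?thesis using C(4) [OF s, of N] unfolding char' [OF True] by linarith
    next
      case False
      then have N: "N = 0" by simp
      show ?thesis using C(1) unfolding N by (simp add: S_def prob_space)
    qed
    then show ?thesis using C by (intro exI [of _ "C + 1"] exI [of _ \<theta>]) auto
  qed
  have near': "\<exists>d>0. \<forall>s. \<bar>s\<bar> \<le> d \<longrightarrow>
       cmod (\<mu> s - (\<i> * of_real (A * s) - of_real (\<sigma>2 * s\<^sup>2 / 2) + of_real s ^ 3 * poly (poly_shift 3 p) (of_real s))) \<le> \<epsilon> * \<bar>s\<bar> ^ (r + 2) \<and>
       cmod (a s - poly b (of_real s)) \<le> \<epsilon> * \<bar>s\<bar> ^ r" if "\<epsilon> > 0" for \<epsilon>
  proof -
    have "\<i> * of_real (A * s) - of_real (\<sigma>2 * s\<^sup>2 / 2) + of_real s ^ 3 * poly (poly_shift 3 p) (of_real s) = poly p (of_real s)" for s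
      unfolding pe [of "of_real s"] by simp
    then show ?thesis using near [OF that] by (simp only:)
  qed
  have r1': "r \<ge> 1" using r_ge by simp
  interpret E: edgeworth M S A \<sigma>2 "poly_shift 3 p" b r \<mu> a \<delta>1 C \<theta> K \<rho>
  proof (intro edgeworth.intro edgeworth_axioms.intro)
  qed (fact prob S_meas sigma_pos b r1' near' \<delta>1 C \<theta> approx mid K \<rho> high)+
  show ?thesis
    using E.expansion unfolding E.Y_def by (intro exI [of _ E.P]) blast
qed

end
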